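(* Let $p=1+\sqrt2$. Let $\mu:[0,\infty)\to[0,\infty)$ be a continuous and increasing function such that $$\int_0^1\frac{\mu^{p}(\lambda)}{\lambda}\,d\lambda=\infty .$$ Suppose also that $F(u):=|u|^p\mu(|u|)$ belongs to $C^2(\mathbb{R})$, that $\mu\in C^1((0,\infty);(0,\infty))$, and that $$\lim_{\lambda\to0+}\frac{\lambda\mu'(\lambda)}{\mu(\lambda)}=0 .$$ Consider the Cauchy problem $$\partial_t^2u-\Delta u=F(u),\qquad u(0,x)=0,\quad u_t(0,x)=u_1(x),\qquad x\in\mathbb{R}^3. \qquad ( * )$$ Then the classical solution $u$ of $( * )$ blows up in finite time for any radial, non-negative and non-trivial $u_1\in C^2_c(\mathbb{R}^3)$. More precisely, for any radial, non-negative and non-trivial function $f\in C^2_c(\mathbb{R}^3)$ there exist positive constants $c,C$ such that for any sufficiently small $\delta>0$ there exists $\varepsilon_0=\varepsilon_0(f,\delta)>0$ such that, for every $\varepsilon\in(0,\varepsilon_0]$, the lifespan $T(\varepsilon)$ of the solution of $( * )$ with $u_1=\varepsilon f$ satisfies $$c\,\varepsilon^{-p(p-1)}\le A_\varepsilon(T(\varepsilon))\le C\,\varepsilon^{-p(p-1)-\delta/p}$$ (the constants $c,C$ are independent of $\varepsilon$ and $\delta$).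
   Context: The unknown $u$ is a real-valued function of $(t,x)$, $t\ge0$, $x\in\mathbb{R}^3$, and $\Delta$ is the Laplacian in $x$. $\mu^p(\lambda)$ denotes $(\mu(\lambda))^p$. A classical solution on $[0,T]$ is a solution $u\in C^2([0,T]\times\mathbb{R}^3)$; the lifespan $T(\varepsilon)$ is the supremum of all $T>0$ such that a (unique) classical solution with $u_1=\varepsilon f$ exists on $[0,T]\times\mathbb{R}^3$. Blow up in finite time means that this supremum is finite. For $\delta>0$ the function $A_\delta:[1,\infty)\to[0,\infty)$ is defined by $$A_\delta(t)=\int_{t^{-1}}^{1}\frac{\mu^{p}(\delta\lambda)}{\lambda}\,d\lambda ,$$ and $A_\varepsilon$ is this function with $\delta$ replaced by $\varepsilon$. *)

theory Defs
  imports "HOL-Analysis.Analysis"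
begin

(* Derivatives are taken within S, hence one-sided at boundary points of S.  For convex S with
   nonempty interior they are unique, so for S = [0,T] x R^3 this is the class C^2 up to the
   boundary, and for S = UNIV it is the usual C^2. *)
definition C2_on :: "'a::real_normed_vector set \<Rightarrow> ('a \<Rightarrow> real) \<Rightarrow> bool" where
  "C2_on S f \<longleftrightarrow>
     (\<exists>(f' :: 'a \<Rightarrow> 'a \<Rightarrow>\<^sub>L real) (f'' :: 'a \<Rightarrow> 'a \<Rightarrow>\<^sub>L 'a \<Rightarrow>\<^sub>L real).
        (\<forall>z\<in>S. (f has_derivative blinfun_apply (f' z)) (at z within S)) \<and>
        (\<forall>z\<in>S. (f' has_derivative blinfun_apply (f'' z)) (at z within S)) \<and>
        continuous_on S f'')"

definition C2_compact_support :: "('a::real_normed_vector \<Rightarrow> real) \<Rightarrow> bool" where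
  "C2_compact_support f \<longleftrightarrow> C2_on UNIV f \<and> compact (closure (support_on UNIV f))"

definition radial :: "('a::real_normed_vector \<Rightarrow> real) \<Rightarrow> bool" where
  "radial f \<longleftrightarrow> (\<forall>x y. norm x = norm y \<longrightarrow> f x = f y)"

definition laplacian :: "('a::euclidean_space \<Rightarrow> real) \<Rightarrow> 'a \<Rightarrow> real" where
  "laplacian v x = (\<Sum>b\<in>Basis. (deriv ^^ 2) (\<lambda>s. v (x + s *\<^sub>R b)) 0)"

definition time_deriv :: "real \<Rightarrow> (real \<Rightarrow> 'a \<Rightarrow> real) \<Rightarrow> real \<Rightarrow> 'a \<Rightarrow> real" where
  "time_deriv T u t x = vector_derivative (\<lambda>s. u s x) (at t within {0..T})"

definition classical_solution ::
    "(real \<Rightarrow> real) \<Rightarrow> (real ^ 3 \<Rightarrow> real) \<Rightarrow> real \<Rightarrow> (real \<Rightarrow> real ^ 3 \<Rightarrow> real) \<Rightarrow> bool" where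
  "classical_solution F u\<^sub>1 T u \<longleftrightarrow>
     C2_on ({0..T} \<times> UNIV) (\<lambda>(t, x). u t x) \<and>
     (\<forall>t\<in>{0..T}. \<forall>x. time_deriv T (time_deriv T u) t x - laplacian (u t) x = F (u t x)) \<and>
     (\<forall>x. u 0 x = 0) \<and>
     (\<forall>x. time_deriv T u 0 x = u\<^sub>1 x)"

(* Functions are total, so uniqueness is agreement on [0,T] x R^3 only. *)
definition unique_classical_solution_exists ::
    "(real \<Rightarrow> real) \<Rightarrow> (real ^ 3 \<Rightarrow> real) \<Rightarrow> real \<Rightarrow> bool" where
  "unique_classical_solution_exists F u\<^sub>1 T \<longleftrightarrow>
     (\<exists>u. classical_solution F u\<^sub>1 T u \<and>
        (\<forall>v. classical_solution F u\<^sub>1 T v \<longrightarrow> (\<forall>t\<in>{0..T}. \<forall>x. v t x = u t x)))"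

definition lifespan :: "(real \<Rightarrow> real) \<Rightarrow> (real ^ 3 \<Rightarrow> real) \<Rightarrow> ereal" where
  "lifespan F u\<^sub>1 = Sup (ereal ` {T. T > 0 \<and> unique_classical_solution_exists F u\<^sub>1 T})"

(* If no local solution existed, the supremum would be that of the empty set, -\<infinity>, which
   this condition excludes as well: there is a solution, and its lifespan is a real number. *)
definition blows_up_in_finite_time :: "(real \<Rightarrow> real) \<Rightarrow> (real ^ 3 \<Rightarrow> real) \<Rightarrow> bool" where
  "blows_up_in_finite_time F u\<^sub>1 \<longleftrightarrow> \<bar>lifespan F u\<^sub>1\<bar> \<noteq> \<infinity>"

definition nonlinearity :: "real \<Rightarrow> (real \<Rightarrow> real) \<Rightarrow> real \<Rightarrow> real" where
  "nonlinearity p \<mu> s = \<bar>s\<bar> powr p * \<mu> \<bar>s\<bar>"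

(* Meant for t \<ge> 1. *)
definition A_fun :: "real \<Rightarrow> (real \<Rightarrow> real) \<Rightarrow> real \<Rightarrow> real \<Rightarrow> real" where
  "A_fun p \<mu> \<delta> t = integral {1 / t..1} (\<lambda>s. \<mu> (\<delta> * s) powr p / s)"

end

theory Submission
  imports Defs
begin

text \<open>
  In three space dimensions every solution is given by Kirchhoff's formula: the solution of
  $u_{tt} - \Delta u = F(u)$ with $u = 0$, $u_t = f$ at time 0 is the free wave of $f$ plus the Duhamel
  integral of $F(u)$, and both are averages with non-negative weights (theorem \<open>kirchhoff\<close>).
  Positivity makes comparison arguments possible, and for radial functions the Duhamel integral is an
  integral over characteristic coordinates $\alpha = s + l$, $\beta = s - l$
  (lemma \<open>duhamel_characteristic\<close>):
  \[ r\, D(t,r) = \frac14 \int\!\!\int l\, F(u(s,l))\, d\beta\, d\alpha, \qquad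
     |t - r| \le \alpha \le t + r, \quad -\alpha \le \beta \le t - r . \]

  The equation $p = 1 + \sqrt 2$ says $p (p - 2) = 1$. It makes the profile
  $(t + r)^{-1} (t - r)^{-(p - 2)}$ reproduce itself: its $p$-th power times $l$ is at most
  $\alpha^{1 - p}$ times $\beta^{-1}$, the $\alpha$-integral divided by $r$ gives back the profile
  (lemma \<open>alpha_integral_bound\<close>), and the $\beta$-integral is logarithmic. With the factor
  $\mu$ in $F$ that logarithm becomes an integral of $\mu^p(\ldots) / \beta$, which a change of variables
  identifies with $A_\varepsilon$. One pass through the Duhamel integral thus turns a bound with amplitude
  $N \varepsilon^p$ into one with amplitude about $N^p \varepsilon^{p^2} A_\varepsilon(T)$, and the two
  are comparable exactly when $A_\varepsilon(T)$ is of size $\varepsilon^{-p (p - 1)}$.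

  Lower bound for the lifespan (theorem \<open>existence_while_A_fun_small\<close>). While
  $A_\varepsilon(T) \le c\, \varepsilon^{-p (p - 1)}$, all Picard iterates stay below one barrier of that
  profile. Bounded iterates converge together with their first and second derivatives, because in an
  exponentially weighted norm the Duhamel operator contracts by any prescribed factor
  (lemma \<open>picard_converges\<close>).

  Upper bound and blow-up (theorem \<open>duhamel_inequality_bounds_A_fun\<close>). The free wave is positive near
  the light cone, which gives the solution a first lower bound with the same profile. Feeding a lower bound
  back into the Duhamel integral improves its amplitude by a factor 4. Each pass has to keep away from
  the axis $l = 0$ and uses up a part of the $\beta$-integral, but the gaps can shrink so fast that the
  parts used up have a finite sum.
  If $A_\varepsilon(T)$ were much larger than $\varepsilon^{-p (p - 1)}$, this could be repeated for ever
  and the solution would be infinite at one point. Since $A_\varepsilon$ is unbounded, solutions blow up,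
  and continuity of $A_\varepsilon$ transfers both bounds to the lifespan.

  In both directions $\mu$ has to be evaluated at a bound for $u$ instead of at $u$. The assumption
  $\lambda \mu'(\lambda) / \mu(\lambda) \to 0$ enters only through $\mu(s') \le \sqrt{s'/s}\, \mu(s)$
  for small $s \le s'$ (lemma \<open>slow_variation\<close>).
\<close>

section \<open>Integrals of a function over a family of linear maps\<close>

text \<open>
  The pullbacks of a linear and of a bilinear form along \<open>A\<close>, as bounded linear functions, so that
  derivatives of \<open>h \<circ> A\<close> can be integrated and differentiated again as Banach-space valued functions.
\<close>
definition pull1 :: "('a::real_normed_vector \<Rightarrow>\<^sub>L 'b::real_normed_vector) \<Rightarrow> ('b \<Rightarrow>\<^sub>L real) \<Rightarrow> ('a \<Rightarrow>\<^sub>L real)" where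
  "pull1 A g = g o\<^sub>L A"

definition pull2 :: "('a::real_normed_vector \<Rightarrow>\<^sub>L 'b::real_normed_vector) \<Rightarrow> ('b \<Rightarrow>\<^sub>L 'b \<Rightarrow>\<^sub>L real) \<Rightarrow> ('a \<Rightarrow>\<^sub>L 'a \<Rightarrow>\<^sub>L real)" where
  "pull2 A g = bounded_bilinear.prod_left (o\<^sub>L) A o\<^sub>L (g o\<^sub>L A)"

lemma prod_left_compose_apply [simp]:
  "blinfun_apply (bounded_bilinear.prod_left (o\<^sub>L) A) g = g o\<^sub>L A"
  by (simp add: bounded_bilinear.prod_left.rep_eq[OF bounded_bilinear_blinfun_compose])

lemma pull1_apply [simp]: "blinfun_apply (pull1 A g) w = g (A w)"
  by (simp add: pull1_def)

lemma pull2_apply [simp]: "blinfun_apply (blinfun_apply (pull2 A g) w) v = g (A w) (A v)"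
  by (simp add: pull2_def)

lemma continuous_on_prod_left_compose [continuous_intros]:
  "continuous_on S A \<Longrightarrow> continuous_on S (\<lambda>y. bounded_bilinear.prod_left (o\<^sub>L) (A y) :: ('b::real_normed_vector \<Rightarrow>\<^sub>L 'c::real_normed_vector) \<Rightarrow>\<^sub>L ('a::real_normed_vector \<Rightarrow>\<^sub>L 'c))"
  by (rule bounded_linear.continuous_on[OF bounded_bilinear.bounded_linear_prod_left[OF bounded_bilinear_blinfun_compose]])

lemma norm_pull1: "norm (pull1 A g) \<le> norm g * norm A"
  unfolding pull1_def by (rule norm_blinfun_compose)

lemma norm_pull2: "norm (pull2 A g) \<le> norm g * (norm A)\<^sup>2"
proof (rule norm_blinfun_bound)
  show "0 \<le> norm g * (norm A)\<^sup>2" by simp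
  fix w
  show "norm (blinfun_apply (pull2 A g) w) \<le> norm g * (norm A)\<^sup>2 * norm w"
  proof (rule norm_blinfun_bound)
    fix v
    have "norm (blinfun_apply (blinfun_apply (pull2 A g) w) v) \<le> norm (g (A w)) * norm (A v)"
      unfolding pull2_apply by (rule norm_blinfun)
    also have "\<dots> \<le> (norm g * (norm A * norm w)) * (norm A * norm v)"
      by (intro mult_mono norm_blinfun order_trans[OF norm_blinfun] mult_left_mono) auto
    finally show "norm (blinfun_apply (blinfun_apply (pull2 A g) w) v) \<le> norm g * (norm A)\<^sup>2 * norm w * norm v"
      by (simp add: power2_eq_square algebra_simps)
  qed simp
qed

text \<open>
  Kirchhoff's formula becomes an integral of $h(\Lambda_y z)$ over a parameter $y$ in a fixed box, with
  $\Lambda_y$ linear in $z$. In this form the regularity of the integral in $z$ is that of $h$, and each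
  derivative passes under the integral and picks up one factor $\Lambda_y$.
\<close>
locale linear_family =
  fixes S :: "'a::euclidean_space set" and S' :: "'b::euclidean_space set"
    and lo hi :: "'y::euclidean_space" and \<kappa> :: "'y \<Rightarrow> real" and \<Lambda> :: "'y \<Rightarrow> 'a \<Rightarrow>\<^sub>L 'b"
  assumes conv: "convex S" and cont\<kappa>: "continuous_on (cbox lo hi) \<kappa>"
    and cont\<Lambda>: "continuous_on (cbox lo hi) \<Lambda>"
    and maps: "\<And>y z. y \<in> cbox lo hi \<Longrightarrow> z \<in> S \<Longrightarrow> \<Lambda> y z \<in> S'"
begin

definition "I0 h = (\<lambda>z. integral (cbox lo hi) (\<lambda>y. \<kappa> y * h (\<Lambda> y z)))"
definition "I1 h' = (\<lambda>z. integral (cbox lo hi) (\<lambda>y. \<kappa> y *\<^sub>R pull1 (\<Lambda> y) (h' (\<Lambda> y z))))"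
definition "I2 h'' = (\<lambda>z. integral (cbox lo hi) (\<lambda>y. \<kappa> y *\<^sub>R pull2 (\<Lambda> y) (h'' (\<Lambda> y z))))"

lemma cont_comp:
  fixes h :: "'b \<Rightarrow> 'c::topological_space"
  assumes "continuous_on S' h"
  shows "continuous_on (S \<times> cbox lo hi) (\<lambda>q. h (\<Lambda> (snd q) (fst q)))"
  by (rule continuous_on_compose2[OF assms])
     (auto intro!: continuous_intros continuous_on_compose2[OF cont\<Lambda>] maps)

lemma cont0:
  assumes "continuous_on S' h"
  shows "continuous_on (S \<times> cbox lo hi) (\<lambda>q. \<kappa> (snd q) * h (\<Lambda> (snd q) (fst q)))"
  by (intro continuous_on_mult cont_comp[OF assms] continuous_on_compose2[OF cont\<kappa>])
     (auto intro!: continuous_intros)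

lemma cont1:
  assumes "continuous_on S' h'"
  shows "continuous_on (S \<times> cbox lo hi) (\<lambda>q. \<kappa> (snd q) *\<^sub>R pull1 (\<Lambda> (snd q)) (h' (\<Lambda> (snd q) (fst q))))"
  unfolding pull1_def
  by (intro continuous_intros cont_comp[OF assms] continuous_on_compose2[OF cont\<kappa>] continuous_on_compose2[OF cont\<Lambda>])
     (auto intro!: continuous_intros)

lemma cont2:
  assumes "continuous_on S' h''"
  shows "continuous_on (S \<times> cbox lo hi) (\<lambda>q. \<kappa> (snd q) *\<^sub>R pull2 (\<Lambda> (snd q)) (h'' (\<Lambda> (snd q) (fst q))))"
  unfolding pull2_def
  by (intro continuous_intros cont_comp[OF assms] continuous_on_compose2[OF cont\<kappa>] continuous_on_compose2[OF cont\<Lambda>])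
     (auto intro!: continuous_intros)

lemma int0: "continuous_on S' h \<Longrightarrow> z \<in> S \<Longrightarrow> (\<lambda>y. \<kappa> y * h (\<Lambda> y z)) integrable_on cbox lo hi"
  by (rule integrable_continuous, rule continuous_on_compose2[OF cont0, of h "cbox lo hi" "\<lambda>y. (z,y)", simplified])
     (auto intro!: continuous_intros)

lemma int1: "continuous_on S' h' \<Longrightarrow> z \<in> S \<Longrightarrow> (\<lambda>y. \<kappa> y *\<^sub>R pull1 (\<Lambda> y) (h' (\<Lambda> y z))) integrable_on cbox lo hi"
  by (rule integrable_continuous, rule continuous_on_compose2[OF cont1, of h' "cbox lo hi" "\<lambda>y. (z,y)", simplified])
     (auto intro!: continuous_intros)

lemma int2: "continuous_on S' h'' \<Longrightarrow> z \<in> S \<Longrightarrow> (\<lambda>y. \<kappa> y *\<^sub>R pull2 (\<Lambda> y) (h'' (\<Lambda> y z))) integrable_on cbox lo hi"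
  by (rule integrable_continuous, rule continuous_on_compose2[OF cont2, of h'' "cbox lo hi" "\<lambda>y. (z,y)", simplified])
     (auto intro!: continuous_intros)

lemma cont_I2: "continuous_on S' h \<Longrightarrow> continuous_on S (I2 h)"
  unfolding I2_def using integral_continuous_on_param[of S lo hi "\<lambda>z y. \<kappa> y *\<^sub>R pull2 (\<Lambda> y) (h (\<Lambda> y z))"] cont2[of h]
  by (simp add: split_beta)

lemma compose_deriv:
  assumes "\<And>z. z \<in> S' \<Longrightarrow> (h has_derivative h' z) (at z within S')" "y \<in> cbox lo hi" "z \<in> S"
  shows "((\<lambda>z. h (\<Lambda> y z)) has_derivative (\<lambda>w. h' (\<Lambda> y z) (\<Lambda> y w))) (at z within S)"
  by (rule has_derivative_in_compose2[OF assms(1)])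
     (use maps assms(2,3) in \<open>auto intro!: bounded_linear_imp_has_derivative blinfun.bounded_linear_right\<close>)

lemma deriv_I0:
  assumes h: "\<And>z. z \<in> S' \<Longrightarrow> (h has_derivative blinfun_apply (h' z)) (at z within S')"
    and c: "continuous_on S' h'" and z: "z \<in> S"
  shows "(I0 h has_derivative blinfun_apply (I1 h' z)) (at z within S)"
  unfolding I0_def I1_def
proof (rule leibniz_rule[where fx="\<lambda>x t. \<kappa> t *\<^sub>R pull1 (\<Lambda> t) (h' (\<Lambda> t x))", OF _ _ _ z conv])
  have ch: "continuous_on S' h" by (rule has_derivative_continuous_on[OF h])
  show "\<And>x. x \<in> S \<Longrightarrow> (\<lambda>y. \<kappa> y * h (\<Lambda> y x)) integrable_on cbox lo hi"
    by (rule int0[OF ch])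
  show "continuous_on (S \<times> cbox lo hi) (\<lambda>(x, t). \<kappa> t *\<^sub>R pull1 (\<Lambda> t) (h' (\<Lambda> t x)))"
    using cont1[OF c] by (simp add: split_beta)
  fix x t assume x: "x \<in> S" "t \<in> cbox lo hi"
  show "((\<lambda>x. \<kappa> t * h (\<Lambda> t x)) has_derivative blinfun_apply (\<kappa> t *\<^sub>R pull1 (\<Lambda> t) (h' (\<Lambda> t x)))) (at x within S)"
    using has_derivative_mult_right[OF compose_deriv[OF h x(2,1)], of "\<kappa> t"]
    by (rule has_derivative_eq_rhs) (auto simp: fun_eq_iff blinfun.scaleR_left)
qed

lemma deriv_I1:
  assumes h: "\<And>z. z \<in> S' \<Longrightarrow> (h' has_derivative blinfun_apply (h'' z)) (at z within S')"
    and c: "continuous_on S' h''" and z: "z \<in> S"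
  shows "(I1 h' has_derivative blinfun_apply (I2 h'' z)) (at z within S)"
  unfolding I1_def I2_def
proof (rule leibniz_rule[where fx="\<lambda>x t. \<kappa> t *\<^sub>R pull2 (\<Lambda> t) (h'' (\<Lambda> t x))", OF _ _ _ z conv])
  have ch: "continuous_on S' h'" by (rule has_derivative_continuous_on[OF h])
  show "\<And>x. x \<in> S \<Longrightarrow> (\<lambda>y. \<kappa> y *\<^sub>R pull1 (\<Lambda> y) (h' (\<Lambda> y x))) integrable_on cbox lo hi"
    by (rule int1[OF ch])
  show "continuous_on (S \<times> cbox lo hi) (\<lambda>(x, t). \<kappa> t *\<^sub>R pull2 (\<Lambda> t) (h'' (\<Lambda> t x)))"
    using cont2[OF c] by (simp add: split_beta)
  fix x t assume x: "x \<in> S" "t \<in> cbox lo hi"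
  have "((\<lambda>x. \<kappa> t *\<^sub>R (bounded_bilinear.prod_left (o\<^sub>L) (\<Lambda> t)) (h' (\<Lambda> t x))) has_derivative
     (\<lambda>w. \<kappa> t *\<^sub>R (bounded_bilinear.prod_left (o\<^sub>L) (\<Lambda> t)) (h'' (\<Lambda> t x) (\<Lambda> t w)))) (at x within S)"
    by (intro has_derivative_scaleR_right bounded_linear.has_derivative[OF blinfun.bounded_linear_right]
        compose_deriv[OF h x(2,1)])
  moreover have "(\<lambda>w. \<kappa> t *\<^sub>R (bounded_bilinear.prod_left (o\<^sub>L) (\<Lambda> t)) (h'' (\<Lambda> t x) (\<Lambda> t w)))
      = blinfun_apply (\<kappa> t *\<^sub>R pull2 (\<Lambda> t) (h'' (\<Lambda> t x)))"
    by (auto simp: fun_eq_iff pull2_def blinfun.bilinear_simps)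
  ultimately show "((\<lambda>x. \<kappa> t *\<^sub>R pull1 (\<Lambda> t) (h' (\<Lambda> t x))) has_derivative blinfun_apply (\<kappa> t *\<^sub>R pull2 (\<Lambda> t) (h'' (\<Lambda> t x)))) (at x within S)"
    by (simp add: pull1_def)
qed

end

section \<open>Spherical means\<close>

definition unit_dir :: "real \<times> real \<Rightarrow> real ^ 3" where
  "unit_dir y = (sin (fst y) * cos (snd y)) *\<^sub>R axis 1 1 + (sin (fst y) * sin (snd y)) *\<^sub>R axis 2 1 + cos (fst y) *\<^sub>R axis 3 1"

abbreviation "sphere_box \<equiv> cbox (0::real, 0::real) (pi, 2 * pi)"

text \<open>
  The normalised surface integral over the unit sphere in polar and azimuthal angles: the surface element
  is $\sin\theta$, the total area $4\pi$.
\<close>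
definition sphere_mean :: "(real ^ 3 \<Rightarrow> 'b::banach) \<Rightarrow> 'b" where
  "sphere_mean g = integral sphere_box (\<lambda>y. (sin (fst y) / (4 * pi)) *\<^sub>R g (unit_dir y))"

lemma unit_dir_nth [simp]:
  "unit_dir y $ 1 = sin (fst y) * cos (snd y)" "unit_dir y $ 2 = sin (fst y) * sin (snd y)"
  "unit_dir y $ 3 = cos (fst y)"
  by (simp_all add: unit_dir_def axis_def)

lemma norm_unit_dir [simp]: "norm (unit_dir y) = 1"
proof -
  have "(norm (unit_dir y))\<^sup>2 = (sin (fst y))\<^sup>2 * ((cos (snd y))\<^sup>2 + (sin (snd y))\<^sup>2) + (cos (fst y))\<^sup>2"
    unfolding power2_norm_eq_inner inner_vec_def sum_3 inner_real_def unit_dir_nth by algebra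
  then have "(norm (unit_dir y))\<^sup>2 = 1\<^sup>2" by simp
  then show ?thesis by (rule power2_eq_imp_eq) auto
qed

lemma continuous_on_unit_dir [continuous_intros]:
  fixes f :: "'a::t2_space \<Rightarrow> real \<times> real"
  assumes "continuous_on S f" shows "continuous_on S (\<lambda>x. unit_dir (f x))"
  unfolding unit_dir_def by (intro continuous_intros assms)

lemma sphere_weight_nonneg: "y \<in> sphere_box \<Longrightarrow> 0 \<le> sin (fst y) / (4 * pi)"
  by (cases y) (auto intro!: divide_nonneg_nonneg sin_ge_zero)

lemma sphere_mean_cont:
  fixes g :: "real ^ 3 \<Rightarrow> 'b::banach"
  assumes "continuous_on (sphere 0 1) g"
  shows "continuous_on sphere_box (\<lambda>y. (sin (fst y) / (4 * pi)) *\<^sub>R g (unit_dir y))"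
proof (rule continuous_on_scaleR)
  show "continuous_on sphere_box (\<lambda>y. sin (fst y) / (4 * pi))" by (intro continuous_intros) auto
  show "continuous_on sphere_box (\<lambda>y. g (unit_dir y))"
    by (rule continuous_on_compose2[OF assms]) (auto intro!: continuous_intros)
qed

lemmas sphere_mean_int = integrable_continuous[OF sphere_mean_cont]

lemma sphere_mean_const [simp]: "sphere_mean (\<lambda>_. c::real) = c"
proof -
  have "sphere_mean (\<lambda>_. c) = integral (cbox 0 pi) (\<lambda>x. integral (cbox 0 (2*pi)) (\<lambda>y. sin x / (4*pi) * c))"
    unfolding sphere_mean_def
    by (subst integral_prod_continuous) (auto intro!: continuous_intros simp: pi_neq_zero)
  also have "\<dots> = integral {0..pi} (\<lambda>x. sin x * (c / 2))"
    by (simp add: field_simps)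
  also have "\<dots> = c"
  proof (rule integral_unique)
    have "((\<lambda>x. sin x * (c / 2)) has_integral (- cos pi * (c/2) - (- cos 0 * (c/2)))) {0..pi}"
      by (rule fundamental_theorem_of_calculus)
         (auto intro!: derivative_eq_intros simp: has_real_derivative_iff_has_vector_derivative[symmetric])
    then show "((\<lambda>x. sin x * (c / 2)) has_integral c) {0..pi}" by simp
  qed
  finally show ?thesis .
qed

lemma sphere_mean_add:
  assumes "continuous_on (sphere 0 1) f" "continuous_on (sphere 0 1) g"
  shows "sphere_mean (\<lambda>w. f w + g w) = sphere_mean f + sphere_mean g"
  unfolding sphere_mean_def scaleR_add_right
  by (rule integral_add) (intro sphere_mean_int assms)+

lemma sphere_mean_diff:
  assumes "continuous_on (sphere 0 1) f" "continuous_on (sphere 0 1) g"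
  shows "sphere_mean (\<lambda>w. f w - g w) = sphere_mean f - sphere_mean g"
  unfolding sphere_mean_def scaleR_diff_right
  by (rule integral_diff) (intro sphere_mean_int assms)+

lemma sphere_mean_cmult: "sphere_mean (\<lambda>w. c * f w :: real) = c * sphere_mean f"
proof -
  have "(\<lambda>y. (sin (fst y) / (4 * pi)) *\<^sub>R (c * f (unit_dir y))) = (\<lambda>y. c * ((sin (fst y) / (4 * pi)) *\<^sub>R f (unit_dir y)))"
    by (auto simp: fun_eq_iff)
  then show ?thesis unfolding sphere_mean_def by simp
qed

lemma sphere_mean_mono:
  fixes f g :: "real ^ 3 \<Rightarrow> real"
  assumes "continuous_on (sphere 0 1) f" "continuous_on (sphere 0 1) g" "\<And>w. norm w = 1 \<Longrightarrow> f w \<le> g w"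
  shows "sphere_mean f \<le> sphere_mean g"
  unfolding sphere_mean_def
proof (rule integral_le)
  fix y assume y: "y \<in> sphere_box"
  show "(sin (fst y) / (4 * pi)) *\<^sub>R f (unit_dir y) \<le> (sin (fst y) / (4 * pi)) *\<^sub>R g (unit_dir y)"
    using mult_left_mono[OF assms(3)[of "unit_dir y"] sphere_weight_nonneg[OF y]] by simp
qed (intro sphere_mean_int assms)+

lemma sphere_mean_cong:
  "(\<And>w. norm w = 1 \<Longrightarrow> f w = g w) \<Longrightarrow> sphere_mean f = sphere_mean g"
  unfolding sphere_mean_def by (intro integral_cong) simp

section \<open>Second derivatives: symmetry and traces\<close>

lemma has_vector_derivative_compose:
  assumes "(g has_derivative g') (at (c t) within S)" "(c has_vector_derivative v) (at t within U)" "c ` U \<subseteq> S"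
  shows "((\<lambda>t. g (c t)) has_vector_derivative g' v) (at t within U)"
  using vector_derivative_diff_chain_within[OF assms(2) has_derivative_subset[OF assms(1,3)]]
  by (simp add: o_def)

text \<open>
  The domain may have boundary points, where only one-sided derivatives exist, so a parallelogram
  with corner \<open>z\<close> has to suffice. Writing increments of \<open>f\<close> in direction \<open>a\<close> as integrals of \<open>f'\<close> and
  differentiating these integrals in direction \<open>b\<close> gives the mixed derivative in both orders.
\<close>
lemma second_derivative_symmetric:
  fixes f :: "'a::real_normed_vector \<Rightarrow> real"
  assumes f: "\<And>z. z \<in> S \<Longrightarrow> (f has_derivative blinfun_apply (f' z)) (at z within S)"
    and f': "\<And>z. z \<in> S \<Longrightarrow> (f' has_derivative blinfun_apply (f'' z)) (at z within S)"
    and c: "continuous_on S f''" and d: "0 < d"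
    and sq: "\<And>s r. s \<in> {0..d} \<Longrightarrow> r \<in> {0..d} \<Longrightarrow> z + s *\<^sub>R a + r *\<^sub>R b \<in> S"
  shows "f'' z a b = f'' z b a"
proof -
  have cf': "continuous_on S f'" by (rule has_derivative_continuous_on[OF f'])
  have za: "z + s *\<^sub>R a \<in> S" if "s \<in> {0..d}" for s using sq[OF that, of 0] d by simp
  have zb: "z + s *\<^sub>R b \<in> S" if "s \<in> {0..d}" for s using sq[of 0, OF _ that] d by simp
  have zz: "z \<in> S" using za[of 0] d by simp
  have c1: "((\<lambda>s. z + s *\<^sub>R a + r *\<^sub>R b) has_vector_derivative a) (at s within U)" for s r U
    by (auto intro!: derivative_eq_intros)
  have c2: "((\<lambda>r. z + s *\<^sub>R a + r *\<^sub>R b) has_vector_derivative b) (at r within U)" for s r U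
    by (auto intro!: derivative_eq_intros)
  have i1: "integral {0..s} (\<lambda>\<sigma>. f' (z + \<sigma> *\<^sub>R a + r *\<^sub>R b) a) = f (z + s *\<^sub>R a + r *\<^sub>R b) - f (z + r *\<^sub>R b)"
    if "s \<in> {0..d}" "r \<in> {0..d}" for s r
  proof (rule integral_unique)
    have "((\<lambda>\<sigma>. f' (z + \<sigma> *\<^sub>R a + r *\<^sub>R b) a) has_integral f (z + s *\<^sub>R a + r *\<^sub>R b) - f (z + 0 *\<^sub>R a + r *\<^sub>R b)) {0..s}"
      by (rule fundamental_theorem_of_calculus)
        (use that sq in \<open>auto intro!: has_vector_derivative_compose[OF f c1]\<close>)
    then show "((\<lambda>\<sigma>. f' (z + \<sigma> *\<^sub>R a + r *\<^sub>R b) a) has_integral f (z + s *\<^sub>R a + r *\<^sub>R b) - f (z + r *\<^sub>R b)) {0..s}"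
      by simp
  qed
  have i2: "integral {0..s} (\<lambda>\<sigma>. f'' (z + \<sigma> *\<^sub>R a) b a) = f' (z + s *\<^sub>R a) b - f' z b"
    if s: "s \<in> {0..d}" for s
  proof -
    have "((\<lambda>r. integral (cbox 0 s) (\<lambda>\<sigma>. f' (z + \<sigma> *\<^sub>R a + r *\<^sub>R b) a)) has_field_derivative
        integral (cbox 0 s) (\<lambda>\<sigma>. f'' (z + \<sigma> *\<^sub>R a + 0 *\<^sub>R b) b a)) (at 0 within {0..d})"
    proof (rule leibniz_rule_field_derivative[where fx="\<lambda>r \<sigma>. f'' (z + \<sigma> *\<^sub>R a + r *\<^sub>R b) b a"])
      fix r \<sigma> assume r: "r \<in> {0..d}" "\<sigma> \<in> cbox 0 s"
      have "((\<lambda>r. f' (z + \<sigma> *\<^sub>R a + r *\<^sub>R b)) has_vector_derivative f'' (z + \<sigma> *\<^sub>R a + r *\<^sub>R b) b) (at r within {0..d})"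
        by (rule has_vector_derivative_compose[OF f' c2]) (use r s sq in auto)
      then show "((\<lambda>r. f' (z + \<sigma> *\<^sub>R a + r *\<^sub>R b) a) has_real_derivative f'' (z + \<sigma> *\<^sub>R a + r *\<^sub>R b) b a) (at r within {0..d})"
        unfolding has_real_derivative_iff_has_vector_derivative
        by (rule bounded_linear.has_vector_derivative[OF blinfun.bounded_linear_left])
    next
      show "(\<lambda>\<sigma>. f' (z + \<sigma> *\<^sub>R a + r *\<^sub>R b) a) integrable_on cbox 0 s" if "r \<in> {0..d}" for r
        by (rule integrable_continuous) (use that s sq in \<open>auto intro!: continuous_intros continuous_on_compose2[OF cf']\<close>)
      show "continuous_on ({0..d} \<times> cbox 0 s) (\<lambda>(r, \<sigma>). f'' (z + \<sigma> *\<^sub>R a + r *\<^sub>R b) b a)"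
        unfolding split_beta using s sq
        by (auto intro!: continuous_intros continuous_on_compose2[OF c])
    qed (use d in auto)
    moreover have "((\<lambda>r. integral (cbox 0 s) (\<lambda>\<sigma>. f' (z + \<sigma> *\<^sub>R a + r *\<^sub>R b) a)) has_vector_derivative
        (f' (z + s *\<^sub>R a) b - f' z b)) (at 0 within {0..d})"
    proof (rule has_vector_derivative_transform[OF _ i1[unfolded cbox_interval[symmetric]]])
      have "((\<lambda>r. f (z + s *\<^sub>R a + r *\<^sub>R b)) has_vector_derivative f' (z + s *\<^sub>R a + 0 *\<^sub>R b) b) (at 0 within {0..d})"
        by (rule has_vector_derivative_compose[OF f c2]) (use s d sq za zb zz in auto)
      moreover have "((\<lambda>r. f (z + 0 *\<^sub>R a + r *\<^sub>R b)) has_vector_derivative f' (z + 0 *\<^sub>R a + 0 *\<^sub>R b) b) (at 0 within {0..d})"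
        by (rule has_vector_derivative_compose[OF f c2]) (use d sq za zb zz in auto)
      ultimately show "((\<lambda>r. f (z + s *\<^sub>R a + r *\<^sub>R b) - f (z + r *\<^sub>R b)) has_vector_derivative f' (z + s *\<^sub>R a) b - f' z b) (at 0 within {0..d})"
        by (auto intro!: derivative_eq_intros)
    qed (use s d za zb zz in auto)
    ultimately show ?thesis
      using vector_derivative_unique_within_closed_interval[of 0 d 0]  d
      by (simp add: has_real_derivative_iff_has_vector_derivative)
  qed
  have "((\<lambda>s. integral {0..s} (\<lambda>\<sigma>. f'' (z + \<sigma> *\<^sub>R a) b a)) has_vector_derivative f'' (z + 0 *\<^sub>R a) b a) (at 0 within {0..d})"
    by (rule integral_has_vector_derivative)
      (use d za in \<open>auto intro!: continuous_intros continuous_on_compose2[OF c]\<close>)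
  moreover have "((\<lambda>s. integral {0..s} (\<lambda>\<sigma>. f'' (z + \<sigma> *\<^sub>R a) b a)) has_vector_derivative f'' z a b) (at 0 within {0..d})"
  proof (rule has_vector_derivative_transform[OF _ i2])
    have "((\<lambda>s. f' (z + s *\<^sub>R a + 0 *\<^sub>R b)) has_vector_derivative f'' (z + 0 *\<^sub>R a + 0 *\<^sub>R b) a) (at 0 within {0..d})"
      by (rule has_vector_derivative_compose[OF f' c1]) (use d za zz in auto)
    from bounded_linear.has_vector_derivative[OF blinfun.bounded_linear_left this, of b]
    show "((\<lambda>s. f' (z + s *\<^sub>R a) b - f' z b) has_vector_derivative f'' z a b) (at 0 within {0..d})"
      by (auto intro!: derivative_eq_intros)
  qed (use d in auto)
  ultimately show ?thesis
    using vector_derivative_unique_within_closed_interval[of 0 d 0] d by simp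
qed

lemma sum_Basis_axis:
  fixes f :: "real ^ 'n \<Rightarrow> real"
  shows "(\<Sum>b\<in>Basis. f b) = (\<Sum>i\<in>UNIV. f (axis i 1))"
proof -
  have *: "(Basis :: (real ^ 'n) set) = range (\<lambda>i. axis i 1)" by (auto simp: Basis_vec_def)
  show ?thesis unfolding * by (subst sum.reindex) (auto simp: inj_on_def axis_eq_axis)
qed

lemma vec_axis_expansion:
  fixes v :: "real ^ 'n"
  shows "v = (\<Sum>i\<in>UNIV. v $ i *\<^sub>R axis i 1)"
  using basis_expansion[of v] by (simp add: vector_scalar_mult_def scalar_mult_eq_scaleR)

text \<open>
  The assumption says that the vectors \<open>e k\<close> form an orthonormal basis (it is the completeness relation);
  the trace of a bilinear form is the same in every such basis.
\<close>
lemma trace_frame: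
  fixes B :: "(real ^ 'n) \<Rightarrow>\<^sub>L (real ^ 'n) \<Rightarrow>\<^sub>L real" and e :: "'k \<Rightarrow> real ^ 'n"
  assumes on: "\<And>i j. (\<Sum>k\<in>K. e k $ i * e k $ j) = (if i = j then 1 else 0)"
  shows "(\<Sum>k\<in>K. B (e k) (e k)) = (\<Sum>b\<in>Basis. B b b)"
proof -
  define b where "b i j = B (axis i 1) (axis j 1)" for i j
  have ex: "B v w = (\<Sum>i\<in>UNIV. \<Sum>j\<in>UNIV. v $ i * w $ j * b i j)" for v w
    apply (subst (1) vec_axis_expansion[of v], subst (1) vec_axis_expansion[of w])
    by (simp add: b_def blinfun.sum_left blinfun.sum_right blinfun.scaleR_left blinfun.scaleR_right sum_distrib_left mult.assoc)
      (subst sum.swap, simp add: mult.left_commute)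
  have "(\<Sum>k\<in>K. B (e k) (e k)) = (\<Sum>i\<in>UNIV. \<Sum>j\<in>UNIV. (\<Sum>k\<in>K. e k $ i * e k $ j) * b i j)"
    unfolding ex sum_distrib_right
    by (subst sum.swap, rule sum.cong[OF refl], subst sum.swap) simp
  also have "\<dots> = (\<Sum>i\<in>UNIV. b i i)" by (simp add: on if_distrib if_distribR cong: if_cong)
  finally show ?thesis by (simp add: sum_Basis_axis b_def)
qed

section \<open>The spherical divergence identity\<close>

text \<open>
  With \<open>unit_dir\<close> these are the unit vectors of spherical coordinates, the normalised derivatives
  in the polar and in the azimuthal angle.
\<close>
definition dir_th :: "real \<times> real \<Rightarrow> real ^ 3" where
  "dir_th y = (cos (fst y) * cos (snd y)) *\<^sub>R axis 1 1 + (cos (fst y) * sin (snd y)) *\<^sub>R axis 2 1 - sin (fst y) *\<^sub>R axis 3 1"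
definition dir_ph :: "real \<times> real \<Rightarrow> real ^ 3" where
  "dir_ph y = - sin (snd y) *\<^sub>R axis 1 1 + cos (snd y) *\<^sub>R axis 2 1"

lemma continuous_on_dirs [continuous_intros]:
  fixes f :: "'a::t2_space \<Rightarrow> real \<times> real"
  assumes "continuous_on S f"
  shows "continuous_on S (\<lambda>x. dir_th (f x))" "continuous_on S (\<lambda>x. dir_ph (f x))"
  unfolding dir_th_def dir_ph_def by (intro continuous_intros assms)+

lemma trace_spherical:
  fixes B :: "(real ^ 3) \<Rightarrow>\<^sub>L (real ^ 3) \<Rightarrow>\<^sub>L real"
  shows "B (unit_dir y) (unit_dir y) + B (dir_th y) (dir_th y) + B (dir_ph y) (dir_ph y) = (\<Sum>b\<in>Basis. B b b)"
proof -
  define e where "e k = (if k = (0::nat) then unit_dir y else if k = 1 then dir_th y else dir_ph y)" for k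
  have sc: "sin a ^ 2 + cos a ^ 2 = 1" for a :: real by simp
  have n: "dir_th y $ 1 = cos (fst y) * cos (snd y)" "dir_th y $ 2 = cos (fst y) * sin (snd y)" "dir_th y $ 3 = - sin (fst y)"
     "dir_ph y $ 1 = - sin (snd y)" "dir_ph y $ 2 = cos (snd y)" "dir_ph y $ 3 = 0"
    by (simp_all add: dir_th_def dir_ph_def axis_def)
  have "(\<Sum>k\<in>{0,1,2}. B (e k) (e k)) = (\<Sum>b\<in>Basis. B b b)"
  proof (rule trace_frame)
    have *: "\<forall>i j. unit_dir y $ i * unit_dir y $ j + dir_th y $ i * dir_th y $ j + dir_ph y $ i * dir_ph y $ j = (if i = j then 1 else 0)"
      unfolding forall_3 n unit_dir_nth
      by simp (intro conjI; use sc[of "fst y"] sc[of "snd y"] in algebra)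
    fix i j :: 3
    show "(\<Sum>k\<in>{0,1,2}. e k $ i * e k $ j) = (if i = j then 1 else 0)"
      using *[rule_format, of i j] by (auto simp: e_def add.assoc)
  qed
  then show ?thesis by (simp add: e_def)
qed

lemma dir_derivs:
  "((\<lambda>s. unit_dir (s, ph)) has_vector_derivative dir_th (th, ph)) (at th within A)"
  "((\<lambda>s. dir_th (s, ph)) has_vector_derivative - unit_dir (th, ph)) (at th within A)"
  "((\<lambda>s. unit_dir (th, s)) has_vector_derivative sin th *\<^sub>R dir_ph (th, ph)) (at ph within A)"
  "((\<lambda>s. dir_ph (th, s)) has_vector_derivative - (sin th *\<^sub>R unit_dir (th, ph) + cos th *\<^sub>R dir_th (th, ph))) (at ph within A)"
proof -
  show "((\<lambda>s. unit_dir (s, ph)) has_vector_derivative dir_th (th, ph)) (at th within A)"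
    unfolding unit_dir_def dir_th_def fst_conv snd_conv
    by (auto intro!: derivative_eq_intros simp: algebra_simps)
  show "((\<lambda>s. dir_th (s, ph)) has_vector_derivative - unit_dir (th, ph)) (at th within A)"
    unfolding unit_dir_def dir_th_def fst_conv snd_conv
    by (auto intro!: derivative_eq_intros simp: algebra_simps)
  show "((\<lambda>s. unit_dir (th, s)) has_vector_derivative sin th *\<^sub>R dir_ph (th, ph)) (at ph within A)"
    unfolding unit_dir_def dir_ph_def fst_conv snd_conv
    by (auto intro!: derivative_eq_intros simp: algebra_simps)
  have "sin th *\<^sub>R unit_dir (th, ph) + cos th *\<^sub>R dir_th (th, ph) = cos ph *\<^sub>R axis 1 1 + sin ph *\<^sub>R axis 2 1"
  proof -
    have sc: "sin th * sin th + cos th * cos th = 1" using sin_cos_squared_add[of th] by (simp add: power2_eq_square)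
    have "\<forall>i. (sin th *\<^sub>R unit_dir (th, ph) + cos th *\<^sub>R dir_th (th, ph)) $ i = (cos ph *\<^sub>R axis 1 1 + sin ph *\<^sub>R axis 2 1 :: real^3) $ i"
      unfolding forall_3 using sc by (simp add: dir_th_def axis_def) (intro conjI; algebra)
    then show ?thesis by (simp add: vec_eq_iff)
  qed
  then show "((\<lambda>s. dir_ph (th, s)) has_vector_derivative - (sin th *\<^sub>R unit_dir (th, ph) + cos th *\<^sub>R dir_th (th, ph))) (at ph within A)"
    unfolding dir_ph_def fst_conv snd_conv
    by (auto intro!: derivative_eq_intros simp: algebra_simps)
qed

text \<open>
  The divergence theorem on the sphere for the tangential part of the gradient of $g(x + \tau w)$: the
  tangential Laplacian of a function has mean zero. The integrand times the surface element is a sum of a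
  derivative in the polar angle of a function that vanishes at both poles and a derivative in the azimuthal
  angle of a periodic function.
\<close>
lemma sphere_divergence:
  fixes g' :: "real ^ 3 \<Rightarrow> (real ^ 3) \<Rightarrow>\<^sub>L real"
  assumes g': "\<And>z. (g' has_derivative blinfun_apply (g'' z)) (at z)" and c: "continuous_on UNIV g''"
  shows "sphere_mean (\<lambda>w. \<tau> * ((\<Sum>b\<in>Basis. g'' (x + \<tau> *\<^sub>R w) b b) - g'' (x + \<tau> *\<^sub>R w) w w) - 2 * g' (x + \<tau> *\<^sub>R w) w) = 0"
proof -
  define X where "X y = x + \<tau> *\<^sub>R unit_dir y" for y
  \<comment> \<open>the polar and the azimuthal derivative just mentioned; see A0 and D0 for their primitives\<close>
  define A where "A y = cos (fst y) * g' (X y) (dir_th y) + sin (fst y) * (\<tau> * g'' (X y) (dir_th y) (dir_th y) - g' (X y) (unit_dir y))" for y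
  define D where "D y = \<tau> * sin (fst y) * g'' (X y) (dir_ph y) (dir_ph y) - sin (fst y) * g' (X y) (unit_dir y) - cos (fst y) * g' (X y) (dir_th y)" for y
  have c': "continuous_on UNIV g'" by (rule has_derivative_continuous_on) (use g' in auto)
  have cX: "continuous_on S X" for S unfolding X_def by (intro continuous_intros)
  have cA: "continuous_on S A" for S unfolding A_def
    by (intro continuous_intros continuous_on_compose2[OF c'] continuous_on_compose2[OF c] cX) auto
  have cD: "continuous_on S D" for S unfolding D_def
    by (intro continuous_intros continuous_on_compose2[OF c'] continuous_on_compose2[OF c] cX) auto
  have Xth: "((\<lambda>s. X (s, ph)) has_vector_derivative \<tau> *\<^sub>R dir_th (th, ph)) (at th within U)" for th ph U
    unfolding X_def by (rule derivative_eq_intros dir_derivs refl)+ simp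
  have Xph: "((\<lambda>s. X (th, s)) has_vector_derivative \<tau> *\<^sub>R sin th *\<^sub>R dir_ph (th, ph)) (at ph within U)" for th ph U
    unfolding X_def by (rule derivative_eq_intros dir_derivs refl)+ simp
  have A0: "integral {0..pi} (\<lambda>th. A (th, ph)) = 0" for ph
  proof (rule integral_unique)
    have "((\<lambda>th. A (th, ph)) has_integral (sin pi * g' (X (pi, ph)) (dir_th (pi, ph)) - sin 0 * g' (X (0, ph)) (dir_th (0, ph)))) {0..pi}"
    proof (rule fundamental_theorem_of_calculus)
      fix th assume "th \<in> {0..pi}"
      have 1: "((\<lambda>th. g' (X (th, ph))) has_vector_derivative g'' (X (th, ph)) (\<tau> *\<^sub>R dir_th (th, ph))) (at th within {0..pi})"
        by (rule has_vector_derivative_compose[OF has_derivative_at_withinI[OF g'] Xth]) auto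
      have 2: "((\<lambda>th. g' (X (th, ph)) (dir_th (th, ph))) has_vector_derivative (g' (X (th, ph)) (- unit_dir (th, ph)) + g'' (X (th, ph)) (\<tau> *\<^sub>R dir_th (th, ph)) (dir_th (th, ph)))) (at th within {0..pi})"
        by (rule bounded_bilinear.has_vector_derivative[OF bounded_bilinear_blinfun_apply 1 dir_derivs(2)])
      show "((\<lambda>th. sin th * g' (X (th, ph)) (dir_th (th, ph))) has_vector_derivative A (th, ph)) (at th within {0..pi})"
        using 2 unfolding has_real_derivative_iff_has_vector_derivative[symmetric] A_def
        by (auto intro!: derivative_eq_intros simp: blinfun.bilinear_simps algebra_simps)
    qed simp
    then show "((\<lambda>th. A (th, ph)) has_integral 0) {0..pi}" by simp
  qed
  have D0: "integral {0..2*pi} (\<lambda>ph. D (th, ph)) = 0" for th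
  proof (rule integral_unique)
    have "((\<lambda>ph. D (th, ph)) has_integral (g' (X (th, 2*pi)) (dir_ph (th, 2*pi)) - g' (X (th, 0)) (dir_ph (th, 0)))) {0..2*pi}"
    proof (rule fundamental_theorem_of_calculus)
      fix ph assume "ph \<in> {0..2*pi}"
      have 1: "((\<lambda>ph. g' (X (th, ph))) has_vector_derivative g'' (X (th, ph)) (\<tau> *\<^sub>R sin th *\<^sub>R dir_ph (th, ph))) (at ph within {0..2*pi})"
        by (rule has_vector_derivative_compose[OF has_derivative_at_withinI[OF g'] Xph]) auto
      have 2: "((\<lambda>ph. g' (X (th, ph)) (dir_ph (th, ph))) has_vector_derivative (g' (X (th, ph)) (- (sin th *\<^sub>R unit_dir (th, ph) + cos th *\<^sub>R dir_th (th, ph))) + g'' (X (th, ph)) (\<tau> *\<^sub>R sin th *\<^sub>R dir_ph (th, ph)) (dir_ph (th, ph)))) (at ph within {0..2*pi})"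
        by (rule bounded_bilinear.has_vector_derivative[OF bounded_bilinear_blinfun_apply 1 dir_derivs(4)])
      then show "((\<lambda>ph. g' (X (th, ph)) (dir_ph (th, ph))) has_vector_derivative D (th, ph)) (at ph within {0..2*pi})"
        unfolding D_def by (simp add: blinfun.bilinear_simps algebra_simps)
    qed simp
    moreover have "X (th, 2*pi) = X (th, 0)" "dir_ph (th, 2*pi) = dir_ph (th, 0)"
      by (simp_all add: X_def unit_dir_def dir_ph_def)
    ultimately show "((\<lambda>ph. D (th, ph)) has_integral 0) {0..2*pi}" by simp
  qed
  have "sphere_mean (\<lambda>w. \<tau> * ((\<Sum>b\<in>Basis. g'' (x + \<tau> *\<^sub>R w) b b) - g'' (x + \<tau> *\<^sub>R w) w w) - 2 * g' (x + \<tau> *\<^sub>R w) w)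
      = integral sphere_box (\<lambda>y. (A y + D y) / (4 * pi))"
    unfolding sphere_mean_def
  proof (rule integral_cong)
    fix y
    have "(\<Sum>b\<in>Basis. g'' (X y) b b) - g'' (X y) (unit_dir y) (unit_dir y) = g'' (X y) (dir_th y) (dir_th y) + g'' (X y) (dir_ph y) (dir_ph y)"
      using trace_spherical[of "g'' (X y)" y] by simp
    then have "A y + D y = sin (fst y) * (\<tau> * ((\<Sum>b\<in>Basis. g'' (X y) b b) - g'' (X y) (unit_dir y) (unit_dir y)) - 2 * g' (X y) (unit_dir y))"
      unfolding A_def D_def by (simp add: algebra_simps)
    then show "(sin (fst y) / (4 * pi)) *\<^sub>R (\<tau> * ((\<Sum>b\<in>Basis. g'' (x + \<tau> *\<^sub>R unit_dir y) b b) - g'' (x + \<tau> *\<^sub>R unit_dir y) (unit_dir y) (unit_dir y)) - 2 * g' (x + \<tau> *\<^sub>R unit_dir y) (unit_dir y)) = (A y + D y) / (4 * pi)"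
      unfolding X_def[symmetric] by simp
  qed
  also have "\<dots> = (integral sphere_box A + integral sphere_box D) / (4 * pi)"
    by (simp add: integral_add[OF integrable_continuous[OF cA] integrable_continuous[OF cD]])
  also have "integral sphere_box D = 0"
    using D0 by (subst integral_prod_continuous[OF cD]) simp
  also have "integral sphere_box A = 0"
    using A0 by (subst integral_prod_continuous[OF cA], subst integral_swap_continuous) (auto simp: split_beta intro!: cA)
  finally show ?thesis by simp
qed

section \<open>Classical solutions as functions on space-time\<close>

definition ST :: "real \<Rightarrow> (real \<times> (real ^ 3)) set" where "ST T = {0..T} \<times> UNIV"

lemma ST_iff [simp]: "(t, x) \<in> ST T \<longleftrightarrow> 0 \<le> t \<and> t \<le> T" by (auto simp: ST_def)

lemma convex_ST: "convex (ST T)" unfolding ST_def by (intro convex_Times) auto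

definition spatial :: "(real ^ 3) \<Rightarrow>\<^sub>L (real \<times> (real ^ 3))" where "spatial = Blinfun (\<lambda>x. (0, x))"

lemma spatial_apply [simp]: "blinfun_apply spatial x = (0, x)"
  unfolding spatial_def by (subst bounded_linear_Blinfun_apply) (auto intro!: bounded_linear_intros)

text \<open>
  \<open>C2_on\<close> with explicit derivatives, which the formulas for derivatives of integrals need.
\<close>
definition C2_with :: "'a::real_normed_vector set \<Rightarrow> ('a \<Rightarrow> real) \<Rightarrow> ('a \<Rightarrow> 'a \<Rightarrow>\<^sub>L real) \<Rightarrow> ('a \<Rightarrow> 'a \<Rightarrow>\<^sub>L 'a \<Rightarrow>\<^sub>L real) \<Rightarrow> bool" where
  "C2_with S f f' f'' \<longleftrightarrow> (\<forall>z\<in>S. (f has_derivative blinfun_apply (f' z)) (at z within S)) \<and>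
        (\<forall>z\<in>S. (f' has_derivative blinfun_apply (f'' z)) (at z within S)) \<and> continuous_on S f''"

lemma C2_on_iff: "C2_on S f \<longleftrightarrow> (\<exists>f' f''. C2_with S f f' f'')"
  unfolding C2_on_def C2_with_def ..

lemma C2_withD:
  assumes "C2_with S f f' f''"
  shows "z \<in> S \<Longrightarrow> (f has_derivative blinfun_apply (f' z)) (at z within S)"
    and "z \<in> S \<Longrightarrow> (f' has_derivative blinfun_apply (f'' z)) (at z within S)"
    and "continuous_on S f" "continuous_on S f'" "continuous_on S f''"
proof -
  have 1: "\<And>z. z \<in> S \<Longrightarrow> (f has_derivative blinfun_apply (f' z)) (at z within S)"
    and 2: "\<And>z. z \<in> S \<Longrightarrow> (f' has_derivative blinfun_apply (f'' z)) (at z within S)"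
    and 3: "continuous_on S f''" using assms unfolding C2_with_def by blast+
  show "z \<in> S \<Longrightarrow> (f has_derivative blinfun_apply (f' z)) (at z within S)"
    "z \<in> S \<Longrightarrow> (f' has_derivative blinfun_apply (f'' z)) (at z within S)" "continuous_on S f''"
    by (fact 1 2 3)+
  show "continuous_on S f" by (rule has_derivative_continuous_on[OF 1])
  show "continuous_on S f'" by (rule has_derivative_continuous_on[OF 2])
qed

text \<open>
  The linear problem $v_{tt} - \Delta v = g$ with data $(0, f)$, with derivatives taken from the
  Frechet derivatives on the slab; with $g = F(v)$ it is the semilinear problem, see
  \<open>classical_solution_iff_wave_sol\<close>.
\<close>
definition wave_sol :: "real \<Rightarrow> (real \<times> (real ^ 3) \<Rightarrow> real) \<Rightarrow> (real ^ 3 \<Rightarrow> real) \<Rightarrow> (real \<times> (real ^ 3) \<Rightarrow> real) \<Rightarrow> bool" where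
  "wave_sol T g f v \<longleftrightarrow> (\<exists>v' v''. C2_with (ST T) v v' v'' \<and>
     (\<forall>z\<in>ST T. v'' z (1, 0) (1, 0) - (\<Sum>b\<in>Basis. v'' z (0, b) (0, b)) = g z) \<and>
     (\<forall>x. v (0, x) = 0) \<and> (\<forall>x. v' (0, x) (1, 0) = f x))"

lemma time_line:
  assumes "C2_with (ST T) v v' v''" "t \<in> {0..T}"
  shows "((\<lambda>s. v (s, x)) has_vector_derivative v' (t, x) (1, 0)) (at t within {0..T})"
    and "((\<lambda>s. v' (s, x) a) has_vector_derivative v'' (t, x) (1, 0) a) (at t within {0..T})"
proof -
  have c: "((\<lambda>s. (s, x)) has_vector_derivative (1, 0)) (at t within {0..T})"
    by (auto simp: has_vector_derivative_def intro!: derivative_eq_intros)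
  show "((\<lambda>s. v (s, x)) has_vector_derivative v' (t, x) (1, 0)) (at t within {0..T})"
    by (rule has_vector_derivative_compose[OF C2_withD(1)[OF assms(1)] c]) (use assms in \<open>auto\<close>)
  have "((\<lambda>s. v' (s, x)) has_vector_derivative v'' (t, x) (1, 0)) (at t within {0..T})"
    by (rule has_vector_derivative_compose[OF C2_withD(2)[OF assms(1)] c]) (use assms in \<open>auto\<close>)
  from bounded_linear.has_vector_derivative[OF blinfun.bounded_linear_left this, of a]
  show "((\<lambda>s. v' (s, x) a) has_vector_derivative v'' (t, x) (1, 0) a) (at t within {0..T})" .
qed

lemma space_line:
  assumes "C2_with (ST T) v v' v''" "t \<in> {0..T}"
  shows "((\<lambda>s. v (t, x + s *\<^sub>R b)) has_real_derivative v' (t, x + s *\<^sub>R b) (0, b)) (at s)"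
    and "((\<lambda>s. v' (t, x + s *\<^sub>R b) a) has_real_derivative v'' (t, x + s *\<^sub>R b) (0, b) a) (at s)"
proof -
  have c: "((\<lambda>s. (t, x + s *\<^sub>R b)) has_vector_derivative (0, b)) (at s)"
    by (auto simp: has_vector_derivative_def intro!: derivative_eq_intros)
  show "((\<lambda>s. v (t, x + s *\<^sub>R b)) has_real_derivative v' (t, x + s *\<^sub>R b) (0, b)) (at s)"
    unfolding has_real_derivative_iff_has_vector_derivative
    by (rule has_vector_derivative_compose[OF C2_withD(1)[OF assms(1)] c]) (use assms in \<open>auto\<close>)
  have "((\<lambda>s. v' (t, x + s *\<^sub>R b)) has_vector_derivative v'' (t, x + s *\<^sub>R b) (0, b)) (at s)"
    by (rule has_vector_derivative_compose[OF C2_withD(2)[OF assms(1)] c]) (use assms in \<open>auto\<close>)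
  from bounded_linear.has_vector_derivative[OF blinfun.bounded_linear_left this, of a]
  show "((\<lambda>s. v' (t, x + s *\<^sub>R b) a) has_real_derivative v'' (t, x + s *\<^sub>R b) (0, b) a) (at s)"
    unfolding has_real_derivative_iff_has_vector_derivative .
qed

text \<open>
  Iterated partial derivatives along lines are entries of the second Frechet derivative, one-sided ones at
  the ends of the time interval included.
\<close>
lemma classical_solution_iff_wave_sol:
  assumes T: "0 < T"
  shows "classical_solution F f T u \<longleftrightarrow> wave_sol T (\<lambda>z. F (u (fst z) (snd z))) f (\<lambda>z. u (fst z) (snd z))"
proof -
  define v where "v = (\<lambda>z. u (fst z) (snd z))"
  have uv: "u t x = v (t, x)" for t x by (simp add: v_def)
  have key: "time_deriv T u t x = v' (t, x) (1, 0)"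
     "time_deriv T (time_deriv T u) t x = v'' (t, x) (1, 0) (1, 0)"
     "laplacian (u t) x = (\<Sum>b\<in>Basis. v'' (t, x) (0, b) (0, b))"
    if v: "C2_with (ST T) v v' v''" and t: "t \<in> {0..T}" for t x v' v''
  proof -
    have 1: "time_deriv T u t x = v' (t, x) (1, 0)" if "t \<in> {0..T}" for t
      unfolding time_deriv_def uv
      by (rule vector_derivative_within_closed_interval[OF T]) (use that time_line(1)[OF v] in auto)
    then show "time_deriv T u t x = v' (t, x) (1, 0)" using t .
    have "vector_derivative (\<lambda>s. time_deriv T u s x) (at t within {0..T}) = v'' (t, x) (1, 0) (1, 0)"
    proof (rule vector_derivative_within_closed_interval[OF T t])
      show "((\<lambda>s. time_deriv T u s x) has_vector_derivative v'' (t, x) (1, 0) (1, 0)) (at t within {0..T})"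
        by (rule has_vector_derivative_transform[OF t _ time_line(2)[OF v t]]) (use 1 in auto)
    qed
    then show "time_deriv T (time_deriv T u) t x = v'' (t, x) (1, 0) (1, 0)"
      by (subst time_deriv_def)
    show "laplacian (u t) x = (\<Sum>b\<in>Basis. v'' (t, x) (0, b) (0, b))"
      unfolding laplacian_def
    proof (rule sum.cong[OF refl])
      fix b :: "real ^ 3"
      have "deriv (\<lambda>s. u t (x + s *\<^sub>R b)) = (\<lambda>s. v' (t, x + s *\<^sub>R b) (0, b))"
        unfolding uv using DERIV_imp_deriv[OF space_line(1)[OF v t]] by (rule ext)
      then show "(deriv ^^ 2) (\<lambda>s. u t (x + s *\<^sub>R b)) 0 = v'' (t, x) (0, b) (0, b)"
        using DERIV_imp_deriv[OF space_line(2)[OF v t], of x b "(0,b)" 0] by (simp add: numeral_2_eq_2)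
    qed
  qed
  have c2: "C2_on ({0..T} \<times> UNIV) (\<lambda>(t, x). u t x) \<longleftrightarrow> (\<exists>v' v''. C2_with (ST T) v v' v'')"
    unfolding C2_on_iff ST_def v_def case_prod_unfold ..
  have 0: "0 \<in> {0..T}" using T by simp
  have "classical_solution F f T u \<longleftrightarrow> (\<exists>v' v''. C2_with (ST T) v v' v'') \<and>
     (\<forall>t\<in>{0..T}. \<forall>x. time_deriv T (time_deriv T u) t x - laplacian (u t) x = F (v (t, x))) \<and>
     (\<forall>x. v (0, x) = 0) \<and> (\<forall>x. time_deriv T u 0 x = f x)"
    unfolding classical_solution_def c2 uv ..
  also have "\<dots> \<longleftrightarrow> wave_sol T (\<lambda>z. F (v z)) f v"
  proof
    assume *: "(\<exists>v' v''. C2_with (ST T) v v' v'') \<and>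
     (\<forall>t\<in>{0..T}. \<forall>x. time_deriv T (time_deriv T u) t x - laplacian (u t) x = F (v (t, x))) \<and>
     (\<forall>x. v (0, x) = 0) \<and> (\<forall>x. time_deriv T u 0 x = f x)"
    then obtain v' v'' where v: "C2_with (ST T) v v' v''" by blast
    show "wave_sol T (\<lambda>z. F (v z)) f v"
      unfolding wave_sol_def
    proof (intro exI[of _ v'] exI[of _ v''] conjI v ballI)
      fix z assume z: "z \<in> ST T"
      obtain t x where tx: "z = (t, x)" by (cases z)
      have t: "t \<in> {0..T}" using z by (simp add: tx)
      show "v'' z (1, 0) (1, 0) - (\<Sum>b\<in>Basis. v'' z (0, b) (0, b)) = F (v z)"
        using * t key(2,3)[OF v t] unfolding tx by metis
    qed (use * key(1)[OF v 0] in auto)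
  next
    assume "wave_sol T (\<lambda>z. F (v z)) f v"
    then obtain v' v'' where v: "C2_with (ST T) v v' v''" and
      e: "\<forall>z\<in>ST T. v'' z (1, 0) (1, 0) - (\<Sum>b\<in>Basis. v'' z (0, b) (0, b)) = F (v z)"
      and d: "\<forall>x. v (0, x) = 0" "\<forall>x. v' (0, x) (1, 0) = f x"
      unfolding wave_sol_def by blast
    show "(\<exists>v' v''. C2_with (ST T) v v' v'') \<and>
     (\<forall>t\<in>{0..T}. \<forall>x. time_deriv T (time_deriv T u) t x - laplacian (u t) x = F (v (t, x))) \<and>
     (\<forall>x. v (0, x) = 0) \<and> (\<forall>x. time_deriv T u 0 x = f x)"
    proof (intro conjI ballI allI)
      fix t x assume t: "t \<in> {0..T}"
      then have "(t, x) \<in> ST T" by simp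
      from e[rule_format, OF this] show "time_deriv T (time_deriv T u) t x - laplacian (u t) x = F (v (t, x))"
        by (simp only: key(2,3)[OF v t])
    qed (use v d key(1)[OF v 0] in auto)
  qed
  finally show ?thesis unfolding v_def .
qed

section \<open>Kirchhoff's formula\<close>

definition free_wave :: "(real ^ 3 \<Rightarrow> real) \<Rightarrow> real \<times> (real ^ 3) \<Rightarrow> real" where
  "free_wave f z = fst z * sphere_mean (\<lambda>w. f (snd z + fst z *\<^sub>R w))"

definition duhamel :: "(real \<times> (real ^ 3) \<Rightarrow> real) \<Rightarrow> real \<times> (real ^ 3) \<Rightarrow> real" where
  "duhamel g z = integral {0..fst z} (\<lambda>s. (fst z - s) * sphere_mean (\<lambda>w. g (s, snd z + (fst z - s) *\<^sub>R w)))"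

lemma sphere_mean_param_cont:
  fixes k :: "'a::t2_space \<Rightarrow> real ^ 3 \<Rightarrow> real"
  assumes "continuous_on (U \<times> sphere 0 1) (\<lambda>q. k (fst q) (snd q))"
  shows "continuous_on U (\<lambda>u. sphere_mean (k u))"
  unfolding sphere_mean_def
proof (rule integral_continuous_on_param)
  have "continuous_on (U \<times> sphere_box) (\<lambda>q. (sin (fst (snd q)) / (4 * pi)) *\<^sub>R k (fst q) (unit_dir (snd q)))"
  proof (intro continuous_on_scaleR)
    show "continuous_on (U \<times> sphere_box) (\<lambda>q. k (fst q) (unit_dir (snd q)))"
      by (rule continuous_on_compose2[OF assms, of _ "\<lambda>q. (fst q, unit_dir (snd q))", simplified])
        (auto intro!: continuous_intros)
  qed (auto intro!: continuous_intros)
  then show "continuous_on (U \<times> sphere_box) (\<lambda>(u, y). (sin (fst y) / (4 * pi)) *\<^sub>R k u (unit_dir y))"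
    by (simp add: split_beta)
qed

lemma sphere_mean_has_derivative:
  fixes k :: "real \<Rightarrow> real ^ 3 \<Rightarrow> real"
  assumes d: "\<And>u w. u \<in> U \<Longrightarrow> norm w = 1 \<Longrightarrow> ((\<lambda>u. k u w) has_real_derivative k' u w) (at u within U)"
    and c: "\<And>u. u \<in> U \<Longrightarrow> continuous_on (sphere 0 1) (k u)"
    and c': "continuous_on (U \<times> sphere 0 1) (\<lambda>q. k' (fst q) (snd q))" and u: "u \<in> U" "convex U"
  shows "((\<lambda>u. sphere_mean (k u)) has_real_derivative sphere_mean (k' u)) (at u within U)"
  unfolding sphere_mean_def
proof (rule leibniz_rule_field_derivative[where fx="\<lambda>u y. (sin (fst y) / (4 * pi)) *\<^sub>R k' u (unit_dir y)"])
  show "(\<lambda>y. (sin (fst y) / (4 * pi)) *\<^sub>R k u (unit_dir y)) integrable_on sphere_box" if "u \<in> U" for u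
    by (rule sphere_mean_int[OF c[OF that]])
  show "((\<lambda>u. (sin (fst y) / (4 * pi)) *\<^sub>R k u (unit_dir y)) has_real_derivative (sin (fst y) / (4 * pi)) *\<^sub>R k' u (unit_dir y)) (at u within U)"
    if "u \<in> U" for u y unfolding real_scaleR_def by (rule DERIV_cmult[OF d[OF that]]) simp
  have "continuous_on (U \<times> sphere_box) (\<lambda>q. (sin (fst (snd q)) / (4 * pi)) *\<^sub>R k' (fst q) (unit_dir (snd q)))"
  proof (intro continuous_on_scaleR)
    show "continuous_on (U \<times> sphere_box) (\<lambda>q. k' (fst q) (unit_dir (snd q)))"
      by (rule continuous_on_compose2[OF c', of _ "\<lambda>q. (fst q, unit_dir (snd q))", simplified])
        (auto intro!: continuous_intros)
  qed (auto intro!: continuous_intros)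
  then show "continuous_on (U \<times> sphere_box) (\<lambda>(u, y). (sin (fst y) / (4 * pi)) *\<^sub>R k' u (unit_dir y))"
    by (simp add: split_beta)
qed (use u in auto)

lemma C2_with_slice:
  assumes v: "C2_with (ST T) v v' v''" and t: "t \<in> {0..T}"
  shows "C2_with UNIV (\<lambda>x. v (t, x)) (\<lambda>x. pull1 spatial (v' (t, x))) (\<lambda>x. pull2 spatial (v'' (t, x)))"
  unfolding C2_with_def
proof (intro conjI ballI)
  fix x
  have c: "((\<lambda>x. (t, x)) has_derivative blinfun_apply spatial) (at x)"
    by (auto simp: fun_eq_iff intro!: derivative_eq_intros)
  have "((\<lambda>x. v (t, x)) has_derivative (\<lambda>w. v' (t, x) (spatial w))) (at x)"
    by (rule has_derivative_in_compose2[OF C2_withD(1)[OF v] _ _ c]) (use t in auto)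
  then show "((\<lambda>x. v (t, x)) has_derivative blinfun_apply (pull1 spatial (v' (t, x)))) (at x)"
    by (rule has_derivative_eq_rhs) (auto simp: fun_eq_iff)
  have "((\<lambda>x. v' (t, x)) has_derivative (\<lambda>w. v'' (t, x) (spatial w))) (at x)"
    by (rule has_derivative_in_compose2[OF C2_withD(2)[OF v] _ _ c]) (use t in auto)
  from bounded_linear.has_derivative[OF blinfun.bounded_linear_right this, of "bounded_bilinear.prod_left (o\<^sub>L) spatial"]
  show "((\<lambda>x. pull1 spatial (v' (t, x))) has_derivative blinfun_apply (pull2 spatial (v'' (t, x)))) (at x)"
    unfolding prod_left_compose_apply pull1_def[symmetric]
    by (rule has_derivative_eq_rhs) (auto simp: fun_eq_iff intro!: blinfun_eqI)
next
  show "continuous_on UNIV (\<lambda>x. pull2 spatial (v'' (t, x)))"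
    unfolding pull2_def by (intro continuous_intros continuous_on_compose2[OF C2_withD(5)[OF v]]) (use t in auto)
qed

text \<open>
  Darboux's equation: $\tau$ times the spherical mean over radius $\tau$ solves the one-dimensional
  wave equation in $\tau$ with the Laplacian of $g$ as right-hand side. This is why Kirchhoff's formula
  solves the wave equation.
\<close>
lemma darboux:
  fixes g :: "real ^ 3 \<Rightarrow> real"
  assumes g: "C2_with UNIV g g' g''"
  shows "((\<lambda>\<tau>. \<tau> * sphere_mean (\<lambda>w. g (x + \<tau> *\<^sub>R w))) has_real_derivative
            sphere_mean (\<lambda>w. g (x + \<tau> *\<^sub>R w) + \<tau> * g' (x + \<tau> *\<^sub>R w) w)) (at \<tau>)"
    and "((\<lambda>\<tau>. sphere_mean (\<lambda>w. g (x + \<tau> *\<^sub>R w) + \<tau> * g' (x + \<tau> *\<^sub>R w) w)) has_real_derivative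
            \<tau> * sphere_mean (\<lambda>w. \<Sum>b\<in>Basis. g'' (x + \<tau> *\<^sub>R w) b b)) (at \<tau>)"
proof -
  note gc = C2_withD(3-5)[OF g]
  have line: "((\<lambda>\<tau>. x + \<tau> *\<^sub>R w) has_vector_derivative w) (at \<tau>)" for w \<tau>
    by (auto intro!: derivative_eq_intros)
  have d1: "((\<lambda>\<tau>. g (x + \<tau> *\<^sub>R w)) has_real_derivative g' (x + \<tau> *\<^sub>R w) w) (at \<tau>)" for w \<tau>
    unfolding has_real_derivative_iff_has_vector_derivative
    by (rule has_vector_derivative_compose[OF C2_withD(1)[OF g] line]) auto
  have "((\<lambda>\<tau>. g' (x + \<tau> *\<^sub>R w)) has_vector_derivative g'' (x + \<tau> *\<^sub>R w) w) (at \<tau>)" for w \<tau>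
    by (rule has_vector_derivative_compose[OF C2_withD(2)[OF g] line]) auto
  from bounded_linear.has_vector_derivative[OF blinfun.bounded_linear_left this]
  have d2: "((\<lambda>\<tau>. g' (x + \<tau> *\<^sub>R w) w) has_real_derivative g'' (x + \<tau> *\<^sub>R w) w w) (at \<tau>)" for w \<tau>
    unfolding has_real_derivative_iff_has_vector_derivative .
  have c0: "continuous_on S (\<lambda>w. g (x + \<tau> *\<^sub>R w))" "continuous_on S (\<lambda>w. g' (x + \<tau> *\<^sub>R w) w)"
     "continuous_on S (\<lambda>w. g'' (x + \<tau> *\<^sub>R w) w w)" "continuous_on S (\<lambda>w. \<Sum>b\<in>Basis. g'' (x + \<tau> *\<^sub>R w) b b)" for S \<tau>
    by (auto intro!: continuous_intros continuous_on_compose2[OF gc(1)] continuous_on_compose2[OF gc(2)] continuous_on_compose2[OF gc(3)])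
  have "((\<lambda>\<tau>. sphere_mean (\<lambda>w. \<tau> * g (x + \<tau> *\<^sub>R w))) has_real_derivative
            sphere_mean (\<lambda>w. g (x + \<tau> *\<^sub>R w) + \<tau> * g' (x + \<tau> *\<^sub>R w) w)) (at \<tau>)"
  proof (rule sphere_mean_has_derivative)
    fix u w show "((\<lambda>\<tau>. \<tau> * g (x + \<tau> *\<^sub>R w)) has_real_derivative g (x + u *\<^sub>R w) + u * g' (x + u *\<^sub>R w) w) (at u)"
      by (auto intro!: derivative_eq_intros d1)
  qed (auto intro!: continuous_intros c0 continuous_on_compose2[OF gc(1)] continuous_on_compose2[OF gc(2)])
  then show "((\<lambda>\<tau>. \<tau> * sphere_mean (\<lambda>w. g (x + \<tau> *\<^sub>R w))) has_real_derivative
            sphere_mean (\<lambda>w. g (x + \<tau> *\<^sub>R w) + \<tau> * g' (x + \<tau> *\<^sub>R w) w)) (at \<tau>)"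
    by (simp add: sphere_mean_cmult)
  have "((\<lambda>\<tau>. sphere_mean (\<lambda>w. g (x + \<tau> *\<^sub>R w) + \<tau> * g' (x + \<tau> *\<^sub>R w) w)) has_real_derivative
            sphere_mean (\<lambda>w. 2 * g' (x + \<tau> *\<^sub>R w) w + \<tau> * g'' (x + \<tau> *\<^sub>R w) w w)) (at \<tau>)"
  proof (rule sphere_mean_has_derivative)
    fix u w show "((\<lambda>\<tau>. g (x + \<tau> *\<^sub>R w) + \<tau> * g' (x + \<tau> *\<^sub>R w) w) has_real_derivative 2 * g' (x + u *\<^sub>R w) w + u * g'' (x + u *\<^sub>R w) w w) (at u)"
      by (auto intro!: derivative_eq_intros d1 d2)
  qed (auto intro!: continuous_intros c0 continuous_on_compose2[OF gc(3)] continuous_on_compose2[OF gc(2)])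
  moreover have "sphere_mean (\<lambda>w. 2 * g' (x + \<tau> *\<^sub>R w) w + \<tau> * g'' (x + \<tau> *\<^sub>R w) w w) = \<tau> * sphere_mean (\<lambda>w. \<Sum>b\<in>Basis. g'' (x + \<tau> *\<^sub>R w) b b)"
  proof -
    have "\<tau> * sphere_mean (\<lambda>w. \<Sum>b\<in>Basis. g'' (x + \<tau> *\<^sub>R w) b b) - sphere_mean (\<lambda>w. 2 * g' (x + \<tau> *\<^sub>R w) w + \<tau> * g'' (x + \<tau> *\<^sub>R w) w w)
       = sphere_mean (\<lambda>w. \<tau> * (\<Sum>b\<in>Basis. g'' (x + \<tau> *\<^sub>R w) b b) - (2 * g' (x + \<tau> *\<^sub>R w) w + \<tau> * g'' (x + \<tau> *\<^sub>R w) w w))"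
      by (subst sphere_mean_diff) (auto intro!: continuous_intros c0 simp: sphere_mean_cmult)
    also have "\<dots> = 0"
      using sphere_divergence[of g' g'' \<tau> x] C2_withD(2)[OF g] gc(3) by (simp add: algebra_simps)
    finally show ?thesis by simp
  qed
  ultimately show "((\<lambda>\<tau>. sphere_mean (\<lambda>w. g (x + \<tau> *\<^sub>R w) + \<tau> * g' (x + \<tau> *\<^sub>R w) w)) has_real_derivative
            \<tau> * sphere_mean (\<lambda>w. \<Sum>b\<in>Basis. g'' (x + \<tau> *\<^sub>R w) b b)) (at \<tau>)" by simp
qed

text \<open>
  The function \<open>N s\<close> below averages $v + (t - s) (v_t + \partial_w v)$ over the sphere of radius
  $t - s$ that the backward light cone from $(t, x)$ cuts out at time $s$. Along the cone its derivative
  contains only the wave operator, up to a term that \<open>sphere_divergence\<close> integrates to zero; its value at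
  $s = t$ is $v(t, x)$ and its value at $s = 0$ is the free wave.
\<close>
theorem kirchhoff:
  assumes sol: "wave_sol T g f v" and t: "t \<in> {0..T}"
  shows "v (t, x) = free_wave f (t, x) + duhamel g (t, x)"
proof (cases "t = 0")
  case True
  then show ?thesis using sol by (auto simp: wave_sol_def free_wave_def duhamel_def)
next
  case False
  with t have tp: "0 < t" "t \<le> T" by auto
  obtain v' v'' where v: "C2_with (ST T) v v' v''"
    and eq: "\<And>z. z \<in> ST T \<Longrightarrow> v'' z (1, 0) (1, 0) - (\<Sum>b\<in>Basis. v'' z (0, b) (0, b)) = g z"
    and v0: "\<And>x. v (0, x) = 0" and v1: "\<And>x. v' (0, x) (1, 0) = f x"
    using sol unfolding wave_sol_def by blast
  note vc = C2_withD(3-5)[OF v]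
  have cg: "continuous_on (ST T) g"
  proof -
    have "continuous_on (ST T) (\<lambda>z. v'' z (1, 0) (1, 0) - (\<Sum>b\<in>Basis. v'' z (0, b) (0, b)))"
      by (intro continuous_intros vc)
    then show ?thesis by (rule continuous_on_eq) (simp add: eq)
  qed
  define X where "X s w = (s, x + (t - s) *\<^sub>R w)" for s and w :: "real ^ 3"
  have XS: "X s w \<in> ST T" if "s \<in> {0..t}" for s w using that tp by (simp add: X_def)
  have cX: "continuous_on U (\<lambda>q. X (a q) (b q))" if "continuous_on U a" "continuous_on U b" for U :: "'z::t2_space set" and a b
    unfolding X_def by (intro continuous_intros that)
  have dX: "((\<lambda>s. X s w) has_vector_derivative (1, - w)) (at s within U)" for s w U
    unfolding X_def by (auto simp: has_vector_derivative_def intro!: derivative_eq_intros)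
  define N where "N s = sphere_mean (\<lambda>w. v (X s w) + (t - s) * v' (X s w) (1, w))" for s
  define N' where "N' s = sphere_mean (\<lambda>w. v' (X s w) (1, - w) - v' (X s w) (1, w) + (t - s) * v'' (X s w) (1, - w) (1, w))" for s
  have der: "(N has_real_derivative N' s) (at s within {0..t})" if s: "s \<in> {0..t}" for s
    unfolding N_def[abs_def] N'_def
  proof (rule sphere_mean_has_derivative)
    fix s w assume s: "s \<in> {0..t}"
    have 1: "((\<lambda>s. v (X s w)) has_real_derivative v' (X s w) (1, - w)) (at s within {0..t})"
      unfolding has_real_derivative_iff_has_vector_derivative
      by (rule has_vector_derivative_compose[OF C2_withD(1)[OF v XS] dX]) (use s XS in auto)
    have "((\<lambda>s. v' (X s w)) has_vector_derivative v'' (X s w) (1, - w)) (at s within {0..t})"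
      by (rule has_vector_derivative_compose[OF C2_withD(2)[OF v XS] dX]) (use s XS in auto)
    from bounded_linear.has_vector_derivative[OF blinfun.bounded_linear_left this, of "(1, w)"]
    have 2: "((\<lambda>s. v' (X s w) (1, w)) has_real_derivative v'' (X s w) (1, - w) (1, w)) (at s within {0..t})"
      unfolding has_real_derivative_iff_has_vector_derivative .
    show "((\<lambda>s. v (X s w) + (t - s) * v' (X s w) (1, w)) has_real_derivative
       v' (X s w) (1, - w) - v' (X s w) (1, w) + (t - s) * v'' (X s w) (1, - w) (1, w)) (at s within {0..t})"
      by (auto intro!: derivative_eq_intros 1 2)
  next
    show "continuous_on (sphere 0 1) (\<lambda>w. v (X s w) + (t - s) * v' (X s w) (1, w))" if "s \<in> {0..t}" for s
      by (intro continuous_intros continuous_on_compose2[OF vc(1)] continuous_on_compose2[OF vc(2)] cX) (use XS that in auto)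
    show "continuous_on ({0..t} \<times> sphere 0 1) (\<lambda>q. v' (X (fst q) (snd q)) (1, - snd q) - v' (X (fst q) (snd q)) (1, snd q) + (t - fst q) * v'' (X (fst q) (snd q)) (1, - snd q) (1, snd q))"
      by (intro continuous_intros continuous_on_compose2[OF vc(3)] continuous_on_compose2[OF vc(2)] cX) (use XS in auto)
  qed (use s in auto)
  have N'_eq: "N' s = (t - s) * sphere_mean (\<lambda>w. g (X s w))" if s: "0 < s" "s < t" for s
  proof -
    have sI: "s \<in> {0..t}" "s \<in> {0..T}" using s tp by auto
    have pt: "v' (X s w) (1, - w) - v' (X s w) (1, w) + (t - s) * v'' (X s w) (1, - w) (1, w)
       = (t - s) * g (X s w) + ((t - s) * ((\<Sum>b\<in>Basis. v'' (X s w) (0, b) (0, b)) - v'' (X s w) (0, w) (0, w)) - 2 * v' (X s w) (0, w))" for w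
    proof -
      have sym: "v'' (X s w) (1, 0) (0, w) = v'' (X s w) (0, w) (1, 0)"
      proof (rule second_derivative_symmetric[OF C2_withD(1,2)[OF v] vc(3), of "t - s"])
        fix r k assume "r \<in> {0..t - s}" "k \<in> {0..t - s}"
        then show "X s w + r *\<^sub>R (1, 0) + k *\<^sub>R (0, w) \<in> ST T"
          using s tp by (simp add: X_def)
      qed (use s in auto)
      have d: "(1, - w) = (1, 0) - (0 :: real, w)" "(1, w) = (1, 0) + (0 :: real, w)" by (auto simp: minus_prod_def plus_prod_def)
      have g: "g (X s w) = v'' (X s w) (1, 0) (1, 0) - (\<Sum>b\<in>Basis. v'' (X s w) (0, b) (0, b))"
        using eq[OF XS[OF sI(1)]] by simp
      define e0 e1 where "e0 = (1::real, 0::real^3)" and "e1 = (0::real, w)"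
      show ?thesis using sym unfolding d g e0_def[symmetric] e1_def[symmetric]
        by (simp add: blinfun.add_left blinfun.add_right blinfun.diff_left blinfun.diff_right algebra_simps)
    qed
    have "N' s = sphere_mean (\<lambda>w. (t - s) * g (X s w)) + sphere_mean (\<lambda>w. ((t - s) * ((\<Sum>b\<in>Basis. v'' (X s w) (0, b) (0, b)) - v'' (X s w) (0, w) (0, w)) - 2 * v' (X s w) (0, w)))"
      unfolding N'_def pt
      by (rule sphere_mean_add)
        (intro continuous_intros continuous_on_compose2[OF vc(3)] continuous_on_compose2[OF vc(2)] continuous_on_compose2[OF cg] cX; use XS sI in auto)+
    also have "sphere_mean (\<lambda>w. ((t - s) * ((\<Sum>b\<in>Basis. v'' (X s w) (0, b) (0, b)) - v'' (X s w) (0, w) (0, w)) - 2 * v' (X s w) (0, w))) = 0"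
      using sphere_divergence[of "\<lambda>y. pull1 spatial (v' (s, y))" "\<lambda>y. pull2 spatial (v'' (s, y))" "t - s" x]
        C2_withD(2,5)[OF C2_with_slice[OF v sI(2)]] unfolding X_def by simp
    finally show ?thesis by (simp add: sphere_mean_cmult)
  qed
  have "((\<lambda>s. (t - s) * sphere_mean (\<lambda>w. g (X s w))) has_integral N t - N 0) {0..t}"
  proof (rule fundamental_theorem_of_calculus_interior)
    show "continuous_on {0..t} N" by (rule DERIV_continuous_on[OF der])
    fix s assume s: "s \<in> {0<..<t}"
    then have "(N has_real_derivative N' s) (at s)"
      using der[of s] at_within_Icc_at[of 0 s t] by auto
    then show "(N has_vector_derivative (t - s) * sphere_mean (\<lambda>w. g (X s w))) (at s)"
      using N'_eq[of s] s by (simp add: has_real_derivative_iff_has_vector_derivative)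
  qed (use tp in auto)
  then have "duhamel g (t, x) = N t - N 0"
    unfolding duhamel_def X_def by (simp add: integral_unique)
  moreover have "N t = v (t, x)" by (simp add: N_def X_def)
  moreover have "N 0 = free_wave f (t, x)"
  proof -
    have sp0: "v' (0, y) (0, w) = 0" for y w
    proof -
      have "((\<lambda>s. v (0, y + s *\<^sub>R w)) has_real_derivative v' (0, y + 0 *\<^sub>R w) (0, w)) (at 0)"
        by (rule space_line(1)[OF v]) (use tp in auto)
      then have "((\<lambda>s. 0) has_real_derivative v' (0, y) (0, w)) (at 0)" by (simp add: v0)
      then show ?thesis using DERIV_unique[OF _ DERIV_const] by blast
    qed
    have "v' (0, y) (1, w) = f y" for y w
    proof -
      have "(1, w) = (1, 0) + (0::real, w)" by simp
      then show ?thesis using v1[of y] sp0[of y w] by (metis blinfun.add_right add.right_neutral)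
    qed
    then show ?thesis unfolding N_def free_wave_def X_def by (simp add: v0 sphere_mean_cmult)
  qed
  ultimately show ?thesis by simp
qed

section \<open>Regularity of the free wave and of the Duhamel integral\<close>

text \<open>
  Parametrisation of the backward light cone of $z$ by the box $[0,1] \times [0,\pi] \times [0,2\pi]$:
  with the substitution $s \mapsto (1 - s) t$ the Duhamel integral is $t^2$ times the integral of
  $h(\Lambda_y z)$ against the weight \<open>\<kappa>3\<close>, and \<open>\<Lambda>3\<close> is linear in $z$. The pair
  \<open>\<kappa>2\<close>, \<open>\<Lambda>2\<close> does the same for the sphere at time 0.
\<close>
definition \<kappa>3 :: "real \<times> real \<times> real \<Rightarrow> real" where "\<kappa>3 y = fst y * (sin (fst (snd y)) / (4 * pi))"

definition \<Lambda>3 :: "real \<times> real \<times> real \<Rightarrow> (real \<times> (real ^ 3)) \<Rightarrow>\<^sub>L (real \<times> (real ^ 3))" where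
  "\<Lambda>3 y = (1 - fst y) *\<^sub>R (id_blinfun - (spatial o\<^sub>L snd_blinfun)) + (spatial o\<^sub>L snd_blinfun)
     + (spatial o\<^sub>L (blinfun_scaleR_left (fst y *\<^sub>R unit_dir (snd y)) o\<^sub>L fst_blinfun))"

definition \<kappa>2 :: "real \<times> real \<Rightarrow> real" where "\<kappa>2 y = sin (fst y) / (4 * pi)"

definition \<Lambda>2 :: "real \<times> real \<Rightarrow> (real \<times> (real ^ 3)) \<Rightarrow>\<^sub>L (real ^ 3)" where
  "\<Lambda>2 y = snd_blinfun + (blinfun_scaleR_left (unit_dir y) o\<^sub>L fst_blinfun)"

abbreviation "cone_box \<equiv> cbox (0::real, 0::real, 0::real) (1, pi, 2 * pi)"

lemma cone_box_iff: "(s, y) \<in> cone_box \<longleftrightarrow> 0 \<le> s \<and> s \<le> 1 \<and> y \<in> sphere_box"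
  by (cases y) (auto simp: cbox_Pair_eq)

lemma \<Lambda>3_apply: "blinfun_apply (\<Lambda>3 y) z = ((1 - fst y) * fst z, snd z + (fst z * fst y) *\<^sub>R unit_dir (snd y))"
  by (cases z) (simp add: \<Lambda>3_def blinfun.add_left blinfun.diff_left blinfun.scaleR_left)

lemma \<Lambda>2_apply: "blinfun_apply (\<Lambda>2 y) z = snd z + fst z *\<^sub>R unit_dir y"
  by (simp add: \<Lambda>2_def blinfun.add_left)

lemma norm_\<Lambda>3: "y \<in> cone_box \<Longrightarrow> norm (\<Lambda>3 y) \<le> 3"
proof (rule norm_blinfun_bound)
  fix z assume y: "y \<in> cone_box"
  obtain s d where sd: "y = (s, d)" by (cases y)
  have s: "0 \<le> s" "s \<le> 1" using y by (auto simp: sd cone_box_iff)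
  have "norm (\<Lambda>3 y z) \<le> norm ((1 - s) * fst z) + norm (snd z + (fst z * s) *\<^sub>R unit_dir d)"
    by (simp add: \<Lambda>3_apply sd norm_Pair_le del: real_norm_def)
  also have "\<dots> \<le> \<bar>fst z\<bar> + (norm (snd z) + \<bar>fst z\<bar>)"
  proof (intro add_mono)
    show "norm ((1 - s) * fst z) \<le> \<bar>fst z\<bar>" using s by (simp add: abs_mult mult_left_le_one_le)
    have "norm ((fst z * s) *\<^sub>R unit_dir d) \<le> \<bar>fst z\<bar>" using s by (simp add: abs_mult mult_right_le_one_le)
    then show "norm (snd z + (fst z * s) *\<^sub>R unit_dir d) \<le> norm (snd z) + \<bar>fst z\<bar>"
      by (intro order_trans[OF norm_triangle_ineq] add_left_mono)
  qed
  also have "\<dots> \<le> 3 * norm z" using norm_fst_le[of "fst z" "snd z"] norm_snd_le[of "snd z" "fst z"] by simp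
  finally show "norm (\<Lambda>3 y z) \<le> 3 * norm z" .
qed simp

lemma norm_\<Lambda>2: "norm (\<Lambda>2 y) \<le> 2"
proof (rule norm_blinfun_bound)
  fix z
  have "norm (\<Lambda>2 y z) \<le> norm (snd z) + \<bar>fst z\<bar>"
    unfolding \<Lambda>2_apply by (rule order_trans[OF norm_triangle_ineq]) simp
  then show "norm (\<Lambda>2 y z) \<le> 2 * norm z" using norm_fst_le[of "fst z" "snd z"] norm_snd_le[of "snd z" "fst z"] by simp
qed simp

lemma \<Lambda>3_ST: "y \<in> cone_box \<Longrightarrow> z \<in> ST T \<Longrightarrow> \<Lambda>3 y z \<in> ST T"
proof -
  assume y: "y \<in> cone_box" and z: "z \<in> ST T"
  obtain s d where sd: "y = (s, d)" by (cases y)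
  have s: "0 \<le> s" "s \<le> 1" using y by (auto simp: sd cone_box_iff)
  have t: "0 \<le> fst z" "fst z \<le> T" using z by (cases z, simp)+
  have "(1 - s) * fst z \<le> 1 * fst z" using s t by (intro mult_right_mono) auto
  then show ?thesis using s t by (simp add: \<Lambda>3_apply sd)
qed

interpretation cone: linear_family "ST T" "ST T" "(0, 0, 0)" "(1, pi, 2 * pi)" \<kappa>3 \<Lambda>3 for T
proof
  show "continuous_on cone_box \<kappa>3" unfolding \<kappa>3_def by (intro continuous_intros) auto
  show "continuous_on cone_box \<Lambda>3" unfolding \<Lambda>3_def
    by (intro continuous_intros bounded_linear.continuous_on[OF bounded_linear_blinfun_scaleR_left])
qed (auto simp: convex_ST \<Lambda>3_ST)

interpretation sph: linear_family "ST T" UNIV "(0, 0)" "(pi, 2 * pi)" \<kappa>2 \<Lambda>2 for T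
proof
  show "continuous_on sphere_box \<kappa>2" unfolding \<kappa>2_def by (intro continuous_intros) auto
  show "continuous_on sphere_box \<Lambda>2" unfolding \<Lambda>2_def
    by (intro continuous_intros bounded_linear.continuous_on[OF bounded_linear_blinfun_scaleR_left])
qed (auto simp: convex_ST)

lemma cone_weight_nonneg: "y \<in> cone_box \<Longrightarrow> 0 \<le> \<kappa>3 y"
proof -
  assume y: "y \<in> cone_box"
  then have "0 \<le> fst y" "snd y \<in> sphere_box" using cone_box_iff[of "fst y" "snd y"] by auto
  then show ?thesis unfolding \<kappa>3_def by (intro mult_nonneg_nonneg sphere_weight_nonneg)
qed

lemma cone_integral:
  fixes k :: "real \<Rightarrow> real ^ 3 \<Rightarrow> real"
  assumes "continuous_on ({0..1} \<times> sphere 0 1) (\<lambda>q. k (fst q) (snd q))"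
  shows "integral cone_box (\<lambda>y. \<kappa>3 y * k (fst y) (unit_dir (snd y))) = integral {0..1} (\<lambda>s. s * sphere_mean (k s))"
proof -
  have "integral cone_box (\<lambda>y. \<kappa>3 y * k (fst y) (unit_dir (snd y)))
     = integral (cbox 0 1) (\<lambda>s. integral sphere_box (\<lambda>d. \<kappa>3 (s, d) * k s (unit_dir d)))"
  proof (subst integral_prod_continuous)
    have "continuous_on cone_box \<kappa>3" by (rule cone.cont\<kappa>)
    then show "continuous_on cone_box (\<lambda>y. \<kappa>3 y * k (fst y) (unit_dir (snd y)))"
    proof (rule continuous_on_mult)
      show "continuous_on cone_box (\<lambda>y. k (fst y) (unit_dir (snd y)))"
        by (rule continuous_on_compose2[OF assms, of _ "\<lambda>y. (fst y, unit_dir (snd y))", simplified])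
          (auto intro!: continuous_intros simp: cone_box_iff)
    qed
  qed simp
  also have "\<dots> = integral {0..1} (\<lambda>s. s * sphere_mean (k s))"
    unfolding sphere_mean_def cbox_interval
    by (rule integral_cong, subst integral_mult_right[symmetric], rule integral_cong) (simp add: \<kappa>3_def)
  finally show ?thesis .
qed

lemma duhamel_eq_cone:
  assumes g: "continuous_on (ST T) g" and z: "z \<in> ST T"
  shows "duhamel g z = (fst z)\<^sup>2 * cone.I0 g z"
proof -
  obtain t x where tx: "z = (t, x)" by (cases z)
  have t: "0 \<le> t" "t \<le> T" using z by (auto simp: tx)
  define k where "k s = (t - s) * sphere_mean (\<lambda>w. g (s, x + (t - s) *\<^sub>R w))" for s
  have ck: "continuous_on {0..t} k"
    unfolding k_def
  proof (intro continuous_intros sphere_mean_param_cont continuous_on_compose2[OF g])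
    show "(\<lambda>q. (fst q, x + (t - fst q) *\<^sub>R snd q)) ` ({0..t} \<times> sphere 0 1) \<subseteq> ST T" using t by auto
  qed
  have c1: "cone.I0 g z = integral {0..1} (\<lambda>s. s * sphere_mean (\<lambda>w. g ((1 - s) * t, x + (t * s) *\<^sub>R w)))"
    unfolding cone.I0_def \<Lambda>3_apply tx fst_conv snd_conv
  proof (rule cone_integral[where k="\<lambda>s w. g ((1 - s) * t, x + (t * s) *\<^sub>R w)"])
    have "(1 - s) * t \<le> T" if "0 \<le> s" for s using t mult_right_mono[of "1 - s" 1 t] that by simp
    then show "continuous_on ({0..1} \<times> sphere 0 1) (\<lambda>q. g ((1 - fst q) * t, x + (t * fst q) *\<^sub>R snd q))"
      by (intro continuous_intros continuous_on_compose2[OF g]) (use t in auto)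
  qed
  have "((\<lambda>s. - t *\<^sub>R k (t - t * s)) has_integral (integral {t - t * 0..t - t * 1} k - integral {t - t * 1..t - t * 0} k)) {0..1}"
  proof (rule has_integral_substitution_general[OF finite.emptyI _ _ ck])
    show "(\<lambda>s. t - t * s) ` {0..1} \<subseteq> {0..t}" using t by (auto simp: mult_left_le)
  qed (auto intro!: continuous_intros derivative_eq_intros)
  then have "((\<lambda>s. - (t * k (t - t * s))) has_integral - integral {0..t} k) {0..1}"
    using t by (cases "t = 0") auto
  then have "((\<lambda>s. t * k (t - t * s)) has_integral integral {0..t} k) {0..1}"
    using has_integral_neg by force
  then have "integral {0..t} k = integral {0..1} (\<lambda>s. t * k (t - t * s))" by (rule integral_unique[symmetric])
  also have "\<dots> = integral {0..1} (\<lambda>s. t\<^sup>2 * (s * sphere_mean (\<lambda>w. g ((1 - s) * t, x + (t * s) *\<^sub>R w))))"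
    by (rule integral_cong) (simp add: k_def power2_eq_square algebra_simps)
  also have "\<dots> = t\<^sup>2 * cone.I0 g z" by (simp add: c1)
  moreover have "duhamel g z = integral {0..t} k" unfolding duhamel_def tx k_def[abs_def] by simp
  ultimately show ?thesis by (simp add: tx)
qed

lemma free_wave_eq_sph: "free_wave f z = fst z * sph.I0 f z"
  by (simp add: free_wave_def sph.I0_def sphere_mean_def \<kappa>2_def \<Lambda>2_apply)

text \<open>
  First and second derivative of $t\, i(t, x)$ when \<open>i'\<close> and \<open>i''\<close> are those of \<open>i\<close>.
\<close>
definition tm1 :: "(real \<times> (real ^ 3) \<Rightarrow> real) \<Rightarrow> (real \<times> (real ^ 3) \<Rightarrow> (real \<times> (real ^ 3)) \<Rightarrow>\<^sub>L real) \<Rightarrow> (real \<times> (real ^ 3) \<Rightarrow> (real \<times> (real ^ 3)) \<Rightarrow>\<^sub>L real)" where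
  "tm1 i i' z = i z *\<^sub>R fst_blinfun + fst z *\<^sub>R i' z"

definition tm2 :: "(real \<times> (real ^ 3) \<Rightarrow> (real \<times> (real ^ 3)) \<Rightarrow>\<^sub>L real) \<Rightarrow> (real \<times> (real ^ 3) \<Rightarrow> (real \<times> (real ^ 3)) \<Rightarrow>\<^sub>L (real \<times> (real ^ 3)) \<Rightarrow>\<^sub>L real)
    \<Rightarrow> (real \<times> (real ^ 3) \<Rightarrow> (real \<times> (real ^ 3)) \<Rightarrow>\<^sub>L (real \<times> (real ^ 3)) \<Rightarrow>\<^sub>L real)" where
  "tm2 i' i'' z = (blinfun_scaleR_left fst_blinfun o\<^sub>L i' z) + (blinfun_scaleR_left (i' z) o\<^sub>L fst_blinfun) + fst z *\<^sub>R i'' z"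

lemma tm1_apply: "blinfun_apply (tm1 i i' z) a = i z * fst a + fst z * i' z a"
  by (simp add: tm1_def blinfun.add_left blinfun.scaleR_left)

lemma tm2_apply: "blinfun_apply (blinfun_apply (tm2 i' i'' z) a) b = i' z a * fst b + fst a * i' z b + fst z * i'' z a b"
  by (simp add: tm2_def blinfun.add_left blinfun.scaleR_left)

lemma C2_with_times_fst:
  assumes i: "C2_with S i i' i''"
  shows "C2_with S (\<lambda>z. fst z * i z) (tm1 i i') (tm2 i' i'')"
  unfolding C2_with_def
proof (intro conjI ballI)
  note d = C2_withD[OF i]
  fix z assume z: "z \<in> S"
  show "((\<lambda>z. fst z * i z) has_derivative blinfun_apply (tm1 i i' z)) (at z within S)"
    by (rule derivative_eq_intros d(1)[OF z] refl)+ (auto simp: tm1_apply fun_eq_iff)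
  show "(tm1 i i' has_derivative blinfun_apply (tm2 i' i'' z)) (at z within S)"
    unfolding tm1_def[abs_def]
    by (rule derivative_eq_intros d(1,2)[OF z] refl)+ (auto simp: tm2_apply tm2_def blinfun.add_left blinfun.scaleR_left fun_eq_iff)
next
  note d = C2_withD[OF i]
  show "continuous_on S (tm2 i' i'')" unfolding tm2_def[abs_def]
    by (intro continuous_intros d(4,5) bounded_linear.continuous_on[OF bounded_linear_blinfun_scaleR_left])
qed

lemma C2_with_cong:
  assumes "C2_with S f f' f''" "\<And>z. z \<in> S \<Longrightarrow> g z = f z"
  shows "C2_with S g f' f''"
  using assms has_derivative_transform[of _ S g f] unfolding C2_with_def by metis

text \<open>
  First and second derivatives of the Duhamel integral and of the free wave; see \<open>C2_with_duhamel\<close> and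
  \<open>C2_with_free_wave\<close>.
\<close>
definition "duh1 h h' = tm1 (\<lambda>z. fst z * cone.I0 h z) (tm1 (cone.I0 h) (cone.I1 h'))"
definition "duh2 h h' h'' = tm2 (tm1 (cone.I0 h) (cone.I1 h')) (tm2 (cone.I1 h') (cone.I2 h''))"
definition "fr1 f f' = tm1 (sph.I0 f) (sph.I1 f')"
definition "fr2 f' f'' = tm2 (sph.I1 f') (sph.I2 f'')"

lemma C2_with_cone:
  assumes "C2_with (ST T) h h' h''"
  shows "C2_with (ST T) (cone.I0 h) (cone.I1 h') (cone.I2 h'')"
  using cone.deriv_I0[of T h h'] cone.deriv_I1[of T h' h''] cone.cont_I2[of T h''] C2_withD[OF assms]
  unfolding C2_with_def by blast

lemma C2_with_sph:
  assumes "C2_with UNIV f f' f''"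
  shows "C2_with (ST T) (sph.I0 f) (sph.I1 f') (sph.I2 f'')"
  using sph.deriv_I0[of f f' _ T] sph.deriv_I1[of f' f'' _ T] sph.cont_I2[of f'' T] C2_withD[OF assms]
  unfolding C2_with_def by blast

lemma C2_with_duhamel:
  assumes "C2_with (ST T) h h' h''"
  shows "C2_with (ST T) (duhamel h) (duh1 h h') (duh2 h h' h'')"
  unfolding duh1_def duh2_def
  by (rule C2_with_cong[OF C2_with_times_fst[OF C2_with_times_fst[OF C2_with_cone[OF assms]]]])
    (simp add: duhamel_eq_cone[OF C2_withD(3)[OF assms]] power2_eq_square)

lemma C2_with_free_wave:
  assumes "C2_with UNIV f f' f''"
  shows "C2_with (ST T) (free_wave f) (fr1 f f') (fr2 f' f'')"
  unfolding fr1_def fr2_def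
  by (rule C2_with_cong[OF C2_with_times_fst[OF C2_with_sph[OF assms]]]) (simp add: free_wave_eq_sph)

lemma cone_I2_apply:
  assumes "continuous_on (ST T) h''" "z \<in> ST T"
  shows "blinfun_apply (blinfun_apply (cone.I2 h'' z) a) b = integral cone_box (\<lambda>y. \<kappa>3 y * h'' (\<Lambda>3 y z) (\<Lambda>3 y a) (\<Lambda>3 y b))"
proof -
  have bl: "bounded_linear (\<lambda>G :: (real \<times> (real ^ 3)) \<Rightarrow>\<^sub>L (real \<times> (real ^ 3)) \<Rightarrow>\<^sub>L real. G a b)"
    by (intro bounded_linear_compose[OF blinfun.bounded_linear_left] blinfun.bounded_linear_left)
  show ?thesis unfolding cone.I2_def
    using integral_linear[OF cone.int2[OF assms] bl, symmetric] by (simp add: o_def blinfun.scaleR_left)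
qed

lemma sph_I2_apply:
  assumes "continuous_on UNIV h''" "z \<in> ST T"
  shows "blinfun_apply (blinfun_apply (sph.I2 h'' z) a) b = integral sphere_box (\<lambda>y. \<kappa>2 y * h'' (\<Lambda>2 y z) (\<Lambda>2 y a) (\<Lambda>2 y b))"
proof -
  have bl: "bounded_linear (\<lambda>G :: (real \<times> (real ^ 3)) \<Rightarrow>\<^sub>L (real \<times> (real ^ 3)) \<Rightarrow>\<^sub>L real. G a b)"
    by (intro bounded_linear_compose[OF blinfun.bounded_linear_left] blinfun.bounded_linear_left)
  show ?thesis unfolding sph.I2_def
    using integral_linear[OF sph.int2[OF assms] bl, symmetric] by (simp add: o_def blinfun.scaleR_left)
qed

section \<open>Solving the linear wave equation\<close>

text \<open>
  Both dependences on $t$ are separated: the integral is a differentiable function of its upper limit and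
  of the parameter, evaluated on the diagonal.
\<close>
lemma integral_upper_limit_derivative:
  fixes k kt :: "real \<Rightarrow> real \<Rightarrow> real"
  assumes d: "\<And>t s. t \<in> {0..T} \<Longrightarrow> s \<in> {0..T} \<Longrightarrow> ((\<lambda>t. k t s) has_real_derivative kt t s) (at t within {0..T})"
    and ck: "continuous_on ({0..T} \<times> {0..T}) (\<lambda>q. k (fst q) (snd q))"
    and ckt: "continuous_on ({0..T} \<times> {0..T}) (\<lambda>q. kt (fst q) (snd q))"
    and t: "t \<in> {0..T}"
  shows "((\<lambda>t. integral {0..t} (k t)) has_real_derivative (k t t + integral {0..t} (kt t))) (at t within {0..T})"
proof -
  let ?I = "{0..T}"
  have ck1: "continuous_on {0..a} (k \<tau>)" if "a \<in> ?I" "\<tau> \<in> ?I" for a \<tau>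
    by (rule continuous_on_compose2[OF ck, of _ "\<lambda>s. (\<tau>, s)", simplified]) (use that in \<open>auto intro!: continuous_intros\<close>)
  have ckt1: "continuous_on {0..a} (kt \<tau>)" if "a \<in> ?I" "\<tau> \<in> ?I" for a \<tau>
    by (rule continuous_on_compose2[OF ckt, of _ "\<lambda>s. (\<tau>, s)", simplified]) (use that in \<open>auto intro!: continuous_intros\<close>)
  have D: "((\<lambda>(a, \<tau>). integral {0..a} (k \<tau>)) has_derivative (\<lambda>(da, d\<tau>). da * k t t + blinfun_scaleR_left (integral {0..t} (kt t)) d\<tau>)) (at (t, t) within ?I \<times> ?I)"
  proof (rule has_derivative_partialsI[where fy="\<lambda>a \<tau>. blinfun_scaleR_left (integral {0..a} (kt \<tau>))"])
    have "((\<lambda>a. integral {0..a} (k t)) has_real_derivative k t t) (at t within ?I)"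
      by (rule integral_has_real_derivative[OF _ t]) (use ck1[of T t] t in auto)
    then show "((\<lambda>a. integral {0..a} (k t)) has_derivative (\<lambda>da. da * k t t)) (at t within ?I)"
      unfolding has_field_derivative_def by (rule has_derivative_eq_rhs) (auto simp: fun_eq_iff)
    show "((\<lambda>\<tau>. integral {0..a} (k \<tau>)) has_derivative blinfun_apply (blinfun_scaleR_left (integral {0..a} (kt \<tau>)))) (at \<tau> within ?I)"
      if a: "a \<in> ?I" and \<tau>: "\<tau> \<in> ?I" for a \<tau>
    proof -
      have "((\<lambda>\<tau>. integral (cbox 0 a) (k \<tau>)) has_real_derivative integral (cbox 0 a) (kt \<tau>)) (at \<tau> within ?I)"
      proof (rule leibniz_rule_field_derivative[OF _ _ _ \<tau>])
        show "continuous_on (?I \<times> cbox 0 a) (\<lambda>(x, t). kt x t)"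
          unfolding split_beta by (rule continuous_on_subset[OF ckt]) (use a in auto)
      qed (use d a ck1[OF a] in \<open>auto intro!: integrable_continuous_real\<close>)
      then show ?thesis unfolding has_field_derivative_def cbox_interval by (rule has_derivative_eq_rhs) (auto simp: fun_eq_iff)
    qed
    have c: "continuous_on (?I \<times> ?I) (\<lambda>q. integral {0..fst q} (kt (snd q)))"
    proof (rule continuous_on_eq)
      have "continuous_on ((?I \<times> ?I) \<times> cbox 0 1) (\<lambda>(q, \<sigma>). kt (snd q) (fst q * \<sigma>))"
        unfolding split_beta
        by (rule continuous_on_compose2[OF ckt, of _ "\<lambda>r. (snd (fst r), fst (fst r) * snd r)", simplified])
          (auto intro!: continuous_intros simp: mult_left_le order_trans[OF mult_left_le])
      from integral_continuous_on_param[OF this]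
      show "continuous_on (?I \<times> ?I) (\<lambda>q. fst q * integral (cbox 0 1) (\<lambda>\<sigma>. kt (snd q) (fst q * \<sigma>)))"
        by (intro continuous_intros)
      fix q assume q: "q \<in> ?I \<times> ?I"
      have "((\<lambda>\<sigma>. fst q *\<^sub>R kt (snd q) (fst q * \<sigma>)) has_integral integral {fst q * 0..fst q * 1} (kt (snd q))) {0..1}"
        by (rule has_integral_substitution[where c=0 and d="fst q"])
          (use q in \<open>auto intro!: ckt1 derivative_eq_intros simp: mult_left_le\<close>)
      then show "fst q * integral (cbox 0 1) (\<lambda>\<sigma>. kt (snd q) (fst q * \<sigma>)) = integral {0..fst q} (kt (snd q))"
        by (auto dest: integral_unique)
    qed
    have "continuous_on (?I \<times> ?I) (\<lambda>(a, \<tau>). blinfun_scaleR_left (integral {0..a} (kt \<tau>)) :: real \<Rightarrow>\<^sub>L real)"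
      unfolding split_beta by (rule bounded_linear.continuous_on[OF bounded_linear_blinfun_scaleR_left c])
    then show "continuous (at (t, t) within ?I \<times> ?I) (\<lambda>(a, \<tau>). blinfun_scaleR_left (integral {0..a} (kt \<tau>)) :: real \<Rightarrow>\<^sub>L real)"
      using t by (auto simp: continuous_on_eq_continuous_within)
  qed (use t in auto)
  have dd: "((\<lambda>\<tau>. (\<tau>, \<tau>)) has_derivative (\<lambda>h. (h, h))) (at t within ?I)"
    by (auto intro!: derivative_eq_intros)
  have "((\<lambda>(a, \<tau>). integral {0..a} (k \<tau>)) has_derivative (\<lambda>(da, d\<tau>). da * k t t + blinfun_scaleR_left (integral {0..t} (kt t)) d\<tau>)) (at (t, t) within (\<lambda>\<tau>. (\<tau>, \<tau>)) ` ?I)"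
    by (rule has_derivative_subset[OF D]) auto
  from has_derivative_in_compose[OF dd this]
  have "((\<lambda>\<tau>. integral {0..\<tau>} (k \<tau>)) has_derivative (\<lambda>h. h * k t t + h * integral {0..t} (kt t))) (at t within ?I)"
    by simp
  then show ?thesis unfolding has_field_derivative_def
    by (rule has_derivative_eq_rhs) (auto simp: fun_eq_iff algebra_simps)
qed

text \<open>
  The second time derivative is computed from the original form of the Duhamel integral, where two
  derivatives of the kernel $\tau M(\tau)$ give the Laplacian by Darboux's equation and the boundary term at
  $s = t$ gives \<open>h\<close>; uniqueness of derivatives identifies it with the entry of \<open>duh2\<close>.
\<close>
theorem duhamel_wave_sol:
  assumes T: "0 < T" and h: "C2_with (ST T) h h' h''"
  shows "z \<in> ST T \<Longrightarrow> duh2 h h' h'' z (1, 0) (1, 0) - (\<Sum>b\<in>Basis. duh2 h h' h'' z (0, b) (0, b)) = h z"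
    and "duh1 h h' (0, x) (1, 0) = 0"
proof -
  show "duh1 h h' (0, x) (1, 0) = 0" by (simp add: duh1_def tm1_apply)
  assume z: "z \<in> ST T"
  obtain t x where tx: "z = (t, x)" by (cases z)
  have t: "t \<in> {0..T}" using z by (simp add: tx)
  note hc = C2_withD(3-5)[OF h]
  define L where "L z = (\<Sum>b\<in>Basis. h'' z (0, b) (0, b))" for z
  have cL: "continuous_on (ST T) L" unfolding L_def by (intro continuous_intros hc)
  note D2 = C2_with_duhamel[OF h]
  have space: "(\<Sum>b\<in>Basis. duh2 h h' h'' z (0, b) (0, b)) = duhamel L z"
  proof -
    have "duh2 h h' h'' z (0, b) (0, b) = (fst z)\<^sup>2 * integral cone_box (\<lambda>y. \<kappa>3 y * h'' (\<Lambda>3 y z) (0, b) (0, b))" for b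
      unfolding duh2_def tm2_apply cone_I2_apply[OF hc(3) z]
      by (simp add: \<Lambda>3_apply power2_eq_square)
    then have "(\<Sum>b\<in>Basis. duh2 h h' h'' z (0, b) (0, b)) = (\<Sum>b\<in>Basis. (fst z)\<^sup>2 * integral cone_box (\<lambda>y. \<kappa>3 y * h'' (\<Lambda>3 y z) (0, b) (0, b)))"
      by simp
    also have "\<dots> = (fst z)\<^sup>2 * (\<Sum>b\<in>Basis. integral cone_box (\<lambda>y. \<kappa>3 y * h'' (\<Lambda>3 y z) (0, b) (0, b)))"
      by (simp only: sum_distrib_left)
    also have "(\<Sum>b\<in>(Basis :: (real ^ 3) set). integral cone_box (\<lambda>y. \<kappa>3 y * h'' (\<Lambda>3 y z) (0, b) (0, b))) = integral cone_box (\<lambda>y. \<Sum>b\<in>Basis. \<kappa>3 y * h'' (\<Lambda>3 y z) (0, b) (0, b))"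
      by (rule integral_sum[symmetric]) (auto intro!: cone.int0[where h="\<lambda>z. h'' z (0, b) (0, b)" for b, OF _ z] continuous_intros hc)
    also have "(fst z)\<^sup>2 * integral cone_box (\<lambda>y. \<Sum>b\<in>Basis. \<kappa>3 y * h'' (\<Lambda>3 y z) (0, b) (0, b)) = duhamel L z"
      unfolding duhamel_eq_cone[OF cL z] cone.I0_def L_def sum_distrib_left by (rule refl)
    finally show ?thesis .
  qed
  define P where "P s \<tau> = \<tau> * sphere_mean (\<lambda>w. h (s, x + \<tau> *\<^sub>R w))" for s \<tau>
  define P1 where "P1 s \<tau> = sphere_mean (\<lambda>w. h (s, x + \<tau> *\<^sub>R w) + \<tau> * h' (s, x + \<tau> *\<^sub>R w) (0, w))" for s \<tau>
  define P2 where "P2 s \<tau> = \<tau> * sphere_mean (\<lambda>w. L (s, x + \<tau> *\<^sub>R w))" for s \<tau>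
  have dP: "(P s has_real_derivative P1 s \<tau>) (at \<tau>)" and dP1: "(P1 s has_real_derivative P2 s \<tau>) (at \<tau>)"
    if "s \<in> {0..T}" for s \<tau>
    using darboux[OF C2_with_slice[OF h that], of x \<tau>] unfolding P_def[abs_def] P1_def[abs_def] P2_def L_def by simp_all
  let ?I2 = "{0..T} \<times> {0..T}"
  have cP: "continuous_on ?I2 (\<lambda>q. P (snd q) (fst q - snd q))" unfolding P_def
    by (intro continuous_intros sphere_mean_param_cont continuous_on_compose2[OF hc(1)]) auto
  have cP1: "continuous_on ?I2 (\<lambda>q. P1 (snd q) (fst q - snd q))" unfolding P1_def
    by (intro continuous_intros sphere_mean_param_cont continuous_on_compose2[OF hc(1)] continuous_on_compose2[OF hc(2)]) auto
  have cP2: "continuous_on ?I2 (\<lambda>q. P2 (snd q) (fst q - snd q))" unfolding P2_def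
    by (intro continuous_intros sphere_mean_param_cont continuous_on_compose2[OF cL]) auto
  have sh: "((\<lambda>t. P s (t - s)) has_real_derivative P1 s (t - s)) (at t within {0..T})"
     "((\<lambda>t. P1 s (t - s)) has_real_derivative P2 s (t - s)) (at t within {0..T})"
    if "s \<in> {0..T}" for s t
  proof -
    have l: "((\<lambda>t. t - s) has_real_derivative 1) (at t within {0..T})" by (auto intro!: derivative_eq_intros)
    show "((\<lambda>t. P s (t - s)) has_real_derivative P1 s (t - s)) (at t within {0..T})"
      using DERIV_chain2[OF dP[OF that] l] by simp
    show "((\<lambda>t. P1 s (t - s)) has_real_derivative P2 s (t - s)) (at t within {0..T})"
      using DERIV_chain2[OF dP1[OF that] l] by simp
  qed
  have D0: "duhamel h (t, x) = integral {0..t} (\<lambda>s. P s (t - s))" for t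
    unfolding duhamel_def P_def by simp
  have v1: "duh1 h h' (t, x) (1, 0) = integral {0..t} (\<lambda>s. P1 s (t - s))" if t: "t \<in> {0..T}" for t
  proof -
    have "((\<lambda>t. duhamel h (t, x)) has_real_derivative (P t (t - t) + integral {0..t} (\<lambda>s. P1 s (t - s)))) (at t within {0..T})"
      unfolding D0 by (rule integral_upper_limit_derivative[where k="\<lambda>t s. P s (t - s)"]) (use sh cP cP1 t in auto)
    moreover have "P t (t - t) = 0" by (simp add: P_def)
    ultimately show ?thesis
      using vector_derivative_unique_within_closed_interval[OF T, of t] t time_line(1)[OF D2 t, of x]
      by (simp add: has_real_derivative_iff_has_vector_derivative)
  qed
  have v2: "duh2 h h' h'' (t, x) (1, 0) (1, 0) = h (t, x) + integral {0..t} (\<lambda>s. P2 s (t - s))"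
  proof -
    have "((\<lambda>t. duh1 h h' (t, x) (1, 0)) has_vector_derivative (P1 t (t - t) + integral {0..t} (\<lambda>s. P2 s (t - s)))) (at t within {0..T})"
    proof (rule has_vector_derivative_transform[OF t v1])
      show "((\<lambda>t. integral {0..t} (\<lambda>s. P1 s (t - s))) has_vector_derivative (P1 t (t - t) + integral {0..t} (\<lambda>s. P2 s (t - s)))) (at t within {0..T})"
        unfolding has_real_derivative_iff_has_vector_derivative[symmetric]
        by (rule integral_upper_limit_derivative[where k="\<lambda>t s. P1 s (t - s)"]) (use sh cP1 cP2 t in auto)
    qed auto
    moreover have "P1 t (t - t) = h (t, x)" by (simp add: P1_def)
    ultimately show ?thesis
      using vector_derivative_unique_within_closed_interval[OF T, of t] t time_line(2)[OF D2 t, of x "(1,0)"]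
      by simp
  qed
  have "duhamel L (t, x) = integral {0..t} (\<lambda>s. P2 s (t - s))" unfolding duhamel_def P2_def by simp
  then show "duh2 h h' h'' z (1, 0) (1, 0) - (\<Sum>b\<in>Basis. duh2 h h' h'' z (0, b) (0, b)) = h z"
    unfolding space unfolding tx v2 by simp
qed

theorem free_wave_wave_sol:
  assumes T: "0 < T" and f: "C2_with UNIV f f' f''"
  shows "z \<in> ST T \<Longrightarrow> fr2 f' f'' z (1, 0) (1, 0) - (\<Sum>b\<in>Basis. fr2 f' f'' z (0, b) (0, b)) = 0"
    and "fr1 f f' (0, x) (1, 0) = f x"
proof -
  have "sph.I0 f (0, x) = sphere_mean (\<lambda>w. f x)"
    by (simp add: sph.I0_def sphere_mean_def \<kappa>2_def \<Lambda>2_apply del: sphere_mean_const)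
  then show "fr1 f f' (0, x) (1, 0) = f x" by (simp add: fr1_def tm1_apply)
  assume z: "z \<in> ST T"
  obtain t x where tx: "z = (t, x)" by (cases z)
  have t: "t \<in> {0..T}" using z by (simp add: tx)
  note fc = C2_withD(3-5)[OF f]
  note D2 = C2_with_free_wave[OF f, of T]
  define L where "L z = (\<Sum>b\<in>Basis. f'' z b b)" for z
  have space: "(\<Sum>b\<in>Basis. fr2 f' f'' z (0, b) (0, b)) = t * sphere_mean (\<lambda>w. L (x + t *\<^sub>R w))"
  proof -
    have "fr2 f' f'' z (0, b) (0, b) = fst z * integral sphere_box (\<lambda>y. \<kappa>2 y * f'' (\<Lambda>2 y z) b b)" for b
      unfolding fr2_def tm2_apply sph_I2_apply[OF fc(3) z] by (simp add: \<Lambda>2_apply)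
    then have "(\<Sum>b\<in>Basis. fr2 f' f'' z (0, b) (0, b)) = (\<Sum>b\<in>Basis. fst z * integral sphere_box (\<lambda>y. \<kappa>2 y * f'' (\<Lambda>2 y z) b b))"
      by simp
    also have "\<dots> = fst z * (\<Sum>b\<in>Basis. integral sphere_box (\<lambda>y. \<kappa>2 y * f'' (\<Lambda>2 y z) b b))"
      by (simp only: sum_distrib_left)
    also have "(\<Sum>b\<in>(Basis :: (real ^ 3) set). integral sphere_box (\<lambda>y. \<kappa>2 y * f'' (\<Lambda>2 y z) b b)) = integral sphere_box (\<lambda>y. \<Sum>b\<in>Basis. \<kappa>2 y * f'' (\<Lambda>2 y z) b b)"
      by (rule integral_sum[symmetric]) (auto intro!: sph.int0[where h="\<lambda>z. f'' z b b" for b, OF _ z] continuous_intros fc)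
    also have "fst z * integral sphere_box (\<lambda>y. \<Sum>b\<in>Basis. \<kappa>2 y * f'' (\<Lambda>2 y z) b b) = t * sphere_mean (\<lambda>w. L (x + t *\<^sub>R w))"
      unfolding sphere_mean_def L_def sum_distrib_left scaleR_sum_right by (simp add: tx \<kappa>2_def \<Lambda>2_apply)
    finally show ?thesis .
  qed
  define P where "P \<tau> = \<tau> * sphere_mean (\<lambda>w. f (x + \<tau> *\<^sub>R w))" for \<tau>
  define P1 where "P1 \<tau> = sphere_mean (\<lambda>w. f (x + \<tau> *\<^sub>R w) + \<tau> * f' (x + \<tau> *\<^sub>R w) w)" for \<tau>
  define P2 where "P2 \<tau> = \<tau> * sphere_mean (\<lambda>w. L (x + \<tau> *\<^sub>R w))" for \<tau>
  have dP: "(P has_real_derivative P1 \<tau>) (at \<tau>)" and dP1: "(P1 has_real_derivative P2 \<tau>) (at \<tau>)" for \<tau>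
    using darboux[OF f, of x \<tau>] unfolding P_def[abs_def] P1_def[abs_def] P2_def L_def by simp_all
  have D0: "free_wave f (t, x) = P t" for t unfolding free_wave_def P_def by simp
  have v1: "fr1 f f' (t, x) (1, 0) = P1 t" if t: "t \<in> {0..T}" for t
  proof -
    have "((\<lambda>t. free_wave f (t, x)) has_vector_derivative P1 t) (at t within {0..T})"
      unfolding D0 has_real_derivative_iff_has_vector_derivative[symmetric] by (rule has_field_derivative_at_within[OF dP])
    then show ?thesis
      using vector_derivative_unique_within_closed_interval[OF T, of t] t time_line(1)[OF D2 t, of x] by simp
  qed
  have v2: "fr2 f' f'' (t, x) (1, 0) (1, 0) = P2 t"
  proof -
    have "((\<lambda>t. fr1 f f' (t, x) (1, 0)) has_vector_derivative P2 t) (at t within {0..T})"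
    proof (rule has_vector_derivative_transform[OF t v1])
      show "(P1 has_vector_derivative P2 t) (at t within {0..T})"
        unfolding has_real_derivative_iff_has_vector_derivative[symmetric] by (rule has_field_derivative_at_within[OF dP1])
    qed auto
    then show ?thesis
      using vector_derivative_unique_within_closed_interval[OF T, of t] t time_line(2)[OF D2 t, of x "(1,0)"] by simp
  qed
  show "fr2 f' f'' z (1, 0) (1, 0) - (\<Sum>b\<in>Basis. fr2 f' f'' z (0, b) (0, b)) = 0"
    unfolding space unfolding tx v2 P2_def by simp
qed

lemma C2_with_add:
  assumes "C2_with S f f' f''" "C2_with S g g' g''"
  shows "C2_with S (\<lambda>z. f z + g z) (\<lambda>z. f' z + g' z) (\<lambda>z. f'' z + g'' z)"
  using assms unfolding C2_with_def
  by (auto intro!: continuous_intros simp: plus_blinfun.rep_eq has_derivative_add)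

lemma wave_sol_representation:
  assumes T: "0 < T" and f: "C2_with UNIV f f' f''" and h: "C2_with (ST T) h h' h''"
  shows "wave_sol T h f (\<lambda>z. free_wave f z + duhamel h z)"
  unfolding wave_sol_def
proof (intro exI conjI ballI allI)
  show "C2_with (ST T) (\<lambda>z. free_wave f z + duhamel h z) (\<lambda>z. fr1 f f' z + duh1 h h' z) (\<lambda>z. fr2 f' f'' z + duh2 h h' h'' z)"
    by (rule C2_with_add[OF C2_with_free_wave[OF f] C2_with_duhamel[OF h]])
  show "blinfun_apply (blinfun_apply (fr2 f' f'' z + duh2 h h' h'' z) (1, 0)) (1, 0) - (\<Sum>b\<in>Basis. blinfun_apply (blinfun_apply (fr2 f' f'' z + duh2 h h' h'' z) (0, b)) (0, b)) = h z"
    if "z \<in> ST T" for z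
    using free_wave_wave_sol(1)[OF T f that] duhamel_wave_sol(1)[OF T h that]
    by (simp add: blinfun.add_left sum.distrib)
  show "free_wave f (0, x) + duhamel h (0, x) = 0" for x by (simp add: free_wave_def duhamel_def)
  show "blinfun_apply (fr1 f f' (0, x) + duh1 h h' (0, x)) (1, 0) = f x" for x
    using free_wave_wave_sol(2)[OF T f] duhamel_wave_sol(2)[OF T h] by (simp add: blinfun.add_left)
qed

section \<open>Rotations\<close>

lemma orthogonal_trace:
  fixes B :: "(real ^ 'n) \<Rightarrow>\<^sub>L (real ^ 'n) \<Rightarrow>\<^sub>L real" and Q :: "real ^ 'n \<Rightarrow> real ^ 'n"
  assumes Q: "orthogonal_transformation Q"
  shows "(\<Sum>b\<in>Basis. B (Q b) (Q b)) = (\<Sum>b\<in>Basis. B b b)"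
proof -
  have om: "orthogonal_matrix (matrix Q)" using Q orthogonal_transformation_matrix by blast
  have "(\<Sum>k\<in>UNIV. B (Q (axis k 1)) (Q (axis k 1))) = (\<Sum>b\<in>Basis. B b b)"
  proof (rule trace_frame)
    fix i j :: 'n
    have "(matrix Q ** transpose (matrix Q)) $ i $ j = mat 1 $ i $ j" using om unfolding orthogonal_matrix_def by simp
    then show "(\<Sum>k\<in>UNIV. Q (axis k 1) $ i * Q (axis k 1) $ j) = (if i = j then 1 else 0)"
      by (simp add: matrix_matrix_mult_def transpose_def matrix_def mat_def)
  qed
  then show ?thesis by (simp add: sum_Basis_axis)
qed

lemma wave_sol_rotate:
  assumes sol: "wave_sol T g f v" and Q: "orthogonal_transformation Q"
  shows "wave_sol T (\<lambda>z. g (fst z, Q (snd z))) (\<lambda>x. f (Q x)) (\<lambda>z. v (fst z, Q (snd z)))"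
proof -
  have bQ: "bounded_linear Q" using Q orthogonal_transformation_linear linear_conv_bounded_linear by blast
  have Q0: "Q 0 = 0" using bounded_linear.linear[OF bQ] linear_0 by blast
  define R where "R = Blinfun (\<lambda>z :: real \<times> (real ^ 3). (fst z, Q (snd z)))"
  have R: "blinfun_apply R z = (fst z, Q (snd z))" for z
    unfolding R_def by (subst bounded_linear_Blinfun_apply)
      (auto intro!: bounded_linear_Pair bounded_linear_fst bounded_linear_compose[OF bQ] bounded_linear_snd)
  have RS: "R z \<in> ST T" if "z \<in> ST T" for z using that by (cases z) (simp add: R)
  obtain v' v'' where v: "C2_with (ST T) v v' v''"
    and eq: "\<And>z. z \<in> ST T \<Longrightarrow> v'' z (1, 0) (1, 0) - (\<Sum>b\<in>Basis. v'' z (0, b) (0, b)) = g z"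
    and v0: "\<And>x. v (0, x) = 0" and v1: "\<And>x. v' (0, x) (1, 0) = f x"
    using sol unfolding wave_sol_def by blast
  have dR: "(blinfun_apply R has_derivative blinfun_apply R) (at z within S)" for z S
    by (rule bounded_linear_imp_has_derivative[OF blinfun.bounded_linear_right])
  show ?thesis unfolding wave_sol_def
  proof (intro exI conjI ballI allI)
    show "C2_with (ST T) (\<lambda>z. v (fst z, Q (snd z))) (\<lambda>z. pull1 R (v' (R z))) (\<lambda>z. pull2 R (v'' (R z)))"
      unfolding C2_with_def
    proof (intro conjI ballI)
      fix z assume z: "z \<in> ST T"
      have "((\<lambda>z. v (R z)) has_derivative (\<lambda>w. v' (R z) (R w))) (at z within ST T)"
        by (rule has_derivative_in_compose2[OF C2_withD(1)[OF v] _ z dR]) (use RS in auto)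
      then show "((\<lambda>z. v (fst z, Q (snd z))) has_derivative blinfun_apply (pull1 R (v' (R z)))) (at z within ST T)"
        unfolding R[symmetric] by (rule has_derivative_eq_rhs) (auto simp: fun_eq_iff)
      have "((\<lambda>z. v' (R z)) has_derivative (\<lambda>w. v'' (R z) (R w))) (at z within ST T)"
        by (rule has_derivative_in_compose2[OF C2_withD(2)[OF v] _ z dR]) (use RS in auto)
      from bounded_linear.has_derivative[OF blinfun.bounded_linear_right this, of "bounded_bilinear.prod_left (o\<^sub>L) R"]
      show "((\<lambda>z. pull1 R (v' (R z))) has_derivative blinfun_apply (pull2 R (v'' (R z)))) (at z within ST T)"
        unfolding prod_left_compose_apply pull1_def[symmetric]
        by (rule has_derivative_eq_rhs) (auto simp: fun_eq_iff intro!: blinfun_eqI)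
    next
      show "continuous_on (ST T) (\<lambda>z. pull2 R (v'' (R z)))"
        unfolding pull2_def by (intro continuous_intros continuous_on_compose2[OF C2_withD(5)[OF v]]) (use RS in auto)
    qed
    show "pull2 R (v'' (R z)) (1, 0) (1, 0) - (\<Sum>b\<in>Basis. pull2 R (v'' (R z)) (0, b) (0, b)) = g (fst z, Q (snd z))"
      if "z \<in> ST T" for z
    proof -
      have "(\<Sum>b\<in>Basis. v'' (R z) (0, Q b) (0, Q b)) = (\<Sum>b\<in>Basis. v'' (R z) (0, b) (0, b))"
        using orthogonal_trace[OF Q, of "pull2 spatial (v'' (R z))"] by simp
      then show ?thesis using eq[OF RS[OF that]] by (simp add: R Q0)
    qed
    show "v (fst (0, x), Q (snd (0, x))) = 0" for x :: "real^3" using v0 by simp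
    show "pull1 R (v' (R (0, x))) (1, 0) = f (Q x)" for x using v1 by (simp add: R Q0)
  qed
qed

text \<open>
  Composing the solution with a rotation leaves data and right-hand side unchanged, and Kirchhoff's formula
  depends on these alone.
\<close>
lemma wave_sol_radial:
  assumes sol: "wave_sol T g f v" and f: "radial f" and g: "\<And>t. t \<in> {0..T} \<Longrightarrow> radial (\<lambda>x. g (t, x))"
    and t: "t \<in> {0..T}"
  shows "radial (\<lambda>x. v (t, x))"
  unfolding radial_def
proof (intro allI impI)
  fix x y :: "real ^ 3" assume "norm x = norm y"
  then obtain Q where Q: "orthogonal_transformation Q" "Q x = y" by (rule orthogonal_transformation_exists)
  have nQ: "norm (Q a) = norm a" for a using Q(1) by (simp add: orthogonal_transformation)
  have "v (t, Q x) = free_wave (\<lambda>x. f (Q x)) (t, x) + duhamel (\<lambda>z. g (fst z, Q (snd z))) (t, x)"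
    using kirchhoff[OF wave_sol_rotate[OF sol Q(1)] t, of x] by simp
  also have "(\<lambda>x. f (Q x)) = f" by (rule ext) (rule f[unfolded radial_def, rule_format, OF nQ])
  also have "duhamel (\<lambda>z. g (fst z, Q (snd z))) (t, x) = duhamel g (t, x)"
    unfolding duhamel_def fst_conv snd_conv
  proof (rule integral_cong)
    fix s assume "s \<in> {0..t}"
    then have "s \<in> {0..T}" using t by auto
    then have "g (s, Q a) = g (s, a)" for a by (rule g[unfolded radial_def, rule_format, OF _ nQ])
    then show "(t - s) * sphere_mean (\<lambda>w. g (s, Q (x + (t - s) *\<^sub>R w))) = (t - s) * sphere_mean (\<lambda>w. g (s, x + (t - s) *\<^sub>R w))"
      by simp
  qed
  also have "free_wave f (t, x) + duhamel g (t, x) = v (t, x)" using kirchhoff[OF sol t] by simp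
  finally show "v (t, x) = v (t, y)" using Q(2) by simp
qed

section \<open>Exponentially weighted bounds and uniqueness\<close>

lemma cone_kernel_total: "integral cone_box \<kappa>3 = 1 / 2"
proof -
  have "integral cone_box \<kappa>3 = integral {0..1} (\<lambda>s. s * sphere_mean (\<lambda>w. 1))"
    using cone_integral[of "\<lambda>s w. 1"] by simp
  also have "\<dots> = integral {0..1} (\<lambda>s::real. s)" by simp
  also have "\<dots> = 1 / 2" using ident_has_integral[of 0 "1::real"] by (auto dest: integral_unique)
  finally show ?thesis .
qed

text \<open>
  The gain \<open>1 / l\<close> is what makes the Duhamel operator a contraction on any slab when \<open>l\<close> is large.
\<close>
lemma cone_kernel_exp:
  assumes "0 < l" "0 \<le> t" "t \<le> T"
  shows "t\<^sup>2 * integral cone_box (\<lambda>y. \<kappa>3 y * exp (l * ((1 - fst y) * t))) \<le> T / l * exp (l * t)"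
proof -
  have "integral cone_box (\<lambda>y. \<kappa>3 y * exp (l * ((1 - fst y) * t))) = integral {0..1} (\<lambda>s. s * sphere_mean (\<lambda>w. exp (l * ((1 - s) * t))))"
    by (rule cone_integral[where k="\<lambda>s w. exp (l * ((1 - s) * t))"]) (intro continuous_intros)
  also have "\<dots> = integral {0..1} (\<lambda>s. s * exp (l * ((1 - s) * t)))" by simp
  also have "\<dots> \<le> integral {0..1} (\<lambda>s. exp (l * ((1 - s) * t)))"
    by (rule integral_le) (auto intro!: integrable_continuous_real continuous_intros mult_left_le_one_le)
  finally have "t\<^sup>2 * integral cone_box (\<lambda>y. \<kappa>3 y * exp (l * ((1 - fst y) * t))) \<le> t\<^sup>2 * integral {0..1} (\<lambda>s. exp (l * ((1 - s) * t)))"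
    by (rule mult_left_mono) simp
  also have "\<dots> = t / l * integral {0..1} (\<lambda>s. (l * t) * exp (l * ((1 - s) * t)))"
    using assms by (simp add: power2_eq_square)
  also have "integral {0..1} (\<lambda>s. (l * t) * exp (l * ((1 - s) * t))) = exp (l * t) - 1"
  proof (rule integral_unique)
    have "((\<lambda>s. (l * t) * exp (l * ((1 - s) * t))) has_integral (- exp (l * ((1 - 1) * t)) - (- exp (l * ((1 - 0) * t))))) {0..1}"
      by (rule fundamental_theorem_of_calculus)
        (auto intro!: derivative_eq_intros simp: has_real_derivative_iff_has_vector_derivative[symmetric])
    then show "((\<lambda>s. (l * t) * exp (l * ((1 - s) * t))) has_integral (exp (l * t) - 1)) {0..1}" by simp
  qed
  also have "t / l * (exp (l * t) - 1) \<le> T / l * exp (l * t)"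
    using assms by (intro mult_mono divide_right_mono) auto
  finally show ?thesis .
qed

lemma cone_integral_weighted_bound:
  fixes G :: "real \<times> real \<times> real \<Rightarrow> 'b::banach"
  assumes G: "G integrable_on cone_box" and l: "0 < l" and t: "0 \<le> t" "t \<le> T" and c: "0 \<le> c"
    and b: "\<And>y. y \<in> cone_box \<Longrightarrow> norm (G y) \<le> \<kappa>3 y * (c * exp (l * ((1 - fst y) * t)))"
  shows "t\<^sup>2 * norm (integral cone_box G) \<le> c * (T / l) * exp (l * t)"
proof -
  have i: "(\<lambda>y. \<kappa>3 y * exp (l * ((1 - fst y) * t))) integrable_on cone_box"
    by (rule integrable_continuous) (intro continuous_intros cone.cont\<kappa>)
  have "norm (integral cone_box G) \<le> integral cone_box (\<lambda>y. c * (\<kappa>3 y * exp (l * ((1 - fst y) * t))))"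
  proof (rule integral_norm_bound_integral[OF G])
    show "(\<lambda>y. c * (\<kappa>3 y * exp (l * ((1 - fst y) * t)))) integrable_on cone_box"
      using integrable_cmul[OF i, of c] by simp
    show "norm (G y) \<le> c * (\<kappa>3 y * exp (l * ((1 - fst y) * t)))" if "y \<in> cone_box" for y
      using b[OF that] by (simp add: mult.left_commute)
  qed
  then have "t\<^sup>2 * norm (integral cone_box G) \<le> t\<^sup>2 * integral cone_box (\<lambda>y. c * (\<kappa>3 y * exp (l * ((1 - fst y) * t))))"
    by (rule mult_left_mono) simp
  also have "\<dots> = c * (t\<^sup>2 * integral cone_box (\<lambda>y. \<kappa>3 y * exp (l * ((1 - fst y) * t))))"
    by (simp add: mult.left_commute)
  also have "\<dots> \<le> c * (T / l * exp (l * t))"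
    by (rule mult_left_mono[OF cone_kernel_exp c]) (use l t in auto)
  finally show ?thesis by simp
qed

lemma cone_integral_bound:
  fixes G :: "real \<times> real \<times> real \<Rightarrow> 'b::banach"
  assumes G: "G integrable_on cone_box" and c: "0 \<le> c"
    and b: "\<And>y. y \<in> cone_box \<Longrightarrow> norm (G y) \<le> \<kappa>3 y * c"
  shows "norm (integral cone_box G) \<le> c"
proof -
  have i: "\<kappa>3 integrable_on cone_box" by (rule integrable_continuous[OF cone.cont\<kappa>])
  have "norm (integral cone_box G) \<le> integral cone_box (\<lambda>y. \<kappa>3 y * c)"
    by (rule integral_norm_bound_integral[OF G]) (use integrable_cmul[OF i, of c] b in \<open>auto simp: mult.commute\<close>)
  also have "\<dots> = c / 2" by (simp add: cone_kernel_total)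
  finally show ?thesis using c by simp
qed

lemma duhamel_weighted_bound:
  assumes g: "continuous_on (ST T) g" and z: "z \<in> ST T" and l: "0 < l" and c: "0 \<le> c"
    and b: "\<And>y. y \<in> cone_box \<Longrightarrow> \<bar>g (\<Lambda>3 y z)\<bar> \<le> c * exp (l * fst (\<Lambda>3 y z))"
  shows "\<bar>duhamel g z\<bar> \<le> c * (T / l) * exp (l * fst z)"
proof -
  have t: "0 \<le> fst z" "fst z \<le> T" using z by (cases z, simp)+
  have "(fst z)\<^sup>2 * norm (cone.I0 g z) \<le> c * (T / l) * exp (l * fst z)"
    unfolding cone.I0_def
  proof (rule cone_integral_weighted_bound[OF cone.int0[OF g z] l t c])
    fix y assume y: "y \<in> cone_box"
    have "\<bar>\<kappa>3 y * g (\<Lambda>3 y z)\<bar> = \<kappa>3 y * \<bar>g (\<Lambda>3 y z)\<bar>" using cone_weight_nonneg[OF y] by (simp add: abs_mult)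
    also have "\<dots> \<le> \<kappa>3 y * (c * exp (l * fst (\<Lambda>3 y z)))"
      by (rule mult_left_mono[OF b[OF y] cone_weight_nonneg[OF y]])
    finally show "norm (\<kappa>3 y * g (\<Lambda>3 y z)) \<le> \<kappa>3 y * (c * exp (l * ((1 - fst y) * fst z)))" by (simp add: \<Lambda>3_apply)
  qed
  then show ?thesis by (simp add: duhamel_eq_cone[OF g z] abs_mult)
qed

lemma duhamel_diff:
  assumes "continuous_on (ST T) g" "continuous_on (ST T) h" "z \<in> ST T"
  shows "duhamel (\<lambda>z. g z - h z) z = duhamel g z - duhamel h z"
proof -
  have "cone.I0 (\<lambda>z. g z - h z) z = cone.I0 g z - cone.I0 h z"
    unfolding cone.I0_def right_diff_distrib
    by (rule integral_diff) (use assms in \<open>auto intro: cone.int0\<close>)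
  then show ?thesis
    using assms by (simp add: duhamel_eq_cone[of T] continuous_on_diff right_diff_distrib)
qed

lemma duhamel_mono:
  assumes "continuous_on (ST T) g" "continuous_on (ST T) h" "z \<in> ST T"
    and le: "\<And>y. y \<in> cone_box \<Longrightarrow> g (\<Lambda>3 y z) \<le> h (\<Lambda>3 y z)"
  shows "duhamel g z \<le> duhamel h z"
  unfolding duhamel_eq_cone[OF assms(1,3)] duhamel_eq_cone[OF assms(2,3)] cone.I0_def
  by (intro mult_left_mono integral_le cone.int0[OF assms(1,3)] cone.int0[OF assms(2,3)] mult_left_mono le cone_weight_nonneg) auto

lemma C2_lipschitz_on_interval:
  fixes F :: "real \<Rightarrow> real"
  assumes F: "C2_with UNIV F F' F''"
  obtains K where "0 \<le> K" "\<And>a. \<bar>a\<bar> \<le> B \<Longrightarrow> norm (F' a) \<le> K" "\<And>a. \<bar>a\<bar> \<le> B \<Longrightarrow> norm (F'' a) \<le> K"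
    "\<And>a b. \<bar>a\<bar> \<le> B \<Longrightarrow> \<bar>b\<bar> \<le> B \<Longrightarrow> \<bar>F a - F b\<bar> \<le> K * \<bar>a - b\<bar>"
    "\<And>a b. \<bar>a\<bar> \<le> B \<Longrightarrow> \<bar>b\<bar> \<le> B \<Longrightarrow> norm (F' a - F' b) \<le> K * \<bar>a - b\<bar>"
proof -
  note d = C2_withD[OF F]
  have bd: "\<exists>K. \<forall>a\<in>{-B..B}. norm (H a) \<le> K" if "continuous_on UNIV H" for H :: "real \<Rightarrow> 'c::real_normed_vector"
  proof -
    have "compact (H ` {-B..B})"
      by (rule compact_continuous_image[OF continuous_on_subset[OF that]]) auto
    then show ?thesis using compact_imp_bounded bounded_iff by (metis imageI)
  qed
  obtain K1 K2 where K: "\<forall>a\<in>{-B..B}. norm (F' a) \<le> K1" "\<forall>a\<in>{-B..B}. norm (F'' a) \<le> K2"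
    using bd[OF d(4)] bd[OF d(5)] by blast
  define K where "K = max 0 (max K1 K2)"
  have 1: "norm (F' a) \<le> K" "norm (F'' a) \<le> K" if "\<bar>a\<bar> \<le> B" for a
  proof -
    have "a \<in> {-B..B}" using that by auto
    with K have "norm (F' a) \<le> K1" "norm (F'' a) \<le> K2" by blast+
    then show "norm (F' a) \<le> K" "norm (F'' a) \<le> K" by (auto simp: K_def)
  qed
  show ?thesis
  proof (rule that[of K])
    show "0 \<le> K" by (simp add: K_def)
    fix a b assume ab: "\<bar>a\<bar> \<le> B" "\<bar>b\<bar> \<le> B"
    have "norm (F a - F b) \<le> K * norm (a - b)"
      by (rule differentiable_bound[of "{-B..B}" F "\<lambda>x. blinfun_apply (F' x)"])
        (use ab 1 d(1) in \<open>auto simp: norm_blinfun.rep_eq[symmetric] intro: has_derivative_at_withinI\<close>)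
    then show "\<bar>F a - F b\<bar> \<le> K * \<bar>a - b\<bar>" by simp
    have "norm (F' a - F' b) \<le> K * norm (a - b)"
      by (rule differentiable_bound[of "{-B..B}" F' "\<lambda>x. blinfun_apply (F'' x)"])
        (use ab 1 d(2) in \<open>auto simp: norm_blinfun.rep_eq[symmetric] intro: has_derivative_at_withinI\<close>)
    then show "norm (F' a - F' b) \<le> K * \<bar>a - b\<bar>" by simp
  qed (use 1 in auto)
qed

text \<open>
  The backward light cone of a point of the cone with apex \<open>(t0, x0)\<close> is contained in that cone.
\<close>
lemma cone_maps:
  assumes z: "fst z \<in> {0..t0}" "norm (snd z - x0) \<le> t0 - fst z" and y: "y \<in> cone_box"
  shows "fst (\<Lambda>3 y z) \<in> {0..t0}" "norm (snd (\<Lambda>3 y z) - x0) \<le> t0 - fst (\<Lambda>3 y z)"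
proof -
  have s: "0 \<le> fst y" "fst y \<le> 1" using y cone_box_iff[of "fst y" "snd y"] by auto
  have "(1 - fst y) * fst z \<le> 1 * fst z" using s z by (intro mult_right_mono) auto
  then show "fst (\<Lambda>3 y z) \<in> {0..t0}" using s z by (simp add: \<Lambda>3_apply)
  have "norm (snd (\<Lambda>3 y z) - x0) = norm ((snd z - x0) + (fst z * fst y) *\<^sub>R unit_dir (snd y))"
    by (simp add: \<Lambda>3_apply algebra_simps)
  also have "\<dots> \<le> norm (snd z - x0) + fst z * fst y"
    by (rule order_trans[OF norm_triangle_ineq]) (use s z in simp)
  finally show "norm (snd (\<Lambda>3 y z) - x0) \<le> t0 - fst (\<Lambda>3 y z)" using z(2) by (simp add: \<Lambda>3_apply algebra_simps)
qed

text \<open>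
  Solutions need not be bounded on the whole slab, so the comparison takes place on the compact backward
  light cone of the given point, where \<open>F\<close> is Lipschitz on the range of both solutions. There the maximum of
  the difference, weighted by $e^{-l t}$, is at most half of itself.
\<close>
theorem wave_sol_unique:
  assumes T: "0 < T" and F: "C2_with UNIV F F' F''"
    and v: "wave_sol T (\<lambda>z. F (v z)) f v" and w: "wave_sol T (\<lambda>z. F (w z)) f w" and z0: "z0 \<in> ST T"
  shows "v z0 = w z0"
proof -
  obtain t0 x0 where tx0: "z0 = (t0, x0)" by (cases z0)
  have t0: "0 \<le> t0" "t0 \<le> T" using z0 by (auto simp: tx0)
  define C where "C = {z :: real \<times> (real ^ 3). fst z \<in> {0..t0} \<and> norm (snd z - x0) \<le> t0 - fst z}"
  have CS: "z \<in> ST T" if "z \<in> C" for z using that t0 by (cases z) (auto simp: C_def)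
  have "C = ({0..t0} \<times> cball x0 t0) \<inter> {z. norm (snd z - x0) \<le> t0 - fst z}"
    by (auto simp: C_def dist_norm norm_minus_commute)
  moreover have "closed {z :: real \<times> (real ^ 3). norm (snd z - x0) \<le> t0 - fst z}"
    by (intro closed_Collect_le continuous_intros)
  ultimately have cC: "compact C" by (auto intro!: compact_Int_closed compact_Times)
  have z0C: "z0 \<in> C" using t0 by (simp add: C_def tx0)
  have cv: "continuous_on (ST T) v" "continuous_on (ST T) w"
    using v w unfolding wave_sol_def by (auto dest: C2_withD(3))
  have cF: "continuous_on UNIV F" by (rule C2_withD(3)[OF F])
  have cvC: "continuous_on C v" "continuous_on C w" using cv CS continuous_on_subset[of _ _ C] by blast+
  obtain B1 B2 where "\<forall>z\<in>C. \<bar>v z\<bar> \<le> B1" "\<forall>z\<in>C. \<bar>w z\<bar> \<le> B2"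
    using compact_imp_bounded[OF compact_continuous_image[OF cvC(1) cC]] compact_imp_bounded[OF compact_continuous_image[OF cvC(2) cC]]
    unfolding bounded_iff by auto
  then have B: "\<bar>v z\<bar> \<le> max B1 B2" "\<bar>w z\<bar> \<le> max B1 B2" if "z \<in> C" for z using that by fastforce+
  obtain K where K: "0 \<le> K" "\<And>a b. \<bar>a\<bar> \<le> max B1 B2 \<Longrightarrow> \<bar>b\<bar> \<le> max B1 B2 \<Longrightarrow> \<bar>F a - F b\<bar> \<le> K * \<bar>a - b\<bar>"
    using C2_lipschitz_on_interval[OF F, of "max B1 B2"] by metis
  define l where "l = 2 * K * T + 1"
  have l: "0 < l" using K T by (simp add: l_def add_nonneg_pos)
  have "\<exists>zm\<in>C. \<forall>z\<in>C. exp (- l * fst z) * \<bar>v z - w z\<bar> \<le> exp (- l * fst zm) * \<bar>v zm - w zm\<bar>"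
    by (rule continuous_attains_sup[OF cC]) (use z0C in \<open>auto intro!: continuous_intros cvC\<close>)
  then obtain zm where zm: "zm \<in> C" and max: "\<And>z. z \<in> C \<Longrightarrow> exp (- l * fst z) * \<bar>v z - w z\<bar> \<le> exp (- l * fst zm) * \<bar>v zm - w zm\<bar>"
    by blast
  define M where "M = exp (- l * fst zm) * \<bar>v zm - w zm\<bar>"
  have M0: "0 \<le> M" by (simp add: M_def)
  have dif: "\<bar>v z - w z\<bar> \<le> M * exp (l * fst z)" if "z \<in> C" for z
    using max[OF that] unfolding M_def[symmetric] by (simp add: exp_minus field_simps)
  have cFv: "continuous_on (ST T) (\<lambda>z. F (v z))" "continuous_on (ST T) (\<lambda>z. F (w z))"
    by (rule continuous_on_compose2[OF cF cv(1)] continuous_on_compose2[OF cF cv(2)]; simp)+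
  have rep: "v zm - w zm = duhamel (\<lambda>z. F (v z) - F (w z)) zm"
    using kirchhoff[OF v, of "fst zm" "snd zm"] kirchhoff[OF w, of "fst zm" "snd zm"] CS[OF zm] duhamel_diff[OF cFv CS[OF zm]]
    by (cases zm) simp
  have "\<bar>v zm - w zm\<bar> \<le> (K * M) * (T / l) * exp (l * fst zm)"
    unfolding rep
  proof (rule duhamel_weighted_bound[OF _ CS[OF zm] l])
    fix y assume y: "y \<in> cone_box"
    have "\<Lambda>3 y zm \<in> C" using cone_maps[of zm t0 x0 y] zm y unfolding C_def by blast
    then have "\<bar>F (v (\<Lambda>3 y zm)) - F (w (\<Lambda>3 y zm))\<bar> \<le> K * (M * exp (l * fst (\<Lambda>3 y zm)))"
      using order_trans[OF K(2)[OF B] mult_left_mono[OF dif K(1)]] by blast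
    then show "\<bar>F (v (\<Lambda>3 y zm)) - F (w (\<Lambda>3 y zm))\<bar> \<le> K * M * exp (l * fst (\<Lambda>3 y zm))" by (simp add: mult.assoc)
  qed (use K M0 cFv in \<open>auto intro!: continuous_intros\<close>)
  then have "M \<le> K * M * (T / l)" unfolding M_def
    by (simp add: exp_minus field_simps)
  moreover have "K * T / l \<le> 1 / 2" using l K T by (simp add: l_def field_simps)
  then have "M * (K * T / l) \<le> M * (1 / 2)" using M0 by (rule mult_left_mono)
  moreover have "K * M * (T / l) = M * (K * T / l)" by simp
  ultimately have "M \<le> M * (1/2)" by linarith
  then have "M = 0" using M0 by simp
  then show ?thesis using dif[OF z0C] by simp
qed

section \<open>Derivative bounds for the Duhamel integral\<close>

text \<open>
  A contraction up to an error that is small for late indices. The error term is needed for second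
  derivatives: their iteration involves the second derivative of the nonlinearity, which is continuous but
  not Lipschitz. The distance after \<open>k\<close> steps is at most $2 A / 2^k + 2 \eta$.
\<close>
lemma contraction_uniformly_Cauchy:
  fixes g :: "nat \<Rightarrow> 'z \<Rightarrow> 'b::real_normed_vector"
  assumes A: "\<And>n z. z \<in> S \<Longrightarrow> norm (g n z) \<le> A" and E: "\<And>z. z \<in> S \<Longrightarrow> 1 \<le> E z" "\<And>z. z \<in> S \<Longrightarrow> E z \<le> M"
    and step: "\<And>\<eta>. 0 < \<eta> \<Longrightarrow> \<exists>N. \<forall>m\<ge>N. \<forall>n\<ge>N. \<forall>c\<ge>0. (\<forall>z\<in>S. norm (g m z - g n z) \<le> c * E z) \<longrightarrow>
        (\<forall>z\<in>S. norm (g (Suc m) z - g (Suc n) z) \<le> (c / 2 + \<eta>) * E z)"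
    and e: "0 < e"
  shows "\<exists>N. \<forall>m\<ge>N. \<forall>n\<ge>N. \<forall>z\<in>S. norm (g m z - g n z) < e"
proof (cases "S = {}")
  case False
  then obtain z0 where z0: "z0 \<in> S" by blast
  have M: "1 \<le> M" using E[OF z0] by simp
  have A0: "0 \<le> A" using A[OF z0, of 0] norm_ge_zero order_trans by blast
  define \<eta> where "\<eta> = e / (8 * M)"
  have \<eta>: "0 < \<eta>" using e M by (simp add: \<eta>_def)
  obtain N0 where N0: "\<And>m n c. m \<ge> N0 \<Longrightarrow> n \<ge> N0 \<Longrightarrow> 0 \<le> c \<Longrightarrow> (\<forall>z\<in>S. norm (g m z - g n z) \<le> c * E z) \<Longrightarrow>
        (\<forall>z\<in>S. norm (g (Suc m) z - g (Suc n) z) \<le> (c / 2 + \<eta>) * E z)"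
    using step[OF \<eta>] by blast
  have ind: "\<forall>m\<ge>N0 + k. \<forall>n\<ge>N0 + k. \<forall>z\<in>S. norm (g m z - g n z) \<le> (2 * A / 2 ^ k + 2 * \<eta>) * E z" for k
  proof (induction k)
    case 0
    show ?case
    proof (intro allI impI ballI)
      fix m n z assume z: "z \<in> S"
      have "norm (g m z - g n z) \<le> A + A" using norm_triangle_ineq4 A[OF z] by (meson add_mono order_trans)
      also have "\<dots> \<le> (2 * A + 2 * \<eta>) * 1" using \<eta> by simp
      also have "\<dots> \<le> (2 * A + 2 * \<eta>) * E z" using E(1)[OF z] A0 \<eta> by (intro mult_left_mono) auto
      finally show "norm (g m z - g n z) \<le> (2 * A / 2 ^ 0 + 2 * \<eta>) * E z" by simp
    qed
  next
    case (Suc k)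
    show ?case
    proof (intro allI impI)
      fix m n assume mn: "N0 + Suc k \<le> m" "N0 + Suc k \<le> n"
      obtain m' n' where e: "m = Suc m'" "n = Suc n'" using mn by (metis Suc_le_D add_Suc_right)
      have "\<forall>z\<in>S. norm (g (Suc m') z - g (Suc n') z) \<le> ((2 * A / 2 ^ k + 2 * \<eta>) / 2 + \<eta>) * E z"
        by (rule N0) (use Suc mn e A0 \<eta> in auto)
      moreover have "(2 * A / 2 ^ k + 2 * \<eta>) / 2 + \<eta> = 2 * A / 2 ^ Suc k + 2 * \<eta>" by (simp add: field_simps)
      ultimately show "\<forall>z\<in>S. norm (g m z - g n z) \<le> (2 * A / 2 ^ Suc k + 2 * \<eta>) * E z" using e by simp
    qed
  qed
  obtain k where k: "2 * A / \<eta> < 2 ^ k" using real_arch_pow[of 2 "2 * A / \<eta>"] by auto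
  then have "2 * A / 2 ^ k < \<eta>" using \<eta> by (simp add: field_simps)
  then have s: "(2 * A / 2 ^ k + 2 * \<eta>) * E z < e" if "z \<in> S" for z
  proof -
    have "(2 * A / 2 ^ k + 2 * \<eta>) * E z \<le> (3 * \<eta>) * E z"
      using \<open>2 * A / 2 ^ k < \<eta>\<close> E(1)[OF that] by (intro mult_right_mono) auto
    also have "\<dots> \<le> (3 * \<eta>) * M" using E(2)[OF that] \<eta> by (intro mult_left_mono) auto
    also have "\<dots> < e" using e M by (simp add: \<eta>_def field_simps)
    finally show ?thesis .
  qed
  show ?thesis
  proof (intro exI[of _ "N0 + k"] allI impI ballI)
    fix m n z assume "N0 + k \<le> m" "N0 + k \<le> n" and z: "z \<in> S"
    then have "norm (g m z - g n z) \<le> (2 * A / 2 ^ k + 2 * \<eta>) * E z" using ind[of k] by blast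
    then show "norm (g m z - g n z) < e" using s[OF z] by linarith
  qed
qed auto

lemma norm_fst_blinfun: "norm (fst_blinfun :: ('a::real_normed_vector \<times> 'b::real_normed_vector) \<Rightarrow>\<^sub>L 'a) \<le> 1"
  by (rule norm_blinfun_bound) (auto simp: norm_fst_le intro: order_trans[OF norm_fst_le])

lemma norm_tm1: "norm (tm1 i i' z) \<le> \<bar>i z\<bar> + \<bar>fst z\<bar> * norm (i' z)"
proof -
  have "norm (i z *\<^sub>R (fst_blinfun :: (real \<times> (real ^ 3)) \<Rightarrow>\<^sub>L real)) \<le> \<bar>i z\<bar> * 1"
    unfolding norm_scaleR by (rule mult_left_mono[OF norm_fst_blinfun]) simp
  then show ?thesis unfolding tm1_def
    by (intro order_trans[OF norm_triangle_ineq] add_mono) auto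
qed

lemma norm_blinfun_scaleR_left: "norm (blinfun_scaleR_left a) \<le> norm a"
  by (rule norm_blinfun_bound) (auto simp: mult.commute)

lemma norm_tm2: "norm (tm2 i' i'' z) \<le> 2 * norm (i' z) + \<bar>fst z\<bar> * norm (i'' z)"
proof -
  have "norm (blinfun_scaleR_left (fst_blinfun :: (real \<times> (real ^ 3)) \<Rightarrow>\<^sub>L real) o\<^sub>L i' z) \<le> 1 * norm (i' z)"
    by (intro order_trans[OF norm_blinfun_compose] mult_right_mono order_trans[OF norm_blinfun_scaleR_left] norm_fst_blinfun) auto
  moreover have "norm (blinfun_scaleR_left (i' z) o\<^sub>L (fst_blinfun :: (real \<times> (real ^ 3)) \<Rightarrow>\<^sub>L real)) \<le> norm (i' z) * 1"
    by (intro order_trans[OF norm_blinfun_compose] mult_mono norm_blinfun_scaleR_left norm_fst_blinfun) auto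
  ultimately show ?thesis unfolding tm2_def
    using norm_triangle_ineq[of "(blinfun_scaleR_left (fst_blinfun :: (real \<times> (real ^ 3)) \<Rightarrow>\<^sub>L real) o\<^sub>L i' z) + (blinfun_scaleR_left (i' z) o\<^sub>L fst_blinfun)" "fst z *\<^sub>R i'' z"]
      norm_triangle_ineq[of "blinfun_scaleR_left (fst_blinfun :: (real \<times> (real ^ 3)) \<Rightarrow>\<^sub>L real) o\<^sub>L i' z" "blinfun_scaleR_left (i' z) o\<^sub>L (fst_blinfun :: (real \<times> (real ^ 3)) \<Rightarrow>\<^sub>L real)"]
    by simp
qed

lemma cone_pull_bounds:
  assumes y: "y \<in> cone_box"
  shows "norm (\<kappa>3 y *\<^sub>R pull1 (\<Lambda>3 y) A) \<le> \<kappa>3 y * (3 * norm A)"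
    and "norm (\<kappa>3 y *\<^sub>R pull2 (\<Lambda>3 y) H) \<le> \<kappa>3 y * (9 * norm H)"
proof -
  note k = cone_weight_nonneg[OF y]
  have "norm (pull1 (\<Lambda>3 y) A) \<le> norm A * 3"
    by (rule order_trans[OF norm_pull1 mult_left_mono[OF norm_\<Lambda>3[OF y]]]) simp
  from mult_left_mono[OF this k] show "norm (\<kappa>3 y *\<^sub>R pull1 (\<Lambda>3 y) A) \<le> \<kappa>3 y * (3 * norm A)"
    using k by (simp add: mult.commute)
  have "(norm (\<Lambda>3 y))\<^sup>2 \<le> 3\<^sup>2" by (rule power_mono[OF norm_\<Lambda>3[OF y]]) simp
  then have "norm (pull2 (\<Lambda>3 y) H) \<le> norm H * 9"
    by (intro order_trans[OF norm_pull2 mult_left_mono]) auto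
  from mult_left_mono[OF this k] show "norm (\<kappa>3 y *\<^sub>R pull2 (\<Lambda>3 y) H) \<le> \<kappa>3 y * (9 * norm H)"
    using k by (simp add: mult.commute)
qed

lemma exp_weight_cone: "exp (l * fst (\<Lambda>3 y z)) = exp (l * ((1 - fst y) * fst z))"
  by (simp add: \<Lambda>3_apply)

context
  fixes T l :: real and z :: "real \<times> (real ^ 3)"
  assumes T: "0 < T" and l: "0 < l" and z: "z \<in> ST T"
begin

lemma z_time: "0 \<le> fst z" "fst z \<le> T" using z by (cases z, simp)+

lemma cone_I0_bound:
  assumes "continuous_on (ST T) h" "\<And>z. z \<in> ST T \<Longrightarrow> \<bar>h z\<bar> \<le> a"
  shows "\<bar>cone.I0 h z\<bar> \<le> a"
proof -
  have "norm (cone.I0 h z) \<le> a" unfolding cone.I0_def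
  proof (rule cone_integral_bound[OF cone.int0[OF assms(1) z]])
    show "0 \<le> a" using assms(2)[OF z] by linarith
    fix y assume y: "y \<in> cone_box"
    show "norm (\<kappa>3 y * h (\<Lambda>3 y z)) \<le> \<kappa>3 y * a"
      using mult_left_mono[OF assms(2)[OF \<Lambda>3_ST[OF y z]] cone_weight_nonneg[OF y]] cone_weight_nonneg[OF y]
      by (simp add: abs_mult)
  qed
  then show ?thesis by simp
qed

lemma cone_I1_bound:
  assumes "continuous_on (ST T) h'" "\<And>z. z \<in> ST T \<Longrightarrow> norm (h' z) \<le> b"
  shows "norm (cone.I1 h' z) \<le> 3 * b"
  unfolding cone.I1_def
proof (rule cone_integral_bound[OF cone.int1[OF assms(1) z]])
  show "0 \<le> 3 * b" using assms(2)[OF z] norm_ge_zero[of "h' z"] by linarith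
  fix y assume y: "y \<in> cone_box"
  show "norm (\<kappa>3 y *\<^sub>R pull1 (\<Lambda>3 y) (h' (\<Lambda>3 y z))) \<le> \<kappa>3 y * (3 * b)"
    using assms(2)[OF \<Lambda>3_ST[OF y z]]
    by (intro order_trans[OF cone_pull_bounds(1)[OF y]] mult_left_mono cone_weight_nonneg[OF y]) auto
qed

lemma cone_I1_weighted:
  assumes "continuous_on (ST T) h'" "0 \<le> c" "\<And>z. z \<in> ST T \<Longrightarrow> norm (h' z) \<le> c * exp (l * fst z)"
  shows "(fst z)\<^sup>2 * norm (cone.I1 h' z) \<le> 3 * c * (T / l) * exp (l * fst z)"
  unfolding cone.I1_def
proof (rule cone_integral_weighted_bound[OF cone.int1[OF assms(1) z] l z_time])
  fix y assume y: "y \<in> cone_box"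
  show "norm (\<kappa>3 y *\<^sub>R pull1 (\<Lambda>3 y) (h' (\<Lambda>3 y z))) \<le> \<kappa>3 y * (3 * c * exp (l * ((1 - fst y) * fst z)))"
    using assms(3)[OF \<Lambda>3_ST[OF y z]] unfolding exp_weight_cone
    by (intro order_trans[OF cone_pull_bounds(1)[OF y]] mult_left_mono cone_weight_nonneg[OF y]) auto
qed (use assms in auto)

lemma cone_I2_weighted:
  assumes "continuous_on (ST T) h''" "0 \<le> c" "\<And>z. z \<in> ST T \<Longrightarrow> norm (h'' z) \<le> c * exp (l * fst z)"
  shows "(fst z)\<^sup>2 * norm (cone.I2 h'' z) \<le> 9 * c * (T / l) * exp (l * fst z)"
  unfolding cone.I2_def
proof (rule cone_integral_weighted_bound[OF cone.int2[OF assms(1) z] l z_time])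
  fix y assume y: "y \<in> cone_box"
  show "norm (\<kappa>3 y *\<^sub>R pull2 (\<Lambda>3 y) (h'' (\<Lambda>3 y z))) \<le> \<kappa>3 y * (9 * c * exp (l * ((1 - fst y) * fst z)))"
    using assms(3)[OF \<Lambda>3_ST[OF y z]] unfolding exp_weight_cone
    by (intro order_trans[OF cone_pull_bounds(2)[OF y]] mult_left_mono cone_weight_nonneg[OF y]) auto
qed (use assms in auto)

text \<open>
  The highest derivative enters only with the factor \<open>T / l\<close>, lower-order terms with factors that do not
  become small; the same holds in \<open>duh2_bound\<close>. The constants 3 and 9 come from the bound 3 for the
  norm of \<open>\<Lambda>3\<close>.
\<close>
lemma duh1_bound:
  assumes h: "continuous_on (ST T) h" "\<And>z. z \<in> ST T \<Longrightarrow> \<bar>h z\<bar> \<le> a"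
    and h': "continuous_on (ST T) h'" "0 \<le> c" "\<And>z. z \<in> ST T \<Longrightarrow> norm (h' z) \<le> c * exp (l * fst z)"
  shows "norm (duh1 h h' z) \<le> 2 * T * a + 3 * c * (T / l) * exp (l * fst z)"
proof -
  note t = z_time
  have a: "0 \<le> a" using h(2)[OF z] by linarith
  have i0: "fst z * \<bar>cone.I0 h z\<bar> \<le> T * a"
    by (rule mult_mono[OF t(2) cone_I0_bound[OF h]]) (use T in auto)
  have "norm (duh1 h h' z) \<le> fst z * \<bar>cone.I0 h z\<bar> + fst z * (\<bar>cone.I0 h z\<bar> + fst z * norm (cone.I1 h' z))"
    unfolding duh1_def using t
    by (intro order_trans[OF norm_tm1] add_mono mult_mono) (auto simp: abs_mult intro: order_trans[OF norm_tm1])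
  also have "\<dots> = 2 * (fst z * \<bar>cone.I0 h z\<bar>) + (fst z)\<^sup>2 * norm (cone.I1 h' z)"
    by (simp add: power2_eq_square algebra_simps)
  also have "\<dots> \<le> 2 * (T * a) + 3 * c * (T / l) * exp (l * fst z)"
    using i0 cone_I1_weighted[OF h'] by linarith
  finally show ?thesis by simp
qed

lemma duh2_bound:
  assumes h: "continuous_on (ST T) h" "\<And>z. z \<in> ST T \<Longrightarrow> \<bar>h z\<bar> \<le> a"
    and h': "continuous_on (ST T) h'" "\<And>z. z \<in> ST T \<Longrightarrow> norm (h' z) \<le> b"
    and h'': "continuous_on (ST T) h''" "0 \<le> c" "\<And>z. z \<in> ST T \<Longrightarrow> norm (h'' z) \<le> c * exp (l * fst z)"
  shows "norm (duh2 h h' h'' z) \<le> 2 * a + 12 * T * b + 9 * c * (T / l) * exp (l * fst z)"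
proof -
  note t = z_time
  have i1: "fst z * norm (cone.I1 h' z) \<le> T * (3 * b)"
    by (rule mult_mono[OF t(2) cone_I1_bound[OF h']]) (use T in auto)
  have "norm (duh2 h h' h'' z) \<le> 2 * (\<bar>cone.I0 h z\<bar> + fst z * norm (cone.I1 h' z)) + fst z * (2 * norm (cone.I1 h' z) + fst z * norm (cone.I2 h'' z))"
    unfolding duh2_def using t
    by (intro order_trans[OF norm_tm2] add_mono mult_mono) (auto intro: order_trans[OF norm_tm1] order_trans[OF norm_tm2])
  also have "\<dots> = 2 * \<bar>cone.I0 h z\<bar> + 4 * (fst z * norm (cone.I1 h' z)) + (fst z)\<^sup>2 * norm (cone.I2 h'' z)"
    by (simp add: power2_eq_square algebra_simps)
  also have "\<dots> \<le> 2 * a + 4 * (T * (3 * b)) + 9 * c * (T / l) * exp (l * fst z)"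
    using i1 cone_I0_bound[OF h] cone_I2_weighted[OF h''] by linarith
  finally show ?thesis by simp
qed

lemma duh_diff:
  assumes "continuous_on (ST T) h" "continuous_on (ST T) k" "continuous_on (ST T) h'" "continuous_on (ST T) k'"
    "continuous_on (ST T) h''" "continuous_on (ST T) k''"
  shows "duh1 h h' z - duh1 k k' z = duh1 (\<lambda>z. h z - k z) (\<lambda>z. h' z - k' z) z"
    and "duh2 h h' h'' z - duh2 k k' k'' z = duh2 (\<lambda>z. h z - k z) (\<lambda>z. h' z - k' z) (\<lambda>z. h'' z - k'' z) z"
proof -
  have 0: "cone.I0 (\<lambda>z. h z - k z) z = cone.I0 h z - cone.I0 k z"
    unfolding cone.I0_def right_diff_distrib by (rule integral_diff) (use assms z in \<open>auto intro: cone.int0\<close>)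
  have p1: "pull1 A (g - g') = pull1 A g - pull1 A g'" for A and g g' :: "(real \<times> (real ^ 3)) \<Rightarrow>\<^sub>L real"
    by (rule blinfun_eqI) (simp add: blinfun.diff_left)
  have p2: "pull2 A (g - g') = pull2 A g - pull2 A g'" for A and g g' :: "(real \<times> (real ^ 3)) \<Rightarrow>\<^sub>L (real \<times> (real ^ 3)) \<Rightarrow>\<^sub>L real"
    by (intro blinfun_eqI) (simp add: blinfun.diff_left)
  have 1: "cone.I1 (\<lambda>z. h' z - k' z) z = cone.I1 h' z - cone.I1 k' z"
    unfolding cone.I1_def p1 scaleR_diff_right by (rule integral_diff) (use assms z in \<open>auto intro: cone.int1\<close>)
  have 2: "cone.I2 (\<lambda>z. h'' z - k'' z) z = cone.I2 h'' z - cone.I2 k'' z"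
    unfolding cone.I2_def p2 scaleR_diff_right by (rule integral_diff) (use assms z in \<open>auto intro: cone.int2\<close>)
  show "duh1 h h' z - duh1 k k' z = duh1 (\<lambda>z. h z - k z) (\<lambda>z. h' z - k' z) z"
    by (rule blinfun_eqI) (unfold duh1_def tm1_apply blinfun.diff_left 0 1, simp only: algebra_simps)
  show "duh2 h h' h'' z - duh2 k k' k'' z = duh2 (\<lambda>z. h z - k z) (\<lambda>z. h' z - k' z) (\<lambda>z. h'' z - k'' z) z"
    by (intro blinfun_eqI) (unfold duh2_def tm1_apply tm2_apply blinfun.diff_left 0 1 2, simp only: algebra_simps)
qed

lemma free_wave_derivative_bounds:
  assumes f: "C2_with UNIV f f' f''" and m: "\<And>x. \<bar>f x\<bar> \<le> m" "\<And>x. norm (f' x) \<le> m" "\<And>x. norm (f'' x) \<le> m"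
  shows "norm (fr1 f f' z) \<le> m + T * (2 * m)" and "norm (fr2 f' f'' z) \<le> 4 * m + T * (4 * m)"
proof -
  note fc = C2_withD(3-5)[OF f]
  have m0: "0 \<le> m" using m(1)[of 0] by linarith
  have k: "0 \<le> \<kappa>2 y" if "y \<in> sphere_box" for y using sphere_weight_nonneg[OF that] by (simp add: \<kappa>2_def)
  have tot: "integral sphere_box (\<lambda>y. \<kappa>2 y * a) = a" for a
    using sphere_mean_const[of a] unfolding sphere_mean_def \<kappa>2_def by simp
  have ik: "(\<lambda>y. \<kappa>2 y * a) integrable_on sphere_box" for a
    by (intro integrable_continuous continuous_intros sph.cont\<kappa>)
  have 0: "\<bar>sph.I0 f z\<bar> \<le> m"
  proof -
    have "norm (sph.I0 f z) \<le> integral sphere_box (\<lambda>y. \<kappa>2 y * m)"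
      unfolding sph.I0_def
      by (rule integral_norm_bound_integral[OF sph.int0[OF fc(1) z] ik])
        (use k m in \<open>auto simp: abs_mult mult_left_mono\<close>)
    then show ?thesis unfolding tot by simp
  qed
  have 1: "norm (sph.I1 f' z) \<le> 2 * m"
  proof -
    have "norm (sph.I1 f' z) \<le> integral sphere_box (\<lambda>y. \<kappa>2 y * (2 * m))"
      unfolding sph.I1_def
    proof (rule integral_norm_bound_integral[OF sph.int1[OF fc(2) z] ik])
      fix y assume y: "y \<in> sphere_box"
      have "norm (pull1 (\<Lambda>2 y) (f' (\<Lambda>2 y z))) \<le> m * 2"
        by (intro order_trans[OF norm_pull1] mult_mono m norm_\<Lambda>2 m0) auto
      then show "norm (\<kappa>2 y *\<^sub>R pull1 (\<Lambda>2 y) (f' (\<Lambda>2 y z))) \<le> \<kappa>2 y * (2 * m)"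
        using k[OF y] by (simp add: mult_left_mono mult.commute)
    qed
    then show ?thesis unfolding tot .
  qed
  have 2: "norm (sph.I2 f'' z) \<le> 4 * m"
  proof -
    have "norm (sph.I2 f'' z) \<le> integral sphere_box (\<lambda>y. \<kappa>2 y * (4 * m))"
      unfolding sph.I2_def
    proof (rule integral_norm_bound_integral[OF sph.int2[OF fc(3) z] ik])
      fix y assume y: "y \<in> sphere_box"
      have "(norm (\<Lambda>2 y))\<^sup>2 \<le> 2\<^sup>2" by (rule power_mono[OF norm_\<Lambda>2]) simp
      then have "norm (pull2 (\<Lambda>2 y) (f'' (\<Lambda>2 y z))) \<le> m * 4"
        by (intro order_trans[OF norm_pull2] mult_mono m m0) auto
      then show "norm (\<kappa>2 y *\<^sub>R pull2 (\<Lambda>2 y) (f'' (\<Lambda>2 y z))) \<le> \<kappa>2 y * (4 * m)"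
        using k[OF y] by (simp add: mult_left_mono mult.commute)
    qed
    then show ?thesis unfolding tot .
  qed
  show "norm (fr1 f f' z) \<le> m + T * (2 * m)" unfolding fr1_def
    by (intro order_trans[OF norm_tm1] add_mono mult_mono 0 1) (use z_time T in auto)
  have "norm (fr2 f' f'' z) \<le> 2 * (2 * m) + T * (4 * m)" unfolding fr2_def
    by (intro order_trans[OF norm_tm2] add_mono mult_mono mult_left_mono 1 2) (use z_time T in auto)
  then show "norm (fr2 f' f'' z) \<le> 4 * m + T * (4 * m)" by simp
qed

end

section \<open>Convergence of the Picard iteration\<close>

primrec picard :: "(real \<Rightarrow> real) \<Rightarrow> (real ^ 3 \<Rightarrow> real) \<Rightarrow> nat \<Rightarrow> real \<times> (real ^ 3) \<Rightarrow> real" where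
  "picard F f 0 = (\<lambda>z. 0)"
| "picard F f (Suc n) = (\<lambda>z. free_wave f z + duhamel (\<lambda>z. F (picard F f n z)) z)"

lemma uniformly_Cauchy_limit:
  fixes g :: "nat \<Rightarrow> 'z \<Rightarrow> 'b::banach"
  assumes c: "\<And>e. 0 < e \<Longrightarrow> \<exists>N. \<forall>m\<ge>N. \<forall>n\<ge>N. \<forall>z\<in>S. norm (g m z - g n z) < e"
  shows "\<exists>u. \<forall>e>0. \<exists>N. \<forall>n\<ge>N. \<forall>z\<in>S. norm (g n z - u z) < e"
proof -
  have "\<forall>e>0. \<exists>N. \<forall>m n z. N \<le> m \<and> N \<le> n \<and> z \<in> S \<longrightarrow> dist (g m z) (g n z) < e"
    using c unfolding dist_norm by meson
  then have "\<exists>u. \<forall>e>0. \<exists>N. \<forall>n z. N \<le> n \<and> z \<in> S \<longrightarrow> dist (g n z) (u z) < e"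
    by (rule iffD2[OF uniformly_convergent_eq_cauchy[of "\<lambda>z. z \<in> S" g]])
  then obtain u where "\<forall>e>0. \<exists>N. \<forall>n z. N \<le> n \<and> z \<in> S \<longrightarrow> dist (g n z) (u z) < e" by blast
  then show ?thesis unfolding dist_norm by meson
qed

lemma C2_with_compose:
  fixes F :: "real \<Rightarrow> real"
  assumes Fc: "C2_with UNIV F F' F''" and u: "C2_with S u u' u''"
  shows "C2_with S (\<lambda>z. F (u z)) (\<lambda>z. F' (u z) 1 *\<^sub>R u' z)
    (\<lambda>z. F'' (u z) 1 1 *\<^sub>R (blinfun_scaleR_left (u' z) o\<^sub>L u' z) + F' (u z) 1 *\<^sub>R u'' z)"
proof -
  have l: "blinfun_apply L h = h * L 1" for L :: "real \<Rightarrow>\<^sub>L real" and h using blinfun.scaleR_right[of L h 1] by simp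
  note dF = C2_withD[OF Fc] and du = C2_withD[OF u]
  show ?thesis
    unfolding C2_with_def
  proof (intro conjI ballI)
    fix z assume z: "z \<in> S"
    have "((\<lambda>z. F (u z)) has_derivative (\<lambda>w. F' (u z) (u' z w))) (at z within S)"
      by (rule has_derivative_in_compose2[OF dF(1) _ z du(1)[OF z]]) auto
    then show "((\<lambda>z. F (u z)) has_derivative blinfun_apply (F' (u z) 1 *\<^sub>R u' z)) (at z within S)"
      by (rule has_derivative_eq_rhs) (rule ext, subst l, simp add: blinfun.scaleR_left)
    have "((\<lambda>z. F' (u z)) has_derivative (\<lambda>w. F'' (u z) (u' z w))) (at z within S)"
      by (rule has_derivative_in_compose2[OF dF(2) _ z du(1)[OF z]]) auto
    then have 1: "((\<lambda>z. F' (u z) 1) has_derivative (\<lambda>w. F'' (u z) (u' z w) 1)) (at z within S)"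
      by (rule bounded_linear.has_derivative[OF blinfun.bounded_linear_left])
    have e: "F'' (u z) h 1 = h * F'' (u z) 1 1" for h
      using blinfun.scaleR_right[of "F'' (u z)" h 1] by (simp add: blinfun.scaleR_left)
    from has_derivative_scaleR[OF 1 du(2)[OF z]]
    show "((\<lambda>z. F' (u z) 1 *\<^sub>R u' z) has_derivative blinfun_apply (F'' (u z) 1 1 *\<^sub>R (blinfun_scaleR_left (u' z) o\<^sub>L u' z) + F' (u z) 1 *\<^sub>R u'' z)) (at z within S)"
      by (rule has_derivative_eq_rhs) (rule ext, subst e, simp add: blinfun.scaleR_left blinfun.add_left mult.commute)
  next
    show "continuous_on (S) (\<lambda>z. F'' (u z) 1 1 *\<^sub>R (blinfun_scaleR_left (u' z) o\<^sub>L u' z) + F' (u z) 1 *\<^sub>R u'' z)"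
      by (intro continuous_intros du bounded_linear.continuous_on[OF bounded_linear_blinfun_scaleR_left]
          continuous_on_compose2[OF dF(5) du(3)] continuous_on_compose2[OF dF(4) du(3)]) auto
  qed
qed
text \<open>
  A uniform bound \<open>B\<close> for the iterates is all that is assumed about them: on the range
  $[-B, B]$ the nonlinearity and its derivative are Lipschitz.
\<close>
locale picard_iteration =
  fixes T :: real and F :: "real \<Rightarrow> real" and F' F'' and f :: "real ^ 3 \<Rightarrow> real" and f' f'' and m B :: real
  assumes T: "0 < T" and F: "C2_with UNIV F F' F''"
    and f: "C2_with UNIV f f' f''" and m: "\<And>x. \<bar>f x\<bar> \<le> m" "\<And>x. norm (f' x) \<le> m" "\<And>x. norm (f'' x) \<le> m"
    and B: "\<And>n z. z \<in> ST T \<Longrightarrow> \<bar>picard F f n z\<bar> \<le> B"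
begin

text \<open>
  Derivatives of \<open>F\<close> as numbers, and the first and second derivative of $F(u)$.
\<close>
definition "F1 a = F' a 1"
definition "F2 a = F'' a 1 1"
definition "cF1 u u' z = F1 (u z) *\<^sub>R u' z"
definition "cF2 u u' u'' z = F2 (u z) *\<^sub>R (blinfun_scaleR_left (u' z) o\<^sub>L u' z) + F1 (u z) *\<^sub>R u'' z"

lemma F2_cont: "continuous_on S F2"
proof -
  have "continuous_on UNIV F2" unfolding F2_def[abs_def] by (intro continuous_intros C2_withD(5)[OF F])
  then show ?thesis by (rule continuous_on_subset) simp
qed

lemma C2_with_nonlinear:
  "C2_with S u u' u'' \<Longrightarrow> C2_with S (\<lambda>z. F (u z)) (cF1 u u') (cF2 u u' u'')"
  using C2_with_compose[OF F] unfolding cF1_def[abs_def] cF2_def[abs_def] F1_def F2_def by blast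

abbreviation "it \<equiv> picard F f"

primrec it1 where
  "it1 0 = (\<lambda>z. 0)"
| "it1 (Suc n) = (\<lambda>z. fr1 f f' z + duh1 (\<lambda>z. F (it n z)) (cF1 (it n) (it1 n)) z)"

primrec it2 where
  "it2 0 = (\<lambda>z. 0)"
| "it2 (Suc n) = (\<lambda>z. fr2 f' f'' z + duh2 (\<lambda>z. F (it n z)) (cF1 (it n) (it1 n)) (cF2 (it n) (it1 n) (it2 n)) z)"

lemma C2_with_it: "C2_with (ST T) (it n) (it1 n) (it2 n)"
proof (induction n)
  case 0
  show ?case unfolding C2_with_def by (auto simp: zero_blinfun.rep_eq)
next
  case (Suc n)
  show ?case unfolding picard.simps it1.simps it2.simps
    by (rule C2_with_add[OF C2_with_free_wave[OF f] C2_with_duhamel[OF C2_with_nonlinear[OF Suc]]])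
qed

lemmas it_cont = C2_withD(3-5)[OF C2_with_it]
lemmas h_cont = C2_withD(3-5)[OF C2_with_nonlinear[OF C2_with_it]]

text \<open>
  By induction the first and then the second derivatives of the iterates are bounded, and the iterates, then
  their first, then their second derivatives are uniformly Cauchy. Each step is linear in the quantity that it
  estimates, with a coefficient that the weight $e^{l t}$ makes small; quantities from earlier steps enter as
  bounded or small errors. The limit solves the integral equation, hence the differential equation.
\<close>
lemma picard_converges: "\<exists>u. wave_sol T (\<lambda>z. F (u z)) f u \<and> (\<forall>z\<in>ST T. (\<lambda>n. it n z) \<longlonglongrightarrow> u z)"
proof -
  obtain K where K: "0 \<le> K" "\<And>a. \<bar>a\<bar> \<le> B \<Longrightarrow> norm (F' a) \<le> K" "\<And>a. \<bar>a\<bar> \<le> B \<Longrightarrow> norm (F'' a) \<le> K"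
    "\<And>a b. \<bar>a\<bar> \<le> B \<Longrightarrow> \<bar>b\<bar> \<le> B \<Longrightarrow> \<bar>F a - F b\<bar> \<le> K * \<bar>a - b\<bar>"
    "\<And>a b. \<bar>a\<bar> \<le> B \<Longrightarrow> \<bar>b\<bar> \<le> B \<Longrightarrow> norm (F' a - F' b) \<le> K * \<bar>a - b\<bar>"
    using C2_lipschitz_on_interval[OF F] by metis
  have KF1: "\<bar>F1 a\<bar> \<le> K" if "\<bar>a\<bar> \<le> B" for a
    using order_trans[OF norm_blinfun[of "F' a" 1]] K(2)[OF that] by (simp add: F1_def)
  have KF2: "\<bar>F2 a\<bar> \<le> K" if "\<bar>a\<bar> \<le> B" for a
  proof -
    have "norm (F'' a 1 1) \<le> norm (F'' a 1) * norm (1::real)" by (rule norm_blinfun)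
    also have "\<dots> \<le> norm (F'' a) * norm (1::real)" using norm_blinfun[of "F'' a" 1] by simp
    finally show ?thesis using K(3)[OF that] by (simp add: F2_def)
  qed
  have KL1: "\<bar>F1 a - F1 b\<bar> \<le> K * \<bar>a - b\<bar>" if "\<bar>a\<bar> \<le> B" "\<bar>b\<bar> \<le> B" for a b
    using order_trans[OF norm_blinfun[of "F' a - F' b" 1]] K(5)[OF that] by (simp add: F1_def blinfun.diff_left)
  have KLd: "\<bar>F a - F b\<bar> \<le> K * d" if "\<bar>a\<bar> \<le> B" "\<bar>b\<bar> \<le> B" "\<bar>a - b\<bar> \<le> d" for a b d
    by (rule order_trans[OF K(4)[OF that(1,2)] mult_left_mono[OF that(3) K(1)]])
  have KL1d: "\<bar>F1 a - F1 b\<bar> \<le> K * d" if "\<bar>a\<bar> \<le> B" "\<bar>b\<bar> \<le> B" "\<bar>a - b\<bar> \<le> d" for a b d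
    by (rule order_trans[OF KL1[OF that(1,2)] mult_left_mono[OF that(3) K(1)]])
  have z00: "(0, 0) \<in> ST T" using T by simp
  have B0: "0 \<le> B" using B[OF z00, of 0] by simp
  define K0 where "K0 = \<bar>F 0\<bar> + K * B"
  have K00: "0 \<le> K0" using K B0 by (simp add: K0_def)
  have KF: "\<bar>F a\<bar> \<le> K0" if "\<bar>a\<bar> \<le> B" for a
  proof -
    have "\<bar>F a - F 0\<bar> \<le> K * \<bar>a - 0\<bar>" by (rule K(4)) (use that B0 in auto)
    also have "\<dots> \<le> K * B" using that K(1) by (intro mult_left_mono) auto
    finally show ?thesis by (simp add: K0_def)
  qed
  \<comment> \<open>the weight beats the largest constant, 9 in the estimate for second derivatives, by a factor 2\<close>
  define l where "l = 18 * K * T + 1"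
  have l: "0 < l" using K T by (simp add: l_def add_nonneg_pos)
  have Tl: "K * (T / l) \<le> 1 / 18" using l K T by (simp add: l_def field_simps)
  have Tl1: "T / l \<le> T" "0 \<le> T / l" using l K T by (auto simp: l_def field_simps)
  define E where "E z = exp (l * fst z)" for z :: "real \<times> (real ^ 3)"
  have E1: "1 \<le> E z" "E z \<le> exp (l * T)" if "z \<in> ST T" for z
    using that l by (cases z, simp add: E_def)+
  have E0: "0 < E z" for z by (simp add: E_def)
  have m0: "0 \<le> m" using m(1)[of 0] by linarith
  define m1 where "m1 = m + T * (2 * m)"
  define m2 where "m2 = 4 * m + T * (4 * m)"
  have m12: "0 \<le> m1" "0 \<le> m2" using m0 T by (simp_all add: m1_def m2_def)
  have frb: "norm (fr1 f f' z) \<le> m1" "norm (fr2 f' f'' z) \<le> m2" if "z \<in> ST T" for z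
    using free_wave_derivative_bounds[OF T l that f m] by (simp_all add: m1_def m2_def)
  define c1 where "c1 = 2 * (m1 + 2 * T * K0)"
  have c1: "0 \<le> c1" using m12 T K00 by (simp add: c1_def)
  have b1: "norm (it1 n z) \<le> c1 * E z" if "z \<in> ST T" for n z
    using that
  proof (induction n arbitrary: z)
    case 0 then show ?case using c1 E0[of z] by simp
  next
    case (Suc n)
    have h': "norm (cF1 (it n) (it1 n) z) \<le> (K * c1) * exp (l * fst z)" if z: "z \<in> ST T" for z
    proof -
      have "norm (cF1 (it n) (it1 n) z) \<le> K * (c1 * E z)" unfolding cF1_def norm_scaleR real_norm_def
        by (rule mult_mono[OF KF1[OF B[OF z]] Suc.IH[OF z] K(1)]) simp
      then show ?thesis by (simp add: E_def mult.assoc)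
    qed
    have "norm (it1 (Suc n) z) \<le> m1 + (2 * T * K0 + 3 * (K * c1) * (T / l) * exp (l * fst z))"
      unfolding it1.simps
      by (intro order_trans[OF norm_triangle_ineq] add_mono frb[OF Suc.prems] duh1_bound[OF T l Suc.prems])
        (use h_cont KF[OF B] K(1) c1 h' in auto)
    also have "\<dots> = c1 / 2 * 1 + 3 * c1 * (K * (T / l)) * E z"
    proof -
      have "m1 + 2 * T * K0 = c1 / 2" by (simp add: c1_def)
      moreover have "3 * (K * c1) * (T / l) * exp (l * fst z) = 3 * c1 * (K * (T / l)) * E z" by (simp add: E_def)
      ultimately show ?thesis by linarith
    qed
    also have "\<dots> \<le> c1 / 2 * E z + 3 * c1 * (1 / 18) * E z"
      by (intro add_mono mult_left_mono mult_right_mono Tl E1(1)[OF Suc.prems]) (use c1 E0[of z] in auto)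
    also have "\<dots> \<le> c1 * E z" using c1 E0[of z] by (simp add: field_simps)
    finally show ?case .
  qed
  define A1 where "A1 = c1 * exp (l * T)"
  have A10: "0 \<le> A1" using c1 by (simp add: A1_def)
  have A1: "norm (it1 n z) \<le> A1" if "z \<in> ST T" for n z
    using b1[OF that, of n] mult_left_mono[OF E1(2)[OF that] c1] by (simp add: A1_def)
  define c2 where "c2 = 2 * (m2 + 2 * K0 + 12 * T * (K * A1) + A1\<^sup>2)"
  have c2h: "c2 / 2 = m2 + 2 * K0 + 12 * T * (K * A1) + A1\<^sup>2"
    unfolding c2_def by (rule nonzero_mult_div_cancel_left) simp
  have c2: "0 \<le> c2" using m12 T K00 K(1) A10 by (simp add: c2_def)
  have h1: "norm (cF1 (it n) (it1 n) z) \<le> K * A1" if z: "z \<in> ST T" for z n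
    unfolding cF1_def norm_scaleR real_norm_def
    by (rule mult_mono[OF KF1[OF B[OF z]] A1[OF z] K(1)]) simp
  have sq: "norm (blinfun_scaleR_left a o\<^sub>L b) \<le> norm a * norm b" for a b :: "(real \<times> (real ^ 3)) \<Rightarrow>\<^sub>L real"
    by (rule order_trans[OF norm_blinfun_compose mult_right_mono[OF norm_blinfun_scaleR_left]]) simp
  have b2: "norm (it2 n z) \<le> c2 * E z" if "z \<in> ST T" for n z
    using that
  proof (induction n arbitrary: z)
    case 0 then show ?case using c2 E0[of z] by simp
  next
    case (Suc n)
    have h'': "norm (cF2 (it n) (it1 n) (it2 n) z) \<le> (K * A1\<^sup>2 + K * c2) * exp (l * fst z)" if z: "z \<in> ST T" for z
    proof -
      have 1: "norm (F2 (it n z) *\<^sub>R (blinfun_scaleR_left (it1 n z) o\<^sub>L it1 n z)) \<le> K * (A1 * A1)"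
        unfolding norm_scaleR real_norm_def
        by (intro mult_mono KF2[OF B[OF z]] order_trans[OF sq] A1[OF z] K(1) A10) auto
      have 2: "norm (F1 (it n z) *\<^sub>R it2 n z) \<le> K * (c2 * E z)"
        unfolding norm_scaleR real_norm_def by (rule mult_mono[OF KF1[OF B[OF z]] Suc.IH[OF z] K(1)]) simp
      have "norm (cF2 (it n) (it1 n) (it2 n) z) \<le> K * A1\<^sup>2 * 1 + K * (c2 * E z)"
        unfolding cF2_def using norm_triangle_le[OF add_mono[OF 1 2]] by (simp add: power2_eq_square)
      also have "\<dots> \<le> K * A1\<^sup>2 * E z + K * (c2 * E z)"
        using E1(1)[OF z] K(1) by (intro add_right_mono mult_left_mono) auto
      finally show ?thesis by (simp add: E_def algebra_simps)
    qed
    have "norm (it2 (Suc n) z) \<le> m2 + (2 * K0 + 12 * T * (K * A1) + 9 * (K * A1\<^sup>2 + K * c2) * (T / l) * exp (l * fst z))"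
      unfolding it2.simps
      by (intro order_trans[OF norm_triangle_ineq] add_mono frb[OF Suc.prems] duh2_bound[OF T l Suc.prems])
        (use h_cont KF[OF B] K(1) c2 h1 h'' in auto)
    also have "\<dots> = (c2 / 2 - A1\<^sup>2) + 9 * (A1\<^sup>2 + c2) * (K * (T / l)) * E z"
    proof -
      have "m2 + 2 * K0 + 12 * T * (K * A1) = c2 / 2 - A1\<^sup>2" using c2h by linarith
      moreover have "9 * (K * A1\<^sup>2 + K * c2) * (T / l) * exp (l * fst z) = 9 * (A1\<^sup>2 + c2) * (K * (T / l)) * E z"
        unfolding E_def distrib_left[of K, symmetric] by (simp only: mult_ac)
      ultimately show ?thesis by linarith
    qed
    also have "\<dots> \<le> (c2 / 2 - A1\<^sup>2) + 9 * (A1\<^sup>2 + c2) * (1 / 18) * E z"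
      by (intro add_mono mult_left_mono mult_right_mono Tl) (use c2 E0[of z] in auto)
    also have "\<dots> \<le> (c2 / 2 - A1\<^sup>2) * E z + (A1\<^sup>2 / 2 + c2 / 2) * E z"
    proof -
      have "0 \<le> m2 + 2 * K0 + 12 * T * (K * A1)" using m12 T K00 K(1) A10 by simp
      then have "0 \<le> c2 / 2 - A1\<^sup>2" using c2h by linarith
      then have "(c2 / 2 - A1\<^sup>2) * 1 \<le> (c2 / 2 - A1\<^sup>2) * E z" using E1(1)[OF Suc.prems] by (intro mult_left_mono)
      then show ?thesis by (simp add: algebra_simps)
    qed
    also have "\<dots> = (c2 - A1\<^sup>2 / 2) * E z" by (simp add: algebra_simps)
    also have "\<dots> \<le> c2 * E z" using E0[of z] by (intro mult_right_mono) auto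
    finally show ?case .
  qed
  define A2 where "A2 = c2 * exp (l * T)"
  have A20: "0 \<le> A2" using c2 by (simp add: A2_def)
  have A2: "norm (it2 n z) \<le> A2" if "z \<in> ST T" for n z
    using b2[OF that, of n] mult_left_mono[OF E1(2)[OF that] c2] by (simp add: A2_def)
  have cauchy0: "\<exists>N. \<forall>m\<ge>N. \<forall>n\<ge>N. \<forall>z\<in>ST T. norm (it m z - it n z) < e" if "0 < e" for e
  proof (rule contraction_uniformly_Cauchy[where E=E and A=B and M="exp (l * T)", OF _ E1 _ that])
    show "norm (it n z) \<le> B" if "z \<in> ST T" for n z using B[OF that] by simp
    fix \<eta> :: real assume \<eta>: "0 < \<eta>"
    show "\<exists>N. \<forall>m\<ge>N. \<forall>n\<ge>N. \<forall>c\<ge>0. (\<forall>z\<in>ST T. norm (it m z - it n z) \<le> c * E z) \<longrightarrow>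
        (\<forall>z\<in>ST T. norm (it (Suc m) z - it (Suc n) z) \<le> (c / 2 + \<eta>) * E z)"
    proof (intro exI[of _ 0] allI impI ballI)
      fix m n c z assume c: "0 \<le> c" and d: "\<forall>z\<in>ST T. norm (it m z - it n z) \<le> c * E z" and z: "z \<in> ST T"
      have "\<bar>duhamel (\<lambda>z. F (it m z) - F (it n z)) z\<bar> \<le> (K * c) * (T / l) * exp (l * fst z)"
      proof (rule duhamel_weighted_bound[OF _ z l])
        fix y assume "y \<in> cone_box"
        then have y: "\<Lambda>3 y z \<in> ST T" using \<Lambda>3_ST z by blast
        have "\<bar>F (it m (\<Lambda>3 y z)) - F (it n (\<Lambda>3 y z))\<bar> \<le> K * (c * E (\<Lambda>3 y z))"
          using KLd[OF B[OF y] B[OF y] d[rule_format, OF y, unfolded real_norm_def]] .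
        then show "\<bar>F (it m (\<Lambda>3 y z)) - F (it n (\<Lambda>3 y z))\<bar> \<le> K * c * exp (l * fst (\<Lambda>3 y z))"
          by (simp add: E_def mult.assoc)
      qed (use K(1) c h_cont in \<open>auto intro!: continuous_intros\<close>)
      moreover have "it (Suc m) z - it (Suc n) z = duhamel (\<lambda>z. F (it m z) - F (it n z)) z"
        using duhamel_diff[OF h_cont(1) h_cont(1) z] by simp
      ultimately have "norm (it (Suc m) z - it (Suc n) z) \<le> c * (K * (T / l)) * E z"
        by (simp add: E_def algebra_simps)
      also have "\<dots> \<le> c * (1 / 18) * E z" by (intro mult_left_mono mult_right_mono Tl) (use c E0[of z] in auto)
      also have "\<dots> \<le> (c / 2 + \<eta>) * E z" using c \<eta> E0[of z] by (intro mult_right_mono) auto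
      finally show "norm (it (Suc m) z - it (Suc n) z) \<le> (c / 2 + \<eta>) * E z" .
    qed
  qed
  have dh: "\<bar>F (it m z) - F (it n z)\<bar> \<le> K * \<delta>" if "z \<in> ST T" "norm (it m z - it n z) \<le> \<delta>" for m n z \<delta>
    by (rule KLd) (use B that in auto)
  have dh1: "norm (cF1 (it m) (it1 m) z - cF1 (it n) (it1 n) z) \<le> K * d1 + K * \<delta> * A1"
    if z: "z \<in> ST T" and \<delta>: "norm (it m z - it n z) \<le> \<delta>" and d1: "norm (it1 m z - it1 n z) \<le> d1" for m n z \<delta> d1
  proof -
    have "cF1 (it m) (it1 m) z - cF1 (it n) (it1 n) z = F1 (it m z) *\<^sub>R (it1 m z - it1 n z) + (F1 (it m z) - F1 (it n z)) *\<^sub>R it1 n z"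
      by (simp add: cF1_def algebra_simps)
    moreover have "norm (F1 (it m z) *\<^sub>R (it1 m z - it1 n z)) \<le> K * d1"
      unfolding norm_scaleR real_norm_def by (rule mult_mono[OF KF1[OF B[OF z]] d1 K(1)]) simp
    moreover have "norm ((F1 (it m z) - F1 (it n z)) *\<^sub>R it1 n z) \<le> (K * \<delta>) * A1"
      unfolding norm_scaleR real_norm_def
    proof (rule mult_mono[OF _ A1[OF z]])
      show "\<bar>F1 (it m z) - F1 (it n z)\<bar> \<le> K * \<delta>"
        by (rule KL1d) (use B z \<delta> in auto)
      show "0 \<le> K * \<delta>" using K(1) \<delta> norm_ge_zero[of "it m z - it n z"] by (intro mult_nonneg_nonneg) linarith+
    qed simp
    ultimately show ?thesis by (metis norm_triangle_le[OF add_mono])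
  qed
  have cauchy1: "\<exists>N. \<forall>m\<ge>N. \<forall>n\<ge>N. \<forall>z\<in>ST T. norm (it1 m z - it1 n z) < e" if "0 < e" for e
  proof (rule contraction_uniformly_Cauchy[where E=E and A=A1 and M="exp (l * T)", OF A1 E1 _ that])
    fix \<eta> :: real assume \<eta>: "0 < \<eta>"
    define Q where "Q = 2 * T * K + A1 + 1"
    have Q: "0 < Q" using T K(1) A10 by (simp add: Q_def add_nonneg_pos)
    define \<delta> where "\<delta> = \<eta> / Q"
    have \<delta>p: "0 < \<delta>" "\<delta> * Q = \<eta>" using \<eta> Q by (simp_all add: \<delta>_def)
    have "\<delta> * Q = \<delta> * (2 * T * K) + \<delta> * A1 + \<delta>" by (simp add: Q_def distrib_left)
    then have \<delta>: "0 < \<delta>" "\<delta> * (2 * T * K) + \<delta> * A1 \<le> \<eta>" using \<delta>p by linarith+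
    obtain N where N: "\<And>m n z. m \<ge> N \<Longrightarrow> n \<ge> N \<Longrightarrow> z \<in> ST T \<Longrightarrow> norm (it m z - it n z) < \<delta>"
      using cauchy0[OF \<delta>(1)] by blast
    show "\<exists>N. \<forall>m\<ge>N. \<forall>n\<ge>N. \<forall>c\<ge>0. (\<forall>z\<in>ST T. norm (it1 m z - it1 n z) \<le> c * E z) \<longrightarrow>
        (\<forall>z\<in>ST T. norm (it1 (Suc m) z - it1 (Suc n) z) \<le> (c / 2 + \<eta>) * E z)"
    proof (intro exI[of _ N] allI impI ballI)
      fix m n c z assume mn: "N \<le> m" "N \<le> n" and c: "0 \<le> c" and d: "\<forall>z\<in>ST T. norm (it1 m z - it1 n z) \<le> c * E z" and z: "z \<in> ST T"
      have eq1: "it1 (Suc m) z - it1 (Suc n) z = duh1 (\<lambda>z. F (it m z) - F (it n z)) (\<lambda>z. cF1 (it m) (it1 m) z - cF1 (it n) (it1 n) z) z"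
        using duh_diff(1)[OF T l z h_cont(1) h_cont(1) h_cont(2) h_cont(2) h_cont(3) h_cont(3)] by simp
      have bd: "norm (duh1 (\<lambda>z. F (it m z) - F (it n z)) (\<lambda>z. cF1 (it m) (it1 m) z - cF1 (it n) (it1 n) z) z)
         \<le> 2 * T * (K * \<delta>) + 3 * (K * c + K * \<delta> * A1) * (T / l) * exp (l * fst z)"
      proof (rule duh1_bound[OF T l z])
        show "\<bar>F (it m z) - F (it n z)\<bar> \<le> K * \<delta>" if "z \<in> ST T" for z by (rule dh[OF that]) (use N[OF mn that] in simp)
        show "norm (cF1 (it m) (it1 m) z - cF1 (it n) (it1 n) z) \<le> (K * c + K * \<delta> * A1) * exp (l * fst z)" if z: "z \<in> ST T" for z
        proof -
          have "norm (cF1 (it m) (it1 m) z - cF1 (it n) (it1 n) z) \<le> K * (c * E z) + K * \<delta> * A1"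
            by (rule dh1[OF z _ d[rule_format, OF z]]) (use N[OF mn z] in simp)
          also have "\<dots> \<le> K * (c * E z) + K * \<delta> * A1 * E z"
            using mult_left_mono[OF E1(1)[OF z], of "K * \<delta> * A1"] K(1) \<delta> A10 by simp
          finally show ?thesis by (simp add: E_def algebra_simps)
        qed
      qed (use K(1) c \<delta> A10 h_cont in \<open>auto intro!: continuous_intros\<close>)
      moreover have "2 * T * (K * \<delta>) = \<delta> * (2 * T * K) * 1" by simp
      moreover have "3 * (K * c + K * \<delta> * A1) * (T / l) * exp (l * fst z) = 3 * (c + \<delta> * A1) * (K * (T / l)) * E z"
        unfolding E_def mult.assoc[of K] distrib_left[of K, symmetric] by (simp only: mult_ac)
      ultimately have "norm (it1 (Suc m) z - it1 (Suc n) z) \<le> \<delta> * (2 * T * K) * 1 + 3 * (c + \<delta> * A1) * (K * (T / l)) * E z"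
        unfolding eq1 using bd by linarith
      also have "\<dots> \<le> \<delta> * (2 * T * K) * E z + 3 * (c + \<delta> * A1) * (1 / 18) * E z"
        by (intro add_mono mult_left_mono mult_right_mono Tl E1(1)[OF z]) (use c \<delta> A10 K(1) T E0[of z] in auto)
      also have "\<dots> = (c / 6 + (\<delta> * (2 * T * K) + \<delta> * A1 / 6)) * E z" by (simp add: algebra_simps)
      also have "\<dots> \<le> (c / 2 + \<eta>) * E z"
      proof (intro mult_right_mono add_mono)
        have "0 \<le> \<delta> * A1" using \<delta> A10 by simp
        then show "\<delta> * (2 * T * K) + \<delta> * A1 / 6 \<le> \<eta>" using \<delta>(2) by linarith
      qed (use c E0[of z] in auto)
      finally show "norm (it1 (Suc m) z - it1 (Suc n) z) \<le> (c / 2 + \<eta>) * E z" .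
    qed
  qed
  have cauchy2: "\<exists>N. \<forall>m\<ge>N. \<forall>n\<ge>N. \<forall>z\<in>ST T. norm (it2 m z - it2 n z) < e" if "0 < e" for e
  proof (rule contraction_uniformly_Cauchy[where E=E and A=A2 and M="exp (l * T)", OF A2 E1 _ that])
    fix \<eta> :: real assume \<eta>: "0 < \<eta>"
    define P where "P = 2 * K * A1 + A1\<^sup>2 + K * A2"
    define Q where "Q = 2 * K + 12 * T * (K + K * A1) + 9 * T * P + 1"
    have P: "0 \<le> P" using K(1) A10 A20 by (simp add: P_def)
    have Q: "0 < Q" using T K(1) A10 P by (simp add: Q_def add_nonneg_pos)
    define \<theta> where "\<theta> = \<eta> / Q"
    have \<theta>p: "0 < \<theta>" "\<theta> * Q = \<eta>" using \<eta> Q by (simp_all add: \<theta>_def)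
    have "\<theta> * Q = \<theta> * (2 * K + 12 * T * (K + K * A1) + 9 * T * P) + \<theta>" unfolding Q_def by (simp add: distrib_left)
    then have \<theta>: "0 < \<theta>" "\<theta> * (2 * K + 12 * T * (K + K * A1) + 9 * T * P) \<le> \<eta>" using \<theta>p by linarith+
    \<comment> \<open>the second derivative of the nonlinearity has no Lipschitz bound, so its modulus of continuity is used\<close>
    have "uniformly_continuous_on {-B..B} F2" by (rule compact_uniformly_continuous[OF F2_cont]) auto
    then obtain d where d: "0 < d" "\<And>a b. a \<in> {-B..B} \<Longrightarrow> b \<in> {-B..B} \<Longrightarrow> dist a b < d \<Longrightarrow> dist (F2 a) (F2 b) < \<theta>"
      using \<theta>(1) unfolding uniformly_continuous_on_def by (metis dist_commute)
    obtain N0 where N0: "\<And>m n z. m \<ge> N0 \<Longrightarrow> n \<ge> N0 \<Longrightarrow> z \<in> ST T \<Longrightarrow> norm (it m z - it n z) < min \<theta> d"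
      using cauchy0[of "min \<theta> d"] \<theta>(1) d(1) by (metis min_less_iff_conj)
    obtain N1 where N1: "\<And>m n z. m \<ge> N1 \<Longrightarrow> n \<ge> N1 \<Longrightarrow> z \<in> ST T \<Longrightarrow> norm (it1 m z - it1 n z) < \<theta>"
      using cauchy1[OF \<theta>(1)] by blast
    show "\<exists>N. \<forall>m\<ge>N. \<forall>n\<ge>N. \<forall>c\<ge>0. (\<forall>z\<in>ST T. norm (it2 m z - it2 n z) \<le> c * E z) \<longrightarrow>
        (\<forall>z\<in>ST T. norm (it2 (Suc m) z - it2 (Suc n) z) \<le> (c / 2 + \<eta>) * E z)"
    proof (intro exI[of _ "max N0 N1"] allI impI ballI)
      fix m n c z assume mn: "max N0 N1 \<le> m" "max N0 N1 \<le> n" and c: "0 \<le> c" and d2: "\<forall>z\<in>ST T. norm (it2 m z - it2 n z) \<le> c * E z" and z: "z \<in> ST T"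
      have s0: "norm (it m z - it n z) \<le> \<theta>" "norm (it m z - it n z) < d" if "z \<in> ST T" for z
        using N0[OF _ _ that, of m n] mn by auto
      have s1: "norm (it1 m z - it1 n z) \<le> \<theta>" if "z \<in> ST T" for z using N1[OF _ _ that, of m n] mn by auto
      have eq1: "it2 (Suc m) z - it2 (Suc n) z = duh2 (\<lambda>z. F (it m z) - F (it n z)) (\<lambda>z. cF1 (it m) (it1 m) z - cF1 (it n) (it1 n) z)
          (\<lambda>z. cF2 (it m) (it1 m) (it2 m) z - cF2 (it n) (it1 n) (it2 n) z) z"
        using duh_diff(2)[OF T l z h_cont(1) h_cont(1) h_cont(2) h_cont(2) h_cont(3) h_cont(3)] by simp
      have bd: "norm (duh2 (\<lambda>z. F (it m z) - F (it n z)) (\<lambda>z. cF1 (it m) (it1 m) z - cF1 (it n) (it1 n) z)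
          (\<lambda>z. cF2 (it m) (it1 m) (it2 m) z - cF2 (it n) (it1 n) (it2 n) z) z)
         \<le> 2 * (K * \<theta>) + 12 * T * (K * \<theta> + K * \<theta> * A1) + 9 * (K * c + \<theta> * P) * (T / l) * exp (l * fst z)"
      proof (rule duh2_bound[OF T l z])
        show "\<bar>F (it m z) - F (it n z)\<bar> \<le> K * \<theta>" if "z \<in> ST T" for z by (rule dh[OF that s0(1)[OF that]])
        show "norm (cF1 (it m) (it1 m) z - cF1 (it n) (it1 n) z) \<le> K * \<theta> + K * \<theta> * A1" if z: "z \<in> ST T" for z
          by (rule dh1[OF z s0(1)[OF z] s1[OF z]])
        show "norm (cF2 (it m) (it1 m) (it2 m) z - cF2 (it n) (it1 n) (it2 n) z) \<le> (K * c + \<theta> * P) * exp (l * fst z)" if z: "z \<in> ST T" for z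
        proof -
          \<comment> \<open>the difference of the second derivatives, telescoped factor by factor\<close>
          define um un vm vn wm wn where "um = it m z" and "un = it n z" and "vm = it1 m z" and "vn = it1 n z" and "wm = it2 m z" and "wn = it2 n z"
          note defs = um_def un_def vm_def vn_def wm_def wn_def
          have ub: "\<bar>um\<bar> \<le> B" "\<bar>un\<bar> \<le> B" using B[OF z] by (simp_all add: defs)
          have vb: "norm vm \<le> A1" "norm vn \<le> A1" "norm (vm - vn) \<le> \<theta>" using A1[OF z] s1[OF z] by (simp_all add: defs)
          have eq2: "cF2 (it m) (it1 m) (it2 m) z - cF2 (it n) (it1 n) (it2 n) z =
             (F1 um *\<^sub>R (wm - wn) + (F1 um - F1 un) *\<^sub>R wn) +
             (F2 um *\<^sub>R ((blinfun_scaleR_left (vm - vn) o\<^sub>L vm) + (blinfun_scaleR_left vn o\<^sub>L (vm - vn))) + (F2 um - F2 un) *\<^sub>R (blinfun_scaleR_left vn o\<^sub>L vn))"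
            unfolding cF2_def defs[symmetric]
            by (intro blinfun_eqI) (simp add: blinfun.add_left blinfun.diff_left blinfun.scaleR_left algebra_simps)
          have q1: "norm (F1 um *\<^sub>R (wm - wn)) \<le> K * (c * E z)"
            unfolding norm_scaleR real_norm_def by (rule mult_mono[OF KF1[OF ub(1)] _ K(1)]) (use d2 z in \<open>auto simp: defs\<close>)
          have q2: "norm ((F1 um - F1 un) *\<^sub>R wn) \<le> (K * \<theta>) * A2"
            unfolding norm_scaleR real_norm_def
          proof (rule mult_mono)
            show "\<bar>F1 um - F1 un\<bar> \<le> K * \<theta>"
              by (rule KL1d[OF ub]) (use s0(1)[OF z] in \<open>simp add: defs\<close>)
          qed (use K(1) \<theta> A2[OF z] in \<open>auto simp: defs\<close>)
          have q3: "norm (F2 um *\<^sub>R ((blinfun_scaleR_left (vm - vn) o\<^sub>L vm) + (blinfun_scaleR_left vn o\<^sub>L (vm - vn)))) \<le> K * (\<theta> * A1 + A1 * \<theta>)"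
            unfolding norm_scaleR real_norm_def
            by (intro mult_mono KF2[OF ub(1)] K(1) order_trans[OF norm_triangle_ineq] add_mono order_trans[OF sq] vb) (use \<theta> A10 in auto)
          have q4: "norm ((F2 um - F2 un) *\<^sub>R (blinfun_scaleR_left vn o\<^sub>L vn)) \<le> \<theta> * (A1 * A1)"
            unfolding norm_scaleR real_norm_def
          proof (rule mult_mono)
            have "dist (F2 um) (F2 un) < \<theta>" by (rule d(2)) (use ub s0(2)[OF z] in \<open>auto simp: defs dist_norm\<close>)
            then show "\<bar>F2 um - F2 un\<bar> \<le> \<theta>" by (simp add: dist_real_def)
            show "norm (blinfun_scaleR_left vn o\<^sub>L vn) \<le> A1 * A1" by (rule order_trans[OF sq mult_mono]) (use vb A10 in auto)
          qed (use \<theta> in auto)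
          have "norm (cF2 (it m) (it1 m) (it2 m) z - cF2 (it n) (it1 n) (it2 n) z) \<le> (K * (c * E z) + (K * \<theta>) * A2) + (K * (\<theta> * A1 + A1 * \<theta>) + \<theta> * (A1 * A1))"
            unfolding eq2 by (intro order_trans[OF norm_triangle_ineq] add_mono q1 q2 q3 q4)
          also have "\<dots> = K * (c * E z) + \<theta> * P * 1" by (simp add: P_def algebra_simps power2_eq_square)
          also have "\<dots> \<le> K * (c * E z) + \<theta> * P * E z"
            using E1(1)[OF z] \<theta> P by (intro add_left_mono mult_left_mono) auto
          finally show ?thesis by (simp add: E_def algebra_simps)
        qed
      qed (use K(1) c \<theta> P h_cont in \<open>auto intro!: continuous_intros\<close>)
      moreover have "9 * (K * c + \<theta> * P) * (T / l) * exp (l * fst z) = 9 * c * (K * (T / l)) * E z + 9 * (\<theta> * P) * (T / l) * E z"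
        unfolding E_def distrib_left distrib_right by (simp only: mult_ac)
      moreover have "2 * (K * \<theta>) + 12 * T * (K * \<theta> + K * \<theta> * A1) = \<theta> * (2 * K + 12 * T * (K + K * A1)) * 1"
        by (simp add: algebra_simps)
      ultimately have "norm (it2 (Suc m) z - it2 (Suc n) z) \<le> \<theta> * (2 * K + 12 * T * (K + K * A1)) * 1 + 9 * c * (K * (T / l)) * E z + 9 * (\<theta> * P) * (T / l) * E z"
        unfolding eq1 using bd by linarith
      also have "\<dots> \<le> \<theta> * (2 * K + 12 * T * (K + K * A1)) * E z + 9 * c * (1 / 18) * E z + 9 * (\<theta> * P) * T * E z"
        by (intro add_mono mult_left_mono mult_right_mono Tl Tl1 E1(1)[OF z]) (use c \<theta> P A10 K(1) T E0[of z] in auto)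
      also have "\<dots> = (c / 2 + \<theta> * (2 * K + 12 * T * (K + K * A1) + 9 * T * P)) * E z" by (simp add: algebra_simps)
      also have "\<dots> \<le> (c / 2 + \<eta>) * E z" by (intro mult_right_mono add_left_mono \<theta>(2)) (use E0[of z] in simp)
      finally show "norm (it2 (Suc m) z - it2 (Suc n) z) \<le> (c / 2 + \<eta>) * E z" .
    qed
  qed
  obtain u where u: "\<And>e. 0 < e \<Longrightarrow> \<exists>N. \<forall>n\<ge>N. \<forall>z\<in>ST T. norm (it n z - u z) < e"
    using uniformly_Cauchy_limit[where S="ST T" and g=it, OF cauchy0] by blast
  obtain u' where u': "\<And>e. 0 < e \<Longrightarrow> \<exists>N. \<forall>n\<ge>N. \<forall>z\<in>ST T. norm (it1 n z - u' z) < e"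
    using uniformly_Cauchy_limit[where S="ST T" and g=it1, OF cauchy1] by blast
  obtain u'' where u'': "\<And>e. 0 < e \<Longrightarrow> \<exists>N. \<forall>n\<ge>N. \<forall>z\<in>ST T. norm (it2 n z - u'' z) < e"
    using uniformly_Cauchy_limit[where S="ST T" and g=it2, OF cauchy2] by blast
  have lim: "(\<lambda>n. it n z) \<longlonglongrightarrow> u z" "(\<lambda>n. it1 n z) \<longlonglongrightarrow> u' z" if "z \<in> ST T" for z
    unfolding LIMSEQ_iff using u u' that by meson+
  have C2u: "C2_with (ST T) u u' u''"
    unfolding C2_with_def
  proof (intro conjI ballI)
    fix z assume z: "z \<in> ST T"
    have "\<exists>g. \<forall>x\<in>ST T. (\<lambda>n. it n x) \<longlonglongrightarrow> g x \<and> (g has_derivative blinfun_apply (u' x)) (at x within ST T)"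
    proof (rule has_derivative_sequence[where f=it and f'="\<lambda>n x. blinfun_apply (it1 n x)", OF convex_ST _ _ z00 lim(1)[OF z00]])
      show "(it n has_derivative blinfun_apply (it1 n x)) (at x within ST T)" if "x \<in> ST T" for n x
        by (rule C2_withD(1)[OF C2_with_it that])
      fix e :: real assume "0 < e"
      from u'[OF this] obtain N where N: "\<And>n z. n \<ge> N \<Longrightarrow> z \<in> ST T \<Longrightarrow> norm (it1 n z - u' z) < e" by blast
      show "\<forall>\<^sub>F n in sequentially. \<forall>x\<in>ST T. \<forall>h. norm (blinfun_apply (it1 n x) h - blinfun_apply (u' x) h) \<le> e * norm h"
        unfolding eventually_sequentially
      proof (intro exI[of _ N] allI impI ballI)
        fix n and x h :: "real \<times> (real ^ 3)" assume "N \<le> n" "x \<in> ST T"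
        then have "norm (it1 n x - u' x) * norm h \<le> e * norm h" by (intro mult_right_mono less_imp_le[OF N]) auto
        then show "norm (blinfun_apply (it1 n x) h - blinfun_apply (u' x) h) \<le> e * norm h"
          using order_trans[OF norm_blinfun[of "it1 n x - u' x" h]] by (simp add: blinfun.diff_left)
      qed
    qed
    then obtain g where g: "\<And>x. x \<in> ST T \<Longrightarrow> (\<lambda>n. it n x) \<longlonglongrightarrow> g x" "\<And>x. x \<in> ST T \<Longrightarrow> (g has_derivative blinfun_apply (u' x)) (at x within ST T)"
      by blast
    have "u x = g x" if "x \<in> ST T" for x using LIMSEQ_unique lim(1) g(1) that by blast
    then show "(u has_derivative blinfun_apply (u' z)) (at z within ST T)"
      using has_derivative_transform[OF z _ g(2)[OF z]] by blast
    have "\<exists>g. \<forall>x\<in>ST T. (\<lambda>n. it1 n x) \<longlonglongrightarrow> g x \<and> (g has_derivative blinfun_apply (u'' x)) (at x within ST T)"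
    proof (rule has_derivative_sequence[where f=it1 and f'="\<lambda>n x. blinfun_apply (it2 n x)", OF convex_ST _ _ z00 lim(2)[OF z00]])
      show "(it1 n has_derivative blinfun_apply (it2 n x)) (at x within ST T)" if "x \<in> ST T" for n x
        by (rule C2_withD(2)[OF C2_with_it that])
      fix e :: real assume "0 < e"
      from u''[OF this] obtain N where N: "\<And>n z. n \<ge> N \<Longrightarrow> z \<in> ST T \<Longrightarrow> norm (it2 n z - u'' z) < e" by blast
      show "\<forall>\<^sub>F n in sequentially. \<forall>x\<in>ST T. \<forall>h. norm (blinfun_apply (it2 n x) h - blinfun_apply (u'' x) h) \<le> e * norm h"
        unfolding eventually_sequentially
      proof (intro exI[of _ N] allI impI ballI)
        fix n and x h :: "real \<times> (real ^ 3)" assume "N \<le> n" "x \<in> ST T"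
        then have "norm (it2 n x - u'' x) * norm h \<le> e * norm h" by (intro mult_right_mono less_imp_le[OF N]) auto
        then show "norm (blinfun_apply (it2 n x) h - blinfun_apply (u'' x) h) \<le> e * norm h"
          using order_trans[OF norm_blinfun[of "it2 n x - u'' x" h]] by (simp add: blinfun.diff_left)
      qed
    qed
    then obtain g where g: "\<And>x. x \<in> ST T \<Longrightarrow> (\<lambda>n. it1 n x) \<longlonglongrightarrow> g x" "\<And>x. x \<in> ST T \<Longrightarrow> (g has_derivative blinfun_apply (u'' x)) (at x within ST T)"
      by blast
    have "u' x = g x" if "x \<in> ST T" for x using LIMSEQ_unique lim(2) g(1) that by blast
    then show "(u' has_derivative blinfun_apply (u'' z)) (at z within ST T)"
      using has_derivative_transform[OF z _ g(2)[OF z]] by blast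
  next
    show "continuous_on (ST T) u''"
    proof (rule uniform_limit_theorem[OF _ _ sequentially_bot])
      show "\<forall>\<^sub>F n in sequentially. continuous_on (ST T) (it2 n)" using it_cont(3) by simp
      show "uniform_limit (ST T) it2 u'' sequentially"
        unfolding uniform_limit_sequentially_iff dist_norm using u'' by meson
    qed
  qed
  have ub: "\<bar>u z\<bar> \<le> B" if "z \<in> ST T" for z
    by (rule LIMSEQ_le_const2[OF tendsto_rabs[OF lim(1)[OF that]]]) (use B[OF that] in auto)
  define v where "v z = free_wave f z + duhamel (\<lambda>z. F (u z)) z" for z
  have hu: "C2_with (ST T) (\<lambda>z. F (u z)) (cF1 u u') (cF2 u u' u'')" by (rule C2_with_nonlinear[OF C2u])
  have uv: "v z = u z" if z: "z \<in> ST T" for z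
  proof -
    have "(\<lambda>n. it (Suc n) z) \<longlonglongrightarrow> v z"
    proof (rule LIMSEQ_I)
      fix r :: real assume r: "0 < r"
      define e where "e = r / ((K + 1) * (T * exp T + 1))"
      have pos: "0 < (K + 1) * (T * exp T + 1)" using K(1) T by (intro mult_pos_pos add_nonneg_pos) auto
      have e: "0 < e" using r pos by (simp add: e_def)
      have er: "(K * e) * (T / 1) * exp (1 * T) < r"
      proof -
        have "(K * e) * (T / 1) * exp (1 * T) = e * (K * (T * exp T))" by simp
        also have "\<dots> < e * ((K + 1) * (T * exp T + 1))" using e K(1) T by (intro mult_strict_left_mono) (auto simp: algebra_simps add_pos_nonneg)
        also have "\<dots> = r" unfolding e_def by (rule nonzero_eq_divide_eq[THEN iffD1]) (use pos in auto)
        finally show ?thesis .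
      qed
      obtain N where N: "\<And>n z. n \<ge> N \<Longrightarrow> z \<in> ST T \<Longrightarrow> norm (it n z - u z) < e" using u[OF e] by blast
      show "\<exists>N. \<forall>n\<ge>N. norm (it (Suc n) z - v z) < r"
      proof (intro exI[of _ N] allI impI)
        fix n assume n: "N \<le> n"
        have "\<bar>duhamel (\<lambda>z. F (it n z) - F (u z)) z\<bar> \<le> (K * e) * (T / 1) * exp (1 * fst z)"
        proof (rule duhamel_weighted_bound[OF _ z])
          fix y assume "y \<in> cone_box"
          then have y: "\<Lambda>3 y z \<in> ST T" using \<Lambda>3_ST z by blast
          have "0 \<le> fst (\<Lambda>3 y z)" using y by (cases "\<Lambda>3 y z") simp
          then have 1: "1 \<le> exp (1 * fst (\<Lambda>3 y z))" by simp
          have "\<bar>F (it n (\<Lambda>3 y z)) - F (u (\<Lambda>3 y z))\<bar> \<le> K * e * 1"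
            using KLd[OF B[OF y] ub[OF y] less_imp_le[OF N[OF n y, unfolded real_norm_def]]] by simp
          also have "\<dots> \<le> K * e * exp (1 * fst (\<Lambda>3 y z))" using 1 K(1) e by (intro mult_left_mono) auto
          finally show "\<bar>F (it n (\<Lambda>3 y z)) - F (u (\<Lambda>3 y z))\<bar> \<le> K * e * exp (1 * fst (\<Lambda>3 y z))" .
        qed (use K(1) e h_cont C2_withD(3)[OF hu] in \<open>auto intro!: continuous_intros\<close>)
        also have "\<dots> \<le> (K * e) * (T / 1) * exp (1 * T)"
          using K(1) e T z by (intro mult_left_mono) (cases z, auto)
        finally have "\<bar>duhamel (\<lambda>z. F (it n z) - F (u z)) z\<bar> < r" using er by linarith
        moreover have "it (Suc n) z - v z = duhamel (\<lambda>z. F (it n z) - F (u z)) z"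
          using duhamel_diff[OF h_cont(1) C2_withD(3)[OF hu] z] by (simp add: v_def)
        ultimately show "norm (it (Suc n) z - v z) < r" by simp
      qed
    qed
    then show ?thesis using LIMSEQ_unique LIMSEQ_Suc[OF lim(1)[OF z]] by blast
  qed
  have "wave_sol T (\<lambda>z. F (u z)) f v"
    unfolding v_def by (rule wave_sol_representation[OF T f hu])
  then have "wave_sol T (\<lambda>z. F (v z)) f v" using uv unfolding wave_sol_def by auto
  moreover have "\<forall>z\<in>ST T. (\<lambda>n. it n z) \<longlonglongrightarrow> v z" using lim(1) uv by simp
  ultimately show ?thesis by blast
qed

end

section \<open>Radial waves in characteristic coordinates\<close>

text \<open>
  Representative direction: a radial function is determined by its values on this axis.
\<close>
definition e3 :: "real ^ 3" where "e3 = axis 3 1"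

lemma norm_e3 [simp]: "norm e3 = 1" by (simp add: e3_def norm_axis_1)

lemma radialD: "radial f \<Longrightarrow> f x = f (norm x *\<^sub>R e3)"
  unfolding radial_def by (metis norm_e3 norm_scaleR abs_norm_cancel mult.right_neutral)

lemma norm_e3_unit_dir:
  "norm (r *\<^sub>R e3 + \<tau> *\<^sub>R unit_dir y) = sqrt (r\<^sup>2 + \<tau>\<^sup>2 + 2 * r * \<tau> * cos (fst y))"
proof -
  have "e3 \<bullet> unit_dir y = cos (fst y)" by (simp add: e3_def inner_axis')
  moreover have "e3 \<bullet> e3 = 1" "unit_dir y \<bullet> unit_dir y = 1" unfolding norm_eq_1[symmetric] by simp_all
  ultimately have "(norm (r *\<^sub>R e3 + \<tau> *\<^sub>R unit_dir y))\<^sup>2 = r\<^sup>2 + \<tau>\<^sup>2 + 2 * r * \<tau> * cos (fst y)"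
    unfolding power2_norm_eq_inner
    by (simp add: inner_add_left inner_add_right inner_commute[of "unit_dir y" e3] power2_eq_square algebra_simps)
  then show ?thesis by (metis norm_ge_zero real_sqrt_unique)
qed

text \<open>
  Spherical means of radial functions are one-dimensional integrals, because in dimension three the
  surface element is proportional to $k\, dk$ when points are labelled by their distance $k$ from the
  origin.
\<close>
lemma sphere_mean_radial:
  fixes H :: "real \<Rightarrow> real"
  assumes r: "0 < r" and \<tau>: "0 < \<tau>" and H: "continuous_on {0..} H"
  shows "\<tau> * sphere_mean (\<lambda>w. H (norm (r *\<^sub>R e3 + \<tau> *\<^sub>R w))) = integral {\<bar>r - \<tau>\<bar>..r + \<tau>} (\<lambda>k. k * H k / (2 * r))"
proof -
  define q where "q \<theta> = sqrt (r\<^sup>2 + \<tau>\<^sup>2 + 2 * r * \<tau> * cos \<theta>)" for \<theta>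
  define q' where "q' \<theta> = - (r * \<tau> * sin \<theta>) / q \<theta>" for \<theta>
  have rad: "r\<^sup>2 + \<tau>\<^sup>2 + 2 * r * \<tau> * cos \<theta> = (r - \<tau>)\<^sup>2 + 2 * r * \<tau> * (1 + cos \<theta>)" for \<theta>
    by (simp add: power2_eq_square algebra_simps)
  have nn: "0 \<le> 2 * r * \<tau> * (1 + cos \<theta>)" for \<theta>
    using r \<tau> by (intro mult_nonneg_nonneg) (use cos_ge_minus_one[of \<theta>] in linarith)+
  have qge: "\<bar>r - \<tau>\<bar> \<le> q \<theta>" for \<theta>
    unfolding q_def rad using nn[of \<theta>] by (metis add_increasing2 dual_order.refl real_sqrt_abs real_sqrt_le_iff)
  have qle: "q \<theta> \<le> r + \<tau>" for \<theta>
  proof -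
    have "r\<^sup>2 + \<tau>\<^sup>2 + 2 * r * \<tau> * cos \<theta> \<le> (r + \<tau>)\<^sup>2"
      using mult_left_mono[OF cos_le_one, of "2 * r * \<tau>" \<theta>] r \<tau> by (simp add: power2_eq_square algebra_simps)
    then show ?thesis unfolding q_def using r \<tau> by (intro real_le_lsqrt) (auto simp: rad nn)
  qed
  have q0: "0 \<le> q \<theta>" for \<theta> using qge[of \<theta>] by linarith
  have qends: "q 0 = r + \<tau>" "q pi = \<bar>r - \<tau>\<bar>"
  proof -
    have "r\<^sup>2 + \<tau>\<^sup>2 + 2 * r * \<tau> * 1 = (r + \<tau>)\<^sup>2" by (simp add: power2_eq_square algebra_simps)
    then show "q 0 = r + \<tau>" using r \<tau> by (simp add: q_def)
    show "q pi = \<bar>r - \<tau>\<bar>" unfolding q_def rad by simp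
  qed
  have cq: "continuous_on S q" for S unfolding q_def by (intro continuous_intros)
  have cHq: "continuous_on S (\<lambda>\<theta>. H (q \<theta>))" for S
    by (rule continuous_on_compose2[OF H cq]) (use q0 in auto)
  have "sphere_mean (\<lambda>w. H (norm (r *\<^sub>R e3 + \<tau> *\<^sub>R w))) = integral sphere_box (\<lambda>y. sin (fst y) / (4 * pi) * H (q (fst y)))"
    unfolding sphere_mean_def norm_e3_unit_dir q_def by simp
  also have "\<dots> = integral (cbox 0 pi) (\<lambda>\<theta>. integral (cbox 0 (2 * pi)) (\<lambda>ph. sin \<theta> / (4 * pi) * H (q \<theta>)))"
  proof (subst integral_prod_continuous)
    show "continuous_on sphere_box (\<lambda>y. sin (fst y) / (4 * pi) * H (q (fst y)))"
      by (intro continuous_intros continuous_on_compose2[OF cHq[of UNIV]]) auto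
  qed simp
  also have "\<dots> = integral {0..pi} (\<lambda>\<theta>. sin \<theta> * H (q \<theta>) / 2)"
    unfolding cbox_interval by (rule integral_cong) simp
  finally have m: "sphere_mean (\<lambda>w. H (norm (r *\<^sub>R e3 + \<tau> *\<^sub>R w))) = integral {0..pi} (\<lambda>\<theta>. sin \<theta> * H (q \<theta>) / 2)" .
  let ?f = "\<lambda>k. k * H k"
  have "((\<lambda>\<theta>. q' \<theta> *\<^sub>R ?f (q \<theta>)) has_integral (integral {q 0..q pi} ?f - integral {q pi..q 0} ?f)) {0..pi}"
  proof (rule has_integral_substitution_general[where s="{0, pi}" and c="\<bar>r - \<tau>\<bar>" and d="r + \<tau>"])
    show "continuous_on {\<bar>r - \<tau>\<bar>..r + \<tau>} ?f" by (intro continuous_intros continuous_on_subset[OF H]) auto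
    fix \<theta> assume "\<theta> \<in> {0..pi} - {0, pi}"
    then have "cos pi < cos \<theta>" by (intro cos_monotone_0_pi) auto
    then have "0 < 2 * r * \<tau> * (1 + cos \<theta>)" using r \<tau> by (intro mult_pos_pos) auto
    then have pos: "0 < r\<^sup>2 + \<tau>\<^sup>2 + 2 * r * \<tau> * cos \<theta>" unfolding rad by (simp add: add_nonneg_pos)
    show "(q has_real_derivative q' \<theta>) (at \<theta> within {0..pi})"
      unfolding q_def[abs_def] q'_def using pos
      by (auto intro!: derivative_eq_intros simp: field_simps)
  qed (use qge qle cq in auto)
  moreover have "q' \<theta> *\<^sub>R ?f (q \<theta>) = - (r * \<tau> * (sin \<theta> * H (q \<theta>)))" if "\<theta> \<in> {0..pi}" for \<theta>
  proof (cases "q \<theta> = 0")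
    case True
    then have "(r - \<tau>)\<^sup>2 + 2 * r * \<tau> * (1 + cos \<theta>) = 0" unfolding q_def rad by simp
    then have "2 * r * \<tau> * (1 + cos \<theta>) = 0" using nn[of \<theta>] by (smt (verit) zero_le_power2)
    then have "cos \<theta> = - 1" using r \<tau> by simp
    then have "sin \<theta> = 0" using sin_cos_squared_add[of \<theta>] by simp
    then show ?thesis using True by simp
  next
    case False
    then show ?thesis by (simp add: q'_def)
  qed
  ultimately have "((\<lambda>\<theta>. - (r * \<tau> * (sin \<theta> * H (q \<theta>)))) has_integral (integral {q 0..q pi} ?f - integral {q pi..q 0} ?f)) {0..pi}"
    by (rule has_integral_eq[rotated])
  moreover have "{q 0..q pi} = {}" using r \<tau> by (auto simp: qends)
  ultimately have "((\<lambda>\<theta>. - (r * \<tau> * (sin \<theta> * H (q \<theta>)))) has_integral - integral {\<bar>r - \<tau>\<bar>..r + \<tau>} ?f) {0..pi}"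
    by (simp add: qends)
  from has_integral_neg[OF this]
  have "((\<lambda>\<theta>. r * \<tau> * (sin \<theta> * H (q \<theta>))) has_integral integral {\<bar>r - \<tau>\<bar>..r + \<tau>} ?f) {0..pi}"
    by simp
  from integral_unique[OF this]
  have "r * \<tau> * integral {0..pi} (\<lambda>\<theta>. sin \<theta> * H (q \<theta>)) = integral {\<bar>r - \<tau>\<bar>..r + \<tau>} ?f"
    unfolding integral_mult_right .
  then have "\<tau> * (integral {0..pi} (\<lambda>\<theta>. sin \<theta> * H (q \<theta>)) / 2) = integral {\<bar>r - \<tau>\<bar>..r + \<tau>} ?f / (2 * r)"
    using r by (simp add: field_simps)
  then show ?thesis unfolding m by simp
qed

text \<open>
  The coordinate change $\alpha = s + k$, $\beta = s - k$ with Jacobian $1/2$, split into two one-dimensional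
  affine substitutions and Tonelli's theorem.
\<close>
lemma nn_integral_characteristic:
  fixes \<Psi> :: "real \<times> real \<Rightarrow> ennreal"
  assumes [measurable]: "\<Psi> \<in> borel_measurable borel"
  shows "(\<integral>\<^sup>+ s. (\<integral>\<^sup>+ k. \<Psi> (s, k) \<partial>lborel) \<partial>lborel) = (\<integral>\<^sup>+ \<alpha>. (\<integral>\<^sup>+ \<beta>. ennreal (1/2) * \<Psi> ((\<alpha> + \<beta>) / 2, (\<alpha> - \<beta>) / 2) \<partial>lborel) \<partial>lborel)"
proof -
  have [measurable]: "\<Psi> \<in> borel_measurable (borel \<Otimes>\<^sub>M borel)" using assms by (simp add: borel_prod)
  have "(\<integral>\<^sup>+ s. (\<integral>\<^sup>+ k. \<Psi> (s, k) \<partial>lborel) \<partial>lborel) = (\<integral>\<^sup>+ s. (\<integral>\<^sup>+ \<alpha>. \<Psi> (s, \<alpha> - s) \<partial>lborel) \<partial>lborel)"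
  proof (rule nn_integral_cong)
    fix s :: real
    show "(\<integral>\<^sup>+ k. \<Psi> (s, k) \<partial>lborel) = (\<integral>\<^sup>+ \<alpha>. \<Psi> (s, \<alpha> - s) \<partial>lborel)"
      by (subst nn_integral_real_affine[of _ 1 "- s"]) auto
  qed
  also have "\<dots> = (\<integral>\<^sup>+ \<alpha>. (\<integral>\<^sup>+ s. \<Psi> (s, \<alpha> - s) \<partial>lborel) \<partial>lborel)"
    by (rule lborel_pair.Fubini') measurable
  also have "\<dots> = (\<integral>\<^sup>+ \<alpha>. (\<integral>\<^sup>+ \<beta>. ennreal (1/2) * \<Psi> ((\<alpha> + \<beta>) / 2, (\<alpha> - \<beta>) / 2) \<partial>lborel) \<partial>lborel)"
  proof (rule nn_integral_cong)
    fix \<alpha> :: real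
    have "(\<integral>\<^sup>+ s. \<Psi> (s, \<alpha> - s) \<partial>lborel) = ennreal \<bar>1/2\<bar> * (\<integral>\<^sup>+ \<beta>. \<Psi> (\<alpha> / 2 + 1 / 2 * \<beta>, \<alpha> - (\<alpha> / 2 + 1 / 2 * \<beta>)) \<partial>lborel)"
      by (rule nn_integral_real_affine) auto
    also have "\<dots> = (\<integral>\<^sup>+ \<beta>. ennreal (1/2) * \<Psi> (\<alpha> / 2 + 1 / 2 * \<beta>, \<alpha> - (\<alpha> / 2 + 1 / 2 * \<beta>)) \<partial>lborel)"
      by (subst nn_integral_cmult) auto
    also have "\<dots> = (\<integral>\<^sup>+ \<beta>. ennreal (1/2) * \<Psi> ((\<alpha> + \<beta>) / 2, (\<alpha> - \<beta>) / 2) \<partial>lborel)"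
      by (rule nn_integral_cong) (simp add: field_simps)
    finally show "(\<integral>\<^sup>+ s. \<Psi> (s, \<alpha> - s) \<partial>lborel) = (\<integral>\<^sup>+ \<beta>. ennreal (1/2) * \<Psi> ((\<alpha> + \<beta>) / 2, (\<alpha> - \<beta>) / 2) \<partial>lborel)" .
  qed
  finally show ?thesis .
qed

text \<open>
  The region of points $(s, l)$ on spheres of the backward light cone of $(t, r)$, in
  coordinates $\alpha = s + l$, $\beta = s - l$. The condition $-\alpha \le \beta$ is $s \ge 0$, and $l \ge 0$
  follows from the others.
\<close>
definition char_set :: "real \<Rightarrow> real \<Rightarrow> (real \<times> real) set" where
  "char_set t r = {(\<alpha>, \<beta>). t - r \<le> \<alpha> \<and> \<alpha> \<le> t + r \<and> - \<alpha> \<le> \<beta> \<and> \<beta> \<le> t - r}"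

text \<open>
  Integrals of non-negative functions are used so that the order of integration and the coordinates can be
  changed without integrability conditions.
\<close>
lemma duhamel_characteristic:
  assumes g: "continuous_on (ST T) g" and g0: "\<And>z. z \<in> ST T \<Longrightarrow> 0 \<le> g z"
    and rad: "\<And>s. s \<in> {0..T} \<Longrightarrow> radial (\<lambda>x. g (s, x))" and t: "t \<in> {0..T}" and r: "0 < r"
  shows "ennreal (duhamel g (t, r *\<^sub>R e3)) =
     (\<integral>\<^sup>+ \<alpha>. (\<integral>\<^sup>+ \<beta>. indicator (char_set t r) (\<alpha>, \<beta>) * ennreal ((\<alpha> - \<beta>) / 2 * g ((\<alpha> + \<beta>) / 2, ((\<alpha> - \<beta>) / 2) *\<^sub>R e3) / (4 * r)) \<partial>lborel) \<partial>lborel)"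
proof -
  define \<Psi> where "\<Psi> p = ennreal (indicator ({0..t} \<times> {0..}) p *\<^sub>R (snd p * g (fst p, snd p *\<^sub>R e3) / (2 * r)))
      * indicator {p. \<bar>r - (t - fst p)\<bar> \<le> snd p \<and> snd p \<le> r + (t - fst p)} p" for p :: "real \<times> real"
  have tT: "0 \<le> t" "t \<le> T" using t by auto
  have [measurable]: "\<Psi> \<in> borel_measurable borel"
  proof -
    have "continuous_on ({0..t} \<times> {0..}) (\<lambda>p. snd p * g (fst p, snd p *\<^sub>R e3) / (2 * r))"
      by (intro continuous_intros continuous_on_compose2[OF g]) (use r tT in auto)
    then have 1 [measurable]: "(\<lambda>p. indicator ({0..t} \<times> {0..}) p *\<^sub>R (snd p * g (fst p, snd p *\<^sub>R e3) / (2 * r))) \<in> borel_measurable borel"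
      by (rule borel_measurable_continuous_on_indicator[rotated]) (intro borel_closed closed_Times; simp)
    have "closed {p :: real \<times> real. \<bar>r - (t - fst p)\<bar> \<le> snd p \<and> snd p \<le> r + (t - fst p)}"
      by (intro closed_Collect_conj closed_Collect_le continuous_intros)
    then have 2 [measurable]: "{p :: real \<times> real. \<bar>r - (t - fst p)\<bar> \<le> snd p \<and> snd p \<le> r + (t - fst p)} \<in> sets borel" by (rule borel_closed)
    show ?thesis unfolding \<Psi>_def[abs_def] by measurable
  qed
  define k where "k s = (t - s) * sphere_mean (\<lambda>w. g (s, r *\<^sub>R e3 + (t - s) *\<^sub>R w))" for s
  have ck: "continuous_on {0..t} k"
    unfolding k_def
  proof (intro continuous_intros sphere_mean_param_cont continuous_on_compose2[OF g])
    show "(\<lambda>q. (fst q, r *\<^sub>R e3 + (t - fst q) *\<^sub>R snd q)) ` ({0..t} \<times> sphere 0 1) \<subseteq> ST T" using tT by auto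
  qed
  have inner: "indicator {0..t} s * ennreal (k s) = (\<integral>\<^sup>+ l. \<Psi> (s, l) \<partial>lborel)" if "s \<noteq> t" for s
  proof (cases "s \<in> {0..t}")
    case False
    then have "\<Psi> (s, l) = 0" for l by (auto simp: \<Psi>_def indicator_def)
    then show ?thesis using False by simp
  next
    case True
    with that have s: "0 \<le> s" "s < t" by auto
    define H where "H l = g (s, l *\<^sub>R e3)" for l
    have cH: "continuous_on S H" for S unfolding H_def
      by (intro continuous_on_compose2[OF g] continuous_intros) (use s tT in auto)
    have gH: "g (s, x) = H (norm x)" for x unfolding H_def
      using radialD[OF rad[of s], of x] s tT by simp
    have k: "k s = integral {\<bar>r - (t - s)\<bar>..r + (t - s)} (\<lambda>l. l * H l / (2 * r))"
      unfolding k_def gH by (rule sphere_mean_radial[OF r _ cH]) (use s in simp)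
    have "((\<lambda>l. l * H l / (2 * r)) has_integral k s) {\<bar>r - (t - s)\<bar>..r + (t - s)}"
      unfolding k by (intro integrable_integral integrable_continuous_real continuous_intros cH) (use r in auto)
    moreover have "0 \<le> l * H l / (2 * r)" if "l \<in> {\<bar>r - (t - s)\<bar>..r + (t - s)}" for l
    proof -
      have "0 \<le> l" using that by auto
      moreover have "0 \<le> H l" unfolding H_def by (rule g0) (use s tT in auto)
      ultimately show ?thesis using r by simp
    qed
    ultimately have "ennreal (k s) = (\<integral>\<^sup>+ l. indicator {\<bar>r - (t - s)\<bar>..r + (t - s)} l * ennreal (l * H l / (2 * r)) \<partial>lborel)"
      by (subst nn_integral_has_integral_lebesgue[symmetric, of "{\<bar>r - (t - s)\<bar>..r + (t - s)}" "\<lambda>l. l * H l / (2 * r)"])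
        (auto simp: indicator_def intro!: nn_integral_cong)
    also have "\<dots> = (\<integral>\<^sup>+ l. \<Psi> (s, l) \<partial>lborel)"
      by (rule nn_integral_cong) (use s in \<open>auto simp: \<Psi>_def H_def indicator_def\<close>)
    finally show ?thesis using True by simp
  qed
  have k0: "0 \<le> k s" if "s \<in> {0..t}" for s
  proof -
    have "sphere_mean (\<lambda>w. 0) \<le> sphere_mean (\<lambda>w. g (s, r *\<^sub>R e3 + (t - s) *\<^sub>R w))"
      by (rule sphere_mean_mono) (use that tT g0 in \<open>auto intro!: continuous_intros continuous_on_compose2[OF g]\<close>)
    then show ?thesis using that by (simp add: k_def)
  qed
  have "ennreal (duhamel g (t, r *\<^sub>R e3)) = (\<integral>\<^sup>+ s. indicator {0..t} s * ennreal (k s) \<partial>lborel)"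
  proof -
    have "(k has_integral duhamel g (t, r *\<^sub>R e3)) {0..t}"
      unfolding duhamel_def fst_conv snd_conv k_def[symmetric]
      using integrable_integral[OF integrable_continuous_real[OF ck]] by simp
    from nn_integral_has_integral_lebesgue[OF k0 this] show ?thesis
      by (simp add: ennreal_mult'' k0 ennreal_indicator[symmetric] mult.commute)
  qed
  also have "\<dots> = (\<integral>\<^sup>+ s. (\<integral>\<^sup>+ l. \<Psi> (s, l) \<partial>lborel) \<partial>lborel)"
  proof (rule nn_integral_cong_AE)
    have "AE s in lborel. s \<noteq> t" by (rule AE_lborel_singleton)
    then show "AE s in lborel. indicator {0..t} s * ennreal (k s) = (\<integral>\<^sup>+ l. \<Psi> (s, l) \<partial>lborel)"
      by eventually_elim (rule inner)
  qed
  also have "\<dots> = (\<integral>\<^sup>+ \<alpha>. (\<integral>\<^sup>+ \<beta>. ennreal (1/2) * \<Psi> ((\<alpha> + \<beta>) / 2, (\<alpha> - \<beta>) / 2) \<partial>lborel) \<partial>lborel)"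
    by (rule nn_integral_characteristic) measurable
  also have "\<dots> = (\<integral>\<^sup>+ \<alpha>. (\<integral>\<^sup>+ \<beta>. indicator (char_set t r) (\<alpha>, \<beta>) * ennreal ((\<alpha> - \<beta>) / 2 * g ((\<alpha> + \<beta>) / 2, ((\<alpha> - \<beta>) / 2) *\<^sub>R e3) / (4 * r)) \<partial>lborel) \<partial>lborel)"
  proof (intro nn_integral_cong)
    fix \<alpha> \<beta> :: real
    define s l where "s = (\<alpha> + \<beta>) / 2" and "l = (\<alpha> - \<beta>) / 2"
    have ab: "\<alpha> = s + l" "\<beta> = s - l" by (simp_all add: s_def l_def field_simps)
    have iff: "(\<alpha>, \<beta>) \<in> char_set t r \<longleftrightarrow> s \<in> {0..t} \<and> 0 \<le> l \<and> \<bar>r - (t - s)\<bar> \<le> l \<and> l \<le> r + (t - s)"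
      unfolding char_set_def ab using r by auto
    show "ennreal (1/2) * \<Psi> ((\<alpha> + \<beta>) / 2, (\<alpha> - \<beta>) / 2) = indicator (char_set t r) (\<alpha>, \<beta>) * ennreal ((\<alpha> - \<beta>) / 2 * g ((\<alpha> + \<beta>) / 2, ((\<alpha> - \<beta>) / 2) *\<^sub>R e3) / (4 * r))"
      unfolding s_def[symmetric] l_def[symmetric]
    proof (cases "(\<alpha>, \<beta>) \<in> char_set t r")
      case True
      then have "0 \<le> l" "0 \<le> g (s, l *\<^sub>R e3)" using iff g0[of "(s, l *\<^sub>R e3)"] tT by auto
      then have "ennreal (1/2) * ennreal (l * g (s, l *\<^sub>R e3) / (2 * r)) = ennreal (l * g (s, l *\<^sub>R e3) / (4 * r))"
        using r by (subst ennreal_mult[symmetric]) auto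
      then show "ennreal (1/2) * \<Psi> (s, l) = indicator (char_set t r) (\<alpha>, \<beta>) * ennreal (l * g (s, l *\<^sub>R e3) / (4 * r))"
        using True iff by (simp add: \<Psi>_def)
    next
      case False
      then have "\<Psi> (s, l) = 0" using iff by (auto simp: \<Psi>_def indicator_def)
      then show "ennreal (1/2) * \<Psi> (s, l) = indicator (char_set t r) (\<alpha>, \<beta>) * ennreal (l * g (s, l *\<^sub>R e3) / (4 * r))"
        using False by simp
    qed
  qed
  finally show ?thesis .
qed

text \<open>
  The form in which the barrier argument uses characteristic coordinates: a majorant that is a product of
  functions of $\alpha$ and $\beta$.
\<close>
lemma duhamel_upper:
  fixes a b :: "real \<Rightarrow> real"
  assumes g: "continuous_on (ST T) g" and g0: "\<And>z. z \<in> ST T \<Longrightarrow> 0 \<le> g z"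
    and rad: "\<And>s. s \<in> {0..T} \<Longrightarrow> radial (\<lambda>x. g (s, x))" and t: "t \<in> {0..T}" and r: "0 < r"
    and le: "\<And>s l. 0 \<le> s \<Longrightarrow> s \<le> t \<Longrightarrow> 0 \<le> l \<Longrightarrow> \<bar>t - r\<bar> \<le> s + l \<Longrightarrow> s + l \<le> t + r \<Longrightarrow> s - l \<le> t - r \<Longrightarrow> l * g (s, l *\<^sub>R e3) \<le> a (s + l) * b (s - l)"
    and a: "\<And>x. \<bar>t - r\<bar> \<le> x \<Longrightarrow> x \<le> t + r \<Longrightarrow> 0 \<le> a x" "(a has_integral A) {\<bar>t - r\<bar>..t + r}"
    and b: "\<And>x. 0 \<le> b x" "(\<integral>\<^sup>+ x. ennreal (b x) * indicator {..t - r} x \<partial>lborel) \<le> ennreal Bd" "b \<in> borel_measurable borel" "0 \<le> Bd"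
  shows "duhamel g (t, r *\<^sub>R e3) \<le> A * Bd / (4 * r)"
proof -
  let ?I = "{\<bar>t - r\<bar>..t + r}"
  have A0: "0 \<le> A" using has_integral_nonneg[OF a(2)] a(1) by auto
  have nA: "(\<integral>\<^sup>+ x. ennreal (indicator ?I x * a x) \<partial>lborel) = ennreal A"
    using nn_integral_has_integral_lebesgue[OF _ a(2)] a(1) by auto
  have "ennreal (duhamel g (t, r *\<^sub>R e3)) \<le>
     (\<integral>\<^sup>+ \<alpha>. (\<integral>\<^sup>+ \<beta>. ennreal (indicator ?I \<alpha> * a \<alpha>) * (ennreal (b \<beta> / (4 * r)) * indicator {..t - r} \<beta>) \<partial>lborel) \<partial>lborel)"
  proof (subst duhamel_characteristic[where T=T and g=g and t=t and r=r, OF g g0 rad t r], assumption, assumption, intro nn_integral_mono)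
    fix \<alpha> \<beta> :: real
    define s l where "s = (\<alpha> + \<beta>) / 2" and "l = (\<alpha> - \<beta>) / 2"
    have ab: "\<alpha> = s + l" "\<beta> = s - l" by (simp_all add: s_def l_def field_simps)
    show "indicator (char_set t r) (\<alpha>, \<beta>) * ennreal ((\<alpha> - \<beta>) / 2 * g ((\<alpha> + \<beta>) / 2, ((\<alpha> - \<beta>) / 2) *\<^sub>R e3) / (4 * r))
       \<le> ennreal (indicator ?I \<alpha> * a \<alpha>) * (ennreal (b \<beta> / (4 * r)) * indicator {..t - r} \<beta>)"
    proof (cases "(\<alpha>, \<beta>) \<in> char_set t r")
      case True
      then have c: "0 \<le> s" "s \<le> t" "0 \<le> l" "\<bar>t - r\<bar> \<le> s + l" "s + l \<le> t + r" "s - l \<le> t - r"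
        unfolding char_set_def ab using r by auto
      have "l * g (s, l *\<^sub>R e3) / (4 * r) \<le> a (s + l) * b (s - l) / (4 * r)"
        using le[OF c] r by (intro divide_right_mono) auto
      then have "ennreal (l * g (s, l *\<^sub>R e3) / (4 * r)) \<le> ennreal (a (s + l)) * ennreal (b (s - l) / (4 * r))"
        using a(1)[OF c(4,5)] b(1)[of "s - l"] r by (subst ennreal_mult[symmetric]) (auto intro!: ennreal_leI)
      then show ?thesis using True c unfolding s_def[symmetric] l_def[symmetric] by (simp add: ab)
    qed simp
  qed
  also have "\<dots> = (\<integral>\<^sup>+ \<alpha>. ennreal (indicator ?I \<alpha> * a \<alpha>) * (\<integral>\<^sup>+ \<beta>. ennreal (b \<beta> / (4 * r)) * indicator {..t - r} \<beta> \<partial>lborel) \<partial>lborel)"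
    by (rule nn_integral_cong, subst nn_integral_cmult) (use b(3) in measurable)
  also have "\<dots> \<le> (\<integral>\<^sup>+ \<alpha>. ennreal (indicator ?I \<alpha> * a \<alpha>) * ennreal (Bd / (4 * r)) \<partial>lborel)"
  proof (intro nn_integral_mono mult_left_mono)
    have "(\<integral>\<^sup>+ \<beta>. ennreal (b \<beta> / (4 * r)) * indicator {..t - r} \<beta> \<partial>lborel) = (\<integral>\<^sup>+ \<beta>. ennreal (1 / (4 * r)) * (ennreal (b \<beta>) * indicator {..t - r} \<beta>) \<partial>lborel)"
      using r b(1) by (intro nn_integral_cong) (simp add: ennreal_mult'[symmetric] mult.assoc[symmetric])
    also have "\<dots> = ennreal (1 / (4 * r)) * (\<integral>\<^sup>+ \<beta>. ennreal (b \<beta>) * indicator {..t - r} \<beta> \<partial>lborel)"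
      by (rule nn_integral_cmult) (use b(3) in measurable)
    also have "\<dots> \<le> ennreal (1 / (4 * r)) * ennreal Bd" by (rule mult_left_mono[OF b(2)]) simp
    also have "\<dots> = ennreal (Bd / (4 * r))" using r b(4) by (simp add: ennreal_mult'[symmetric])
    finally show "(\<integral>\<^sup>+ \<beta>. ennreal (b \<beta> / (4 * r)) * indicator {..t - r} \<beta> \<partial>lborel) \<le> ennreal (Bd / (4 * r))" .
  qed simp
  also have "\<dots> = ennreal (Bd / (4 * r)) * (\<integral>\<^sup>+ \<alpha>. ennreal (indicator ?I \<alpha> * a \<alpha>) \<partial>lborel)"
  proof -
    have "(\<lambda>\<alpha>. indicator ?I \<alpha> * a \<alpha>) \<in> borel_measurable lebesgue"
      using has_integral_implies_lebesgue_measurable[OF a(2)] by simp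
    then have m: "(\<lambda>\<alpha>. ennreal (indicator ?I \<alpha> * a \<alpha>)) \<in> borel_measurable lebesgue" by measurable
    have "(\<integral>\<^sup>+ \<alpha>. ennreal (indicator ?I \<alpha> * a \<alpha>) * ennreal (Bd / (4 * r)) \<partial>lebesgue) = (\<integral>\<^sup>+ \<alpha>. ennreal (indicator ?I \<alpha> * a \<alpha>) \<partial>lebesgue) * ennreal (Bd / (4 * r))"
      by (rule nn_integral_multc[OF m])
    then show ?thesis by (simp add: nn_integral_completion mult.commute)
  qed
  also have "\<dots> = ennreal (A * Bd / (4 * r))"
    unfolding nA using A0 b(4) r by (simp add: ennreal_mult[symmetric] mult.commute)
  finally show ?thesis using A0 b(4) r by (subst (asm) ennreal_le_iff) auto
qed

lemma duhamel_nonneg: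
  assumes "continuous_on (ST T) g" "\<And>z. z \<in> ST T \<Longrightarrow> 0 \<le> g z" "z \<in> ST T"
  shows "0 \<le> duhamel g z"
proof -
  have "duhamel (\<lambda>z. 0) z \<le> duhamel g z"
    by (rule duhamel_mono[OF _ assms(1,3)]) (use assms \<Lambda>3_ST in auto)
  then show ?thesis by (simp add: duhamel_def)
qed

text \<open>
  The source is kept only on a rectangle in characteristic coordinates; its minorant may depend on
  $\beta$ alone.
\<close>
lemma duhamel_lower:
  fixes b :: "real \<Rightarrow> real"
  assumes g: "continuous_on (ST T) g" and g0: "\<And>z. z \<in> ST T \<Longrightarrow> 0 \<le> g z"
    and rad: "\<And>s. s \<in> {0..T} \<Longrightarrow> radial (\<lambda>x. g (s, x))" and t: "t \<in> {0..T}" and r: "0 < r"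
    and a12: "t - r \<le> a1" "a1 \<le> a2" "a2 \<le> t + r" and b12: "- a1 \<le> b1" "b1 \<le> b2" "b2 \<le> t - r"
    and ge: "\<And>s l. a1 \<le> s + l \<Longrightarrow> s + l \<le> a2 \<Longrightarrow> b1 \<le> s - l \<Longrightarrow> s - l \<le> b2 \<Longrightarrow> c * b (s - l) \<le> l * g (s, l *\<^sub>R e3)"
    and b: "\<And>x. b1 \<le> x \<Longrightarrow> x \<le> b2 \<Longrightarrow> 0 \<le> b x" "continuous_on {b1..b2} b" and c: "0 \<le> c"
  shows "c * (a2 - a1) * integral {b1..b2} b / (4 * r) \<le> duhamel g (t, r *\<^sub>R e3)"
proof -
  have ib: "(b has_integral integral {b1..b2} b) {b1..b2}" by (intro integrable_integral integrable_continuous_real b)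
  have I0: "0 \<le> integral {b1..b2} b" using has_integral_nonneg[OF ib] b(1) by auto
  have nB: "(\<integral>\<^sup>+ x. ennreal (indicator {b1..b2} x * b x) \<partial>lborel) = ennreal (integral {b1..b2} b)"
    using nn_integral_has_integral_lebesgue[OF _ ib] b(1) by auto
  have mb: "(\<lambda>x. indicator {b1..b2} x *\<^sub>R b x) \<in> borel_measurable borel"
    by (rule borel_measurable_continuous_on_indicator) (use b in auto)
  have "ennreal (c * (a2 - a1) * integral {b1..b2} b / (4 * r)) = (\<integral>\<^sup>+ \<alpha>. indicator {a1..a2} \<alpha> * ennreal (c / (4 * r) * integral {b1..b2} b) \<partial>lborel)"
  proof -
    have "(\<integral>\<^sup>+ \<alpha>. indicator {a1..a2} \<alpha> * ennreal (c / (4 * r) * integral {b1..b2} b) \<partial>lborel) = ennreal (a2 - a1) * ennreal (c / (4 * r) * integral {b1..b2} b)"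
      by (subst nn_integral_multc) (use a12 in auto)
    also have "\<dots> = ennreal ((a2 - a1) * (c / (4 * r) * integral {b1..b2} b))"
      using a12 c r I0 by (subst ennreal_mult[symmetric]) auto
    finally show ?thesis by (simp add: mult_ac)
  qed
  also have "\<dots> = (\<integral>\<^sup>+ \<alpha>. (\<integral>\<^sup>+ \<beta>. indicator {a1..a2} \<alpha> * (ennreal (c / (4 * r)) * ennreal (indicator {b1..b2} \<beta> * b \<beta>)) \<partial>lborel) \<partial>lborel)"
  proof (rule nn_integral_cong)
    fix \<alpha> :: real
    have "(\<integral>\<^sup>+ \<beta>. indicator {a1..a2} \<alpha> * (ennreal (c / (4 * r)) * ennreal (indicator {b1..b2} \<beta> * b \<beta>)) \<partial>lborel)
       = indicator {a1..a2} \<alpha> * (ennreal (c / (4 * r)) * ennreal (integral {b1..b2} b))"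
      using mb by (subst nn_integral_cmult, simp, subst nn_integral_cmult) (auto simp: nB)
    also have "\<dots> = indicator {a1..a2} \<alpha> * ennreal (c / (4 * r) * integral {b1..b2} b)"
      using c r I0 by (simp add: ennreal_mult[symmetric])
    finally show "indicator {a1..a2} \<alpha> * ennreal (c / (4 * r) * integral {b1..b2} b) =
      (\<integral>\<^sup>+ \<beta>. indicator {a1..a2} \<alpha> * (ennreal (c / (4 * r)) * ennreal (indicator {b1..b2} \<beta> * b \<beta>)) \<partial>lborel)" by simp
  qed
  also have "\<dots> \<le> ennreal (duhamel g (t, r *\<^sub>R e3))"
  proof (subst duhamel_characteristic[where T=T and g=g and t=t and r=r, OF g g0 rad t r], assumption, assumption, intro nn_integral_mono)
    fix \<alpha> \<beta> :: real
    define s l where "s = (\<alpha> + \<beta>) / 2" and "l = (\<alpha> - \<beta>) / 2"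
    have ab: "\<alpha> = s + l" "\<beta> = s - l" by (simp_all add: s_def l_def field_simps)
    show "indicator {a1..a2} \<alpha> * (ennreal (c / (4 * r)) * ennreal (indicator {b1..b2} \<beta> * b \<beta>)) \<le>
      indicator (char_set t r) (\<alpha>, \<beta>) * ennreal ((\<alpha> - \<beta>) / 2 * g ((\<alpha> + \<beta>) / 2, ((\<alpha> - \<beta>) / 2) *\<^sub>R e3) / (4 * r))"
    proof (cases "\<alpha> \<in> {a1..a2} \<and> \<beta> \<in> {b1..b2}")
      case True
      then have cs: "(\<alpha>, \<beta>) \<in> char_set t r" unfolding char_set_def using a12 b12 by auto
      have "c * b (s - l) \<le> l * g (s, l *\<^sub>R e3)" using True by (intro ge) (auto simp: ab)
      then have "c / (4 * r) * b (s - l) \<le> l * g (s, l *\<^sub>R e3) / (4 * r)" using r by (simp add: divide_right_mono)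
      moreover have "0 \<le> b (s - l)" using True b(1) by (simp add: ab)
      ultimately have "ennreal (c / (4 * r)) * ennreal (b (s - l)) \<le> ennreal (l * g (s, l *\<^sub>R e3) / (4 * r))"
        using c r by (subst ennreal_mult[symmetric]) (auto intro!: ennreal_leI)
      then show ?thesis using True cs unfolding s_def[symmetric] l_def[symmetric] by (simp add: ab)
    qed (auto simp: indicator_def)
  qed
  finally have *: "ennreal (c * (a2 - a1) * integral {b1..b2} b / (4 * r)) \<le> ennreal (duhamel g (t, r *\<^sub>R e3))" .
  have "0 \<le> duhamel g (t, r *\<^sub>R e3)" by (rule duhamel_nonneg[OF g g0]) (use t in auto)
  with * show ?thesis by (simp add: ennreal_le_iff)
qed

lemma free_wave_radial:
  assumes f: "continuous_on UNIV f" "radial f" and t: "0 < t" and r: "0 < r"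
  shows "free_wave f (t, r *\<^sub>R e3) = integral {\<bar>r - t\<bar>..r + t} (\<lambda>k. k * f (k *\<^sub>R e3) / (2 * r))"
proof -
  define H where "H k = f (k *\<^sub>R e3)" for k
  have "continuous_on {0..} H" unfolding H_def by (intro continuous_on_compose2[OF f(1)] continuous_intros) auto
  then have "t * sphere_mean (\<lambda>w. H (norm (r *\<^sub>R e3 + t *\<^sub>R w))) = integral {\<bar>r - t\<bar>..r + t} (\<lambda>k. k * H k / (2 * r))"
    by (rule sphere_mean_radial[OF r t])
  moreover have "(\<lambda>w. H (norm (r *\<^sub>R e3 + t *\<^sub>R w))) = (\<lambda>w. f (r *\<^sub>R e3 + t *\<^sub>R w))"
    unfolding H_def by (rule ext) (rule radialD[OF f(2), symmetric])
  ultimately show ?thesis unfolding free_wave_def H_def by simp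
qed

section \<open>The critical nonlinearity\<close>

locale critical_nonlinearity =
  fixes p :: real and \<mu> :: "real \<Rightarrow> real"
  assumes p: "p = 1 + sqrt 2"
    and mu_nonneg: "\<forall>s\<ge>0. \<mu> s \<ge> 0"
    and mu_cont: "continuous_on {0..} \<mu>"
    and mu_mono_on: "mono_on {0..} \<mu>"
    and mu_div: "(\<integral>\<^sup>+ s\<in>{0<..1}. ennreal (\<mu> s powr p / s) \<partial>lborel) = \<infinity>"
    and F_C2: "C2_on UNIV (nonlinearity p \<mu>)"
    and mu_C1: "\<mu> C1_differentiable_on {0<..}"
    and mu_pos: "\<forall>s>0. \<mu> s > 0"
    and mu_slow: "((\<lambda>s. s * deriv \<mu> s / \<mu> s) \<longlongrightarrow> 0) (at_right 0)"
begin

lemma p_gt: "2 < p" and p_square: "p * (p - 2) = 1"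
proof -
  have "1 < sqrt 2" by simp
  then show "2 < p" using p by simp
  show "p * (p - 2) = 1" unfolding p by (simp add: algebra_simps)
qed

lemma mu_mono: "0 \<le> s \<Longrightarrow> s \<le> s' \<Longrightarrow> \<mu> s \<le> \<mu> s'"
  using mono_onD[OF mu_mono_on, of s s'] by simp

abbreviation "F \<equiv> nonlinearity p \<mu>"

lemma F_pos_eq: "0 \<le> s \<Longrightarrow> F s = s powr p * \<mu> s" by (simp add: nonlinearity_def)

lemma F_zero [simp]: "F 0 = 0" by (simp add: nonlinearity_def)

lemma F_nonneg: "0 \<le> F s" using mu_nonneg by (simp add: nonlinearity_def)

lemma F_mono: "0 \<le> s \<Longrightarrow> s \<le> s' \<Longrightarrow> F s \<le> F s'"
  using mu_nonneg p_gt by (simp add: F_pos_eq) (intro mult_mono powr_mono2 mu_mono; simp)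

lemma F_cont: "continuous_on S F"
proof -
  have "continuous_on UNIV F" using F_C2 unfolding C2_on_iff by (blast dest: C2_withD(3))
  then show ?thesis by (rule continuous_on_subset) simp
qed

text \<open>
  The logarithmic derivative of $\mu(s) / \sqrt s$ is negative for small $s$, since that of $\mu$ is
  $o(1/s)$.
\<close>
lemma slow_variation: "\<exists>s0>0. s0 \<le> 1 \<and> (\<forall>s s'. 0 < s \<longrightarrow> s \<le> s' \<longrightarrow> s' \<le> s0 \<longrightarrow> \<mu> s' \<le> sqrt (s' / s) * \<mu> s)"
proof -
  obtain D where D: "\<And>s. 0 < s \<Longrightarrow> (\<mu> has_real_derivative D s) (at s)"
    using mu_C1 unfolding C1_differentiable_on_def has_real_derivative_iff_has_vector_derivative by auto
  have dD: "deriv \<mu> s = D s" if "0 < s" for s using DERIV_imp_deriv[OF D[OF that]] .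
  have "\<forall>\<^sub>F s in at_right 0. dist (s * deriv \<mu> s / \<mu> s) 0 < 1 / 2"
    by (rule tendstoD[OF mu_slow]) simp
  then obtain b where b: "0 < b" "\<And>s. 0 < s \<Longrightarrow> s < b \<Longrightarrow> dist (s * deriv \<mu> s / \<mu> s) 0 < 1 / 2"
    unfolding eventually_at_right_field by auto
  define s0 where "s0 = min 1 (b / 2)"
  have s0: "0 < s0" "s0 \<le> 1" "s0 < b" using b(1) by (auto simp: s0_def)
  have "\<mu> s' \<le> sqrt (s' / s) * \<mu> s" if s: "0 < s" "s \<le> s'" "s' \<le> s0" for s s'
  proof -
    have "ln (\<mu> s') - ln s' / 2 \<le> ln (\<mu> s) - ln s / 2"
    proof (rule DERIV_nonpos_imp_nonincreasing[OF s(2)])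
      fix x assume x: "s \<le> x" "x \<le> s'"
      then have x0: "0 < x" "x < b" using s s0 by auto
      have mx: "0 < \<mu> x" using mu_pos x0 by auto
      have "((\<lambda>x. ln (\<mu> x) - ln x / 2) has_real_derivative D x / \<mu> x - 1 / x / 2) (at x)"
        using D[OF x0(1)] mx x0 by (auto intro!: derivative_eq_intros)
      moreover have "D x / \<mu> x - 1 / x / 2 \<le> 0"
      proof -
        have "\<bar>x * D x / \<mu> x\<bar> < 1 / 2" using b(2)[OF x0] unfolding dD[OF x0(1)] dist_real_def by simp
        then have "x * D x / \<mu> x < 1 / 2" by (rule le_less_trans[OF abs_ge_self])
        then show ?thesis using x0 mx by (simp add: field_simps)
      qed
      ultimately show "\<exists>y. ((\<lambda>x. ln (\<mu> x) - ln x / 2) has_real_derivative y) (at x) \<and> y \<le> 0" by blast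
    qed
    moreover have mp: "0 < \<mu> s" "0 < \<mu> s'" using mu_pos s by auto
    moreover have "ln (sqrt (s' / s) * \<mu> s) = (ln s' - ln s) / 2 + ln (\<mu> s)"
      using s mp by (simp add: ln_mult ln_sqrt ln_div)
    ultimately have "ln (\<mu> s') \<le> ln (sqrt (s' / s) * \<mu> s)" by argo
    then show ?thesis using s mp by (subst (asm) ln_le_cancel_iff) auto
  qed
  with s0 show ?thesis by blast
qed

text \<open>
  $A_\varepsilon(t)$ is the integral of \<open>dens\<close> over $[\varepsilon / t, \varepsilon]$; in this form
  its dependence on $\varepsilon$ and $t$ sits in the limits of integration.
\<close>
definition "dens s = \<mu> s powr p / s"
definition "J x y = integral {x..y} dens"

lemma dens_cont: "0 < x \<Longrightarrow> continuous_on {x..y} dens"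
  unfolding dens_def
  by (intro continuous_intros continuous_on_subset[OF mu_cont]) (use mu_pos p_gt in \<open>auto simp: less_imp_neq[symmetric]\<close>)

lemma dens_nonneg: "0 < s \<Longrightarrow> 0 \<le> dens s" by (simp add: dens_def)

lemma dens_int: "0 < x \<Longrightarrow> dens integrable_on {x..y}"
  by (rule integrable_continuous_real[OF dens_cont])

lemma J_nonneg: "0 < x \<Longrightarrow> 0 \<le> J x y"
  unfolding J_def by (rule integral_nonneg[OF dens_int]) (auto intro: dens_nonneg)

lemma J_split: "0 < x \<Longrightarrow> x \<le> y \<Longrightarrow> y \<le> w \<Longrightarrow> J x y + J y w = J x w"
  unfolding J_def by (rule Henstock_Kurzweil_Integration.integral_combine) (auto intro: dens_int)

lemma J_antimono: "0 < x \<Longrightarrow> x \<le> x' \<Longrightarrow> J x' y \<le> J x y"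
proof (cases "x' \<le> y")
  case True
  assume "0 < x" "x \<le> x'"
  then show ?thesis using J_split[of x x' y] J_nonneg[of x x'] True by simp
next
  case False
  assume "0 < x" "x \<le> x'"
  then show ?thesis using False J_nonneg[of x y] by (simp add: J_def)
qed

lemma J_upper: "0 < x \<Longrightarrow> x \<le> y \<Longrightarrow> J x y \<le> \<mu> y powr p * ln (y / x)"
proof -
  assume x: "0 < x" "x \<le> y"
  have "((\<lambda>s. \<mu> y powr p / s) has_integral (\<mu> y powr p * ln y - \<mu> y powr p * ln x)) {x..y}"
    by (rule fundamental_theorem_of_calculus)
      (use x in \<open>auto intro!: derivative_eq_intros simp: has_real_derivative_iff_has_vector_derivative[symmetric]\<close>)
  then have "J x y \<le> \<mu> y powr p * ln y - \<mu> y powr p * ln x" unfolding J_def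
  proof (rule has_integral_le[OF integrable_integral[OF dens_int[OF x(1)]]])
    fix s assume "s \<in> {x..y}"
    then show "dens s \<le> \<mu> y powr p / s" unfolding dens_def
      using x mu_nonneg p_gt by (intro divide_right_mono powr_mono2 mu_mono) auto
  qed
  then show ?thesis using x by (simp add: ln_div algebra_simps)
qed

lemma A_fun_eq_J: "0 < \<epsilon> \<Longrightarrow> 1 \<le> t \<Longrightarrow> A_fun p \<mu> \<epsilon> t = J (\<epsilon> / t) \<epsilon>"
proof -
  assume e: "0 < \<epsilon>" and t: "1 \<le> t"
  have et: "\<epsilon> / t \<le> \<epsilon>" using e t frac_le[of \<epsilon> \<epsilon> 1 t] by simp
  have "((\<lambda>s. \<epsilon> *\<^sub>R dens (\<epsilon> * s)) has_integral integral {\<epsilon> * (1 / t)..\<epsilon> * 1} dens) {1 / t..1}"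
  proof (rule has_integral_substitution[where c="\<epsilon> / t" and d="\<epsilon>"])
    show "(\<lambda>s. \<epsilon> * s) ` {1 / t..1} \<subseteq> {\<epsilon> / t..\<epsilon>}" using e t by (auto simp: field_simps mult_left_le)
    show "continuous_on {\<epsilon> / t..\<epsilon>} dens" by (rule dens_cont) (use e t in simp)
  qed (use e t et in \<open>auto intro!: derivative_eq_intros\<close>)
  moreover have "\<epsilon> *\<^sub>R dens (\<epsilon> * s) = \<mu> (\<epsilon> * s) powr p / s" for s using e by (simp add: dens_def)
  ultimately show ?thesis unfolding A_fun_def J_def by (simp add: integral_unique)
qed

text \<open>
  This is the divergence hypothesis, transferred from the Lebesgue integral over $(0, 1]$ by monotone
  convergence.
\<close>
lemma J_unbounded:
  assumes y: "0 < y" "y \<le> 1"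
  shows "\<exists>x0>0. x0 \<le> y \<and> (\<forall>x. 0 < x \<longrightarrow> x \<le> x0 \<longrightarrow> M \<le> J x y)"
proof (rule ccontr)
  assume "\<not> ?thesis"
  then have "\<And>x0. 0 < x0 \<Longrightarrow> x0 \<le> y \<Longrightarrow> \<exists>x. 0 < x \<and> x \<le> x0 \<and> J x y < M" by (meson not_le)
  then have bd: "J x0 y < M" if "0 < x0" "x0 \<le> y" for x0
    using that J_antimono by (meson le_less_trans)
  have bd1: "J x 1 \<le> \<bar>M\<bar> + J y 1" if x: "0 < x" "x \<le> 1" for x
  proof (cases "x \<le> y")
    case True
    then show ?thesis using J_split[OF x(1) True y(2)] bd[OF x(1) True] by linarith
  next
    case False
    then show ?thesis using J_antimono[OF y(1), of x 1] by linarith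
  qed
  let ?f = "\<lambda>n s. indicator {1 / real (Suc n)..1} s * ennreal (dens s)"
  have sup: "(\<integral>\<^sup>+ s. ennreal (dens s) * indicator {0<..1} s \<partial>lborel) = (SUP n. \<integral>\<^sup>+ s. ?f n s \<partial>lborel)"
  proof (subst nn_integral_monotone_convergence_SUP[symmetric])
    show "incseq ?f"
      unfolding incseq_def le_fun_def
    proof (intro allI impI mult_right_mono)
      fix m n :: nat and s :: real assume "m \<le> n"
      then have "1 / real (Suc n) \<le> 1 / real (Suc m)" by (simp add: frac_le)
      then show "indicator {1 / real (Suc m)..1} s \<le> (indicator {1 / real (Suc n)..1} s :: ennreal)"
        by (auto simp: indicator_def)
    qed auto
    show "?f n \<in> borel_measurable lborel" for n
    proof -
      have "(\<lambda>s. indicator {1 / real (Suc n)..1} s *\<^sub>R dens s) \<in> borel_measurable borel"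
        by (rule borel_measurable_continuous_on_indicator) (auto intro!: dens_cont)
      then have "(\<lambda>s. ennreal (indicator {1 / real (Suc n)..1} s *\<^sub>R dens s)) \<in> borel_measurable borel" by measurable
      moreover have "(\<lambda>s. ennreal (indicator {1 / real (Suc n)..1} s *\<^sub>R dens s)) = ?f n"
        by (auto simp: fun_eq_iff indicator_def)
      ultimately show ?thesis by simp
    qed
    show "(\<integral>\<^sup>+ s. ennreal (dens s) * indicator {0<..1} s \<partial>lborel) = (\<integral>\<^sup>+ s. (SUP n. ?f n s) \<partial>lborel)"
    proof (rule nn_integral_cong)
      fix s :: real
      show "ennreal (dens s) * indicator {0<..1} s = (SUP n. ?f n s)"
      proof (cases "s \<in> {0<..1}")
        case True
        obtain n where n: "1 / real (Suc n) < s" using True nat_approx_posE[of s] by (auto simp: inverse_eq_divide)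
        have "?f n s \<le> (SUP n. ?f n s)" by (rule SUP_upper) simp
        moreover have "?f n s = ennreal (dens s)" using True n by simp
        moreover have "(SUP n. ?f n s) \<le> ennreal (dens s)" by (rule SUP_least) (auto simp: indicator_def)
        ultimately show ?thesis using True by simp
      next
        case False
        have "0 < 1 / real (Suc n)" for n by simp
        then have "\<not> (1 / real (Suc n) \<le> s \<and> s \<le> 1)" for n using False by (metis greaterThanAtMost_iff less_le_trans)
        then have "?f n s = 0" for n by (simp add: indicator_def del: of_nat_Suc)
        then have "(SUP n. ?f n s) = 0" by (simp only: SUP_const UNIV_not_empty not_False_eq_True)
        moreover have "ennreal (dens s) * indicator {0<..1} s = 0" using False by (simp add: indicator_def)
        ultimately show ?thesis by (simp only:)
      qed
    qed
  qed
  have "(\<integral>\<^sup>+ s. ?f n s \<partial>lborel) \<le> ennreal (\<bar>M\<bar> + J y 1)" for n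
  proof -
    have n0: "0 < 1 / real (Suc n)" by simp
    have "(dens has_integral J (1 / real (Suc n)) 1) {1 / real (Suc n)..1}"
      unfolding J_def by (rule integrable_integral[OF dens_int[OF n0]])
    moreover have "0 \<le> dens x" if "x \<in> {1 / real (Suc n)..1}" for x
      by (rule dens_nonneg, rule less_le_trans[OF n0]) (use that in simp)
    ultimately have "(\<integral>\<^sup>+ s. ennreal (indicator {1 / real (Suc n)..1} s * dens s) \<partial>lborel) = ennreal (J (1 / real (Suc n)) 1)"
      by (rule nn_integral_has_integral_lebesgue[rotated])
    moreover have "?f n s = ennreal (indicator {1 / real (Suc n)..1} s * dens s)" for s by (auto simp: indicator_def)
    ultimately show ?thesis using bd1[OF n0] by (simp add: ennreal_leI del: of_nat_Suc)
  qed
  then have "(SUP n. \<integral>\<^sup>+ s. ?f n s \<partial>lborel) \<le> ennreal (\<bar>M\<bar> + J y 1)" by (rule SUP_least)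
  moreover have "(\<integral>\<^sup>+ s. ennreal (dens s) * indicator {0<..1} s \<partial>lborel) = \<infinity>"
    using mu_div by (simp add: dens_def)
  ultimately have "(\<infinity> :: ennreal) \<le> ennreal (\<bar>M\<bar> + J y 1)" unfolding sup by (simp only:)
  then show False by (simp add: top_unique)
qed

lemma A_fun_mono: "0 < \<epsilon> \<Longrightarrow> 1 \<le> t \<Longrightarrow> t \<le> t' \<Longrightarrow> A_fun p \<mu> \<epsilon> t \<le> A_fun p \<mu> \<epsilon> t'"
  by (simp add: A_fun_eq_J) (rule J_antimono; simp add: frac_le)

lemma A_fun_one: "0 < \<epsilon> \<Longrightarrow> A_fun p \<mu> \<epsilon> 1 = 0"
  by (simp add: A_fun_eq_J J_def)

lemma A_fun_unbounded: "0 < \<epsilon> \<Longrightarrow> \<epsilon> \<le> 1 \<Longrightarrow> \<exists>t\<ge>1. M \<le> A_fun p \<mu> \<epsilon> t"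
proof -
  assume e: "0 < \<epsilon>" "\<epsilon> \<le> 1"
  obtain x0 where x0: "0 < x0" "x0 \<le> \<epsilon>" "\<forall>x. 0 < x \<longrightarrow> x \<le> x0 \<longrightarrow> M \<le> J x \<epsilon>" using J_unbounded[OF e] by blast
  have "1 \<le> \<epsilon> / x0" "\<epsilon> / (\<epsilon> / x0) = x0" using e x0 by auto
  then show ?thesis using A_fun_eq_J[OF e(1), of "\<epsilon> / x0"] x0 by (intro exI[of _ "\<epsilon> / x0"]) auto
qed

lemma A_fun_cont: "0 < \<epsilon> \<Longrightarrow> continuous_on {1..b} (A_fun p \<mu> \<epsilon>)"
proof (cases "1 \<le> b")
  case b: True
  assume e: "0 < \<epsilon>"
  have "continuous_on {\<epsilon> / b..\<epsilon>} (\<lambda>x. J x \<epsilon>)" unfolding J_def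
    by (rule indefinite_integral_continuous_1'[OF dens_int]) (use e b in simp)
  then have "continuous_on {1..b} (\<lambda>t. J (\<epsilon> / t) \<epsilon>)"
    by (rule continuous_on_compose2) (use e b in \<open>auto intro!: continuous_intros simp: frac_le divide_le_eq_1 field_simps\<close>)
  then show ?thesis by (rule continuous_on_eq) (use e A_fun_eq_J in auto)
qed auto

end

section \<open>Compactly supported data\<close>

lemma C2_compact_supportE:
  fixes f :: "real ^ 3 \<Rightarrow> real"
  assumes f: "C2_compact_support f"
  obtains f' f'' R m where "C2_with UNIV f f' f''" "0 < R" "0 < m" "\<And>x. R < norm x \<Longrightarrow> f x = 0"
    "\<And>x. \<bar>f x\<bar> \<le> m" "\<And>x. norm (f' x) \<le> m" "\<And>x. norm (f'' x) \<le> m"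
proof -
  obtain f' f'' where c2: "C2_with UNIV f f' f''" using f unfolding C2_compact_support_def C2_on_iff by blast
  note d = C2_withD[OF c2]
  have "bounded (closure (support_on UNIV f))" using f unfolding C2_compact_support_def by (blast intro: compact_imp_bounded)
  then obtain R0 where R0: "\<And>x. x \<in> closure (support_on UNIV f) \<Longrightarrow> norm x \<le> R0" unfolding bounded_iff by blast
  define R where "R = max R0 1"
  have z: "f x = 0" if "R < norm x" for x
  proof (rule ccontr)
    assume "f x \<noteq> 0"
    then have "x \<in> closure (support_on UNIV f)" by (intro subsetD[OF closure_subset]) (simp add: support_on_def)
    then show False using R0 that by (fastforce simp: R_def)
  qed
  have op: "open {x :: real ^ 3. R < norm x}" by (intro open_Collect_less continuous_intros)
  have z': "f' x = 0" if "R < norm x" for x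
  proof -
    have "(f has_derivative (\<lambda>h. 0)) (at x)"
      by (rule has_derivative_transform_within_open[OF has_derivative_const op]) (use that z in auto)
    moreover have "(f has_derivative blinfun_apply (f' x)) (at x)" using d(1)[of x] by simp
    ultimately have "blinfun_apply (f' x) = (\<lambda>h. 0)" using has_derivative_unique by blast
    then show ?thesis by (intro blinfun_eqI) simp
  qed
  have z'': "f'' x = 0" if "R < norm x" for x
  proof -
    have "(f' has_derivative (\<lambda>h. 0)) (at x)"
      by (rule has_derivative_transform_within_open[OF has_derivative_const op]) (use that z' in auto)
    moreover have "(f' has_derivative blinfun_apply (f'' x)) (at x)" using d(2)[of x] by simp
    ultimately have "blinfun_apply (f'' x) = (\<lambda>h. 0)" using has_derivative_unique by blast
    then show ?thesis by (intro blinfun_eqI) simp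
  qed
  have bd: "\<exists>K. \<forall>x. norm (h x) \<le> K" if h: "continuous_on UNIV h" "\<And>x. R < norm x \<Longrightarrow> h x = 0" for h :: "real ^ 3 \<Rightarrow> 'c::real_normed_vector"
  proof -
    have "compact (h ` cball 0 R)" by (rule compact_continuous_image[OF continuous_on_subset[OF h(1)]]) auto
    then obtain K where "\<forall>y\<in>h ` cball 0 R. norm y \<le> K" using compact_imp_bounded bounded_iff by metis
    then have "norm (h x) \<le> max K 0" for x
      by (cases "norm x \<le> R") (auto simp: h(2) not_le le_max_iff_disj)
    then show ?thesis by blast
  qed
  obtain K1 K2 K3 where K: "\<And>x. norm (f x) \<le> K1" "\<And>x. norm (f' x) \<le> K2" "\<And>x. norm (f'' x) \<le> K3"
    using bd[OF d(3) z] bd[OF d(4) z'] bd[OF d(5) z''] by blast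
  define m where "m = max (max K1 K2) (max K3 1)"
  show ?thesis
  proof (rule that[OF c2, of R m])
    show "\<bar>f x\<bar> \<le> m" "norm (f' x) \<le> m" "norm (f'' x) \<le> m" for x
      using K(1)[of x] K(2)[of x] K(3)[of x] by (auto simp: m_def)
  qed (use z in \<open>auto simp: R_def m_def\<close>)
qed

lemma C2_with_cmult:
  assumes "C2_with UNIV f f' f''"
  shows "C2_with UNIV (\<lambda>x. c * f x) (\<lambda>x. c *\<^sub>R f' x) (\<lambda>x. c *\<^sub>R f'' x)"
  unfolding C2_with_def
proof (intro conjI ballI)
  note d = C2_withD[OF assms]
  fix z :: 'a
  show "((\<lambda>x. c * f x) has_derivative blinfun_apply (c *\<^sub>R f' z)) (at z)"
    using has_derivative_mult_right[OF d(1)[of z], of c] by (simp add: scaleR_blinfun.rep_eq)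
  show "((\<lambda>x. c *\<^sub>R f' x) has_derivative blinfun_apply (c *\<^sub>R f'' z)) (at z)"
    using has_derivative_scaleR_right[OF d(2)[of z], of c] by (simp add: scaleR_blinfun.rep_eq)
  show "continuous_on UNIV (\<lambda>x. c *\<^sub>R f'' x)" by (intro continuous_intros d)
qed

lemma free_wave_cmult: "free_wave (\<lambda>x. c * f x) z = c * free_wave f z"
  by (simp add: free_wave_def sphere_mean_cmult)

lemma free_wave_nonneg:
  assumes "continuous_on UNIV f" "\<And>x. 0 \<le> f x" "0 \<le> fst z"
  shows "0 \<le> free_wave f z"
proof -
  have "sphere_mean (\<lambda>w. 0) \<le> sphere_mean (\<lambda>w. f (snd z + fst z *\<^sub>R w))"
    by (rule sphere_mean_mono) (use assms in \<open>auto intro!: continuous_intros continuous_on_compose2[OF assms(1)]\<close>)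
  then show ?thesis using assms by (simp add: free_wave_def)
qed

lemma free_wave_crude_bound:
  assumes "continuous_on UNIV f" "\<And>x. \<bar>f x\<bar> \<le> m" "0 \<le> fst z"
  shows "free_wave f z \<le> fst z * m"
proof -
  have "sphere_mean (\<lambda>w. f (snd z + fst z *\<^sub>R w)) \<le> sphere_mean (\<lambda>w. m)"
    by (rule sphere_mean_mono) (use assms(2) abs_le_D1 in \<open>auto intro!: continuous_intros continuous_on_compose2[OF assms(1)]\<close>)
  then show ?thesis using assms by (simp add: free_wave_def mult_left_mono)
qed

lemma free_wave_support:
  assumes f: "\<And>x. R < norm x \<Longrightarrow> f x = 0" and t: "0 \<le> t" and off: "R < \<bar>t - norm x\<bar>"
  shows "free_wave f (t, x) = 0"
proof -
  have "f (x + t *\<^sub>R w) = 0" if "norm w = 1" for w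
  proof (rule f)
    have 1: "norm x \<le> norm (x + t *\<^sub>R w) + t" using norm_triangle_ineq4[of "x + t *\<^sub>R w" "t *\<^sub>R w"] that t by simp
    have 2: "t \<le> norm (x + t *\<^sub>R w) + norm x" using norm_triangle_ineq4[of "x + t *\<^sub>R w" x] that t by simp
    show "R < norm (x + t *\<^sub>R w)" using 1 2 off by linarith
  qed
  then have "sphere_mean (\<lambda>w. f (x + t *\<^sub>R w)) = sphere_mean (\<lambda>w. 0)" by (intro sphere_mean_cong) auto
  then show ?thesis by (simp add: free_wave_def)
qed

text \<open>
  Free waves with compactly supported data decay like $1/t$ and live in the shell $|t - r| \le R$ (strong
  Huygens principle). For $r \le 1$ the factor $1/r$ in the one-dimensional formula is useless, but there $t$
  is bounded.
\<close>
lemma free_wave_decay: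
  fixes f :: "real ^ 3 \<Rightarrow> real"
  assumes fc: "continuous_on UNIV f" and rad: "radial f" and m: "\<And>x. \<bar>f x\<bar> \<le> m" and f0: "\<And>x. 0 \<le> f x"
    and R: "0 < R" "\<And>x. R < norm x \<Longrightarrow> f x = 0" and t: "0 \<le> t" and r: "0 \<le> r"
  shows "free_wave f (t, r *\<^sub>R e3) \<le> (R + 1)\<^sup>2 * (R + 3) * m / (1 + t + r)"
proof -
  have m0: "0 \<le> m" using m[of 0] by linarith
  have pos: "0 < 1 + t + r" using t r by simp
  have K: "0 \<le> (R + 1)\<^sup>2 * (R + 3) * m / (1 + t + r)" using R m0 pos by simp
  show ?thesis
  proof (cases "\<bar>t - r\<bar> \<le> R")
    case False
    then show ?thesis using free_wave_support[OF R(2) t, where x="r *\<^sub>R e3"] r K by simp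
  next
    case near: True
    show ?thesis
    proof (cases "r \<le> 1")
      case True
      have "free_wave f (t, r *\<^sub>R e3) \<le> t * m" using free_wave_crude_bound[OF fc m, where z="(t, r *\<^sub>R e3)"] t by simp
      also have "\<dots> \<le> (R + 1) * m" using near True m0 by (intro mult_right_mono) auto
      finally have "free_wave f (t, r *\<^sub>R e3) * (1 + t + r) \<le> ((R + 1) * m) * (R + 3)"
        by (rule mult_mono) (use near True pos m0 R in auto)
      also have "\<dots> \<le> (R + 1)\<^sup>2 * (R + 3) * m"
      proof -
        have "(R + 1) * 1 \<le> (R + 1) * (R + 1)" using R by (intro mult_left_mono) auto
        then have "(R + 1) * (m * (R + 3)) \<le> (R + 1)\<^sup>2 * (m * (R + 3))"
          unfolding power2_eq_square by (intro mult_right_mono) (use m0 R in auto)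
        then show ?thesis by (simp add: mult_ac)
      qed
      finally show ?thesis using pos by (simp add: pos_le_divide_eq)
    next
      case False
      then have r1: "1 < r" by simp
      show ?thesis
      proof (cases "t = 0")
        case True
        then show ?thesis using K by (simp add: free_wave_def)
      next
        case False
        with t have t0: "0 < t" by simp
        let ?h = "\<lambda>k. k * f (k *\<^sub>R e3) / (2 * r)"
        have hc: "continuous_on S ?h" for S
          by (intro continuous_intros continuous_on_compose2[OF fc]) (use r1 in auto)
        have hi: "?h integrable_on {a..b}" for a b by (rule integrable_continuous_real[OF hc])
        have h0: "0 \<le> ?h k" if "0 \<le> k" for k using that f0 r1 by simp
        define d where "d = max (r + t) R"
        have "integral {\<bar>r - t\<bar>..r + t} ?h \<le> integral {0..d} ?h"
          by (rule integral_subset_le) (use hi h0 r1 t0 in \<open>auto simp: d_def\<close>)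
        also have "\<dots> = integral {0..R} ?h + integral {R..d} ?h"
          by (rule Henstock_Kurzweil_Integration.integral_combine[symmetric]) (use R hi in \<open>auto simp: d_def\<close>)
        also have "integral {R..d} ?h = integral {R..d} (\<lambda>k. 0)"
        proof (rule integral_spike[of "{R}"])
          fix k assume "k \<in> {R..d} - {R}"
          then have "R < norm (k *\<^sub>R e3)" using R by auto
          then show "0 = ?h k" using R(2) by simp
        qed simp
        also have "integral {0..R} ?h \<le> integral {0..R} (\<lambda>k. R * m / (2 * r))"
        proof (rule integral_le[OF hi])
          fix k assume k: "k \<in> {0..R}"
          have "k * f (k *\<^sub>R e3) \<le> R * m" using k f0 m abs_le_D1 R by (intro mult_mono) auto
          then show "?h k \<le> R * m / (2 * r)" using r1 by (simp add: divide_right_mono)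
        qed (rule integrable_const_ivl)
        finally have "free_wave f (t, r *\<^sub>R e3) \<le> R * (R * m / (2 * r))"
          using free_wave_radial[OF fc rad t0, of r] r1 R by simp
        moreover have "R * (R * m / (2 * r)) \<le> (R + 1)\<^sup>2 * (R + 3) * m / (1 + t + r)"
        proof -
          have "1 + t + r \<le> (R + 3) * r"
          proof -
            have "R * 1 \<le> R * r" using R r1 by (intro mult_left_mono) auto
            then show ?thesis using near r1 by (simp add: algebra_simps)
          qed
          then have "R\<^sup>2 * m * (1 + t + r) \<le> R\<^sup>2 * m * ((R + 3) * r)" using m0 by (intro mult_left_mono) auto
          also have "\<dots> \<le> (R + 1)\<^sup>2 * m * ((R + 3) * r)"
            using R m0 r1 by (intro mult_right_mono power_mono) auto
          also have "\<dots> \<le> 2 * ((R + 1)\<^sup>2 * m * ((R + 3) * r))" using R m0 r1 by simp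
          finally have "R\<^sup>2 * m * (1 + t + r) \<le> ((R + 1)\<^sup>2 * (R + 3) * m) * (2 * r)" by (simp add: mult_ac)
          then show ?thesis using pos r1 by (simp add: field_simps power2_eq_square)
        qed
        ultimately show ?thesis by linarith
      qed
    qed
  qed
qed

section \<open>Existence and the lower bound for the lifespan\<close>

context critical_nonlinearity
begin

text \<open>
  A priori bounds for the Picard iterates are enough for existence and uniqueness.
\<close>
lemma unique_solutionI:
  assumes T: "0 < T" and f: "C2_with UNIV f f' f''"
    and m: "\<And>x. \<bar>f x\<bar> \<le> m" "\<And>x. norm (f' x) \<le> m" "\<And>x. norm (f'' x) \<le> m"
    and B: "\<And>n z. z \<in> ST T \<Longrightarrow> \<bar>picard F f n z\<bar> \<le> B"
  shows "unique_classical_solution_exists F f T"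
proof -
  obtain F' F'' where Fc: "C2_with UNIV F F' F''" using F_C2 unfolding C2_on_iff by blast
  interpret picard_iteration T F F' F'' f f' f'' m B
    by unfold_locales (use T Fc f m B in auto)
  obtain u where u: "wave_sol T (\<lambda>z. F (u z)) f u" using picard_converges by blast
  have cs: "classical_solution F f T (\<lambda>t x. u (t, x))"
    unfolding classical_solution_iff_wave_sol[OF T] using u by simp
  show ?thesis unfolding unique_classical_solution_exists_def
  proof (intro exI conjI allI impI ballI)
    show "classical_solution F f T (\<lambda>t x. u (t, x))" by (rule cs)
    fix v t x assume v: "classical_solution F f T v" and t: "t \<in> {0..T}"
    have "wave_sol T (\<lambda>z. F (v (fst z) (snd z))) f (\<lambda>z. v (fst z) (snd z))"
      using v unfolding classical_solution_iff_wave_sol[OF T] .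
    from wave_sol_unique[OF T Fc this u, of "(t, x)"] t show "v t x = u (t, x)" by simp
  qed
qed

lemma picard_facts:
  assumes T: "0 < T" and f: "C2_with UNIV f f' f''" and rad: "radial f" and f0: "\<And>x. 0 \<le> f x"
  shows "continuous_on (ST T) (picard F f n)" and "z \<in> ST T \<Longrightarrow> 0 \<le> picard F f n z"
    and "t \<in> {0..T} \<Longrightarrow> radial (\<lambda>x. picard F f n (t, x))"
    and "continuous_on (ST T) (\<lambda>z. F (picard F f n z))"
    and "t \<in> {0..T} \<Longrightarrow> radial (\<lambda>x. F (picard F f n (t, x)))"
proof -
  obtain F' F'' where Fc: "C2_with UNIV F F' F''" using F_C2 unfolding C2_on_iff by blast
  have comp: "C2_on (ST T) (\<lambda>z. F (u z))" if "C2_on (ST T) u" for u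
    using that C2_with_compose[OF Fc] unfolding C2_on_iff by blast
  have main: "C2_on (ST T) (picard F f n) \<and> (\<forall>z\<in>ST T. 0 \<le> picard F f n z) \<and> (\<forall>t\<in>{0..T}. radial (\<lambda>x. picard F f n (t, x)))"
  proof (induction n)
    case 0
    have "C2_with (ST T) (\<lambda>z. 0) (\<lambda>z. 0) (\<lambda>z. 0)" unfolding C2_with_def by (auto simp: zero_blinfun.rep_eq)
    then show ?case unfolding C2_on_iff by (auto simp: radial_def)
  next
    case (Suc n)
    obtain h' h'' where h: "C2_with (ST T) (\<lambda>z. F (picard F f n z)) h' h''"
      using comp Suc unfolding C2_on_iff by blast
    have sol: "wave_sol T (\<lambda>z. F (picard F f n z)) f (picard F f (Suc n))"
      using wave_sol_representation[OF T f h] by simp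
    have rg: "radial (\<lambda>x. F (picard F f n (t, x)))" if "t \<in> {0..T}" for t
      using Suc that unfolding radial_def by metis
    show ?case
    proof (intro conjI ballI)
      show "C2_on (ST T) (picard F f (Suc n))" using sol unfolding wave_sol_def C2_on_iff by blast
      fix z assume z: "z \<in> ST T"
      have "0 \<le> duhamel (\<lambda>z. F (picard F f n z)) z" by (rule duhamel_nonneg[OF C2_withD(3)[OF h] F_nonneg z])
      moreover have "0 \<le> free_wave f z" by (rule free_wave_nonneg[OF C2_withD(3)[OF f] f0]) (use z in \<open>cases z; simp\<close>)
      ultimately show "0 \<le> picard F f (Suc n) z" by simp
    next
      fix t assume t: "t \<in> {0..T}"
      show "radial (\<lambda>x. picard F f (Suc n) (t, x))"
        by (rule wave_sol_radial[where g="\<lambda>z. F (picard F f n z)", OF sol rad _ t]) (rule rg)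
    qed
  qed
  show "continuous_on (ST T) (picard F f n)" using main unfolding C2_on_iff by (blast dest: C2_withD(3))
  then show "continuous_on (ST T) (\<lambda>z. F (picard F f n z))" by (rule continuous_on_compose2[OF F_cont[of UNIV]]) auto
  show "z \<in> ST T \<Longrightarrow> 0 \<le> picard F f n z" "t \<in> {0..T} \<Longrightarrow> radial (\<lambda>x. picard F f n (t, x))" using main by auto
  then show "t \<in> {0..T} \<Longrightarrow> radial (\<lambda>x. F (picard F f n (t, x)))" unfolding radial_def by metis
qed

lemma picard_support:
  assumes T: "0 < T" and f: "\<And>x. R < norm x \<Longrightarrow> f x = 0" and R: "0 < R"
    and z: "(t, x) \<in> ST T" and off: "t + R < norm x"
  shows "picard F f n (t, x) = 0"
  using z off
proof (induction n arbitrary: t x)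
  case (Suc n)
  have t: "0 \<le> t" "t \<le> T" using Suc.prems by auto
  have "free_wave f (t, x) = 0" by (rule free_wave_support[OF f t(1)]) (use Suc.prems t R in auto)
  moreover have "duhamel (\<lambda>z. F (picard F f n z)) (t, x) = 0"
  proof -
    have "integral {0..t} (\<lambda>s. (t - s) * sphere_mean (\<lambda>w. F (picard F f n (s, x + (t - s) *\<^sub>R w)))) = integral {0..t} (\<lambda>s. 0)"
    proof (rule integral_cong)
      fix s assume s: "s \<in> {0..t}"
      have "sphere_mean (\<lambda>w. F (picard F f n (s, x + (t - s) *\<^sub>R w))) = sphere_mean (\<lambda>w. 0)"
      proof (rule sphere_mean_cong)
        fix w :: "real ^ 3" assume w: "norm w = 1"
        have "norm x \<le> norm (x + (t - s) *\<^sub>R w) + (t - s)"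
          using norm_triangle_ineq4[of "x + (t - s) *\<^sub>R w" "(t - s) *\<^sub>R w"] w s by simp
        then have "picard F f n (s, x + (t - s) *\<^sub>R w) = 0"
          by (intro Suc.IH) (use s t Suc.prems in auto)
        then show "F (picard F f n (s, x + (t - s) *\<^sub>R w)) = 0" by simp
      qed
      then show "(t - s) * sphere_mean (\<lambda>w. F (picard F f n (s, x + (t - s) *\<^sub>R w))) = 0" by simp
    qed
    then show ?thesis by (simp add: duhamel_def)
  qed
  ultimately show ?case by simp
qed simp

text \<open>
  On a short time interval the iterates stay below 1.
\<close>
theorem local_existence:
  assumes f: "C2_compact_support f" and rad: "radial f" and f0: "\<And>x. 0 \<le> f x"
  shows "\<exists>T>0. unique_classical_solution_exists F f T"
proof -
  obtain f' f'' R m where c2: "C2_with UNIV f f' f''" and R: "0 < R" "\<And>x. R < norm x \<Longrightarrow> f x = 0"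
    and m: "0 < m" "\<And>x. \<bar>f x\<bar> \<le> m" "\<And>x. norm (f' x) \<le> m" "\<And>x. norm (f'' x) \<le> m"
    by (rule C2_compact_supportE[OF f]) metis
  define T where "T = 1 / (1 + m + 3 * F 1)"
  have den: "1 \<le> 1 + m + 3 * F 1" using m(1) F_nonneg[of 1] by simp
  have T: "0 < T" "T \<le> 1" using den by (auto simp: T_def)
  have Tm: "T * m + 3 * F 1 * T \<le> 1"
  proof -
    have "T * (1 + m + 3 * F 1) = 1" using den by (simp add: T_def)
    then show ?thesis using T by (simp add: algebra_simps)
  qed
  note pf = picard_facts[OF T(1) c2 rad f0]
  have le1: "picard F f n z \<le> 1" if "z \<in> ST T" for n z
    using that
  proof (induction n arbitrary: z)
    case (Suc n)
    have z: "0 \<le> fst z" "fst z \<le> T" using Suc.prems by (cases z, simp)+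
    have "\<bar>duhamel (\<lambda>z. F (picard F f n z)) z\<bar> \<le> F 1 * (T / 1) * exp (1 * fst z)"
    proof (rule duhamel_weighted_bound[OF pf(4) Suc.prems _ F_nonneg])
      fix y assume "y \<in> cone_box"
      then have y: "\<Lambda>3 y z \<in> ST T" using \<Lambda>3_ST Suc.prems by blast
      then have "0 \<le> fst (\<Lambda>3 y z)" by (cases "\<Lambda>3 y z") simp
      then have "1 \<le> exp (1 * fst (\<Lambda>3 y z))" by simp
      then have "F 1 * 1 \<le> F 1 * exp (1 * fst (\<Lambda>3 y z))" by (rule mult_left_mono[OF _ F_nonneg])
      moreover have "F (picard F f n (\<Lambda>3 y z)) \<le> F 1" by (rule F_mono[OF pf(2)[OF y] Suc.IH[OF y]])
      ultimately show "\<bar>F (picard F f n (\<Lambda>3 y z))\<bar> \<le> F 1 * exp (1 * fst (\<Lambda>3 y z))" using F_nonneg by simp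
    qed simp
    also have "\<dots> \<le> F 1 * (T / 1) * 3"
    proof -
      have "exp (1 * fst z) \<le> exp 1" using z T by simp
      also have "exp 1 \<le> (3 :: real)" by (rule exp_le)
      finally have "exp (1 * fst z) \<le> 3" .
      then show ?thesis using F_nonneg T by (intro mult_left_mono) auto
    qed
    finally have 1: "duhamel (\<lambda>z. F (picard F f n z)) z \<le> 3 * F 1 * T" by simp
    have "free_wave f z \<le> fst z * m" by (rule free_wave_crude_bound[OF C2_withD(3)[OF c2] m(2) z(1)])
    also have "\<dots> \<le> T * m" using z m(1) by (intro mult_right_mono) auto
    finally show ?case using 1 Tm by simp
  qed simp
  have "unique_classical_solution_exists F f T"
    by (rule unique_solutionI[OF T(1) c2 m(2-4), of 1]) (use le1 pf(2) in auto)
  then show ?thesis using T(1) by blast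
qed

text \<open>
  The $\alpha$-integral divided by $r$ reproduces the profile. For $r$ comparable with $t$ the integral over
  $[|t - r|, \infty)$ suffices; for small $r$ the interval has length at most $2 r$, which cancels the $1/r$.
\<close>
lemma alpha_integral_bound:
  assumes t: "0 \<le> t" and r: "0 < r"
  shows "\<exists>A. ((\<lambda>\<alpha>. (1 + \<alpha>) powr (1 - p)) has_integral A) {\<bar>t - r\<bar>..t + r} \<and>
     A / (4 * r) \<le> (1 + 1 / (p - 2)) / ((1 + t + r) * (1 + \<bar>t - r\<bar>) powr (p - 2))"
proof -
  define c d where "c = \<bar>t - r\<bar>" and "d = t + r"
  define A where "A = - ((1 + d) powr (2 - p)) / (p - 2) + (1 + c) powr (2 - p) / (p - 2)"
  have cd: "0 \<le> c" "c \<le> d" using t r by (auto simp: c_def d_def)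
  have q: "0 < p - 2" using p_gt by simp
  have hi: "((\<lambda>\<alpha>. (1 + \<alpha>) powr (1 - p)) has_integral (- ((1 + d) powr (2 - p)) / (p - 2) - (- ((1 + c) powr (2 - p)) / (p - 2)))) {c..d}"
  proof (rule fundamental_theorem_of_calculus[OF cd(2)])
    fix x assume "x \<in> {c..d}"
    then have x: "0 < 1 + x" using cd by auto
    have "((\<lambda>x. 1 + x) has_real_derivative 1) (at x within {c..d})" by (auto intro!: derivative_eq_intros)
    from DERIV_chain2[OF has_real_derivative_powr[OF x, of "2 - p"] this]
    have "((\<lambda>x. (1 + x) powr (2 - p)) has_real_derivative (2 - p) * (1 + x) powr (1 - p)) (at x within {c..d})"
      by (simp add: diff_diff_eq2[symmetric] algebra_simps)
    from DERIV_cmult[OF this, of "- 1 / (p - 2)"]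
    have "((\<lambda>x. - ((1 + x) powr (2 - p)) / (p - 2)) has_real_derivative (- 1 / (p - 2)) * ((2 - p) * (1 + x) powr (1 - p))) (at x within {c..d})"
      by simp
    also have "(- 1 / (p - 2)) * ((2 - p) * (1 + x) powr (1 - p)) = (1 + x) powr (1 - p)" using q by (simp add: field_simps)
    finally have "((\<lambda>x. - ((1 + x) powr (2 - p)) / (p - 2)) has_real_derivative (1 + x) powr (1 - p)) (at x within {c..d})" .
    then show "((\<lambda>x. - ((1 + x) powr (2 - p)) / (p - 2)) has_vector_derivative (1 + x) powr (1 - p)) (at x within {c..d})"
      by (simp add: has_real_derivative_iff_has_vector_derivative)
  qed
  then have hiA: "((\<lambda>\<alpha>. (1 + \<alpha>) powr (1 - p)) has_integral A) {c..d}" by (simp add: A_def)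
  have pw: "(1 + c) powr (2 - p) = 1 / (1 + c) powr (p - 2)"
    using powr_minus_divide[of "1 + c" "p - 2"] by simp
  have pc: "0 < (1 + c) powr (p - 2)" using cd by simp
  have A1: "A \<le> (1 / (1 + c) powr (p - 2)) / (p - 2)"
    unfolding A_def pw using q by simp
  have A2: "A \<le> 2 * r * (1 + c) powr (1 - p)"
  proof -
    have "A \<le> integral {c..d} (\<lambda>\<alpha>. (1 + c) powr (1 - p))"
      by (rule has_integral_le[OF hiA integrable_integral[OF integrable_const_ivl]])
        (use cd p_gt in \<open>auto intro!: powr_mono2'\<close>)
    also have "\<dots> = (d - c) * (1 + c) powr (1 - p)" using cd by simp
    also have "\<dots> \<le> 2 * r * (1 + c) powr (1 - p)"
      by (rule mult_right_mono) (use t r in \<open>auto simp: c_def d_def\<close>)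
    finally show ?thesis .
  qed
  have pos: "0 < 1 + t + r" using t r by simp
  have "A / (4 * r) \<le> (1 + 1 / (p - 2)) / ((1 + t + r) * (1 + c) powr (p - 2))"
  proof (cases "1 + t + r \<le> 4 * r")
    case True
    have "A / (4 * r) \<le> ((1 / (1 + c) powr (p - 2)) / (p - 2)) / (4 * r)"
      by (rule divide_right_mono[OF A1]) (use r in simp)
    also have "\<dots> \<le> ((1 / (1 + c) powr (p - 2)) / (p - 2)) / (1 + t + r)"
      by (rule divide_left_mono[OF True]) (use pc q pos r in auto)
    also have "\<dots> = (1 / (p - 2)) / ((1 + t + r) * (1 + c) powr (p - 2))" by simp
    also have "\<dots> \<le> (1 + 1 / (p - 2)) / ((1 + t + r) * (1 + c) powr (p - 2))"
      by (rule divide_right_mono) (use pc pos in auto)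
    finally show ?thesis .
  next
    case False
    then have "3 * r < 1 + t" by simp
    moreover have "t - r \<le> c" unfolding c_def by (rule abs_ge_self)
    ultimately have c2: "1 + t + r \<le> 2 * (1 + c)" by (simp add: algebra_simps)
    have "(1 + c) powr (1 - p) = (1 + c) powr (2 - p) / (1 + c)"
      using cd powr_diff[of "1 + c" "2 - p" 1] by simp
    then have e: "(1 + c) powr (1 - p) = 1 / ((1 + c) powr (p - 2) * (1 + c))" by (simp add: pw)
    have "A / (4 * r) \<le> (2 * r * (1 + c) powr (1 - p)) / (4 * r)"
      by (rule divide_right_mono[OF A2]) (use r in simp)
    also have "\<dots> = 1 / (2 * ((1 + c) powr (p - 2) * (1 + c)))"
    proof -
      have g: "2 * r * (1 / X) / (4 * r) = 1 / (2 * X)" for X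
        by (cases "X = 0") (use r in \<open>auto simp: field_simps\<close>)
      show ?thesis unfolding e by (rule g)
    qed
    also have "\<dots> = 1 / ((1 + c) powr (p - 2) * (2 * (1 + c)))" by (simp only: mult.left_commute)
    also have "\<dots> \<le> 1 / ((1 + c) powr (p - 2) * (1 + t + r))"
      by (intro divide_left_mono mult_left_mono c2) (use pc pos cd in auto)
    also have "\<dots> \<le> (1 + 1 / (p - 2)) / ((1 + t + r) * (1 + c) powr (p - 2))"
      using q pc pos by (subst mult.commute, intro divide_right_mono) auto
    finally show ?thesis .
  qed
  then show ?thesis using hiA unfolding c_def d_def by blast
qed

text \<open>
  The $\beta$-integral in the barrier argument is $A_\varepsilon$ up to the shift from $T$ to $1 + T$.
\<close>
lemma J_tail_integral:
  assumes e: "0 < \<epsilon>" and T: "0 < T"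
  shows "((\<lambda>\<beta>. \<mu> (\<epsilon> / (1 + \<beta>)) powr p / (1 + \<beta>)) has_integral J (\<epsilon> / (1 + T)) \<epsilon>) {0..T}"
proof -
  let ?g = "\<lambda>\<beta>. \<epsilon> / (1 + \<beta>)"
  have "((\<lambda>\<beta>. (- \<epsilon> / (1 + \<beta>)\<^sup>2) *\<^sub>R dens (?g \<beta>)) has_integral (integral {?g 0..?g T} dens - integral {?g T..?g 0} dens)) {0..T}"
  proof (rule has_integral_substitution_general[OF finite.emptyI])
    show "?g ` {0..T} \<subseteq> {\<epsilon> / (1 + T)..\<epsilon>}"
    proof
      fix y assume "y \<in> ?g ` {0..T}"
      then obtain x where x: "0 \<le> x" "x \<le> T" "y = \<epsilon> / (1 + x)" by auto
      have "\<epsilon> / (1 + T) \<le> \<epsilon> / (1 + x)" using x e by (intro divide_left_mono) auto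
      moreover have "\<epsilon> / (1 + x) \<le> \<epsilon> / 1" using x e by (intro divide_left_mono) auto
      ultimately show "y \<in> {\<epsilon> / (1 + T)..\<epsilon>}" using x by simp
    qed
    show "continuous_on {\<epsilon> / (1 + T)..\<epsilon>} dens" by (rule dens_cont) (use e T in simp)
    fix x assume "x \<in> {0..T} - {}"
    then have x: "0 < 1 + x" by auto
    show "(?g has_real_derivative (- \<epsilon> / (1 + x)\<^sup>2)) (at x within {0..T})"
      using x by (auto intro!: derivative_eq_intros simp: power2_eq_square field_simps)
  qed (use T in \<open>auto intro!: continuous_intros\<close>)
  moreover have "\<epsilon> / (1 + T) < \<epsilon> / 1" using e T by (intro divide_strict_left_mono) auto
  ultimately have "((\<lambda>\<beta>. (- \<epsilon> / (1 + \<beta>)\<^sup>2) *\<^sub>R dens (?g \<beta>)) has_integral - J (\<epsilon> / (1 + T)) \<epsilon>) {0..T}"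
    by (simp add: J_def)
  from has_integral_neg[OF this]
  have h: "((\<lambda>\<beta>. - ((- \<epsilon> / (1 + \<beta>)\<^sup>2) *\<^sub>R dens (?g \<beta>))) has_integral J (\<epsilon> / (1 + T)) \<epsilon>) {0..T}" by simp
  show ?thesis
  proof (rule has_integral_eq[OF _ h])
    fix x assume "x \<in> {0..T}"
    then have "0 < 1 + x" by auto
    then show "- ((- \<epsilon> / (1 + x)\<^sup>2) *\<^sub>R dens (?g x)) = \<mu> (\<epsilon> / (1 + x)) powr p / (1 + x)"
      using e by (simp add: dens_def power2_eq_square)
  qed
qed

lemma J_shifted_le:
  assumes e: "0 < \<epsilon>" "\<epsilon> \<le> 1" and T: "1 \<le> T"
  shows "J (\<epsilon> / (1 + T)) \<epsilon> \<le> A_fun p \<mu> \<epsilon> T + \<mu> 1 powr p * ln 2"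
proof -
  have o: "\<epsilon> / (1 + T) \<le> \<epsilon> / T" "\<epsilon> / T \<le> \<epsilon>" "0 < \<epsilon> / (1 + T)"
    using e T frac_le[of \<epsilon> \<epsilon> 1 T] by (auto intro: divide_left_mono)
  have "J (\<epsilon> / (1 + T)) (\<epsilon> / T) \<le> \<mu> (\<epsilon> / T) powr p * ln ((\<epsilon> / T) / (\<epsilon> / (1 + T)))" by (rule J_upper) (use o in auto)
  also have "\<dots> \<le> \<mu> 1 powr p * ln 2"
  proof (rule mult_mono)
    show "\<mu> (\<epsilon> / T) powr p \<le> \<mu> 1 powr p"
      using e T o p_gt mu_nonneg by (intro powr_mono2 mu_mono) auto
    have "(\<epsilon> / T) / (\<epsilon> / (1 + T)) = (1 + T) / T" using e T by simp
    also have "\<dots> \<le> 2" using T by (simp add: field_simps)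
    finally show "ln ((\<epsilon> / T) / (\<epsilon> / (1 + T))) \<le> ln 2" using e T by (subst ln_le_cancel_iff) auto
    have "1 \<le> (\<epsilon> / T) / (\<epsilon> / (1 + T))" using e T by (simp add: field_simps)
    then show "0 \<le> ln ((\<epsilon> / T) / (\<epsilon> / (1 + T)))" by (rule ln_ge_zero)
  qed simp
  finally show ?thesis using J_split[OF o(3,1,2)] A_fun_eq_J[OF e(1) T] by simp
qed

text \<open>
  The barrier is \<open>W\<close> below: a bound for the free wave in a shell around the light cone plus \<open>W2\<close>, the
  self-reproducing profile with amplitude $N \varepsilon^p \mu(\varepsilon / (1 + |t - r|))$. In the Duhamel
  integral the source is estimated in three regions: outside the cone ($\beta < -(R + 1)$) the iterates vanish
  by finite speed of propagation; in the shell $F$ of the free-wave bound contributes a multiple of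
  $\varepsilon^p$; inside the cone $F(W2)$ contributes $N^p \varepsilon^{p^2}$ times the integral of
  $\mu^p / \beta$. With the choice of \<open>N\<close> the second is at most half of \<open>W2\<close>, and with that of
  \<open>c\<close> the third is at most the other half.
\<close>
theorem existence_while_A_fun_small:
  assumes f: "C2_compact_support f" and rad: "radial f" and f0: "\<And>x. 0 \<le> f x"
  shows "\<exists>c>0. \<exists>\<epsilon>\<^sub>0>0. \<forall>\<epsilon>\<in>{0<..\<epsilon>\<^sub>0}. \<forall>T\<ge>1. A_fun p \<mu> \<epsilon> T \<le> c * \<epsilon> powr (- p * (p - 1)) \<longrightarrow>
     unique_classical_solution_exists F (\<lambda>x. \<epsilon> * f x) T"
proof -
  obtain f' f'' R m where c2: "C2_with UNIV f f' f''" and R: "0 < R" "\<And>x. R < norm x \<Longrightarrow> f x = 0"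
    and m: "0 < m" "\<And>x. \<bar>f x\<bar> \<le> m" "\<And>x. norm (f' x) \<le> m" "\<And>x. norm (f'' x) \<le> m"
    by (rule C2_compact_supportE[OF f]) metis
  obtain s0 where s0: "0 < s0" "s0 \<le> 1" and slow: "\<And>s s'. 0 < s \<Longrightarrow> s \<le> s' \<Longrightarrow> s' \<le> s0 \<Longrightarrow> \<mu> s' \<le> sqrt (s' / s) * \<mu> s"
    using slow_variation by blast
  define q where "q = p - 2"
  have q: "0 < q" "p * q = 1" using p_gt p_square by (auto simp: q_def)
  have p0: "0 < p" "1 < p" using p_gt by auto
  \<comment> \<open>K0 bounds the free wave, C1 the $\alpha$-integral, and K1 the effect of $F$ on the shell; $N$ makes the
  contribution of the shell half of the barrier, and $c$ that of the interior\<close>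
  define K0 where "K0 = (R + 1)\<^sup>2 * (R + 3) * m + 1"
  have K0: "1 \<le> K0" using R m by (simp add: K0_def)
  define C1 where "C1 = 1 + 1 / q"
  have C1: "0 < C1" using q by (simp add: C1_def add_pos_pos)
  define K1 where "K1 = (2 * K0) powr p * sqrt (2 * K0)"
  have K1: "0 < K1" using K0 by (simp add: K1_def)
  define N where "N = 4 * C1 * (R + 1) * K1"
  have N: "0 < N" using C1 R K1 by (simp add: N_def)
  define M0 where "M0 = \<mu> 1 powr p * ln 2"
  have M0: "0 \<le> M0" by (simp add: M0_def)
  define c where "c = 1 / (4 * C1 * N powr (p - 1))"
  have c: "0 < c" using C1 N by (simp add: c_def)
  have mu1: "0 < \<mu> 1" using mu_pos by simp
  have pw0: "((\<lambda>\<epsilon>. \<epsilon> powr a) \<longlongrightarrow> 0) (at_right 0)" if "0 < a" for a :: real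
    by (rule tendsto_zero_powrI[OF tendsto_ident_at tendsto_const _ that]) (auto simp: eventually_at_filter)
  have "\<forall>\<^sub>F \<epsilon> in at_right 0. N * \<mu> 1 * \<epsilon> powr (p - 1) < 1"
    using order_tendstoD(2)[OF tendsto_mult_left[OF pw0, of "p - 1" "N * \<mu> 1"], of 1] p0 by simp
  moreover have "\<forall>\<^sub>F \<epsilon> in at_right 0. M0 * \<epsilon> powr (p * (p - 1)) < c"
    using order_tendstoD(2)[OF tendsto_mult_left[OF pw0, of "p * (p - 1)" M0], of c] p0 c by simp
  ultimately have "\<forall>\<^sub>F \<epsilon> in at_right 0. N * \<mu> 1 * \<epsilon> powr (p - 1) < 1 \<and> M0 * \<epsilon> powr (p * (p - 1)) < c"
    by eventually_elim simp
  then obtain b0 where b0: "0 < b0" "\<And>\<epsilon>. 0 < \<epsilon> \<Longrightarrow> \<epsilon> < b0 \<Longrightarrow> N * \<mu> 1 * \<epsilon> powr (p - 1) < 1 \<and> M0 * \<epsilon> powr (p * (p - 1)) < c"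
    unfolding eventually_at_right_field by auto
  define \<epsilon>0 where "\<epsilon>0 = min (b0 / 2) (min 1 (s0 / (2 * K0)))"
  have \<epsilon>0: "0 < \<epsilon>0" using b0 s0 K0 by (simp add: \<epsilon>0_def)
  have main: "unique_classical_solution_exists F (\<lambda>x. \<epsilon> * f x) T"
    if e: "0 < \<epsilon>" "\<epsilon> \<le> \<epsilon>0" and T1: "1 \<le> T" and A: "A_fun p \<mu> \<epsilon> T \<le> c * \<epsilon> powr (- p * (p - 1))" for \<epsilon> T
  proof -
    have "\<epsilon> \<le> 1" "\<epsilon> \<le> s0 / (2 * K0)" "\<epsilon> \<le> b0 / 2" using e(2) by (simp_all add: \<epsilon>0_def)
    then have e1: "\<epsilon> \<le> 1" "2 * K0 * \<epsilon> \<le> s0" "\<epsilon> < b0" using b0(1) K0 by (auto simp: field_simps)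
    have sm: "N * \<mu> 1 * \<epsilon> powr (p - 1) \<le> 1" "M0 * \<epsilon> powr (p * (p - 1)) \<le> c" using b0(2)[OF e(1) e1(3)] by auto
    have epm: "\<epsilon> powr p = \<epsilon> * \<epsilon> powr (p - 1)" using e powr_add[of \<epsilon> 1 "p - 1"] by simp
    have sm1: "N * \<epsilon> powr p * \<mu> 1 \<le> \<epsilon>"
      using mult_left_mono[OF sm(1), of \<epsilon>] e epm by (simp add: mult_ac)
    have T: "0 < T" using T1 by simp
    define h where "h = (\<lambda>x. \<epsilon> * f x)"
    have hc2: "C2_with UNIV h (\<lambda>x. \<epsilon> *\<^sub>R f' x) (\<lambda>x. \<epsilon> *\<^sub>R f'' x)" unfolding h_def by (rule C2_with_cmult[OF c2])
    have hrad: "radial h" using rad unfolding radial_def h_def by metis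
    have h0: "0 \<le> h x" for x using f0 e by (simp add: h_def)
    have hR: "h x = 0" if "R < norm x" for x using R(2)[OF that] by (simp add: h_def)
    note pf = picard_facts[OF T hc2 hrad h0]
    \<comment> \<open>a continuous cutoff to the shell, so that the barrier extends continuously to $r = 0$\<close>
    define cut where "cut \<beta> = max 0 (min 1 (R + 1 - \<bar>\<beta>\<bar>))" for \<beta> :: real
    have cut: "0 \<le> cut \<beta>" "cut \<beta> \<le> 1" "\<bar>\<beta>\<bar> \<le> R \<Longrightarrow> cut \<beta> = 1" "R + 1 < \<beta> \<Longrightarrow> cut \<beta> = 0" for \<beta>
      by (auto simp: cut_def)
    define mb where "mb \<beta> = \<mu> (\<epsilon> / (1 + \<bar>\<beta>\<bar>))" for \<beta>
    have mb: "0 < mb \<beta>" "mb \<beta> \<le> \<mu> 1" for \<beta>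
    proof -
      show "0 < mb \<beta>" using mu_pos e by (simp add: mb_def add_pos_nonneg)
      have "\<epsilon> / (1 + \<bar>\<beta>\<bar>) \<le> 1 / 1" using e e1 by (intro frac_le) auto
      then show "mb \<beta> \<le> \<mu> 1" unfolding mb_def using e by (intro mu_mono) auto
    qed
    define W2 where "W2 t r = N * \<epsilon> powr p * mb (t - r) / ((1 + t + r) * (1 + \<bar>t - r\<bar>) powr q)" for t r
    define W where "W t r = \<epsilon> * K0 / (1 + t + r) * cut (t - r) + W2 t r" for t r
    have W2: "0 \<le> W2 t r" "W2 t r \<le> \<epsilon> / (1 + t + r)" if "0 \<le> t" "0 \<le> r" for t r
    proof -
      have pos: "0 < 1 + t + r" using that by simp
      show "0 \<le> W2 t r" unfolding W2_def using N mb(1)[of "t - r"] pos by simp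
      have "W2 t r \<le> N * \<epsilon> powr p * \<mu> 1 / ((1 + t + r) * 1)"
        unfolding W2_def
      proof (rule frac_le)
        show "(1 + t + r) * 1 \<le> (1 + t + r) * (1 + \<bar>t - r\<bar>) powr q"
          using pos q by (intro mult_left_mono ge_one_powr_ge_zero) auto
      qed (use N mb mu1 pos in \<open>auto intro!: mult_left_mono\<close>)
      also have "\<dots> \<le> \<epsilon> / (1 + t + r)" using sm1 pos by (simp add: divide_right_mono)
      finally show "W2 t r \<le> \<epsilon> / (1 + t + r)" .
    qed
    have barrier: "\<forall>t\<in>{0..T}. \<forall>r\<ge>0. picard F h n (t, r *\<^sub>R e3) \<le> W t r" for n
    proof (induction n)
      case 0
      show ?case
      proof (intro ballI allI impI)
        fix t r :: real assume "t \<in> {0..T}" "0 \<le> r"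
        then show "picard F h 0 (t, r *\<^sub>R e3) \<le> W t r"
          using W2(1)[of t r] cut(1)[of "t - r"] e K0 by (simp add: W_def)
      qed
    next
      case (Suc n)
      have pos_case: "picard F h (Suc n) (t, r *\<^sub>R e3) \<le> W t r" if t: "t \<in> {0..T}" and r: "0 < r" for t r
      proof -
        have t0: "0 \<le> t" "t \<le> T" using t by auto
        have pos: "0 < 1 + t + r" using t0 r by simp
        have free: "free_wave h (t, r *\<^sub>R e3) \<le> \<epsilon> * K0 / (1 + t + r) * cut (t - r)"
        proof (cases "\<bar>t - r\<bar> \<le> R")
          case True
          have "free_wave f (t, r *\<^sub>R e3) \<le> (R + 1)\<^sup>2 * (R + 3) * m / (1 + t + r)"
            by (rule free_wave_decay[OF C2_withD(3)[OF c2] rad m(2) f0 R(1) R(2) t0(1) less_imp_le[OF r]]) simp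
          also have "\<dots> \<le> K0 / (1 + t + r)" using pos by (intro divide_right_mono) (auto simp: K0_def)
          finally have "\<epsilon> * free_wave f (t, r *\<^sub>R e3) \<le> \<epsilon> * (K0 / (1 + t + r))" using e by (intro mult_left_mono) auto
          then show ?thesis using cut(3)[OF True] by (simp add: h_def free_wave_cmult)
        next
          case False
          have "free_wave h (t, r *\<^sub>R e3) = 0" by (rule free_wave_support[OF hR t0(1)]) (use False r in auto)
          then show ?thesis using cut(1) e K0 pos by simp
        qed
        define mt where "mt = mb (t - r)"
        \<comment> \<open>the $\beta$-integrand contributed by the interior of the cone; \<open>b\<close> adds that of the shell, and
        both carry the factor $\mu(\varepsilon / (1 + |t - r|))$, which up to a constant bounds $\mu(u)$ from above\<close>
        define d2 where "d2 \<beta> = N powr p * \<epsilon> powr (p * p) * (\<mu> (\<epsilon> / (1 + \<beta>)) powr p / (1 + \<beta>))" for \<beta>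
        define b where "b \<beta> = mt * ((if \<beta> \<in> {- (R + 1)..R + 1} then K1 * \<epsilon> powr p else 0) + (if \<beta> \<in> {0..T} then d2 \<beta> else 0))" for \<beta>
        define Bd where "Bd = mt * (2 * (R + 1) * (K1 * \<epsilon> powr p) + N powr p * \<epsilon> powr (p * p) * J (\<epsilon> / (1 + T)) \<epsilon>)"
        have mt: "0 < mt" using mb by (simp add: mt_def)
        have d20: "0 \<le> d2 \<beta>" if "0 \<le> \<beta>" for \<beta> using that by (simp add: d2_def)
        have b0: "0 \<le> b \<beta>" for \<beta> using mt K1 d20 by (simp add: b_def)
        have bI: "(b has_integral Bd) UNIV"
        proof -
          have 1: "((\<lambda>\<beta>. if \<beta> \<in> {- (R + 1)..R + 1} then K1 * \<epsilon> powr p else 0) has_integral (2 * (R + 1) * (K1 * \<epsilon> powr p))) UNIV"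
            unfolding has_integral_restrict_UNIV using has_integral_const_real[of "K1 * \<epsilon> powr p" "- (R + 1)" "R + 1"] R by simp
          have 2: "((\<lambda>\<beta>. if \<beta> \<in> {0..T} then d2 \<beta> else 0) has_integral (N powr p * \<epsilon> powr (p * p) * J (\<epsilon> / (1 + T)) \<epsilon>)) UNIV"
            unfolding has_integral_restrict_UNIV d2_def by (rule has_integral_mult_right[OF J_tail_integral[OF e(1) T]])
          show ?thesis unfolding b_def[abs_def] Bd_def by (rule has_integral_mult_right[OF has_integral_add[OF 1 2]])
        qed
        have Bd0: "0 \<le> Bd" using has_integral_nonneg[OF bI] b0 by simp
        have bm: "b \<in> borel_measurable borel"
        proof -
          have "continuous_on {0..T} d2" unfolding d2_def
            by (intro continuous_intros continuous_on_compose2[OF mu_cont]) (use e p0 mu_pos in \<open>auto simp: less_imp_neq[symmetric] divide_nonneg_nonneg\<close>)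
          then have "(\<lambda>\<beta>. indicator {0..T} \<beta> *\<^sub>R d2 \<beta>) \<in> borel_measurable borel"
            by (rule borel_measurable_continuous_on_indicator[rotated]) simp
          moreover have "(\<lambda>\<beta>. indicator {0..T} \<beta> *\<^sub>R d2 \<beta>) = (\<lambda>\<beta>. if \<beta> \<in> {0..T} then d2 \<beta> else 0)" by (auto simp: indicator_def)
          ultimately have [measurable]: "(\<lambda>\<beta>. if \<beta> \<in> {0..T} then d2 \<beta> else 0) \<in> borel_measurable borel" by simp
          have [measurable]: "(\<lambda>\<beta>. if \<beta> \<in> {- (R + 1)..R + 1} then K1 * \<epsilon> powr p else 0) \<in> borel_measurable borel"
            by (intro measurable_If_set) auto
          show ?thesis unfolding b_def[abs_def] by measurable
        qed
        have bN: "(\<integral>\<^sup>+ x. ennreal (b x) * indicator {..t - r} x \<partial>lborel) \<le> ennreal Bd"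
        proof -
          have "(\<integral>\<^sup>+ x. ennreal (b x) * indicator {..t - r} x \<partial>lborel) \<le> (\<integral>\<^sup>+ x. ennreal (indicator UNIV x * b x) \<partial>lborel)"
            by (rule nn_integral_mono) (auto simp: indicator_def)
          also have "\<dots> = ennreal Bd" by (rule nn_integral_has_integral_lebesgue[OF _ bI]) (rule b0)
          finally show ?thesis .
        qed
        obtain Ai where Ai: "((\<lambda>\<alpha>. (1 + \<alpha>) powr (1 - p)) has_integral Ai) {\<bar>t - r\<bar>..t + r}"
            "Ai / (4 * r) \<le> C1 / ((1 + t + r) * (1 + \<bar>t - r\<bar>) powr q)"
          using alpha_integral_bound[OF t0(1) r] unfolding C1_def q_def by blast
        have "duhamel (\<lambda>z. F (picard F h n z)) (t, r *\<^sub>R e3) \<le> Ai * Bd / (4 * r)"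
        proof (rule duhamel_upper[where a="\<lambda>\<alpha>. (1 + \<alpha>) powr (1 - p)" and g="\<lambda>z. F (picard F h n z)", OF pf(4) F_nonneg pf(5) t r _ _ Ai(1) b0 bN bm Bd0])
          fix s l assume sl: "0 \<le> s" "s \<le> t" "0 \<le> l" "\<bar>t - r\<bar> \<le> s + l" "s + l \<le> t + r" "s - l \<le> t - r"
          define u where "u = picard F h n (s, l *\<^sub>R e3)"
          have sT: "s \<in> {0..T}" "(s, l *\<^sub>R e3) \<in> ST T" using sl t0 by auto
          have u0: "0 \<le> u" unfolding u_def by (rule pf(2)[OF sT(2)])
          have uW: "u \<le> W s l" unfolding u_def using Suc sT sl by blast
          define \<alpha> \<beta> where "\<alpha> = s + l" and "\<beta> = s - l"
          have al: "0 \<le> \<alpha>" "0 < 1 + \<alpha>" "l \<le> 1 + \<alpha>" "1 + s + l = 1 + \<alpha>" using sl by (auto simp: \<alpha>_def)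
          have lal: "l * (X / (1 + \<alpha>) powr p) \<le> (1 + \<alpha>) powr (1 - p) * X" if "0 \<le> X" for X
          proof -
            have "(1 + \<alpha>) powr (1 - p) = (1 + \<alpha>) / (1 + \<alpha>) powr p" using al by (simp add: powr_diff)
            moreover have "l * (X / (1 + \<alpha>) powr p) \<le> (1 + \<alpha>) * (X / (1 + \<alpha>) powr p)"
              using al that by (intro mult_right_mono) auto
            ultimately show ?thesis by simp
          qed
          have mua: "\<mu> (\<epsilon> / (1 + \<alpha>)) \<le> mt" unfolding mt_def mb_def
            using e al sl by (intro mu_mono divide_left_mono) (auto simp: \<alpha>_def)
          have "l * F u \<le> (1 + \<alpha>) powr (1 - p) * b \<beta>"
          proof -
            consider "\<beta> < - (R + 1)" | "\<bar>\<beta>\<bar> \<le> R + 1" | "R + 1 < \<beta>" by linarith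
            then show ?thesis
            proof cases
              case 1
              have "u = 0" unfolding u_def
                by (rule picard_support[OF T hR R(1) sT(2)]) (use 1 sl in \<open>auto simp: \<beta>_def\<close>)
              then show ?thesis using b0[of \<beta>] by simp
            next
              case 2
              define \<sigma> where "\<sigma> = \<epsilon> / (1 + \<alpha>)"
              have \<sigma>: "0 < \<sigma>" "\<sigma> \<le> \<epsilon>" using e al by (auto simp: \<sigma>_def field_simps)
              have "W s l \<le> \<epsilon> * K0 / (1 + \<alpha>) * 1 + \<epsilon> / (1 + \<alpha>)"
                unfolding W_def al(4)[symmetric] using W2(2)[of s l] sl cut(2) e K0 by (intro add_mono mult_left_mono) auto
              also have "\<dots> \<le> 2 * K0 * \<sigma>"
              proof -
                have "1 * \<sigma> \<le> K0 * \<sigma>" using K0 \<sigma> by (intro mult_right_mono) auto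
                moreover have "\<epsilon> * K0 / (1 + \<alpha>) * 1 + \<epsilon> / (1 + \<alpha>) = K0 * \<sigma> + \<sigma>" by (simp add: \<sigma>_def)
                ultimately show ?thesis by simp
              qed
              finally have uu: "u \<le> 2 * K0 * \<sigma>" using uW by linarith
              have "F u \<le> F (2 * K0 * \<sigma>)" by (rule F_mono[OF u0 uu])
              also have "\<dots> = (2 * K0 * \<sigma>) powr p * \<mu> (2 * K0 * \<sigma>)" using K0 \<sigma> by (simp add: F_pos_eq)
              also have "\<dots> \<le> (2 * K0 * \<sigma>) powr p * (sqrt (2 * K0) * \<mu> \<sigma>)"
              proof (rule mult_left_mono)
                have "2 * K0 * \<sigma> \<le> s0" using mult_left_mono[OF \<sigma>(2), of "2 * K0"] K0 e1 by linarith
                moreover have "\<sigma> \<le> 2 * K0 * \<sigma>" using mult_right_mono[of 1 "2 * K0" \<sigma>] K0 \<sigma> by simp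
                ultimately have "\<mu> (2 * K0 * \<sigma>) \<le> sqrt (2 * K0 * \<sigma> / \<sigma>) * \<mu> \<sigma>" using slow \<sigma> by blast
                then show "\<mu> (2 * K0 * \<sigma>) \<le> sqrt (2 * K0) * \<mu> \<sigma>" using \<sigma> by simp
              qed simp
              also have "\<dots> \<le> (2 * K0 * \<sigma>) powr p * (sqrt (2 * K0) * mt)"
                using mua K0 by (intro mult_left_mono) (auto simp: \<sigma>_def)
              also have "\<dots> = (mt * (K1 * \<epsilon> powr p)) / (1 + \<alpha>) powr p"
                using e al K0 by (simp add: K1_def \<sigma>_def powr_mult powr_divide)
              finally have "l * F u \<le> l * ((mt * (K1 * \<epsilon> powr p)) / (1 + \<alpha>) powr p)" using sl by (intro mult_left_mono)
              also have "\<dots> \<le> (1 + \<alpha>) powr (1 - p) * (mt * (K1 * \<epsilon> powr p))" by (rule lal) (use mt K1 in simp)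
              also have "\<dots> \<le> (1 + \<alpha>) powr (1 - p) * b \<beta>"
              proof (rule mult_left_mono)
                have "\<beta> \<in> {- (R + 1)..R + 1}" using 2 by auto
                moreover have "0 \<le> (if \<beta> \<in> {0..T} then d2 \<beta> else 0)" using d20[of \<beta>] by simp
                ultimately show "mt * (K1 * \<epsilon> powr p) \<le> b \<beta>" unfolding b_def using mt by (intro mult_left_mono) auto
              qed simp
              finally show ?thesis .
            next
              case 3
              have bT: "\<beta> \<in> {0..T}" "0 < 1 + \<beta>" "\<bar>\<beta>\<bar> = \<beta>" using 3 R sl t0 by (auto simp: \<beta>_def)
              define Y where "Y = N * \<epsilon> powr p * \<mu> (\<epsilon> / (1 + \<beta>)) / ((1 + \<alpha>) * (1 + \<beta>) powr q)"
              have WY: "W s l = Y" unfolding W_def W2_def Y_def mb_def using cut(4)[of "s - l"] 3 bT(3) al(4) by (simp add: \<beta>_def)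
              have Y: "0 \<le> Y" "Y \<le> \<epsilon> / (1 + \<alpha>)"
                using W2[of s l] sl WY cut(4)[of "s - l"] 3 al(4) unfolding W_def by (auto simp: \<beta>_def)
              have muY: "\<mu> Y \<le> mt" using mu_mono[OF Y] mua by linarith
              have mu0: "0 \<le> \<mu> (\<epsilon> / (1 + \<beta>))" using mu_nonneg e bT by simp
              have "F u \<le> F Y" using F_mono[OF u0] uW WY by simp
              also have "\<dots> = Y powr p * \<mu> Y" by (rule F_pos_eq[OF Y(1)])
              also have "\<dots> \<le> Y powr p * mt" by (rule mult_left_mono[OF muY]) simp
              also have "Y powr p = d2 \<beta> / (1 + \<alpha>) powr p"
              proof -
                have "((1 + \<beta>) powr q) powr p = 1 + \<beta>" using bT q by (simp add: powr_powr mult.commute)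
                then show ?thesis unfolding Y_def d2_def using N e mu0 al bT
                  by (simp add: powr_mult powr_divide powr_powr)
              qed
              finally have "l * F u \<le> l * ((mt * d2 \<beta>) / (1 + \<alpha>) powr p)" using sl by (intro mult_left_mono) (auto simp: mult.commute)
              also have "\<dots> \<le> (1 + \<alpha>) powr (1 - p) * (mt * d2 \<beta>)" by (rule lal) (use mt d20 bT in simp)
              also have "\<dots> \<le> (1 + \<alpha>) powr (1 - p) * b \<beta>"
              proof (rule mult_left_mono)
                have "0 \<le> (if \<beta> \<in> {- (R + 1)..R + 1} then K1 * \<epsilon> powr p else 0)" using K1 by simp
                then show "mt * d2 \<beta> \<le> b \<beta>" unfolding b_def using bT(1) mt by (intro mult_left_mono) auto
              qed simp
              finally show ?thesis .
            qed
          qed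
          then show "l * F (picard F h n (s, l *\<^sub>R e3)) \<le> (1 + (s + l)) powr (1 - p) * b (s - l)"
            by (simp add: u_def \<alpha>_def \<beta>_def)
        qed auto
        also have "\<dots> = Ai / (4 * r) * Bd" by simp
        also have "\<dots> \<le> C1 / ((1 + t + r) * (1 + \<bar>t - r\<bar>) powr q) * Bd" by (rule mult_right_mono[OF Ai(2) Bd0])
        also have "\<dots> = (C1 * Bd) / ((1 + t + r) * (1 + \<bar>t - r\<bar>) powr q)" by simp
        also have "\<dots> \<le> (N * \<epsilon> powr p * mt) / ((1 + t + r) * (1 + \<bar>t - r\<bar>) powr q)"
        proof (rule divide_right_mono)
          have epp: "\<epsilon> powr (p * p) = \<epsilon> powr p * \<epsilon> powr (p * (p - 1))"
            using powr_add[of \<epsilon> p "p * (p - 1)"] by (simp add: algebra_simps)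
          have NN: "N powr p = N * N powr (p - 1)" using N powr_add[of N 1 "p - 1"] by simp
          have "\<epsilon> powr (p * (p - 1)) * J (\<epsilon> / (1 + T)) \<epsilon> \<le> \<epsilon> powr (p * (p - 1)) * (A_fun p \<mu> \<epsilon> T + M0)"
            using J_shifted_le[OF e(1) e1(1) T1] by (intro mult_left_mono) (auto simp: M0_def)
          also have "\<dots> \<le> c + c"
          proof -
            have "\<epsilon> powr (p * (p - 1)) * A_fun p \<mu> \<epsilon> T \<le> \<epsilon> powr (p * (p - 1)) * (c * \<epsilon> powr (- p * (p - 1)))"
              by (rule mult_left_mono[OF A]) simp
            also have "\<dots> = c" using e powr_add[of \<epsilon> "p * (p - 1)" "- p * (p - 1)"] by simp
            finally show ?thesis using sm(2)
              unfolding distrib_left by (simp add: mult.commute)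
          qed
          finally have "C1 * (N powr p * (\<epsilon> powr (p * (p - 1)) * J (\<epsilon> / (1 + T)) \<epsilon>)) \<le> C1 * (N powr p * (2 * c))"
            using C1 N by (intro mult_left_mono) auto
          also have "\<dots> = N / 2" unfolding NN c_def using C1 N by simp
          finally have x: "C1 * (N powr p * (\<epsilon> powr (p * (p - 1)) * J (\<epsilon> / (1 + T)) \<epsilon>)) \<le> N / 2" .
          have y: "C1 * (2 * (R + 1) * K1) = N / 2" unfolding N_def by simp
          have "C1 * Bd = (mt * \<epsilon> powr p) * (C1 * (2 * (R + 1) * K1) + C1 * (N powr p * (\<epsilon> powr (p * (p - 1)) * J (\<epsilon> / (1 + T)) \<epsilon>)))"
            unfolding Bd_def epp by (simp add: distrib_left mult_ac)
          also have "\<dots> \<le> (mt * \<epsilon> powr p) * (N / 2 + N / 2)"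
            using x mt unfolding y by (intro mult_left_mono) auto
          finally show "C1 * Bd \<le> N * \<epsilon> powr p * mt" by (simp add: mult_ac)
        qed (use pos in simp)
        also have "\<dots> = W2 t r" by (simp add: W2_def mt_def)
        finally have "duhamel (\<lambda>z. F (picard F h n z)) (t, r *\<^sub>R e3) \<le> W2 t r" .
        then show ?thesis using free by (simp add: W_def)
      qed
      show ?case
      proof (intro ballI allI impI)
        fix t r :: real assume t: "t \<in> {0..T}" and r: "0 \<le> r"
        show "picard F h (Suc n) (t, r *\<^sub>R e3) \<le> W t r"
        proof (cases "r = 0")
          case False
          then show ?thesis using pos_case[OF t] r by simp
        next
          case True
          \<comment> \<open>characteristic coordinates need $r > 0$; the axis follows by continuity\<close>
          have l0: "(\<lambda>k. 1 / real (Suc k)) \<longlonglongrightarrow> 0" using LIMSEQ_inverse_real_of_nat by (simp add: inverse_eq_divide)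
          have cu: "continuous_on {0..} (\<lambda>r. picard F h (Suc n) (t, r *\<^sub>R e3))"
            by (rule continuous_on_compose2[OF pf(1)]) (use t in \<open>auto intro!: continuous_intros\<close>)
          have cW: "continuous_on {0..} (W t)"
            unfolding W_def[abs_def] W2_def mb_def cut_def using t e
            by (intro continuous_intros continuous_on_compose2[OF mu_cont]) (auto simp: divide_nonneg_nonneg add_nonneg_eq_0_iff)
          have "(\<lambda>k. picard F h (Suc n) (t, (1 / real (Suc k)) *\<^sub>R e3)) \<longlonglongrightarrow> picard F h (Suc n) (t, 0 *\<^sub>R e3)"
            by (rule continuous_on_tendsto_compose[OF cu l0]) auto
          moreover have "(\<lambda>k. W t (1 / real (Suc k))) \<longlonglongrightarrow> W t 0"
            by (rule continuous_on_tendsto_compose[OF cW l0]) auto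
          moreover have "picard F h (Suc n) (t, (1 / real (Suc k)) *\<^sub>R e3) \<le> W t (1 / real (Suc k))" for k
            by (rule pos_case[OF t]) simp
          then have "\<exists>N. \<forall>k\<ge>N. picard F h (Suc n) (t, (1 / real (Suc k)) *\<^sub>R e3) \<le> W t (1 / real (Suc k))" by blast
          ultimately show ?thesis unfolding True by (rule LIMSEQ_le)
        qed
      qed
    qed
    have bound: "\<bar>picard F h n z\<bar> \<le> \<epsilon> * K0 + \<epsilon>" if z: "z \<in> ST T" for n z
    proof -
      obtain t x where tx: "z = (t, x)" by (cases z)
      have t: "t \<in> {0..T}" "0 \<le> t" using z by (auto simp: tx)
      have "picard F h n z = picard F h n (t, norm x *\<^sub>R e3)" unfolding tx using radialD[OF pf(3)[OF t(1)], of n x] .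
      also have "\<dots> \<le> W t (norm x)" using barrier t by simp
      also have "\<dots> \<le> \<epsilon> * K0 / (1 + t + norm x) * 1 + \<epsilon> / (1 + t + norm x)"
        unfolding W_def using W2(2)[of t "norm x"] cut(2) t e K0 by (intro add_mono mult_left_mono) auto
      also have "\<dots> \<le> \<epsilon> * K0 / 1 * 1 + \<epsilon> / 1"
        using t e K0 by (intro add_mono mult_right_mono divide_left_mono) (auto simp: add_pos_nonneg)
      finally show ?thesis using pf(2)[OF z, of n] by simp
    qed
    have "unique_classical_solution_exists F h T"
    proof (rule unique_solutionI[OF T hc2 _ _ _ bound])
      have le: "\<epsilon> * a \<le> m" if "0 \<le> a" "a \<le> m" for a
        using mult_mono[OF e1(1) that(2)] that e by simp
      show "\<bar>h x\<bar> \<le> m" for x using le[of "\<bar>f x\<bar>"] m(2)[of x] e by (simp add: h_def abs_mult)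
      show "norm (\<epsilon> *\<^sub>R f' x) \<le> m" for x using le[of "norm (f' x)"] m(3)[of x] e by simp
      show "norm (\<epsilon> *\<^sub>R f'' x) \<le> m" for x using le[of "norm (f'' x)"] m(4)[of x] e by simp
    qed
    then show ?thesis unfolding h_def .
  qed
  show ?thesis
    by (intro exI[of _ c] exI[of _ \<epsilon>0] conjI c \<epsilon>0 ballI allI impI) (use main in auto)
qed

end

section \<open>Blow-up and the upper bound for the lifespan\<close>

text \<open>
  The annulus is moved slightly outwards so that it stays away from the origin.
\<close>
lemma radial_positive_annulus:
  fixes f :: "real ^ 3 \<Rightarrow> real"
  assumes c: "continuous_on UNIV f" and rad: "radial f" and f0: "\<And>x. 0 \<le> f x" and nz: "f y \<noteq> 0"
  obtains l1 l2 \<eta> where "0 < l1" "l1 < l2" "0 < \<eta>" "\<And>k. l1 \<le> k \<Longrightarrow> k \<le> l2 \<Longrightarrow> \<eta> \<le> f (k *\<^sub>R e3)"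
proof -
  define \<phi> where "\<phi> k = f (k *\<^sub>R e3)" for k
  have c\<phi>: "continuous_on UNIV \<phi>" unfolding \<phi>_def by (intro continuous_on_compose2[OF c] continuous_intros) auto
  define k0 where "k0 = norm y"
  have p0: "0 < \<phi> k0" using f0[of y] nz radialD[OF rad, of y] by (simp add: \<phi>_def k0_def)
  have "isCont \<phi> k0" using c\<phi> by (simp add: continuous_on_eq_continuous_at)
  then obtain d where d: "0 < d" "\<And>k. dist k k0 < d \<Longrightarrow> dist (\<phi> k) (\<phi> k0) < \<phi> k0 / 2"
    unfolding continuous_at_eps_delta using p0 by (meson half_gt_zero)
  show ?thesis
  proof (rule that[of "k0 + d / 4" "k0 + d / 2" "\<phi> k0 / 2"])
    show "0 < k0 + d / 4" using d(1) by (simp add: k0_def add_nonneg_pos)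
    fix k assume "k0 + d / 4 \<le> k" "k \<le> k0 + d / 2"
    then have "dist k k0 < d" using d(1) by (simp add: dist_real_def)
    from d(2)[OF this] have "\<phi> k0 / 2 \<le> \<phi> k" by (simp add: dist_real_def abs_if split: if_splits)
    then show "\<phi> k0 / 2 \<le> f (k *\<^sub>R e3)" by (simp add: \<phi>_def)
  qed (use d p0 in auto)
qed

text \<open>
  For $|t - r| \le l_1$ and $t + r \ge l_2$ the interval of integration in \<open>free_wave_radial\<close>
  contains the annulus.
\<close>
lemma free_wave_lower:
  assumes c: "continuous_on UNIV f" and rad: "radial f" and f0: "\<And>x. 0 \<le> f x"
    and l: "0 < l1" "l1 < l2" "0 < \<eta>" and ge: "\<And>k. l1 \<le> k \<Longrightarrow> k \<le> l2 \<Longrightarrow> \<eta> \<le> f (k *\<^sub>R e3)"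
    and t: "0 < t" and r: "0 < r" and near: "\<bar>t - r\<bar> \<le> l1" "l2 \<le> t + r"
  shows "l1 * \<eta> * (l2 - l1) / (2 * r) \<le> free_wave f (t, r *\<^sub>R e3)"
proof -
  let ?h = "\<lambda>k. k * f (k *\<^sub>R e3) / (2 * r)"
  have hc: "continuous_on S ?h" for S by (intro continuous_intros continuous_on_compose2[OF c]) (use r in auto)
  have hi: "?h integrable_on {a..b}" for a b by (rule integrable_continuous_real[OF hc])
  have "l1 * \<eta> * (l2 - l1) / (2 * r) = integral {l1..l2} (\<lambda>k. l1 * \<eta> / (2 * r))" using l by simp
  also have "\<dots> \<le> integral {l1..l2} ?h"
  proof (rule integral_le[OF integrable_const_ivl hi])
    fix k assume "k \<in> {l1..l2}"
    then have "l1 * \<eta> \<le> k * f (k *\<^sub>R e3)" using l ge by (intro mult_mono) auto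
    then show "l1 * \<eta> / (2 * r) \<le> ?h k" using r by (simp add: divide_right_mono)
  qed
  also have "\<dots> \<le> integral {\<bar>r - t\<bar>..r + t} ?h"
    by (rule integral_subset_le) (use near hi f0 r l in auto)
  also have "\<dots> = free_wave f (t, r *\<^sub>R e3)" by (rule free_wave_radial[OF c rad t r, symmetric])
  finally show ?thesis .
qed

lemma min_ratio: "0 < r \<Longrightarrow> 0 \<le> \<rho> \<Longrightarrow> \<rho> / (\<rho> + 2 * r) \<le> min r \<rho> / (r :: real)"
proof (cases "r \<le> \<rho>")
  case True
  assume "0 < r" "0 \<le> \<rho>"
  then show ?thesis using True by (simp add: min_def divide_le_eq)
next
  case False
  assume "0 < r" "0 \<le> \<rho>"
  then show ?thesis using False by (simp add: min_def) (rule divide_left_mono; simp)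
qed

context critical_nonlinearity
begin

text \<open>
  The part of the $\alpha$-interval below $3 (t - r)$ has length $2 \min(r, t - r)$, and divided by $r$ this
  is at least a multiple of $(t - r) / (t + r)$. On it $\alpha$ is comparable with $t - r$.
\<close>
lemma duhamel_lower_strip:
  assumes T: "0 < T" and u: "continuous_on (ST T) (\<lambda>z. F (u z))" "\<And>s. s \<in> {0..T} \<Longrightarrow> radial (\<lambda>x. F (u (s, x)))"
    and t: "t \<in> {0..T}" and r: "0 < r" and \<rho>: "0 < t - r"
    and b12: "0 \<le> b1" "b1 \<le> b2" "b2 \<le> t - r"
    and ge: "\<And>s l. t - r \<le> s + l \<Longrightarrow> s + l \<le> 3 * (t - r) \<Longrightarrow> s + l \<le> t + r \<Longrightarrow> b1 \<le> s - l \<Longrightarrow> s - l \<le> b2 \<Longrightarrow> c * b (s - l) \<le> l * F (u (s, l *\<^sub>R e3))"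
    and b: "\<And>x. b1 \<le> x \<Longrightarrow> x \<le> b2 \<Longrightarrow> 0 \<le> b x" "continuous_on {b1..b2} b" and c: "0 \<le> c"
  shows "c * integral {b1..b2} b / 2 * ((t - r) / (t + r)) \<le> duhamel (\<lambda>z. F (u z)) (t, r *\<^sub>R e3)"
proof -
  define \<rho> where "\<rho> = t - r"
  have p: "0 < \<rho>" using \<rho> by (simp add: \<rho>_def)
  have I0: "0 \<le> integral {b1..b2} b"
    by (rule integral_nonneg) (use b in \<open>auto intro: integrable_continuous_real\<close>)
  have "c * (\<rho> + 2 * min r \<rho> - \<rho>) * integral {b1..b2} b / (4 * r) \<le> duhamel (\<lambda>z. F (u z)) (t, r *\<^sub>R e3)"
  proof (rule duhamel_lower[where g="\<lambda>z. F (u z)", OF u(1) F_nonneg u(2) t r _ _ _ _ b12(2,3) _ b c])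
    fix s l assume "\<rho> \<le> s + l" "s + l \<le> \<rho> + 2 * min r \<rho>" "b1 \<le> s - l" "s - l \<le> b2"
    then show "c * b (s - l) \<le> l * F (u (s, l *\<^sub>R e3))"
      by (intro ge) (auto simp: \<rho>_def min_def split: if_splits)
  qed (use b12 p r in \<open>auto simp: \<rho>_def\<close>)
  also have "c * (\<rho> + 2 * min r \<rho> - \<rho>) * integral {b1..b2} b / (4 * r) = c * integral {b1..b2} b / 2 * (min r \<rho> / r)"
    using r by (simp add: field_simps)
  finally have le: "c * integral {b1..b2} b / 2 * (min r \<rho> / r) \<le> duhamel (\<lambda>z. F (u z)) (t, r *\<^sub>R e3)" .
  have "c * integral {b1..b2} b / 2 * (\<rho> / (\<rho> + 2 * r)) \<le> c * integral {b1..b2} b / 2 * (min r \<rho> / r)"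
    by (rule mult_left_mono[OF min_ratio]) (use r p c I0 in auto)
  also note le
  also have "\<rho> + 2 * r = t + r" by (simp add: \<rho>_def)
  finally show ?thesis unfolding \<rho>_def .
qed

text \<open>
  The substitution $s = \kappa \beta^{-k}$: $ds / s = -k\, d\beta / \beta$, so a power of $\beta$ inside $\mu$ costs
  only a constant factor.
\<close>
lemma power_density_integral:
  assumes k: "0 < k" and \<kappa>: "0 < \<kappa>" and ab: "0 < a" "a \<le> b"
  shows "((\<lambda>\<beta>. \<mu> (\<kappa> * \<beta> powr (- k)) powr p / \<beta>) has_integral J (\<kappa> * b powr (- k)) (\<kappa> * a powr (- k)) / k) {a..b}"
proof -
  let ?g = "\<lambda>\<beta>. \<kappa> * \<beta> powr (- k)"
  have mono: "?g y \<le> ?g x" if "0 < x" "x \<le> y" for x y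
    using that k \<kappa> by (intro mult_left_mono powr_mono2') auto
  have gp: "0 < ?g b" using \<kappa> ab by simp
  have "((\<lambda>\<beta>. (\<kappa> * (- k * \<beta> powr (- k - 1))) *\<^sub>R dens (?g \<beta>)) has_integral (integral {?g a..?g b} dens - integral {?g b..?g a} dens)) {a..b}"
  proof (rule has_integral_substitution_general[OF finite.emptyI ab(2)])
    show "?g ` {a..b} \<subseteq> {?g b..?g a}" using mono ab by fastforce
    show "continuous_on {?g b..?g a} dens" by (rule dens_cont[OF gp])
    show "continuous_on {a..b} ?g" using ab by (intro continuous_intros) auto
    fix x assume "x \<in> {a..b} - {}"
    then have x: "0 < x" using ab by auto
    show "(?g has_real_derivative \<kappa> * (- k * x powr (- k - 1))) (at x within {a..b})"
      by (rule DERIV_cmult, rule has_field_derivative_at_within, rule has_real_derivative_powr[OF x])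
  qed
  moreover have "integral {?g a..?g b} dens = 0"
  proof (cases "?g a = ?g b")
    case False
    then have "?g b < ?g a" using mono[OF ab] by linarith
    then show ?thesis by simp
  next
    case True
    show ?thesis unfolding True by simp
  qed
  ultimately have "((\<lambda>\<beta>. (\<kappa> * (- k * \<beta> powr (- k - 1))) *\<^sub>R dens (?g \<beta>)) has_integral - J (?g b) (?g a)) {a..b}"
    by (simp add: J_def)
  from has_integral_mult_right[OF this, of "- 1 / k"]
  have h: "((\<lambda>\<beta>. (- 1 / k) * ((\<kappa> * (- k * \<beta> powr (- k - 1))) *\<^sub>R dens (?g \<beta>))) has_integral J (?g b) (?g a) / k) {a..b}"
    by simp
  show ?thesis
  proof (rule has_integral_eq[OF _ h])
    fix x assume "x \<in> {a..b}"
    then have x: "0 < x" using ab by auto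
    have "x powr (- k - 1) = x powr (- k) / x" using x by (simp add: powr_diff)
    moreover have "0 < x powr (- k)" using x by simp
    ultimately show "(- 1 / k) * ((\<kappa> * (- k * x powr (- k - 1))) *\<^sub>R dens (?g x)) = \<mu> (\<kappa> * x powr (- k)) powr p / x"
      using x k \<kappa> by (simp add: dens_def)
  qed
qed

text \<open>
  Write $\rho = t - r$, $q = p - 2$. The lower bounds have the form
  $4^j E\, m(\rho) / ((t + r) \rho^q)$ with $E = c_1 \varepsilon^p$, where $m(\rho) = \mu(\kappa' \rho^{-k})$,
  $k = 2 (p - 1)$, is a lower bound for $\mu(u)$ at all points at which such a bound for $u$ is used (fact
  \<open>mE\<close>). The number $j$ of improvements available at $(t, r)$ is controlled by
  \<open>G \<rho>\<close>, the integral of $m^p / \beta$ up to $\rho$: the bound with index $j$ holds once $G(\rho)$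
  exceeds \<open>SS j\<close> (fact \<open>claim\<close>). The sequence \<open>SS\<close> is bounded by a multiple of
  $\varepsilon^{-p (p - 1)}$, so $G(T/2)$ cannot exceed that multiple without $u(T, T/2)$ being larger
  than every $4^j w$, where $w > 0$. The substitution $s = \kappa' \beta^{-k}$ turns $G$ into $A_\varepsilon$ up to
  lower-order terms.
\<close>
theorem duhamel_inequality_bounds_A_fun:
  fixes f :: "real ^ 3 \<Rightarrow> real"
  assumes fc: "continuous_on UNIV f" and rad: "radial f" and f0: "\<And>x. 0 \<le> f x" and nz: "f y \<noteq> 0"
  shows "\<exists>C>0. \<exists>\<epsilon>\<^sub>0>0. \<forall>\<epsilon>\<in>{0<..\<epsilon>\<^sub>0}. \<forall>T\<ge>1. \<forall>u. continuous_on (ST T) (\<lambda>z. F (u z)) \<longrightarrow>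
     (\<forall>s\<in>{0..T}. radial (\<lambda>x. F (u (s, x)))) \<longrightarrow>
     (\<forall>z\<in>ST T. \<epsilon> * free_wave f z + duhamel (\<lambda>z. F (u z)) z \<le> u z) \<longrightarrow>
     A_fun p \<mu> \<epsilon> T \<le> C * \<epsilon> powr (- p * (p - 1))"
proof -
  obtain l1 l2 \<eta> where l: "0 < l1" "l1 < l2" "0 < \<eta>" and ge: "\<And>k. l1 \<le> k \<Longrightarrow> k \<le> l2 \<Longrightarrow> \<eta> \<le> f (k *\<^sub>R e3)"
    by (rule radial_positive_annulus[OF fc rad f0 nz]) blast
  obtain s0 where s0: "0 < s0" "s0 \<le> 1" and slow: "\<And>s s'. 0 < s \<Longrightarrow> s \<le> s' \<Longrightarrow> s' \<le> s0 \<Longrightarrow> \<mu> s' \<le> sqrt (s' / s) * \<mu> s"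
    using slow_variation by blast
  define q where "q = p - 2"
  have q: "0 < q" "p * q = 1" "2 - p = - q" "p - 1 = 1 + q" using p_gt p_square by (auto simp: q_def algebra_simps power2_eq_square)
  have p0: "0 < p" "1 < p" "2 < p" "1 < p - 1" using p_gt by auto
  define c0 where "c0 = l1 * \<eta> * (l2 - l1) / 2"
  have c0: "0 < c0" using l by (simp add: c0_def)
  define \<rho>0 where "\<rho>0 = max 1 (max (2 * l1) l2)"
  have \<rho>0: "1 \<le> \<rho>0" "2 * l1 \<le> \<rho>0" "l2 \<le> \<rho>0" by (auto simp: \<rho>0_def)
  define c1 where "c1 = l1 * (c0 / 3) powr p / 8"
  have c1: "0 < c1" using l c0 by (simp add: c1_def)
  define k where "k = 2 * (p - 1)"
  have k: "1 \<le> k" "0 < k" using p0 by (auto simp: k_def)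
  \<comment> \<open>by slow variation $\mu(s) \ge c_2 \sqrt s$ for $s \le s_0$; \<open>\<kappa>\<close> is chosen such that
  $\kappa' \rho^{-k}$ then stays below the lower bounds for $u$ that are used, see \<open>mE\<close>\<close>
  define c2 where "c2 = \<mu> s0 / sqrt s0"
  have c2: "0 < c2" using mu_pos s0 by (simp add: c2_def)
  define \<kappa> where "\<kappa> = min 1 ((c1 * c2 / 3)\<^sup>2)"
  have \<kappa>: "0 < \<kappa>" "\<kappa> \<le> 1" "\<kappa> \<le> (c1 * c2 / 3)\<^sup>2" using c1 c2 by (auto simp: \<kappa>_def)
  define M1 where "M1 = \<mu> 1 powr p"
  have M1: "0 < M1" using mu_pos by (auto simp: M1_def intro!: powr_gt_zero[THEN iffD2])
  define c7 where "c7 = 3 powr (1 - p) / 16"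
  have c7: "0 < c7" by (simp add: c7_def)
  \<comment> \<open>chosen such that one pass through the Duhamel integral gains the factor 4, see \<open>EM\<close>\<close>
  define C' where "C' = 4 / (c7 * c1 powr (p - 1))"
  have C': "0 < C'" using c7 c1 by (simp add: C'_def)
  define C where "C = k * C' + 2 * k * M1 + M1 * (2 * p - 1) + M1 * \<bar>ln (\<rho>0 powr k / \<kappa>)\<bar> + M1 * ln (2 * \<rho>0)"
  have C: "0 < C" using k C' M1 p0 \<rho>0 by (auto simp: C_def intro!: add_pos_nonneg)
  have pw0: "((\<lambda>\<epsilon>. \<epsilon> powr a) \<longlongrightarrow> 0) (at_right 0)" if "0 < a" for a :: real
    by (rule tendsto_zero_powrI[OF tendsto_ident_at tendsto_const _ that]) (auto simp: eventually_at_filter)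
  have "\<forall>\<^sub>F \<epsilon> in at_right 0. \<epsilon> powr (2 * p - 1) < min (c0 / 3) (1 / 2 powr k)"
    using order_tendstoD(2)[OF pw0, of "2 * p - 1" "min (c0 / 3) (1 / 2 powr k)"] p0 c0 by simp
  then obtain b0 where b0: "0 < b0" "\<And>\<epsilon>. 0 < \<epsilon> \<Longrightarrow> \<epsilon> < b0 \<Longrightarrow> \<epsilon> powr (2 * p - 1) < min (c0 / 3) (1 / 2 powr k)"
    unfolding eventually_at_right_field by auto
  define \<epsilon>0 where "\<epsilon>0 = min (b0 / 2) (min 1 s0)"
  have \<epsilon>0: "0 < \<epsilon>0" using b0 s0 by (simp add: \<epsilon>0_def)
  have main: "A_fun p \<mu> \<epsilon> T \<le> C * \<epsilon> powr (- p * (p - 1))"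
    if e: "0 < \<epsilon>" "\<epsilon> \<le> \<epsilon>0" and T: "1 \<le> T"
      and u: "continuous_on (ST T) (\<lambda>z. F (u z))" "\<And>s. s \<in> {0..T} \<Longrightarrow> radial (\<lambda>x. F (u (s, x)))"
      and ineq: "\<And>z. z \<in> ST T \<Longrightarrow> \<epsilon> * free_wave f z + duhamel (\<lambda>z. F (u z)) z \<le> u z" for \<epsilon> T u
  proof -
    have e1: "\<epsilon> \<le> 1" "\<epsilon> \<le> s0" "\<epsilon> \<le> b0 / 2" using e(2) by (simp_all add: \<epsilon>0_def)
    have eb: "\<epsilon> powr (2 * p - 1) \<le> c0 / 3" "\<epsilon> powr (2 * p - 1) * 2 powr k \<le> 1"
      using b0(2)[OF e(1)] e1(3) b0(1) by (auto simp: field_simps)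
    have e2p: "\<epsilon> powr (2 * p) = \<epsilon> * \<epsilon> powr (2 * p - 1)" using e powr_add[of \<epsilon> 1 "2 * p - 1"] by simp
    define \<kappa>' where "\<kappa>' = \<kappa> * \<epsilon> powr (2 * p)"
    have \<kappa>'0: "0 < \<kappa>'" using \<kappa> e by (simp add: \<kappa>'_def)
    have \<kappa>'le: "\<kappa>' \<le> \<epsilon> powr (2 * p)" using \<kappa> by (simp add: \<kappa>'_def mult_left_le_one_le)
    have e2ple: "\<epsilon> powr (2 * p) \<le> \<epsilon>"
      unfolding e2p using e e1 p0 by (intro mult_right_le_one_le powr_le1) auto
    define sg where "sg \<rho> = \<kappa>' * \<rho> powr (- k)" for \<rho>
    define m where "m \<rho> = \<mu> (sg \<rho>)" for \<rho>
    have rk: "\<rho> powr (- k) \<le> 1 / \<rho>" "\<rho> powr (- k) \<le> 1" "0 < \<rho> powr (- k)" if "1 \<le> \<rho>" for \<rho>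
    proof -
      have "\<rho> powr (- k) \<le> \<rho> powr (- 1)" using that k by (intro powr_mono) auto
      then show 1: "\<rho> powr (- k) \<le> 1 / \<rho>" using that by (simp add: powr_minus_divide)
      have "1 / \<rho> \<le> 1" using that by simp
      with 1 show "\<rho> powr (- k) \<le> 1" by linarith
      show "0 < \<rho> powr (- k)" using that by simp
    qed
    have sgp: "0 < sg \<rho>" "sg \<rho> \<le> \<kappa>'" if "1 \<le> \<rho>" for \<rho>
      using rk[OF that] \<kappa>'0 by (auto simp: sg_def mult_left_le)
    have sgs0: "sg \<rho> \<le> s0" if "1 \<le> \<rho>" for \<rho> using sgp(2)[OF that] \<kappa>'le e2ple e1(2) by linarith
    have mpos: "0 < m \<rho>" if "1 \<le> \<rho>" for \<rho> using mu_pos sgp[OF that] by (simp add: m_def)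
    have manti: "m \<rho>' \<le> m \<rho>" if "1 \<le> \<rho>" "\<rho> \<le> \<rho>'" for \<rho> \<rho>'
      unfolding m_def using that k \<kappa>'0 sgp[of \<rho>'] by (intro mu_mono) (auto simp: sg_def intro!: mult_left_mono powr_mono2')
    have mM1: "m \<rho> powr p \<le> M1" if "1 \<le> \<rho>" for \<rho>
    proof -
      have "m \<rho> \<le> \<mu> 1" unfolding m_def using sgp[OF that] sgs0[OF that] s0 by (intro mu_mono) auto
      then show ?thesis unfolding M1_def using p0 mpos[OF that] by (intro powr_mono2) auto
    qed
    define E where "E = c1 * \<epsilon> powr p"
    have E: "0 < E" using c1 e by (simp add: E_def)
    define M' where "M' = C' * \<epsilon> powr (- p * (p - 1))"
    have M': "0 < M'" using C' e by (simp add: M'_def)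
    \<comment> \<open>it suffices that $\kappa' \rho^{-k}$ is below the argument of $\mu$ on the right; its square root is
    below $c_1 c_2 \varepsilon^p \rho^{-(p - 1)} / 3$ by the choice of \<open>\<kappa>\<close>, and $m(\beta)$ above
    $c_2$ times that square root\<close>
    have mE: "m \<rho> \<le> \<mu> (Z * m \<beta> / (\<alpha> * \<beta> powr q))"
      if \<rho>: "1 \<le> \<beta>" "\<beta> \<le> \<rho>" and \<alpha>: "0 < \<alpha>" "\<alpha> \<le> 3 * \<rho>" and Z: "E \<le> Z" for \<rho> \<beta> \<alpha> Z
    proof -
      have r1: "1 \<le> \<rho>" using \<rho> by linarith
      have "\<mu> s0 \<le> sqrt (s0 / sg \<rho>) * m \<rho>" unfolding m_def by (rule slow) (use sgp[OF r1] sgs0[OF r1] in auto)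
      then have "\<mu> s0 * sqrt (sg \<rho>) \<le> (sqrt (s0 / sg \<rho>) * m \<rho>) * sqrt (sg \<rho>)"
        using sgp[OF r1] by (intro mult_right_mono) auto
      also have "\<dots> = m \<rho> * sqrt s0" using sgp[OF r1] by (simp add: real_sqrt_divide)
      finally have "\<mu> s0 / sqrt s0 * sqrt (sg \<rho>) \<le> m \<rho>" using s0 by (simp add: divide_le_eq)
      then have mlow: "c2 * sqrt (sg \<rho>) \<le> m \<rho>" by (simp add: c2_def)
      have sq: "sqrt (sg \<rho>) \<le> c1 * c2 / 3 * (\<epsilon> powr p * \<rho> powr (- (p - 1)))"
      proof (rule real_le_lsqrt)
        show "0 \<le> c1 * c2 / 3 * (\<epsilon> powr p * \<rho> powr (- (p - 1)))" using c1 c2 by simp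
        have "(\<epsilon> powr p * \<rho> powr (- (p - 1)))\<^sup>2 = \<epsilon> powr (2 * p) * \<rho> powr (- k)"
          by (simp add: power_mult_distrib k_def power2_eq_square powr_add[symmetric] algebra_simps)
        then have "(c1 * c2 / 3 * (\<epsilon> powr p * \<rho> powr (- (p - 1))))\<^sup>2 = (c1 * c2 / 3)\<^sup>2 * (\<epsilon> powr (2 * p) * \<rho> powr (- k))"
          by (simp only: power_mult_distrib[of "c1 * c2 / 3"])
        moreover have "sg \<rho> \<le> (c1 * c2 / 3)\<^sup>2 * (\<epsilon> powr (2 * p) * \<rho> powr (- k))"
          unfolding sg_def \<kappa>'_def mult.assoc using \<kappa>(3) by (intro mult_right_mono) auto
        ultimately show "sg \<rho> \<le> (c1 * c2 / 3 * (\<epsilon> powr p * \<rho> powr (- (p - 1))))\<^sup>2" by simp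
      qed
      have "sg \<rho> = sqrt (sg \<rho>) * sqrt (sg \<rho>)" using sgp[OF r1] by simp
      also have "\<dots> \<le> (c1 * c2 / 3 * (\<epsilon> powr p * \<rho> powr (- (p - 1)))) * sqrt (sg \<rho>)"
        by (rule mult_right_mono[OF sq]) (use sgp[OF r1] in simp)
      also have "\<dots> = E * (c2 * sqrt (sg \<rho>)) / (3 * \<rho> powr (p - 1))"
        unfolding E_def powr_minus_divide by simp
      also have "\<dots> \<le> Z * m \<beta> / (\<alpha> * \<beta> powr q)"
      proof (rule frac_le)
        have "c2 * sqrt (sg \<rho>) \<le> m \<beta>" using mlow manti[OF \<rho>] by linarith
        then show "E * (c2 * sqrt (sg \<rho>)) \<le> Z * m \<beta>" using Z E c2 sgp[OF r1] by (intro mult_mono) auto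
        show "0 \<le> Z * m \<beta>" using Z E mpos[OF \<rho>(1)] by simp
        show "0 < \<alpha> * \<beta> powr q" using \<alpha> \<rho> by simp
        have "\<alpha> * \<beta> powr q \<le> (3 * \<rho>) * \<rho> powr q" using \<alpha> \<rho> q by (intro mult_mono powr_mono2) auto
        also have "\<dots> = 3 * \<rho> powr (p - 1)" unfolding q(4) using r1 by (simp add: powr_add)
        finally show "\<alpha> * \<beta> powr q \<le> 3 * \<rho> powr (p - 1)" .
      qed
      finally show ?thesis unfolding m_def[of \<rho>] using sgp[OF r1] by (intro mu_mono) auto
    qed
    have T0: "0 < T" using T by simp
    have duh0: "0 \<le> duhamel (\<lambda>z. F (u z)) z" if "z \<in> ST T" for z by (rule duhamel_nonneg[OF u(1) F_nonneg that])
    have fr0: "0 \<le> free_wave f z" if "z \<in> ST T" for z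
      by (rule free_wave_nonneg[OF fc f0]) (use that in \<open>cases z; simp\<close>)
    have u_duh: "duhamel (\<lambda>z. F (u z)) z \<le> u z" if "z \<in> ST T" for z
      using ineq[OF that] fr0[OF that] e mult_nonneg_nonneg[of \<epsilon> "free_wave f z"] by linarith
    have near: "\<epsilon> * c0 / (s + r) \<le> u (s, r *\<^sub>R e3)"
      if "s \<in> {0..T}" "0 < s" "0 < r" "\<bar>s - r\<bar> \<le> l1" "l2 \<le> s + r" for s r
    proof -
      have z: "(s, r *\<^sub>R e3) \<in> ST T" using that by simp
      have "c0 / (s + r) \<le> c0 / r" using that c0 by (intro divide_left_mono) auto
      also have "\<dots> \<le> free_wave f (s, r *\<^sub>R e3)"
        using free_wave_lower[OF fc rad f0 l ge that(2-5)] by (simp add: c0_def)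
      finally have "\<epsilon> * (c0 / (s + r)) \<le> \<epsilon> * free_wave f (s, r *\<^sub>R e3)" using e by (intro mult_left_mono) auto
      then show ?thesis using ineq[OF z] duh0[OF z] by simp
    qed
    have first: "E * m (t - r) / ((t + r) * (t - r) powr q) \<le> u (t, r *\<^sub>R e3)"
      if t: "t \<in> {0..T}" and r: "0 < r" and tr: "\<rho>0 \<le> t - r" for t r
    proof -
      define \<rho> where "\<rho> = t - r"
      have \<rho>: "1 \<le> \<rho>" "2 * l1 \<le> \<rho>" "l2 \<le> \<rho>" using tr \<rho>0 by (auto simp: \<rho>_def)
      have tz: "(t, r *\<^sub>R e3) \<in> ST T" using t by simp
      define v where "v = \<epsilon> * c0 / (3 * \<rho>)"
      have v: "0 < v" using e c0 \<rho> by (simp add: v_def)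
      define cc where "cc = \<rho> / 4 * F v"
      have "cc * integral {0..l1} (\<lambda>_. 1) / 2 * ((t - r) / (t + r)) \<le> duhamel (\<lambda>z. F (u z)) (t, r *\<^sub>R e3)"
      proof (rule duhamel_lower_strip[OF T0 u t r, where b="\<lambda>_. 1"])
        fix s l assume sl: "t - r \<le> s + l" "s + l \<le> 3 * (t - r)" "s + l \<le> t + r" "0 \<le> s - l" "s - l \<le> l1"
        have l4: "\<rho> / 4 \<le> l" "0 < l" "0 < s" using sl \<rho> unfolding \<rho>_def[symmetric] by auto
        have sT: "s \<in> {0..T}" using sl t l4 \<rho> l by (auto simp: \<rho>_def)
        have "v \<le> \<epsilon> * c0 / (s + l)" unfolding v_def using sl l4 e c0 \<rho> by (intro divide_left_mono) (auto simp: \<rho>_def)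
        also have "\<dots> \<le> u (s, l *\<^sub>R e3)" by (rule near[OF sT]) (use l4 sl \<rho> in \<open>auto simp: \<rho>_def\<close>)
        finally have "F v \<le> F (u (s, l *\<^sub>R e3))" using v by (intro F_mono) auto
        then show "cc * 1 \<le> l * F (u (s, l *\<^sub>R e3))" unfolding cc_def using l4 F_nonneg[of v] by (simp only: mult_1_right, intro mult_mono) auto
      qed (use \<rho> l F_nonneg[of v] in \<open>auto simp: \<rho>_def[symmetric] cc_def\<close>)
      then have d: "cc * l1 / 2 * (\<rho> / (t + r)) \<le> u (t, r *\<^sub>R e3)" using u_duh[OF tz] l by (simp add: \<rho>_def)
      have mv: "m \<rho> \<le> \<mu> v"
      proof -
        have "sg \<rho> \<le> \<epsilon> powr (2 * p) * (1 / \<rho>)" unfolding sg_def using \<kappa>'le rk[OF \<rho>(1)] by (intro mult_mono) auto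
        also have "\<dots> \<le> (\<epsilon> * (c0 / 3)) * (1 / \<rho>)" unfolding e2p using eb(1) e \<rho> by (intro mult_right_mono mult_left_mono) auto
        also have "\<dots> = v" by (simp add: v_def)
        finally show ?thesis unfolding m_def using sgp[OF \<rho>(1)] by (intro mu_mono) auto
      qed
      have "E * m \<rho> / ((t + r) * \<rho> powr q) = (l1 / 8 * (\<rho> powr (2 - p)) * ((c0 / 3) powr p * \<epsilon> powr p) * m \<rho>) / (t + r)"
        unfolding q(3) E_def c1_def powr_minus_divide
        by (simp only: times_divide_eq_left times_divide_eq_right divide_divide_eq_left mult_ac mult_1_left mult_1_right)
      also have "\<dots> \<le> (l1 / 8 * (\<rho> powr (2 - p)) * ((c0 / 3) powr p * \<epsilon> powr p) * \<mu> v) / (t + r)"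
        using mv l t r by (intro divide_right_mono mult_left_mono) auto
      also have "\<dots> = cc * l1 / 2 * (\<rho> / (t + r))"
      proof -
        have "v powr p = (c0 / 3) powr p * \<epsilon> powr p / \<rho> powr p"
          unfolding v_def using e c0 \<rho> by (simp add: powr_mult powr_divide mult.commute)
        moreover have "\<rho> powr (2 - p) = \<rho> * \<rho> / \<rho> powr p" using \<rho> by (simp add: powr_diff power2_eq_square)
        ultimately show ?thesis using v by (simp add: cc_def F_pos_eq)
      qed
      finally show ?thesis using d by (simp add: \<rho>_def)
    qed
    define dn where "dn \<beta> = m \<beta> powr p / \<beta>" for \<beta>
    define G where "G \<rho> = integral {\<rho>0..\<rho>} dn" for \<rho>
    have dn_int: "(dn has_integral J (sg b) (sg a) / k) {a..b}" if "\<rho>0 \<le> a" "a \<le> b" for a b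
      unfolding dn_def m_def sg_def by (rule power_density_integral[OF k(2) \<kappa>'0]) (use that \<rho>0 in auto)
    have dn0: "0 \<le> dn \<beta>" if "\<rho>0 \<le> \<beta>" for \<beta> using that \<rho>0 by (simp add: dn_def)
    have dnc: "continuous_on {a..b} dn" if "\<rho>0 \<le> a" for a b
    proof -
      have "continuous_on {a..b} sg" unfolding sg_def using that \<rho>0 by (intro continuous_intros) auto
      then have "continuous_on {a..b} m" unfolding m_def
        by (rule continuous_on_compose2[OF mu_cont]) (use that \<rho>0 sgp in \<open>force intro: less_imp_le\<close>)
      then show ?thesis unfolding dn_def
        by (intro continuous_intros) (use that \<rho>0 mpos in \<open>force simp: less_imp_neq[symmetric]\<close>)+
    qed
    have dni: "dn integrable_on {a..b}" if "\<rho>0 \<le> a" for a b by (rule integrable_continuous_real[OF dnc[OF that]])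
    have Gsplit: "G a + integral {a..b} dn = G b" if "\<rho>0 \<le> a" "a \<le> b" for a b
      unfolding G_def by (rule Henstock_Kurzweil_Integration.integral_combine) (use that dni in auto)
    have Gmono: "G a \<le> G b" if "\<rho>0 \<le> a" "a \<le> b" for a b
      using Gsplit[OF that] integral_nonneg[OF dni[OF that(1)], of b] dn0 that by force
    have Gdiff: "G b - G a \<le> M1 * ln (b / a)" if "\<rho>0 \<le> a" "a \<le> b" for a b
    proof -
      have a0: "0 < a" using that \<rho>0 by simp
      have "((\<lambda>s. M1 / s) has_integral (M1 * ln b - M1 * ln a)) {a..b}"
        by (rule fundamental_theorem_of_calculus)
          (use that a0 in \<open>auto intro!: derivative_eq_intros simp: has_real_derivative_iff_has_vector_derivative[symmetric]\<close>)
      then have "integral {a..b} dn \<le> M1 * ln b - M1 * ln a"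
      proof (rule has_integral_le[OF integrable_integral[OF dni[OF that(1)]]])
        fix s assume "s \<in> {a..b}"
        then show "dn s \<le> M1 / s" unfolding dn_def using that \<rho>0 by (intro divide_right_mono mM1) auto
      qed
      then show ?thesis using Gsplit[OF that] a0 that by (simp add: ln_div algebra_simps)
    qed
    have G0: "G \<rho>0 = 0" by (simp add: G_def)
    define SS where "SS j = (M' + 2 * M1) * (1 - 1 / 2 ^ j)" for j :: nat
    have claim: "\<forall>t\<in>{0..T}. \<forall>r>0. \<rho>0 \<le> t - r \<longrightarrow> SS j \<le> G (t - r) \<longrightarrow> 4 ^ j * E * m (t - r) / ((t + r) * (t - r) powr q) \<le> u (t, r *\<^sub>R e3)" for j
    proof (induction j)
      case 0
      then show ?case using first by simp
    next
      case (Suc j)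
      show ?case
      proof (intro ballI allI impI)
        fix t r :: real assume t: "t \<in> {0..T}" and r: "0 < r" and tr: "\<rho>0 \<le> t - r" and GS: "SS (Suc j) \<le> G (t - r)"
        define \<rho> where "\<rho> = t - r"
        have \<rho>: "\<rho>0 \<le> \<rho>" "1 \<le> \<rho>" using tr \<rho>0 by (auto simp: \<rho>_def)
        have tz: "(t, r *\<^sub>R e3) \<in> ST T" using t by simp
        \<comment> \<open>Step $j$ stays at distance $\rho (1 - e^{-d})$ from the axis $l = 0$, where $\beta = \alpha$, so that
        $l \ge \alpha d / 4$. This costs at most $M_1 d$ of the integral $G$, and $\sigma$ of what is left is used
        for the gain. Both $d$ and $\sigma$ are of size $2^{-j}$; the factor $4^{-j}$ lost in their product is
        regained from $(4^j)^p \ge 4^j 4^j$.\<close>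
        define d where "d = (1 / 2 ^ j :: real)"
        have d: "0 < d" "d \<le> 1" by (auto simp: d_def)
        define \<sigma> where "\<sigma> = M' * d / 2"
        have \<sigma>: "0 < \<sigma>" using M' d by (simp add: \<sigma>_def)
        have SSuc: "SS (Suc j) = SS j + \<sigma> + d * M1" by (simp add: SS_def \<sigma>_def d_def field_simps)
        have SS0: "0 \<le> SS j" unfolding SS_def using M' M1 by (intro mult_nonneg_nonneg) auto
        define \<rho>' where "\<rho>' = \<rho> * exp (- d)"
        have \<rho>'le: "\<rho>' \<le> \<rho>" unfolding \<rho>'_def using \<rho> d by (intro mult_right_le_one_le) auto
        have "\<rho> / \<rho>' = exp d" using \<rho>(2) by (simp add: \<rho>'_def exp_minus inverse_eq_divide)
        then have lnr: "ln (\<rho> / \<rho>') = d" by simp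
        have \<rho>'ge: "\<rho>0 \<le> \<rho>'"
        proof (rule ccontr)
          assume "\<not> \<rho>0 \<le> \<rho>'"
          then have "\<rho> / \<rho>0 \<le> \<rho> / \<rho>'" using \<rho> \<rho>0 by (intro divide_left_mono) (auto simp: \<rho>'_def)
          then have "ln (\<rho> / \<rho>0) \<le> d" unfolding lnr[symmetric] using \<rho> \<rho>0 by (subst ln_le_cancel_iff) (auto simp: \<rho>'_def)
          then have "M1 * ln (\<rho> / \<rho>0) \<le> M1 * d" using M1 by simp
          moreover have "G \<rho> \<le> M1 * ln (\<rho> / \<rho>0)" using Gdiff[of \<rho>0 \<rho>] G0 \<rho> by simp
          ultimately show False using GS SSuc SS0 \<sigma> unfolding \<rho>_def[symmetric] by (simp add: mult.commute)
        qed
        have G': "SS j + \<sigma> \<le> G \<rho>'"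
          using Gdiff[OF \<rho>'ge \<rho>'le] GS SSuc unfolding lnr \<rho>_def[symmetric] by (simp add: mult.commute)
        \<comment> \<open>the part of the strip where the induction hypothesis is available starts at \<open>b1\<close>\<close>
        have "\<exists>b1\<ge>\<rho>0. b1 \<le> \<rho>' \<and> G b1 = SS j"
        proof (rule IVT')
          show "G \<rho>0 \<le> SS j" using G0 SS0 by simp
          show "SS j \<le> G \<rho>'" using G' \<sigma> by simp
          show "continuous_on {\<rho>0..\<rho>'} G" unfolding G_def by (rule indefinite_integral_continuous_1[OF dni]) simp
        qed (rule \<rho>'ge)
        then obtain b1 where b1: "\<rho>0 \<le> b1" "b1 \<le> \<rho>'" "G b1 = SS j" by blast
        have Ib: "\<sigma> \<le> integral {b1..\<rho>'} dn" using Gsplit[OF b1(1,2)] b1(3) G' by simp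
        define Z where "Z = 4 ^ j * E"
        have Z: "E \<le> Z" "0 < Z" using E by (auto simp: Z_def)
        define cc where "cc = d / 4 * (3 * \<rho>) powr (1 - p) * Z powr p * m \<rho>"
        have cc: "0 \<le> cc" using d mpos[OF \<rho>(2)] by (simp add: cc_def less_imp_le)
        have "cc * integral {b1..\<rho>'} dn / 2 * ((t - r) / (t + r)) \<le> duhamel (\<lambda>z. F (u z)) (t, r *\<^sub>R e3)"
        proof (rule duhamel_lower_strip[OF T0 u t r])
          fix s l assume sl: "t - r \<le> s + l" "s + l \<le> 3 * (t - r)" "s + l \<le> t + r" "b1 \<le> s - l" "s - l \<le> \<rho>'"
          define \<alpha> \<beta> where "\<alpha> = s + l" and "\<beta> = s - l"
          have ab: "\<rho> \<le> \<alpha>" "\<alpha> \<le> 3 * \<rho>" "b1 \<le> \<beta>" "\<beta> \<le> \<rho>'" using sl by (auto simp: \<alpha>_def \<beta>_def \<rho>_def)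
          have \<beta>: "\<rho>0 \<le> \<beta>" "1 \<le> \<beta>" "\<beta> \<le> \<rho>" using ab b1 \<rho>0 \<rho>'le by auto
          have \<alpha>0: "0 < \<alpha>" using ab \<rho> by linarith
          have ll: "\<alpha> * (d / 4) \<le> l"
          proof -
            have "d / 2 \<le> 1 - exp (- d)"
            proof -
              have "exp (- d) \<le> 1 / (1 + d)" using exp_ge_add_one_self[of d] d by (simp add: exp_minus field_simps)
              also have "\<dots> \<le> 1 - d / 2"
              proof -
                have "d * d \<le> d * 1" using d by (intro mult_left_mono) auto
                then show ?thesis using d by (simp add: field_simps)
              qed
              finally show ?thesis by simp
            qed
            then have "\<alpha> * (d / 2) \<le> \<alpha> * (1 - exp (- d))" using \<alpha>0 by (intro mult_left_mono) auto
            also have "\<dots> = \<alpha> - \<alpha> * exp (- d)" by (simp add: right_diff_distrib)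
            also have "\<dots> \<le> \<alpha> - \<beta>"
            proof -
              have "\<beta> \<le> \<rho> * exp (- d)" using ab by (simp add: \<rho>'_def)
              also have "\<dots> \<le> \<alpha> * exp (- d)" using ab by (intro mult_right_mono) auto
              finally show ?thesis by simp
            qed
            also have "\<dots> = 2 * l" by (simp add: \<alpha>_def \<beta>_def)
            finally show ?thesis by simp
          qed
          have l0: "0 < l" using less_le_trans[OF _ ll] \<alpha>0 d by simp
          have s: "s \<in> {0..T}" using sl l0 \<beta> \<rho>'le t by (auto simp: \<beta>_def \<rho>_def)
          have GSj: "SS j \<le> G \<beta>" using Gmono[OF b1(1) ab(3)] b1(3) by simp
          define y where "y = Z * m \<beta> / (\<alpha> * \<beta> powr q)"
          have y0: "0 \<le> y" using Z mpos[OF \<beta>(2)] \<alpha>0 by (simp add: y_def)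
          have "y \<le> u (s, l *\<^sub>R e3)"
            unfolding y_def Z_def \<alpha>_def \<beta>_def using Suc.IH s l0 \<beta>(1) GSj unfolding \<beta>_def by blast
          then have "F y \<le> F (u (s, l *\<^sub>R e3))" by (rule F_mono[OF y0])
          moreover have "y powr p * m \<rho> \<le> F y"
            unfolding F_pos_eq[OF y0] unfolding y_def using mE[OF \<beta>(2,3) \<alpha>0 ab(2) Z(1)] by (intro mult_left_mono) auto
          ultimately have Fu: "y powr p * m \<rho> \<le> F (u (s, l *\<^sub>R e3))" by linarith
          \<comment> \<open>here $p q = 1$ turns the power of the profile into $1 / \beta$\<close>
          have yp: "y powr p = Z powr p * dn \<beta> / \<alpha> powr p"
          proof -
            have "(\<beta> powr q) powr p = \<beta>" using \<beta> q by (simp add: powr_powr mult.commute)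
            then show ?thesis unfolding y_def dn_def using Z mpos[OF \<beta>(2)] \<alpha>0 \<beta>
              by (simp add: powr_mult powr_divide)
          qed
          have "cc * dn \<beta> = (d / 4 * (3 * \<rho>) powr (1 - p)) * (Z powr p * dn \<beta> * m \<rho>)" by (simp add: cc_def)
          also have "\<dots> \<le> (d / 4 * \<alpha> powr (1 - p)) * (Z powr p * dn \<beta> * m \<rho>)"
          proof (intro mult_right_mono mult_left_mono)
            show "(3 * \<rho>) powr (1 - p) \<le> \<alpha> powr (1 - p)" using ab \<alpha>0 p0 by (intro powr_mono2') auto
          qed (use d dn0[OF \<beta>(1)] mpos[OF \<rho>(2)] in auto)
          also have "\<dots> = (\<alpha> * (d / 4)) * (y powr p * m \<rho>)"
          proof -
            have "\<alpha> powr (1 - p) = \<alpha> / \<alpha> powr p" using \<alpha>0 by (simp add: powr_diff)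
            then show ?thesis unfolding yp by simp
          qed
          also have "\<dots> \<le> l * F (u (s, l *\<^sub>R e3))"
            using ll Fu l0 mpos[OF \<rho>(2)] by (intro mult_mono) auto
          finally show "cc * dn (s - l) \<le> l * F (u (s, l *\<^sub>R e3))" by (simp add: \<beta>_def)
        qed (use b1 \<rho>0 \<rho> \<rho>'le dn0 dnc cc in \<open>auto simp: \<rho>_def[symmetric]\<close>)
        then have d1: "cc * integral {b1..\<rho>'} dn / 2 * (\<rho> / (t + r)) \<le> u (t, r *\<^sub>R e3)" using u_duh[OF tz] by (simp add: \<rho>_def)
        have tr0: "0 < t + r" using t r by auto
        have "4 ^ Suc j * E * m \<rho> / ((t + r) * \<rho> powr q) \<le> cc * \<sigma> / 2 * (\<rho> / (t + r))"
        proof -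
          have rr: "(3 * \<rho>) powr (1 - p) * \<rho> = 3 powr (1 - p) / \<rho> powr q"
          proof -
            have A: "(3 * \<rho>) powr (1 - p) = 3 powr (1 - p) * \<rho> powr (1 - p)" using \<rho> by (simp add: powr_mult)
            have B: "\<rho> powr (1 - p) * \<rho> = \<rho> powr (- q)" using \<rho> powr_add[of \<rho> "1 - p" 1] q(3) by simp
            show ?thesis unfolding A mult.assoc B powr_minus_divide by simp
          qed
          have key: "4 ^ Suc j * E \<le> d / 4 * 3 powr (1 - p) * Z powr p * (\<sigma> / 2)"
          proof -
            have Zp: "Z powr p = (4 ^ j * E) * (4 ^ j * E) powr (p - 1)"
              using Z powr_add[of Z 1 "p - 1"] by (simp add: Z_def)
            have "(4 ^ j * E) powr (p - 1) = (4 ^ j) powr (p - 1) * E powr (p - 1)" using E by (simp add: powr_mult)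
            moreover have "(4 ^ j :: real) powr 1 \<le> (4 ^ j) powr (p - 1)" using p0 by (intro powr_mono) auto
            ultimately have "4 ^ j * E powr (p - 1) \<le> (4 ^ j * E) powr (p - 1)" by (simp add: mult_right_mono)
            then have Zge: "(4 ^ j * E) * (4 ^ j * E powr (p - 1)) \<le> Z powr p"
              unfolding Zp using E by (intro mult_left_mono) auto
            have EM: "c7 * (M' * E powr (p - 1)) = 4"
            proof -
              have "E powr (p - 1) = c1 powr (p - 1) * \<epsilon> powr (p * (p - 1))"
                using c1 e by (simp add: E_def powr_mult powr_powr)
              moreover have "\<epsilon> powr (- p * (p - 1)) * \<epsilon> powr (p * (p - 1)) = 1"
                using e powr_add[of \<epsilon> "- p * (p - 1)" "p * (p - 1)"] by simp
              ultimately have "M' * E powr (p - 1) = C' * c1 powr (p - 1)"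
                unfolding M'_def by (simp add: mult_ac)
              then show ?thesis using c7 c1 by (simp add: C'_def)
            qed
            have dd: "d * d * 4 ^ j = 1"
            proof -
              have "d * d = 1 / 4 ^ j" unfolding d_def by (simp add: power_mult_distrib[symmetric])
              then show ?thesis by simp
            qed
            have "4 ^ Suc j * E = c7 * (M' * E powr (p - 1)) * (4 ^ j * E) * (d * d * 4 ^ j)"
              unfolding EM dd by simp
            also have "\<dots> = d / 4 * 3 powr (1 - p) * ((4 ^ j * E) * (4 ^ j * E powr (p - 1))) * (\<sigma> / 2)"
              by (simp add: c7_def \<sigma>_def)
            also have "\<dots> \<le> d / 4 * 3 powr (1 - p) * Z powr p * (\<sigma> / 2)"
              using Zge d \<sigma> by (intro mult_right_mono mult_left_mono) auto
            finally show ?thesis .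
          qed
          have "4 ^ Suc j * E * m \<rho> / ((t + r) * \<rho> powr q) = (4 ^ Suc j * E) * (m \<rho> / ((t + r) * \<rho> powr q))" by simp
          also have "\<dots> \<le> (d / 4 * 3 powr (1 - p) * Z powr p * (\<sigma> / 2)) * (m \<rho> / ((t + r) * \<rho> powr q))"
            using mpos[OF \<rho>(2)] tr0 by (intro mult_right_mono key) (simp add: less_imp_le)
          also have "\<dots> = (d / 4 * Z powr p * m \<rho> * (\<sigma> / 2) / (t + r)) * (3 powr (1 - p) / \<rho> powr q)"
            by (simp only: times_divide_eq_left times_divide_eq_right divide_divide_eq_left mult_ac)
          also have "\<dots> = cc * \<sigma> / 2 * (\<rho> / (t + r))" unfolding rr[symmetric] cc_def by simp
          finally show ?thesis .
        qed
        also have "\<dots> \<le> cc * integral {b1..\<rho>'} dn / 2 * (\<rho> / (t + r))"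
          using Ib cc \<rho> tr0 by (intro mult_right_mono divide_right_mono mult_left_mono) auto
        finally show "4 ^ Suc j * E * m (t - r) / ((t + r) * (t - r) powr q) \<le> u (t, r *\<^sub>R e3)"
          using d1 unfolding \<rho>_def by linarith
      qed
    qed
    have eexp: "1 / \<epsilon> \<le> \<epsilon> powr (- p * (p - 1))" "1 \<le> \<epsilon> powr (- p * (p - 1))"
    proof -
      have "1 * 1 \<le> p * (p - 1)" using p0 by (intro mult_mono) auto
      then have "\<epsilon> powr (- 1) \<le> \<epsilon> powr (- p * (p - 1))" using e e1 by (intro powr_mono') auto
      then show 1: "1 / \<epsilon> \<le> \<epsilon> powr (- p * (p - 1))" using e by (simp add: powr_minus_divide)
      have "1 \<le> 1 / \<epsilon>" using e e1 by simp
      with 1 show "1 \<le> \<epsilon> powr (- p * (p - 1))" by linarith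
    qed
    define X where "X = \<epsilon> powr (- p * (p - 1))"
    have X: "1 / \<epsilon> \<le> X" "1 \<le> X" using eexp by (auto simp: X_def)
    have Jl: "J x \<epsilon> \<le> M1 * ln (\<epsilon> / x)" if "0 < x" "x \<le> \<epsilon>" for x
    proof -
      have "\<mu> \<epsilon> powr p \<le> M1" unfolding M1_def using e e1 mu_nonneg p0 by (intro powr_mono2 mu_mono) auto
      moreover have "0 \<le> ln (\<epsilon> / x)" using that by (intro ln_ge_zero) auto
      ultimately show ?thesis using J_upper[OF that] mult_right_mono order_trans by blast
    qed
    have M1X: "a \<le> a * X" if "0 \<le> a" for a using mult_left_mono[OF X(2) that] by simp
    show ?thesis
    proof (cases "T / 2 < \<rho>0")
      case True
      have "A_fun p \<mu> \<epsilon> T \<le> M1 * ln (\<epsilon> / (\<epsilon> / T))"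
        unfolding A_fun_eq_J[OF e(1) T] by (rule Jl) (use e T frac_le[of \<epsilon> \<epsilon> 1 T] in auto)
      also have "\<dots> = M1 * ln T" using e T by simp
      also have "\<dots> \<le> M1 * ln (2 * \<rho>0)" using True T M1 by (intro mult_left_mono) auto
      also have "\<dots> \<le> C * 1" using k C' M1 p0 by (simp add: C_def)
      also have "\<dots> \<le> C * X" using X C by (intro mult_left_mono) auto
      finally show ?thesis by (simp add: X_def)
    next
      case False
      then have T2: "\<rho>0 \<le> T / 2" by simp
      have GT: "G (T / 2) < M' + 2 * M1"
      proof (rule ccontr)
        assume "\<not> G (T / 2) < M' + 2 * M1"
        then have GG: "M' + 2 * M1 \<le> G (T / 2)" by simp
        have SSle: "SS j \<le> G (T / 2)" for j
        proof -
          have "SS j \<le> (M' + 2 * M1) * 1" unfolding SS_def using M' M1 by (intro mult_left_mono) auto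
          then show ?thesis using GG by simp
        qed
        define w where "w = E * m (T - T / 2) / ((T + T / 2) * (T - T / 2) powr q)"
        have w: "0 < w" unfolding w_def using E mpos[of "T - T / 2"] T2 \<rho>0 T by simp
        have "4 ^ j * w \<le> u (T, (T / 2) *\<^sub>R e3)" for j
          using claim[of j, rule_format, of T "T / 2"] SSle[of j] T T2 by (simp add: w_def mult.assoc)
        moreover obtain j where "u (T, (T / 2) *\<^sub>R e3) / w < 4 ^ j" using real_arch_pow[of 4] by auto
        ultimately show False using w by (metis linorder_not_le mult.commute pos_divide_less_eq)
      qed
      define s1 s2 where "s1 = sg (T / 2)" and "s2 = sg \<rho>0"
      have T21: "1 \<le> T / 2" using T2 \<rho>0 by linarith
      have s1p: "0 < s1" using sgp[OF T21] by (simp add: s1_def)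
      have s12: "s1 \<le> s2" unfolding s1_def s2_def sg_def using T2 \<rho>0 k \<kappa>'0 by (intro mult_left_mono powr_mono2') auto
      have s2e: "s2 \<le> \<epsilon>" using sgp(2)[OF \<rho>0(1)] \<kappa>'le e2ple by (simp add: s2_def)
      have s1T: "s1 \<le> \<epsilon> / T"
      proof -
        have "s1 \<le> \<epsilon> powr (2 * p) * (2 powr k * T powr (- k))"
        proof -
          have "(T / 2) powr (- k) = 2 powr k * T powr (- k)"
            using T by (simp add: powr_divide powr_minus_divide)
          then show ?thesis unfolding s1_def sg_def using \<kappa>'le T by (simp add: mult_right_mono)
        qed
        also have "\<dots> = \<epsilon> * (\<epsilon> powr (2 * p - 1) * 2 powr k) * T powr (- k)" unfolding e2p by simp
        also have "\<dots> \<le> \<epsilon> * 1 * (1 / T)" using eb(2) e T rk[OF T] by (intro mult_mono) auto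
        finally show ?thesis by simp
      qed
      have "A_fun p \<mu> \<epsilon> T \<le> J s1 \<epsilon>" unfolding A_fun_eq_J[OF e(1) T] by (rule J_antimono[OF s1p s1T])
      also have "\<dots> = J s1 s2 + J s2 \<epsilon>" using J_split[OF s1p s12 s2e] by simp
      also have "J s1 s2 = k * G (T / 2)"
        using integral_unique[OF dn_int[of \<rho>0 "T / 2"]] T2 k by (simp add: G_def s1_def s2_def)
      also have "k * G (T / 2) \<le> k * (M' + 2 * M1)" using GT k by (intro mult_left_mono) auto
      also have "J s2 \<epsilon> \<le> M1 * ln (\<epsilon> / s2)" by (rule Jl) (use s1p s12 s2e in auto)
      also have "M1 * ln (\<epsilon> / s2) \<le> M1 * (2 * p - 1) * X + M1 * \<bar>ln (\<rho>0 powr k / \<kappa>)\<bar> * X"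
      proof -
        have "\<epsilon> / s2 = \<epsilon> powr (- (2 * p - 1)) * (\<rho>0 powr k / \<kappa>)"
          unfolding s2_def sg_def \<kappa>'_def e2p powr_minus_divide using e \<kappa> \<rho>0 by simp
        then have "ln (\<epsilon> / s2) = ln (\<epsilon> powr (- (2 * p - 1))) + ln (\<rho>0 powr k / \<kappa>)"
          using ln_mult_pos[of "\<epsilon> powr (- (2 * p - 1))" "\<rho>0 powr k / \<kappa>"] e \<kappa> \<rho>0 by simp
        then have "ln (\<epsilon> / s2) = - (2 * p - 1) * ln \<epsilon> + ln (\<rho>0 powr k / \<kappa>)"
          unfolding ln_powr .
        moreover have "- (2 * p - 1) * ln \<epsilon> \<le> (2 * p - 1) * X"
        proof -
          have "ln (1 / \<epsilon>) \<le> 1 / \<epsilon>" using ln_le_minus_one[of "1 / \<epsilon>"] e by simp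
          then have "- ln \<epsilon> \<le> X" using X(1) e by (simp add: ln_div)
          then have "(2 * p - 1) * (- ln \<epsilon>) \<le> (2 * p - 1) * X" using p0 by (intro mult_left_mono) auto
          then show ?thesis by (simp only: mult_minus_left mult_minus_right)
        qed
        moreover have "ln (\<rho>0 powr k / \<kappa>) \<le> \<bar>ln (\<rho>0 powr k / \<kappa>)\<bar> * X"
          using M1X[of "\<bar>ln (\<rho>0 powr k / \<kappa>)\<bar>"] by linarith
        ultimately have "ln (\<epsilon> / s2) \<le> (2 * p - 1) * X + \<bar>ln (\<rho>0 powr k / \<kappa>)\<bar> * X" by linarith
        then have "M1 * ln (\<epsilon> / s2) \<le> M1 * ((2 * p - 1) * X + \<bar>ln (\<rho>0 powr k / \<kappa>)\<bar> * X)" using M1 by (intro mult_left_mono) auto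
        then show ?thesis by (simp add: distrib_left mult.assoc)
      qed
      also have "k * (M' + 2 * M1) = k * C' * X + 2 * k * M1" by (simp add: M'_def X_def algebra_simps)
      also have "2 * k * M1 \<le> 2 * k * M1 * X" by (rule M1X) (use k M1 in simp)
      finally have "A_fun p \<mu> \<epsilon> T \<le> k * C' * X + 2 * k * M1 * X + (M1 * (2 * p - 1) * X + M1 * \<bar>ln (\<rho>0 powr k / \<kappa>)\<bar> * X)" by simp
      also have "\<dots> \<le> C * X"
      proof -
        have "0 \<le> M1 * ln (2 * \<rho>0) * X" using M1 \<rho>0 X by simp
        then show ?thesis unfolding C_def distrib_right by linarith
      qed
      finally show ?thesis by (simp add: X_def)
    qed
  qed
  show ?thesis
    by (intro exI[of _ C] exI[of _ \<epsilon>0] conjI C \<epsilon>0 ballI allI impI) (rule main; auto)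
qed

end

section \<open>The lifespan\<close>

context critical_nonlinearity
begin

text \<open>
  A rotated solution solves the same problem, so uniqueness applies.
\<close>
lemma semilinear_solution_radial:
  assumes T: "0 < T" and f: "radial f" and u: "wave_sol T (\<lambda>z. F (u z)) f u" and t: "t \<in> {0..T}"
  shows "radial (\<lambda>x. u (t, x))"
  unfolding radial_def
proof (intro allI impI)
  obtain F' F'' where Fc: "C2_with UNIV F F' F''" using F_C2 unfolding C2_on_iff by blast
  fix x y :: "real ^ 3" assume "norm x = norm y"
  then obtain Q where Q: "orthogonal_transformation Q" "Q x = y" by (rule orthogonal_transformation_exists)
  have "f (Q a) = f a" for a
    by (rule f[unfolded radial_def, rule_format]) (use Q(1) in \<open>simp add: orthogonal_transformation\<close>)
  then have "wave_sol T (\<lambda>z. F (u (fst z, Q (snd z)))) f (\<lambda>z. u (fst z, Q (snd z)))"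
    using wave_sol_rotate[OF u Q(1)] by simp
  from wave_sol_unique[OF T Fc u this, of "(t, x)"] show "u (t, x) = u (t, y)" using t Q(2) by simp
qed

lemma classical_solution_duhamel:
  assumes T: "0 < T" and f: "radial f" and ex: "unique_classical_solution_exists F f T"
  obtains u where "continuous_on (ST T) (\<lambda>z. F (u z))" "\<And>s. s \<in> {0..T} \<Longrightarrow> radial (\<lambda>x. F (u (s, x)))"
    "\<And>z. z \<in> ST T \<Longrightarrow> u z = free_wave f z + duhamel (\<lambda>z. F (u z)) z"
proof -
  obtain w where "classical_solution F f T w" using ex unfolding unique_classical_solution_exists_def by blast
  then have u: "wave_sol T (\<lambda>z. F ((\<lambda>z. w (fst z) (snd z)) z)) f (\<lambda>z. w (fst z) (snd z))"
    unfolding classical_solution_iff_wave_sol[OF T] .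
  show ?thesis
  proof (rule that[of "\<lambda>z. w (fst z) (snd z)"])
    have "continuous_on (ST T) (\<lambda>z. w (fst z) (snd z))" using u C2_withD(3) unfolding wave_sol_def by blast
    then show "continuous_on (ST T) (\<lambda>z. F (w (fst z) (snd z)))"
      by (rule continuous_on_compose2[OF F_cont[of UNIV]]) simp
    show "radial (\<lambda>x. F (w (fst (s, x)) (snd (s, x))))" if "s \<in> {0..T}" for s
      using semilinear_solution_radial[OF T f u that] unfolding radial_def fst_conv snd_conv by metis
    show "w (fst z) (snd z) = free_wave f z + duhamel (\<lambda>z. F (w (fst z) (snd z))) z" if "z \<in> ST T" for z
      using kirchhoff[OF u, of "fst z" "snd z"] that by (cases z) simp
  qed
qed

text \<open>
  The amplitude \<open>a\<close> of the data may exceed \<open>\<epsilon>\<close>, as only a lower bound for the free wave is used.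
  With \<open>a = \<epsilon>\<close> this is the upper bound for the lifespan, with \<open>a = 1\<close> blow-up for data that are
  not small.
\<close>
theorem existence_time_bound:
  assumes f: "C2_compact_support f" and rad: "radial f" and f0: "\<And>x. 0 \<le> f x" and nz: "f y \<noteq> 0"
  shows "\<exists>C>0. \<exists>\<epsilon>\<^sub>0>0. \<forall>\<epsilon>\<in>{0<..\<epsilon>\<^sub>0}. \<forall>a\<ge>\<epsilon>. \<forall>T\<ge>1. unique_classical_solution_exists F (\<lambda>x. a * f x) T \<longrightarrow>
     A_fun p \<mu> \<epsilon> T \<le> C * \<epsilon> powr (- p * (p - 1))"
proof -
  obtain f' f'' where c2: "C2_with UNIV f f' f''" using f unfolding C2_compact_support_def C2_on_iff by blast
  note fc = C2_withD(3)[OF c2]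
  obtain C \<epsilon>0 where C: "0 < C" "0 < \<epsilon>0" and ub: "\<And>\<epsilon> T u. \<epsilon> \<in> {0<..\<epsilon>0} \<Longrightarrow> 1 \<le> T \<Longrightarrow> continuous_on (ST T) (\<lambda>z. F (u z)) \<Longrightarrow>
     (\<forall>s\<in>{0..T}. radial (\<lambda>x. F (u (s, x)))) \<Longrightarrow>
     (\<forall>z\<in>ST T. \<epsilon> * free_wave f z + duhamel (\<lambda>z. F (u z)) z \<le> u z) \<Longrightarrow>
     A_fun p \<mu> \<epsilon> T \<le> C * \<epsilon> powr (- p * (p - 1))"
    using duhamel_inequality_bounds_A_fun[OF fc rad f0 nz] by blast
  have "A_fun p \<mu> \<epsilon> T \<le> C * \<epsilon> powr (- p * (p - 1))"
    if e: "\<epsilon> \<in> {0<..\<epsilon>0}" and a: "\<epsilon> \<le> a" and T: "1 \<le> T" and ex: "unique_classical_solution_exists F (\<lambda>x. a * f x) T" for \<epsilon> a T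
  proof -
    have ra: "radial (\<lambda>x. a * f x)" using rad unfolding radial_def by metis
    obtain u where u: "continuous_on (ST T) (\<lambda>z. F (u z))" "\<And>s. s \<in> {0..T} \<Longrightarrow> radial (\<lambda>x. F (u (s, x)))"
      "\<And>z. z \<in> ST T \<Longrightarrow> u z = free_wave (\<lambda>x. a * f x) z + duhamel (\<lambda>z. F (u z)) z"
      by (rule classical_solution_duhamel[OF _ ra ex]) (use T in auto)
    have "\<epsilon> * free_wave f z + duhamel (\<lambda>z. F (u z)) z \<le> u z" if z: "z \<in> ST T" for z
    proof -
      have "0 \<le> free_wave f z" by (rule free_wave_nonneg[OF fc f0]) (use z in \<open>cases z; simp\<close>)
      then show ?thesis unfolding u(3)[OF z] free_wave_cmult using mult_right_mono[OF a] by simp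
    qed
    then show ?thesis using ub[OF e T u(1)] u(2) by blast
  qed
  then show ?thesis using C by blast
qed

lemma bounded_A_fun_imp_bounded:
  assumes e: "0 < \<epsilon>" "\<epsilon> \<le> 1" and b: "\<And>T. T \<in> S \<Longrightarrow> 1 \<le> T \<Longrightarrow> A_fun p \<mu> \<epsilon> T \<le> B"
  shows "bdd_above S"
proof -
  obtain t0 where t0: "1 \<le> t0" "B + 1 \<le> A_fun p \<mu> \<epsilon> t0" using A_fun_unbounded[OF e] by blast
  show ?thesis
  proof (rule bdd_aboveI[of _ t0], rule ccontr)
    fix T assume "T \<in> S" "\<not> T \<le> t0"
    then have "A_fun p \<mu> \<epsilon> t0 \<le> B" using A_fun_mono[OF e(1) t0(1), of T] b[of T] t0(1) by force
    then show False using t0 by simp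
  qed
qed

text \<open>
  Solutions exist for times arbitrarily close to the supremum, which itself need not be attained.
\<close>
lemma A_fun_Sup_le:
  assumes e: "0 < \<epsilon>" and S: "bdd_above S" "T1 \<in> S" "1 \<le> T1" and b: "\<And>T. T \<in> S \<Longrightarrow> 1 \<le> T \<Longrightarrow> A_fun p \<mu> \<epsilon> T \<le> B"
  shows "A_fun p \<mu> \<epsilon> (Sup S) \<le> B"
proof (cases "T1 = Sup S")
  case True
  then show ?thesis using b[OF S(2,3)] by simp
next
  case False
  have T1: "T1 < Sup S" using cSup_upper[OF S(2,1)] False by simp
  have "A_fun p \<mu> \<epsilon> t \<le> B" if t: "t \<in> {T1..<Sup S}" for t
  proof -
    obtain T where T: "T \<in> S" "t < T" using t less_cSup_iff[OF _ S(1), of t] S(2) by auto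
    then have "A_fun p \<mu> \<epsilon> t \<le> A_fun p \<mu> \<epsilon> T" using t S(3) by (intro A_fun_mono[OF e]) auto
    then show ?thesis using b[OF T(1)] t T(2) S(3) by simp
  qed
  moreover have "continuous_on (closure {T1..<Sup S}) (A_fun p \<mu> \<epsilon>)"
    using T1 S(3) by (simp add: closure_atLeastLessThan) (rule continuous_on_subset[OF A_fun_cont[OF e]]; auto)
  ultimately show ?thesis
    using continuous_le_on_closure[of "{T1..<Sup S}" "A_fun p \<mu> \<epsilon>" "Sup S" B] T1 by (simp add: closure_atLeastLessThan)
qed

lemma lifespan_eq_Sup:
  assumes "bdd_above {T. 0 < T \<and> unique_classical_solution_exists F f T}" "\<exists>T>0. unique_classical_solution_exists F f T"
  shows "lifespan F f = ereal (Sup {T. 0 < T \<and> unique_classical_solution_exists F f T})"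
proof -
  let ?S = "{T. 0 < T \<and> unique_classical_solution_exists F f T}"
  have ne: "?S \<noteq> {}" using assms(2) by auto
  show ?thesis unfolding lifespan_def
  proof (rule Sup_eqI)
    fix y assume "y \<in> ereal ` ?S"
    then show "y \<le> ereal (Sup ?S)" using cSup_upper[OF _ assms(1)] by auto
  next
    fix y assume y: "\<And>z. z \<in> ereal ` ?S \<Longrightarrow> z \<le> y"
    show "ereal (Sup ?S) \<le> y"
    proof (cases y)
      case (real r)
      have "Sup ?S \<le> r" by (rule cSup_least[OF ne]) (use y real in force)
      then show ?thesis using real by simp
    next
      case MInf
      then show ?thesis using y ne by force
    qed simp
  qed
qed

theorem blow_up:
  assumes f: "C2_compact_support f" and rad: "radial f" and f0: "\<And>x. 0 \<le> f x" and nz: "f y \<noteq> 0"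
  shows "blows_up_in_finite_time F f"
proof -
  obtain C \<epsilon>0 where "0 < \<epsilon>0" and ub: "\<forall>\<epsilon>\<in>{0<..\<epsilon>0}. \<forall>a\<ge>\<epsilon>. \<forall>T\<ge>1. unique_classical_solution_exists F (\<lambda>x. a * f x) T \<longrightarrow>
     A_fun p \<mu> \<epsilon> T \<le> C * \<epsilon> powr (- p * (p - 1))"
    using existence_time_bound[OF assms] by blast
  define \<epsilon> where "\<epsilon> = min \<epsilon>0 1"
  have e: "0 < \<epsilon>" "\<epsilon> \<le> 1" "\<epsilon> \<in> {0<..\<epsilon>0}" using \<open>0 < \<epsilon>0\<close> by (auto simp: \<epsilon>_def)
  have "bdd_above {T. 0 < T \<and> unique_classical_solution_exists F f T}"
    using ub[rule_format, OF e(3,2)] by (intro bounded_A_fun_imp_bounded[OF e(1,2)]) simp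
  from lifespan_eq_Sup[OF this local_existence[OF f rad f0]] show ?thesis
    unfolding blows_up_in_finite_time_def by simp
qed

text \<open>
  By continuity $A_\varepsilon$ takes the value $c\, \varepsilon^{-p (p - 1)}$ at some time \<open>T1\<close>, up to which
  the solution exists.
\<close>
theorem lifespan_bounds:
  assumes f: "C2_compact_support f" and rad: "radial f" and f0: "\<And>x. 0 \<le> f x" and nz: "f y \<noteq> 0"
  shows "\<exists>c>0. \<exists>C>0. \<exists>\<epsilon>\<^sub>0>0. \<epsilon>\<^sub>0 \<le> 1 \<and> (\<forall>\<epsilon>\<in>{0<..\<epsilon>\<^sub>0}. \<exists>T\<ge>1. lifespan F (\<lambda>x. \<epsilon> * f x) = ereal T \<and>
     c * \<epsilon> powr (- p * (p - 1)) \<le> A_fun p \<mu> \<epsilon> T \<and> A_fun p \<mu> \<epsilon> T \<le> C * \<epsilon> powr (- p * (p - 1)))"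
proof -
  obtain C e1 where C: "0 < C" "0 < e1" and ub: "\<forall>\<epsilon>\<in>{0<..e1}. \<forall>a\<ge>\<epsilon>. \<forall>T\<ge>1. unique_classical_solution_exists F (\<lambda>x. a * f x) T \<longrightarrow>
     A_fun p \<mu> \<epsilon> T \<le> C * \<epsilon> powr (- p * (p - 1))"
    using existence_time_bound[OF assms] by blast
  obtain c e2 where c: "0 < c" "0 < e2" and lb: "\<forall>\<epsilon>\<in>{0<..e2}. \<forall>T\<ge>1. A_fun p \<mu> \<epsilon> T \<le> c * \<epsilon> powr (- p * (p - 1)) \<longrightarrow>
     unique_classical_solution_exists F (\<lambda>x. \<epsilon> * f x) T"
    using existence_while_A_fun_small[OF f rad f0] by blast
  define \<epsilon>0 where "\<epsilon>0 = min 1 (min e1 e2)"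
  have "\<exists>T\<ge>1. lifespan F (\<lambda>x. \<epsilon> * f x) = ereal T \<and>
     c * \<epsilon> powr (- p * (p - 1)) \<le> A_fun p \<mu> \<epsilon> T \<and> A_fun p \<mu> \<epsilon> T \<le> C * \<epsilon> powr (- p * (p - 1))"
    if "\<epsilon> \<in> {0<..\<epsilon>0}" for \<epsilon>
  proof -
    have e: "0 < \<epsilon>" "\<epsilon> \<le> 1" "\<epsilon> \<in> {0<..e1}" "\<epsilon> \<in> {0<..e2}" using that by (auto simp: \<epsilon>0_def)
    define S where "S = {T. 0 < T \<and> unique_classical_solution_exists F (\<lambda>x. \<epsilon> * f x) T}"
    have SB: "A_fun p \<mu> \<epsilon> T \<le> C * \<epsilon> powr (- p * (p - 1))" if "T \<in> S" "1 \<le> T" for T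
      using ub[rule_format, OF e(3) order_refl that(2)] that by (simp add: S_def)
    have bd: "bdd_above S" by (rule bounded_A_fun_imp_bounded[OF e(1,2) SB])
    have c0: "0 < c * \<epsilon> powr (- p * (p - 1))" using c e by simp
    obtain t where t: "1 \<le> t" "c * \<epsilon> powr (- p * (p - 1)) \<le> A_fun p \<mu> \<epsilon> t" using A_fun_unbounded[OF e(1,2)] by blast
    obtain T1 where T1: "1 \<le> T1" "A_fun p \<mu> \<epsilon> T1 = c * \<epsilon> powr (- p * (p - 1))"
      using IVT'[of "A_fun p \<mu> \<epsilon>" 1 "c * \<epsilon> powr (- p * (p - 1))" t] t c0 A_fun_one[OF e(1)] A_fun_cont[OF e(1)] by force
    have T1S: "T1 \<in> S" using lb[rule_format, OF e(4) T1(1)] T1 by (simp add: S_def)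
    have T1le: "T1 \<le> Sup S" by (rule cSup_upper[OF T1S bd])
    show ?thesis
    proof (intro exI[of _ "Sup S"] conjI)
      show "1 \<le> Sup S" using T1 T1le by simp
      show "lifespan F (\<lambda>x. \<epsilon> * f x) = ereal (Sup S)"
        unfolding S_def by (rule lifespan_eq_Sup) (use bd T1S S_def in auto)
      show "c * \<epsilon> powr (- p * (p - 1)) \<le> A_fun p \<mu> \<epsilon> (Sup S)" using A_fun_mono[OF e(1) T1(1) T1le] T1(2) by simp
      show "A_fun p \<mu> \<epsilon> (Sup S) \<le> C * \<epsilon> powr (- p * (p - 1))" by (rule A_fun_Sup_le[OF e(1) bd T1S T1(1) SB])
    qed
  qed
  moreover have "0 < \<epsilon>0" "\<epsilon>0 \<le> 1" using C c by (auto simp: \<epsilon>0_def)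
  ultimately show ?thesis using C(1) c(1) by blast
qed

end

theorem theorem1p2:
  fixes p :: real and \<mu> :: "real \<Rightarrow> real"
  assumes "p = 1 + sqrt 2"
    and "\<forall>s\<ge>0. \<mu> s \<ge> 0"
    and "continuous_on {0..} \<mu>"
    and "mono_on {0..} \<mu>"
    and "(\<integral>\<^sup>+ s\<in>{0<..1}. ennreal (\<mu> s powr p / s) \<partial>lborel) = \<infinity>"
    and "C2_on UNIV (nonlinearity p \<mu>)"
    and "\<mu> C1_differentiable_on {0<..}"
    and "\<forall>s>0. \<mu> s > 0"
    and "((\<lambda>s. s * deriv \<mu> s / \<mu> s) \<longlongrightarrow> 0) (at_right 0)"
  shows
    "(\<forall>u\<^sub>1 :: real ^ 3 \<Rightarrow> real.
        C2_compact_support u\<^sub>1 \<and> radial u\<^sub>1 \<and> (\<forall>x. u\<^sub>1 x \<ge> 0) \<and> (\<exists>x. u\<^sub>1 x \<noteq> 0) \<longrightarrow>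
        blows_up_in_finite_time (nonlinearity p \<mu>) u\<^sub>1) \<and>
     (\<forall>f :: real ^ 3 \<Rightarrow> real.
        C2_compact_support f \<and> radial f \<and> (\<forall>x. f x \<ge> 0) \<and> (\<exists>x. f x \<noteq> 0) \<longrightarrow>
        (\<exists>c>0. \<exists>C>0. \<forall>\<^sub>F \<delta> in at_right 0. \<exists>\<epsilon>\<^sub>0>0. \<forall>\<epsilon>\<in>{0<..\<epsilon>\<^sub>0}. \<exists>T\<ge>1.
           lifespan (nonlinearity p \<mu>) (\<lambda>x. \<epsilon> * f x) = ereal T \<and>
           c * \<epsilon> powr (- p * (p - 1)) \<le> A_fun p \<mu> \<epsilon> T \<and>
           A_fun p \<mu> \<epsilon> T \<le> C * \<epsilon> powr (- p * (p - 1) - \<delta> / p)))"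
proof (intro conjI allI impI)
  interpret critical_nonlinearity p \<mu> using assms by unfold_locales
  fix f :: "real ^ 3 \<Rightarrow> real"
  assume "C2_compact_support f \<and> radial f \<and> (\<forall>x. f x \<ge> 0) \<and> (\<exists>x. f x \<noteq> 0)"
  then obtain y where f: "C2_compact_support f" "radial f" "\<And>x. 0 \<le> f x" "f y \<noteq> 0" by blast
  show "blows_up_in_finite_time (nonlinearity p \<mu>) f" by (rule blow_up[OF f])
  obtain c C \<epsilon>0 where c: "0 < c" "0 < C" "0 < \<epsilon>0" "\<epsilon>0 \<le> 1" and
    bd: "\<And>\<epsilon>. \<epsilon> \<in> {0<..\<epsilon>0} \<Longrightarrow> \<exists>T\<ge>1. lifespan F (\<lambda>x. \<epsilon> * f x) = ereal T \<and>
     c * \<epsilon> powr (- p * (p - 1)) \<le> A_fun p \<mu> \<epsilon> T \<and> A_fun p \<mu> \<epsilon> T \<le> C * \<epsilon> powr (- p * (p - 1))"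
    using lifespan_bounds[OF f] by blast
  have "\<forall>\<^sub>F \<delta> in at_right 0. (0::real) < \<delta>" by (rule eventually_at_right_less)
  then have "\<forall>\<^sub>F \<delta> in at_right 0. \<exists>\<epsilon>\<^sub>0>0. \<forall>\<epsilon>\<in>{0<..\<epsilon>\<^sub>0}. \<exists>T\<ge>1.
           lifespan (nonlinearity p \<mu>) (\<lambda>x. \<epsilon> * f x) = ereal T \<and>
           c * \<epsilon> powr (- p * (p - 1)) \<le> A_fun p \<mu> \<epsilon> T \<and>
           A_fun p \<mu> \<epsilon> T \<le> C * \<epsilon> powr (- p * (p - 1) - \<delta> / p)"
  proof (rule eventually_mono)
    fix \<delta> :: real assume d: "0 < \<delta>"
    have "\<exists>T\<ge>1. lifespan F (\<lambda>x. \<epsilon> * f x) = ereal T \<and> c * \<epsilon> powr (- p * (p - 1)) \<le> A_fun p \<mu> \<epsilon> T \<and>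
        A_fun p \<mu> \<epsilon> T \<le> C * \<epsilon> powr (- p * (p - 1) - \<delta> / p)" if e: "\<epsilon> \<in> {0<..\<epsilon>0}" for \<epsilon>
    proof -
      have "\<epsilon> powr (- p * (p - 1)) \<le> \<epsilon> powr (- p * (p - 1) - \<delta> / p)"
        using e c(4) d p_gt by (intro powr_mono') auto
      then have "C * \<epsilon> powr (- p * (p - 1)) \<le> C * \<epsilon> powr (- p * (p - 1) - \<delta> / p)"
        using c(2) by (intro mult_left_mono) auto
      then show ?thesis using bd[OF e] order_trans by blast
    qed
    then show "\<exists>\<epsilon>\<^sub>0>0. \<forall>\<epsilon>\<in>{0<..\<epsilon>\<^sub>0}. \<exists>T\<ge>1.
           lifespan (nonlinearity p \<mu>) (\<lambda>x. \<epsilon> * f x) = ereal T \<and>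
           c * \<epsilon> powr (- p * (p - 1)) \<le> A_fun p \<mu> \<epsilon> T \<and>
           A_fun p \<mu> \<epsilon> T \<le> C * \<epsilon> powr (- p * (p - 1) - \<delta> / p)"
      using c(3) by blast
  qed
  then show "\<exists>c>0. \<exists>C>0. \<forall>\<^sub>F \<delta> in at_right 0. \<exists>\<epsilon>\<^sub>0>0. \<forall>\<epsilon>\<in>{0<..\<epsilon>\<^sub>0}. \<exists>T\<ge>1.
           lifespan (nonlinearity p \<mu>) (\<lambda>x. \<epsilon> * f x) = ereal T \<and>
           c * \<epsilon> powr (- p * (p - 1)) \<le> A_fun p \<mu> \<epsilon> T \<and>
           A_fun p \<mu> \<epsilon> T \<le> C * \<epsilon> powr (- p * (p - 1) - \<delta> / p)" using c(1,2) by blast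
qed

end
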